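(* There exist constants $c,C>0$ such that $$c\,\|\boldsymbol w\|_2\le\|\nabla\cdot\sigma(\boldsymbol w)\|_0\le C\,\|\boldsymbol w\|_2\qquad\text{for all }\boldsymbol w\in V .$$
   Context: $\Omega\subset\mathbb R^2$ is a bounded convex Lipschitz domain with unit outward normal $\boldsymbol\nu$. $\lambda,\mu>0$ are constants (Lamé parameters). For $\boldsymbol u=(u_1,u_2)^\top$, $\varepsilon(\boldsymbol u)=\frac12(\nabla\boldsymbol u+(\nabla\boldsymbol u)^\top)$, $\sigma(\boldsymbol u)=2\mu\,\varepsilon(\boldsymbol u)+\lambda\,\mathrm{tr}(\varepsilon(\boldsymbol u))\,\mathrm I$, and $\nabla\cdot\sigma(\boldsymbol u)$ is the row-wise divergence. $\|\cdot\|_0$ is the norm of $(L^2(\Omega))^2$ and $\|\cdot\|_2$ the norm of $(H^2(\Omega))^2$. $$V=\{\boldsymbol\phi\in (H^2(\Omega))^2:\ \boldsymbol\phi=\boldsymbol 0\ \text{and}\ \sigma(\boldsymbol\phi)\boldsymbol\nu=\boldsymbol 0\ \text{on}\ \partial\Omega\}.$$ *)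

theory Defs
  imports "HOL-Analysis.Analysis"
begin

section \<open>Smooth functions and test functions\<close>

definition partial :: "'n::finite \<Rightarrow> (real^'n \<Rightarrow> real) \<Rightarrow> real^'n \<Rightarrow> real" where
  "partial j f x = frechet_derivative f (at x) (axis j 1)"

primrec C_k :: "nat \<Rightarrow> (real^'n::finite \<Rightarrow> real) set" where
  "C_k 0 = {f. continuous_on UNIV f}"
| "C_k (Suc k) = {f. f differentiable_on UNIV \<and> (\<forall>j. partial j f \<in> C_k k)}"

definition C_infinity :: "(real^'n::finite \<Rightarrow> real) set" where
  "C_infinity = (\<Inter>k. C_k k)"

definition test_functions :: "(real^'n::finite) set \<Rightarrow> (real^'n \<Rightarrow> real) set" where
  "test_functions \<Omega> =
     {\<psi> \<in> C_infinity. compact (closure {x. \<psi> x \<noteq> 0}) \<and> closure {x. \<psi> x \<noteq> 0} \<subseteq> \<Omega>}"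


section \<open>Lebesgue and Sobolev spaces\<close>

text \<open>Elements of these spaces are represented by functions on the whole ambient space; only
  their values on \<open>\<Omega>\<close>, up to null sets, matter.\<close>

definition L2 :: "'a measure \<Rightarrow> ('a \<Rightarrow> 'b::euclidean_space) set" where
  "L2 M = {u \<in> borel_measurable M. integrable M (\<lambda>x. (norm (u x))\<^sup>2)}"

definition L2_norm :: "'a measure \<Rightarrow> ('a \<Rightarrow> 'b::euclidean_space) \<Rightarrow> real" where
  "L2_norm M u = sqrt (\<integral>x. (norm (u x))\<^sup>2 \<partial>M)"

definition locally_integrable :: "(real^'n::finite) set \<Rightarrow> (real^'n \<Rightarrow> real) \<Rightarrow> bool" where
  "locally_integrable \<Omega> u \<longleftrightarrow> (\<forall>K. compact K \<and> K \<subseteq> \<Omega> \<longrightarrow> integrable (lebesgue_on K) u)"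

definition has_weak_partial ::
    "(real^'n::finite) set \<Rightarrow> 'n \<Rightarrow> (real^'n \<Rightarrow> real) \<Rightarrow> (real^'n \<Rightarrow> real) \<Rightarrow> bool" where
  "has_weak_partial \<Omega> j u v \<longleftrightarrow>
     locally_integrable \<Omega> u \<and> locally_integrable \<Omega> v \<and>
     (\<forall>\<psi> \<in> test_functions \<Omega>.
        (\<integral>x. u x * partial j \<psi> x \<partial>lebesgue_on \<Omega>) = - (\<integral>x. v x * \<psi> x \<partial>lebesgue_on \<Omega>))"

text \<open>On an open set, weak derivatives are unique up to null sets of \<open>\<Omega>\<close>. The result is
  unspecified if there is none.\<close>

definition weak_partial ::
    "(real^'n::finite) set \<Rightarrow> 'n \<Rightarrow> (real^'n \<Rightarrow> real) \<Rightarrow> real^'n \<Rightarrow> real" where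
  "weak_partial \<Omega> j u = (SOME v. has_weak_partial \<Omega> j u v)"

definition H1 :: "(real^'n::finite) set \<Rightarrow> (real^'n \<Rightarrow> real) set" where
  "H1 \<Omega> = {u \<in> L2 (lebesgue_on \<Omega>). \<forall>j. \<exists>v \<in> L2 (lebesgue_on \<Omega>). has_weak_partial \<Omega> j u v}"

definition H2 :: "(real^'n::finite) set \<Rightarrow> (real^'n \<Rightarrow> real) set" where
  "H2 \<Omega> = {u \<in> H1 \<Omega>. \<forall>j. weak_partial \<Omega> j u \<in> H1 \<Omega>}"

definition H1_norm :: "(real^'n::finite) set \<Rightarrow> (real^'n \<Rightarrow> real) \<Rightarrow> real" where
  "H1_norm \<Omega> u =
     sqrt ((L2_norm (lebesgue_on \<Omega>) u)\<^sup>2 + (\<Sum>j\<in>UNIV. (L2_norm (lebesgue_on \<Omega>) (weak_partial \<Omega> j u))\<^sup>2))"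

definition H2_norm :: "(real^'n::finite) set \<Rightarrow> (real^'n \<Rightarrow> real) \<Rightarrow> real" where
  "H2_norm \<Omega> u =
     sqrt ((H1_norm \<Omega> u)\<^sup>2 +
       (\<Sum>j\<in>UNIV. \<Sum>k\<in>UNIV.
          (L2_norm (lebesgue_on \<Omega>) (weak_partial \<Omega> k (weak_partial \<Omega> j u)))\<^sup>2))"

definition H2_vec :: "(real^'n::finite) set \<Rightarrow> (real^'n \<Rightarrow> real^'m::finite) set" where
  "H2_vec \<Omega> = {w. \<forall>i. (\<lambda>x. w x $ i) \<in> H2 \<Omega>}"

definition H2_vec_norm :: "(real^'n::finite) set \<Rightarrow> (real^'n \<Rightarrow> real^'m::finite) \<Rightarrow> real" where
  "H2_vec_norm \<Omega> w = sqrt (\<Sum>i\<in>UNIV. (H2_norm \<Omega> (\<lambda>x. w x $ i))\<^sup>2)"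


section \<open>Lipschitz domains in the plane, their normal and surface measure\<close>

text \<open>The map \<open>T\<close> is the choice of local Cartesian coordinates in which the boundary is a graph.\<close>

definition lipschitz_domain :: "(real^2) set \<Rightarrow> bool" where
  "lipschitz_domain \<Omega> \<longleftrightarrow>
     open \<Omega> \<and> connected \<Omega> \<and> \<Omega> \<noteq> {} \<and>
     (\<forall>x \<in> frontier \<Omega>. \<exists>r>0. \<exists>(T :: real^2 \<Rightarrow> real^2) (\<gamma> :: real \<Rightarrow> real) L.
        orthogonal_transformation T \<and> L-lipschitz_on UNIV \<gamma> \<and>
        \<Omega> \<inter> ball x r = {y \<in> ball x r. T y $ 2 > \<gamma> (T y $ 1)})"

text \<open>The unit vector \<open>n\<close> is the outward normal at the boundary point \<open>x\<close> if, near \<open>x\<close>, the set lies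
  on the inner side of the hyperplane through \<open>x\<close> orthogonal to \<open>n\<close> up to arbitrarily thin cones
  around that hyperplane. At most one such \<open>n\<close> exists; where the boundary is the graph of a
  function differentiable at \<open>x\<close> (almost everywhere on a Lipschitz boundary, by Rademacher), it is
  the usual normal to the graph.\<close>

definition is_outward_normal :: "'a::euclidean_space set \<Rightarrow> 'a \<Rightarrow> 'a \<Rightarrow> bool" where
  "is_outward_normal \<Omega> x n \<longleftrightarrow>
     norm n = 1 \<and>
     (\<forall>e>0. \<exists>d>0. \<forall>y \<in> ball x d.
        ((y - x) \<bullet> n < - e * norm (y - x) \<longrightarrow> y \<in> \<Omega>) \<and>
        ((y - x) \<bullet> n > e * norm (y - x) \<longrightarrow> y \<notin> \<Omega>))"

definition outward_normal :: "'a::euclidean_space set \<Rightarrow> 'a \<Rightarrow> 'a" where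
  "outward_normal \<Omega> x = (THE n. is_outward_normal \<Omega> x n)"

lemma is_outward_normal_unique:
  assumes "is_outward_normal \<Omega> x n" and "is_outward_normal \<Omega> x m"
  shows "n = m"
proof (rule ccontr)
  assume "n \<noteq> m"
  define v where "v = m - n"
  have nn: "n \<bullet> n = 1" "m \<bullet> m = 1"
    using assms by (simp_all add: is_outward_normal_def norm_eq_1)
  have v: "v \<noteq> 0" using \<open>n \<noteq> m\<close> by (simp add: v_def)
  have "v \<bullet> v > 0" using v by simp
  moreover have vv: "v \<bullet> v = 2 * (v \<bullet> m)" "v \<bullet> v = - 2 * (v \<bullet> n)"
    using nn by (simp_all add: v_def inner_diff_left inner_diff_right inner_commute)
  ultimately have pos: "v \<bullet> m > 0" by simp
  define e where "e = (v \<bullet> m) / (2 * norm v)"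
  have e: "e > 0" using pos v by (simp add: e_def)
  obtain d1 where d1: "d1 > 0"
    "\<And>y. y \<in> ball x d1 \<Longrightarrow> (y - x) \<bullet> n < - e * norm (y - x) \<Longrightarrow> y \<in> \<Omega>"
    using assms(1) e unfolding is_outward_normal_def by blast
  obtain d2 where d2: "d2 > 0"
    "\<And>y. y \<in> ball x d2 \<Longrightarrow> (y - x) \<bullet> m > e * norm (y - x) \<Longrightarrow> y \<notin> \<Omega>"
    using assms(2) e unfolding is_outward_normal_def by blast
  define t where "t = min d1 d2 / (2 * norm v)"
  have t: "t > 0" using d1(1) d2(1) v by (simp add: t_def)
  define y where "y = x + t *\<^sub>R v"
  have "norm (t *\<^sub>R v) = min d1 d2 / 2"
    using d1(1) d2(1) v by (simp add: t_def abs_of_pos)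
  then have y: "y \<in> ball x d1" "y \<in> ball x d2"
    using d1(1) d2(1) by (auto simp: y_def dist_norm)
  have en: "e * norm (y - x) = t * (v \<bullet> m) / 2"
    using v t by (simp add: y_def e_def)
  have half: "t * (v \<bullet> m) / 2 < t * (v \<bullet> m)" using t pos by simp
  have "(y - x) \<bullet> m > e * norm (y - x)"
    unfolding en using half by (simp add: y_def)
  moreover have "v \<bullet> n = - (v \<bullet> m)" using vv by simp
  then have "(y - x) \<bullet> n < - e * norm (y - x)"
    using half en by (simp add: y_def)
  ultimately show False using d1(2) d2(2) y by blast
qed

definition hausdorff1_pre :: "real \<Rightarrow> 'a::metric_space set \<Rightarrow> ennreal" where
  "hausdorff1_pre \<delta> A =
     (INF U \<in> {U :: nat \<Rightarrow> 'a set. A \<subseteq> (\<Union>n. U n) \<and> (\<forall>n. bounded (U n) \<and> diameter (U n) \<le> \<delta>)}.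
        \<Sum>n. ennreal (diameter (U n)))"

definition hausdorff1_outer :: "'a::metric_space set \<Rightarrow> ennreal" where
  "hausdorff1_outer A = (SUP \<delta> \<in> {0<..}. hausdorff1_pre \<delta> A)"

text \<open>The one-dimensional Hausdorff measure. The outer measure is a metric one, hence countably
  additive on the Borel sets.\<close>

definition hausdorff1 :: "'a::metric_space measure" where
  "hausdorff1 = measure_of UNIV (sets borel) hausdorff1_outer"

definition surface_measure :: "(real^2) set \<Rightarrow> (real^2) measure" where
  "surface_measure \<Omega> = restrict_space hausdorff1 (frontier \<Omega>)"

text \<open>For a bounded Lipschitz domain, the trace operator from \<open>H\<^sup>1(\<Omega>)\<close> to \<open>L\<^sup>2(\<partial>\<Omega>)\<close> is the
  continuous extension of the restriction map on functions smooth up to the boundary; the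
  following relation is its graph.\<close>

definition has_trace :: "(real^2) set \<Rightarrow> (real^2 \<Rightarrow> real) \<Rightarrow> (real^2 \<Rightarrow> real) \<Rightarrow> bool" where
  "has_trace \<Omega> u g \<longleftrightarrow>
     u \<in> H1 \<Omega> \<and> g \<in> L2 (surface_measure \<Omega>) \<and>
     (\<exists>U :: nat \<Rightarrow> real^2 \<Rightarrow> real.
        (\<forall>n. U n \<in> C_infinity) \<and>
        (\<lambda>n. H1_norm \<Omega> (\<lambda>x. U n x - u x)) \<longlonglongrightarrow> 0 \<and>
        (\<lambda>n. L2_norm (surface_measure \<Omega>) (\<lambda>x. U n x - g x)) \<longlonglongrightarrow> 0)"


section \<open>Linear elasticity\<close>

definition weak_gradient ::
    "(real^2) set \<Rightarrow> (real^2 \<Rightarrow> real^2) \<Rightarrow> real^2 \<Rightarrow> real^2^2" where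
  "weak_gradient \<Omega> u x = (\<chi> i j. weak_partial \<Omega> j (\<lambda>y. u y $ i) x)"

definition strain :: "(real^2) set \<Rightarrow> (real^2 \<Rightarrow> real^2) \<Rightarrow> real^2 \<Rightarrow> real^2^2" where
  "strain \<Omega> u x = (1/2) *\<^sub>R (weak_gradient \<Omega> u x + transpose (weak_gradient \<Omega> u x))"

definition stress ::
    "real \<Rightarrow> real \<Rightarrow> (real^2) set \<Rightarrow> (real^2 \<Rightarrow> real^2) \<Rightarrow> real^2 \<Rightarrow> real^2^2" where
  "stress lam mu \<Omega> u x =
     (2 * mu) *\<^sub>R strain \<Omega> u x + (lam * trace (strain \<Omega> u x)) *\<^sub>R mat 1"

definition row_divergence ::
    "(real^2) set \<Rightarrow> (real^2 \<Rightarrow> real^2^2) \<Rightarrow> real^2 \<Rightarrow> real^2" where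
  "row_divergence \<Omega> S x = (\<chi> i. \<Sum>j\<in>UNIV. weak_partial \<Omega> j (\<lambda>y. S y $ i $ j) x)"

definition V_space :: "real \<Rightarrow> real \<Rightarrow> (real^2) set \<Rightarrow> (real^2 \<Rightarrow> real^2) set" where
  "V_space lam mu \<Omega> =
     {\<phi> \<in> H2_vec \<Omega>.
        (\<forall>i. has_trace \<Omega> (\<lambda>x. \<phi> x $ i) (\<lambda>x. 0)) \<and>
        (\<exists>S :: real^2 \<Rightarrow> real^2^2.
           (\<forall>i j. has_trace \<Omega> (\<lambda>x. stress lam mu \<Omega> \<phi> x $ i $ j) (\<lambda>x. S x $ i $ j)) \<and>
           (AE x in surface_measure \<Omega>. S x *v outward_normal \<Omega> x = 0))}"

end

theory Submission
  imports Defs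
begin

text \<open>If \<open>w\<close> and \<open>\<sigma>(w) \<nu>\<close> vanish on the boundary, then the extension of \<open>w\<close> by zero to the whole
  plane satisfies, in the sense of distributions, the Lame system whose right hand side is the
  extension by zero of \<open>\<nabla> \<bullet> \<sigma>(w)\<close>. Mollifying gives compactly supported smooth fields \<open>W\<close> with
  \<open>F = \<mu> \<Delta>W + (\<lambda> + \<mu>) \<nabla> div W\<close>, for which integration by parts yields
  \<open>\<mu> \<parallel>D\<^sup>2 W\<parallel> = \<mu> \<parallel>\<Delta>W\<parallel> \<le> \<parallel>F\<parallel>\<close>; Poincare's inequality controls the lower order terms, and the
  bounds pass to the limit. No regularity theory up to the boundary is involved.

  Green's formula on a convex domain is obtained from the Minkowski functional \<open>p\<close> of the domain
  about an interior point: testing with \<open>min 1 (n (1 - p))\<close> and letting \<open>n\<close> tend to infinity turns the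
  boundary term into the integral over the domain of boundary values extended along rays, with
  \<open>\<nabla>p\<close> in the role of the normal. A cone over a boundary set has area at most a constant times the
  length of the set, which transfers the hypotheses on traces, stated with the Hausdorff measure,
  to these radial integrals.\<close>

section \<open>Calculus of smooth functions\<close>

text \<open>Both boundary conditions serve to free the test functions from vanishing at the
  boundary: \<open>\<sigma>(w) \<nu> = 0\<close> removes the boundary term of the first integration
  by parts, \<open>w = 0\<close> that of the second. A mollifier centred near or beyond the boundary
  is then admissible, so the mollified extension solves its system at every point of the plane.
  Conventions in the definitions cause much of the remaining work. A weak derivative is an arbitrary
  choice, so what is known of one must be transferred by uniqueness almost everywhere. An integral
  that does not exist is 0, and \<open>measure_of\<close> applied to a set function that is not a
  measure gives the zero measure; convergence of boundary values in \<open>has_trace\<close> is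
  therefore informative only once the Hausdorff outer measure is countably additive on Borel sets
  and the boundary has finite length. The final constants depend on the domain only through the
  radius of a ball about the origin that contains it.\<close>

lemma partial_eqI: "(f has_derivative D) (at x) \<Longrightarrow> partial j f x = D (axis j 1)"
  unfolding partial_def by (metis frechet_derivative_at)

text \<open>\<open>C_infinity\<close> is the largest set of differentiable functions closed under
  partial differentiation, so smoothness follows by exhibiting an invariant set, without an
  induction on the order in each application.\<close>

lemma C_infinity_coinduct:
  assumes "f \<in> S"
    and diff: "\<And>f x. f \<in> S \<Longrightarrow> f differentiable (at x)"
    and partial: "\<And>f j. f \<in> S \<Longrightarrow> partial j f \<in> S"
  shows "f \<in> C_infinity"
proof -
  have "f \<in> C_k k" if "f \<in> S" for f k
    using that
  proof (induction k arbitrary: f)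
    case 0
    then show ?case
      using diff by (auto intro!: continuous_at_imp_continuous_on differentiable_imp_continuous_within)
  next
    case (Suc k)
    then show ?case
      using diff partial by (auto simp: differentiable_on_def)
  qed
  with assms(1) show ?thesis by (auto simp: C_infinity_def)
qed

lemma C_infinity_differentiable: "f \<in> C_infinity \<Longrightarrow> f differentiable (at x)"
proof -
  assume "f \<in> C_infinity"
  then have "f \<in> C_k (Suc 0)" unfolding C_infinity_def by blast
  then show ?thesis by (auto simp: differentiable_on_def)
qed

lemma C_infinity_partial [intro]: "f \<in> C_infinity \<Longrightarrow> partial j f \<in> C_infinity"
proof -
  assume "f \<in> C_infinity"
  then have "f \<in> C_k (Suc k)" for k unfolding C_infinity_def by blast
  then show ?thesis by (auto simp: C_infinity_def)
qed

lemma C_infinity_has_derivative: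
  assumes "f \<in> C_infinity"
  shows "(f has_derivative (\<lambda>h. \<Sum>j\<in>UNIV. h $ j * partial j f x)) (at x)"
proof -
  let ?D = "frechet_derivative f (at x)"
  have D: "(f has_derivative ?D) (at x)"
    using C_infinity_differentiable[OF assms] by (simp add: frechet_derivative_works[symmetric])
  then interpret bounded_linear ?D by (rule has_derivative_bounded_linear)
  have "?D = (\<lambda>h. \<Sum>j\<in>UNIV. h $ j * partial j f x)"
  proof
    fix h
    have "?D h = ?D (\<Sum>j\<in>UNIV. h $ j *\<^sub>R axis j 1)"
      by (simp add: basis_expansion scalar_mult_eq_scaleR[symmetric])
    then show "?D h = (\<Sum>j\<in>UNIV. h $ j * partial j f x)"
      by (simp add: sum scale partial_def)
  qed
  with D show ?thesis by simp
qed

lemma C_infinity_continuous: "f \<in> C_infinity \<Longrightarrow> continuous_on S f"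
  by (meson C_infinity_differentiable continuous_at_imp_continuous_on differentiable_imp_continuous_within)

lemma C_infinity_measurable [measurable_dest]: "f \<in> C_infinity \<Longrightarrow> f \<in> borel_measurable borel"
  by (intro borel_measurable_continuous_onI C_infinity_continuous)

lemma partial_const [simp]: "partial j (\<lambda>_. c) = (\<lambda>_. 0)"
  by (auto intro!: ext partial_eqI)

lemma partial_add:
  assumes "f differentiable (at x)" "g differentiable (at x)"
  shows "partial j (\<lambda>x. f x + g x) x = partial j f x + partial j g x"
proof -
  have "(f has_derivative frechet_derivative f (at x)) (at x)" "(g has_derivative frechet_derivative g (at x)) (at x)"
    using assms by (simp_all add: frechet_derivative_works[symmetric])
  from has_derivative_add[OF this] show ?thesis
    by (subst partial_eqI, assumption) (simp add: partial_def)
qed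

lemma partial_mult:
  assumes "f differentiable (at x)" "g differentiable (at x)"
  shows "partial j (\<lambda>x. f x * g x) x = partial j f x * g x + f x * partial j g x"
proof -
  have "(f has_derivative frechet_derivative f (at x)) (at x)" "(g has_derivative frechet_derivative g (at x)) (at x)"
    using assms by (simp_all add: frechet_derivative_works[symmetric])
  from has_derivative_mult[OF this] show ?thesis
    by (subst partial_eqI, assumption) (simp add: partial_def)
qed

lemma C_infinity_const [intro, simp]: "(\<lambda>_. c) \<in> C_infinity"
  by (rule C_infinity_coinduct[where S = "range (\<lambda>c _. c)"]) auto

lemma C_infinity_add [intro]:
  assumes "f \<in> C_infinity" "g \<in> C_infinity"
  shows "(\<lambda>x. f x + g x) \<in> C_infinity"
proof (rule C_infinity_coinduct[where S = "{\<lambda>x. f x + g x | f g. f \<in> C_infinity \<and> g \<in> C_infinity}"])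
  fix h :: "real^'a \<Rightarrow> real" and j
  assume "h \<in> {\<lambda>x. f x + g x | f g. f \<in> C_infinity \<and> g \<in> C_infinity}"
  then obtain f g where h: "h = (\<lambda>x. f x + g x)" "f \<in> C_infinity" "g \<in> C_infinity" by blast
  have "partial j h = (\<lambda>x. partial j f x + partial j g x)"
    unfolding h(1) using h(2,3) by (intro ext partial_add C_infinity_differentiable)
  then show "partial j h \<in> {\<lambda>x. f x + g x | f g. f \<in> C_infinity \<and> g \<in> C_infinity}"
    using h(2,3) by blast
qed (use assms in \<open>auto intro: differentiable_add C_infinity_differentiable\<close>)

lemma C_k_Suc_subset: "C_k (Suc k) \<subseteq> C_k k"
proof (induction k)
  case 0
  then show ?case
    by (auto simp: differentiable_imp_continuous_on)
next
  case (Suc k)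
  show ?case
  proof
    fix f :: "real^'a \<Rightarrow> real" assume "f \<in> C_k (Suc (Suc k))"
    then have "f differentiable_on UNIV" "\<And>j. partial j f \<in> C_k (Suc k)"
      by auto
    then show "f \<in> C_k (Suc k)" using Suc by (simp add: subset_iff)
  qed
qed

lemma C_k_add: "f \<in> C_k k \<Longrightarrow> g \<in> C_k k \<Longrightarrow> (\<lambda>x. f x + g x) \<in> C_k k"
proof (induction k arbitrary: f g)
  case 0 then show ?case by (auto intro: continuous_intros)
next
  case (Suc k)
  then have *: "\<And>x. f differentiable (at x)" "\<And>x. g differentiable (at x)"
    by (auto simp: differentiable_on_def)
  have "partial j (\<lambda>x. f x + g x) = (\<lambda>x. partial j f x + partial j g x)" for j
    using * by (intro ext partial_add)
  with Suc show ?case by (auto intro: differentiable_on_add)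
qed

text \<open>The product rule yields a sum of products, so products of smooth functions do not form a
  set visibly closed under \<open>partial\<close>, as \<open>C_infinity_coinduct\<close> would
  require; hence the induction on the order. It uses each factor at order \<open>k\<close> as well
  as at order \<open>Suc k\<close>.\<close>

lemma C_k_mult: "f \<in> C_k k \<Longrightarrow> g \<in> C_k k \<Longrightarrow> (\<lambda>x. f x * g x) \<in> C_k k"
proof (induction k arbitrary: f g)
  case 0 then show ?case by (auto intro: continuous_intros)
next
  case (Suc k)
  then have *: "\<And>x. f differentiable (at x)" "\<And>x. g differentiable (at x)"
    by (auto simp: differentiable_on_def)
  have eq: "partial j (\<lambda>x. f x * g x) = (\<lambda>x. partial j f x * g x + f x * partial j g x)" for j
    using * by (intro ext partial_mult)
  have "f \<in> C_k k" "g \<in> C_k k" using Suc.prems C_k_Suc_subset by blast+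
  with Suc show ?case
    by (auto simp: eq intro!: differentiable_on_mult C_k_add)
qed

lemma C_infinity_mult [intro]:
  "f \<in> C_infinity \<Longrightarrow> g \<in> C_infinity \<Longrightarrow> (\<lambda>x. f x * g x) \<in> C_infinity"
  by (auto simp: C_infinity_def intro: C_k_mult)

lemma C_infinity_sum [intro]:
  "(\<And>i. i \<in> I \<Longrightarrow> f i \<in> C_infinity) \<Longrightarrow> (\<lambda>x. \<Sum>i\<in>I. f i x) \<in> C_infinity"
  by (induction I rule: infinite_finite_induct) auto

lemma C_infinity_prod [intro]:
  "(\<And>i. i \<in> I \<Longrightarrow> f i \<in> C_infinity) \<Longrightarrow> (\<lambda>x. \<Prod>i\<in>I. f i x) \<in> C_infinity"
  by (induction I rule: infinite_finite_induct) auto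

lemma partial_affine:
  assumes "f differentiable (at (a + s *\<^sub>R x))"
  shows "partial j (\<lambda>x. f (a + s *\<^sub>R x)) x = s * partial j f (a + s *\<^sub>R x)"
proof -
  let ?D = "frechet_derivative f (at (a + s *\<^sub>R x))"
  have D: "(f has_derivative ?D) (at (a + s *\<^sub>R x))"
    using assms by (simp add: frechet_derivative_works[symmetric])
  have "((\<lambda>x. a + s *\<^sub>R x) has_derivative (\<lambda>h. s *\<^sub>R h)) (at x)"
    by (auto intro!: derivative_eq_intros)
  from has_derivative_compose[OF this D]
  have "partial j (\<lambda>x. f (a + s *\<^sub>R x)) x = ?D (s *\<^sub>R axis j 1)"
    by (rule partial_eqI)
  also have "\<dots> = s * ?D (axis j 1)"
    using has_derivative_bounded_linear[OF D] by (simp add: linear_simps)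
  finally show ?thesis by (simp add: partial_def)
qed

lemma C_infinity_affine:
  assumes "f \<in> C_infinity"
  shows "(\<lambda>x. f (a + s *\<^sub>R x)) \<in> C_infinity"
\<comment> \<open>The free factor \<open>c\<close> absorbs the power of \<open>s\<close> that each
  differentiation produces.\<close>
proof (rule C_infinity_coinduct[where S = "{\<lambda>x. c * f (a + s *\<^sub>R x) | c f. f \<in> C_infinity}"])
  show "(\<lambda>x. f (a + s *\<^sub>R x)) \<in> {\<lambda>x. c * f (a + s *\<^sub>R x) | c f. f \<in> C_infinity}"
    using assms by (auto intro!: exI[of _ 1] exI[of _ f])
  fix h :: "real^'a \<Rightarrow> real" and j x
  assume "h \<in> {\<lambda>x. c * f (a + s *\<^sub>R x) | c f. f \<in> C_infinity}"
  then obtain c f where h: "h = (\<lambda>x. c * f (a + s *\<^sub>R x))" "f \<in> C_infinity" by blast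
  have d: "(\<lambda>x. f (a + s *\<^sub>R x)) differentiable (at x)" for x
    by (rule differentiable_compose[of f "\<lambda>x. a + s *\<^sub>R x"])
      (use h(2) in \<open>auto intro!: C_infinity_differentiable derivative_intros\<close>)
  then show "h differentiable (at x)" unfolding h(1) by (intro derivative_intros)
  have "partial j h = (\<lambda>x. (c * s) * partial j f (a + s *\<^sub>R x))"
    unfolding h(1)
  proof
    fix x
    show "partial j (\<lambda>x. c * f (a + s *\<^sub>R x)) x = (c * s) * partial j f (a + s *\<^sub>R x)"
      using partial_mult[of "\<lambda>_. c" x "\<lambda>x. f (a + s *\<^sub>R x)" j] d[of x]
        partial_affine[OF C_infinity_differentiable[OF h(2)], where a = a and s = s and x = x and j = j] by simp
  qed
  then show "partial j h \<in> {\<lambda>x. c * f (a + s *\<^sub>R x) | c f. f \<in> C_infinity}"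
    using h(2) by blast
qed

corollary C_infinity_reflect: "f \<in> C_infinity \<Longrightarrow> (\<lambda>y. f (x - y)) \<in> C_infinity"
  using C_infinity_affine[where a = x and s = "-1"] by simp

corollary partial_reflect:
  "f \<in> C_infinity \<Longrightarrow> partial j (\<lambda>y. f (x - y)) = (\<lambda>y. - partial j f (x - y))"
  using partial_affine[where a = x and s = "-1", OF C_infinity_differentiable] by (simp add: fun_eq_iff)

corollary C_infinity_cmult [intro]: "f \<in> C_infinity \<Longrightarrow> (\<lambda>x. c * f x) \<in> C_infinity"
  using C_infinity_mult[OF C_infinity_const] .

corollary C_infinity_diff [intro]:
  "f \<in> C_infinity \<Longrightarrow> g \<in> C_infinity \<Longrightarrow> (\<lambda>x. f x - g x) \<in> C_infinity"
  using C_infinity_add[of f "\<lambda>x. - 1 * g x"] C_infinity_cmult[of g "-1"] by simp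


subsection \<open>Compactly supported smooth functions\<close>

lemma test_functions_UNIV_iff: "\<psi> \<in> test_functions UNIV \<longleftrightarrow> \<psi> \<in> C_infinity \<and> bounded {x. \<psi> x \<noteq> 0}"
  by (simp add: test_functions_def compact_closure)

lemma test_functions_subset_UNIV: "\<psi> \<in> test_functions \<Omega> \<Longrightarrow> \<psi> \<in> test_functions UNIV"
  by (simp add: test_functions_def)

lemma partial_support: "{x. partial j f x \<noteq> 0} \<subseteq> closure {x. f x \<noteq> 0}"
proof (rule subsetI, rule ccontr)
  fix x assume x: "x \<in> {x. partial j f x \<noteq> 0}" "x \<notin> closure {x. f x \<noteq> 0}"
  then have "eventually (\<lambda>y. y \<in> - closure {x. f x \<noteq> 0}) (nhds x)"
    by (intro eventually_nhds_in_open) auto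
  then have "eventually (\<lambda>y. f y = 0) (nhds x)"
    by (rule eventually_mono) (use closure_subset[of "{x. f x \<noteq> 0}"] in auto)
  then have ev: "eventually (\<lambda>y. 0 = f y) (at x)" and "f x = 0"
    using eventually_nhds_x_imp_x by (fastforce simp: eventually_at_filter elim: eventually_mono)+
  then have "(f has_derivative (\<lambda>_. 0)) (at x)"
    by (intro has_derivative_transform_eventually[OF has_derivative_const ev]) auto
  then have "partial j f x = 0" by (rule partial_eqI)
  with x show False by simp
qed

lemma test_functions_partial [intro]: "\<psi> \<in> test_functions \<Omega> \<Longrightarrow> partial j \<psi> \<in> test_functions \<Omega>"
proof -
  assume \<psi>: "\<psi> \<in> test_functions \<Omega>"
  have sub: "closure {x. partial j \<psi> x \<noteq> 0} \<subseteq> closure {x. \<psi> x \<noteq> 0}"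
    using partial_support by (rule closure_minimal) simp
  then have "compact (closure {x. partial j \<psi> x \<noteq> 0})"
    using \<psi> by (auto simp: test_functions_def compact_eq_bounded_closed intro: bounded_subset)
  with sub \<psi> show "partial j \<psi> \<in> test_functions \<Omega>"
    by (auto simp: test_functions_def)
qed

lemma test_functions_mult [intro]:
  assumes "\<phi> \<in> C_infinity" "\<psi> \<in> test_functions \<Omega>"
  shows "(\<lambda>x. \<phi> x * \<psi> x) \<in> test_functions \<Omega>"
proof -
  have sub: "{x. \<phi> x * \<psi> x \<noteq> 0} \<subseteq> {x. \<psi> x \<noteq> 0}" by auto
  from closure_mono[OF sub] bounded_subset[OF _ sub] assms show ?thesis
    by (auto simp: test_functions_def compact_closure)
qed

lemma test_functions_add [intro]:
  assumes "\<phi> \<in> test_functions \<Omega>" "\<psi> \<in> test_functions \<Omega>"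
  shows "(\<lambda>x. \<phi> x + \<psi> x) \<in> test_functions \<Omega>"
proof -
  have sub: "{x. \<phi> x + \<psi> x \<noteq> 0} \<subseteq> {x. \<phi> x \<noteq> 0} \<union> {x. \<psi> x \<noteq> 0}" by auto
  from closure_mono[OF sub] bounded_subset[OF _ sub] assms show ?thesis
    by (auto simp: test_functions_def compact_closure closure_Un)
qed

lemma test_functions_zero [simp]: "(\<lambda>_. 0) \<in> test_functions \<Omega>"
  by (simp add: test_functions_def)

lemma test_functions_sum [intro]:
  "(\<And>i. i \<in> I \<Longrightarrow> f i \<in> test_functions \<Omega>) \<Longrightarrow> (\<lambda>x. \<Sum>i\<in>I. f i x) \<in> test_functions \<Omega>"
  by (induction I rule: infinite_finite_induct) auto

section \<open>Integrals of compactly supported functions and integration by parts on the whole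
  space\<close>

lemma integrable_continuous_bounded_support:
  fixes f :: "'a::euclidean_space \<Rightarrow> real"
  assumes "continuous_on UNIV f" "bounded {x. f x \<noteq> 0}"
  shows "integrable lborel f"
proof -
  have "integrable lborel (\<lambda>x. indicator (closure {x. f x \<noteq> 0}) x *\<^sub>R f x)"
    using assms continuous_on_subset[OF assms(1)] by (intro borel_integrable_compact) (simp_all add: compact_closure)
  also have "(\<lambda>x. indicator (closure {x. f x \<noteq> 0}) x *\<^sub>R f x) = f"
    using closure_subset[of "{x. f x \<noteq> 0}"] by (auto simp: indicator_def fun_eq_iff)
  finally show ?thesis .
qed

lemma continuous_bounded_support_bounded:
  fixes f :: "'a::euclidean_space \<Rightarrow> real"
  assumes "continuous_on UNIV f" "bounded {x. f x \<noteq> 0}"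
  obtains B where "B \<ge> 0" "\<And>x. \<bar>f x\<bar> \<le> B"
proof -
  have "compact (f ` closure {x. f x \<noteq> 0})"
    using assms continuous_on_subset[OF assms(1)] by (intro compact_continuous_image) (simp_all add: compact_closure)
  then obtain B where B: "\<And>y. y \<in> f ` closure {x. f x \<noteq> 0} \<Longrightarrow> norm y \<le> B"
    using compact_imp_bounded bounded_iff by metis
  have "\<bar>f x\<bar> \<le> max 0 B" for x
  proof (cases "f x = 0")
    case False
    then have "x \<in> closure {x. f x \<noteq> 0}" using closure_subset[of "{x. f x \<noteq> 0}"] by auto
    then show ?thesis using B[of "f x"] by auto
  qed simp
  then show ?thesis by (intro that[of "max 0 B"]) auto
qed

lemma integrable_test_function: "\<psi> \<in> test_functions \<Omega> \<Longrightarrow> integrable lborel \<psi>"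
  using test_functions_subset_UNIV[of \<psi> \<Omega>]
  by (intro integrable_continuous_bounded_support) (simp_all add: test_functions_UNIV_iff C_infinity_continuous)

lemma test_function_C_infinity: "\<psi> \<in> test_functions \<Omega> \<Longrightarrow> \<psi> \<in> C_infinity"
  by (simp add: test_functions_def)

lemma test_function_bounded:
  assumes "\<psi> \<in> test_functions \<Omega>"
  obtains B where "B \<ge> 0" "\<And>x. \<bar>\<psi> x\<bar> \<le> B"
  using assms[THEN test_functions_subset_UNIV] unfolding test_functions_UNIV_iff
  by (metis continuous_bounded_support_bounded C_infinity_continuous)

lemma C_infinity_has_line_derivative:
  assumes "f \<in> C_infinity"
  shows "((\<lambda>t. f (x + t *\<^sub>R axis j 1)) has_real_derivative partial j f (x + t *\<^sub>R axis j 1)) (at t)"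
proof -
  have "((\<lambda>t. x + t *\<^sub>R axis j 1) has_derivative (\<lambda>s. s *\<^sub>R axis j 1)) (at t)"
    by (auto intro!: derivative_eq_intros)
  from has_derivative_compose[OF this C_infinity_has_derivative[OF assms]]
  have "((\<lambda>t. f (x + t *\<^sub>R axis j 1)) has_derivative
     (\<lambda>s. \<Sum>i\<in>UNIV. (s *\<^sub>R axis j 1) $ i * partial i f (x + t *\<^sub>R axis j 1))) (at t)" .
  also have "(\<lambda>s. \<Sum>i\<in>UNIV. (s *\<^sub>R axis j 1) $ i * partial i f (x + t *\<^sub>R axis j 1))
      = (*) (partial j f (x + t *\<^sub>R axis j 1))"
    by (auto simp: axis_def if_distrib[of "\<lambda>a. _ * a * _"] sum.delta cong: if_cong)
  finally show ?thesis by (simp add: has_field_derivative_def)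
qed

lemma C_infinity_difference_quotient:
  assumes "f \<in> C_infinity"
  shows "(\<lambda>n. real (Suc n) * (f (x + (1 / real (Suc n)) *\<^sub>R axis j 1) - f x)) \<longlonglongrightarrow> partial j f x"
proof -
  have "(\<lambda>h. (f (x + (0 + h) *\<^sub>R axis j 1) - f (x + 0 *\<^sub>R axis j 1)) / h) \<midarrow>0\<rightarrow> partial j f (x + 0 *\<^sub>R axis j 1)"
    using C_infinity_has_line_derivative[OF assms, of x j 0] unfolding DERIV_def .
  then have "(\<lambda>h. (f (x + h *\<^sub>R axis j 1) - f x) / h) \<midarrow>0\<rightarrow> partial j f x" by simp
  moreover have "filterlim (\<lambda>n. 1 / real (Suc n)) (at 0) sequentially"
    using LIMSEQ_inverse_real_of_nat by (auto simp: filterlim_at inverse_eq_divide)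
  ultimately show ?thesis
    by (auto dest: filterlim_compose simp: mult.commute)
qed

lemma C_infinity_line_mean_value:
  assumes "f \<in> C_infinity" "h > 0"
  obtains t where "0 < t" "t < h" "f (x + h *\<^sub>R axis j 1) - f x = h * partial j f (x + t *\<^sub>R axis j 1)"
  using MVT2[of 0 h "\<lambda>t. f (x + t *\<^sub>R axis j 1)" "\<lambda>t. partial j f (x + t *\<^sub>R axis j 1)"]
    C_infinity_has_line_derivative[OF assms(1)] assms(2) that by auto

lemma integral_lborel_affine:
  fixes f :: "'a::euclidean_space \<Rightarrow> 'b::{banach, second_countable_topology}"
  assumes [measurable]: "f \<in> borel_measurable borel" and "s \<noteq> 0"
  shows "(\<integral>x. f (c + s *\<^sub>R x) \<partial>lborel) = (1 / \<bar>s\<bar> ^ DIM('a)) *\<^sub>R (\<integral>x. f x \<partial>lborel)"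
proof -
  have "(\<integral>x. f x \<partial>lborel) = (\<integral>x. f x \<partial>density (distr lborel borel (\<lambda>x. c + s *\<^sub>R x)) (\<lambda>_. \<bar>s\<bar>^DIM('a)))"
    using lborel_affine[OF assms(2), of c] by simp
  also have "\<dots> = \<bar>s\<bar> ^ DIM('a) *\<^sub>R (\<integral>x. f (c + s *\<^sub>R x) \<partial>lborel)"
    by (subst integral_density) (auto simp: integral_distr)
  finally show ?thesis using assms(2) by simp
qed

lemma integral_lborel_translate:
  fixes f :: "'a::euclidean_space \<Rightarrow> 'b::{banach, second_countable_topology}"
  shows "f \<in> borel_measurable borel \<Longrightarrow> (\<integral>x. f (x + c) \<partial>lborel) = (\<integral>x. f x \<partial>lborel)"
  using integral_lborel_affine[of f 1 c] by (simp add: add.commute)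

lemma integrable_scaleR_iff:
  fixes f :: "'a \<Rightarrow> 'b::{banach, second_countable_topology}"
  assumes "c \<noteq> 0"
  shows "integrable M (\<lambda>x. c *\<^sub>R f x) \<longleftrightarrow> integrable M f"
  using integrable_scaleR_right[of "1 / c" M "\<lambda>x. c *\<^sub>R f x"] assms by auto

lemma integrable_lborel_affine:
  fixes f :: "'a::euclidean_space \<Rightarrow> 'b::{banach, second_countable_topology}"
  assumes [measurable]: "f \<in> borel_measurable borel" and "s \<noteq> 0"
  shows "integrable lborel (\<lambda>x. f (c + s *\<^sub>R x)) \<longleftrightarrow> integrable lborel f"
proof -
  have "integrable lborel f \<longleftrightarrow> integrable (density (distr lborel borel (\<lambda>x. c + s *\<^sub>R x)) (\<lambda>_. \<bar>s\<bar>^DIM('a))) f"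
    using lborel_affine[OF assms(2), of c] by simp
  also have "\<dots> \<longleftrightarrow> integrable lborel (\<lambda>x. f (c + s *\<^sub>R x))"
    using assms(2) by (subst integrable_density) (auto simp: integrable_distr_eq integrable_scaleR_iff)
  finally show ?thesis ..
qed

text \<open>Every difference quotient integrates to 0 by translation invariance; the mean value
  theorem supplies the uniform bound under which the quotients converge to the derivative.\<close>

lemma integral_partial_test_function:
  assumes "\<psi> \<in> test_functions UNIV"
  shows "(\<integral>x. partial j \<psi> x \<partial>lborel) = 0"
proof -
  define q where "q n x = real (Suc n) * (\<psi> (x + (1 / real (Suc n)) *\<^sub>R axis j 1) - \<psi> x)" for n x
  have smooth: "\<psi> \<in> C_infinity" and supp: "bounded {x. \<psi> x \<noteq> 0}"
    using assms by (auto simp: test_functions_UNIV_iff)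
  have [measurable]: "\<psi> \<in> borel_measurable borel" "partial j \<psi> \<in> borel_measurable borel"
    using smooth by (auto intro!: C_infinity_measurable)
  have int: "integrable lborel \<psi>" using assms by (rule integrable_test_function)
  have int_shift: "integrable lborel (\<lambda>x. \<psi> (x + c))" for c
    using integrable_lborel_affine[of \<psi> 1 c] int by (simp add: add.commute)
  obtain R where R: "\<And>x. \<psi> x \<noteq> 0 \<Longrightarrow> norm x \<le> R"
    using supp by (auto simp: bounded_iff)
  obtain B where B: "B \<ge> 0" "\<And>x. \<bar>partial j \<psi> x\<bar> \<le> B"
    using test_function_bounded[OF test_functions_partial[OF assms]] by metis
  \<comment> \<open>The shift has length at most 1, so all quotients vanish outside the ball of
    radius \<open>R + 1\<close>.\<close>
  have bound: "\<bar>q n x\<bar> \<le> B * indicator (cball 0 (R + 1)) x" for n x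
  proof (cases "x \<in> cball 0 (R + 1)")
    case True
    obtain t where "\<psi> (x + (1 / real (Suc n)) *\<^sub>R axis j 1) - \<psi> x = (1 / real (Suc n)) * partial j \<psi> (x + t *\<^sub>R axis j 1)"
      using C_infinity_line_mean_value[OF smooth, of "1 / real (Suc n)"] by (metis zero_less_divide_1_iff of_nat_0_less_iff zero_less_Suc)
    then have "q n x = partial j \<psi> (x + t *\<^sub>R axis j 1)" by (simp add: q_def)
    with B True show ?thesis by simp
  next
    case False
    have "norm x \<le> norm (x + (1 / real (Suc n)) *\<^sub>R axis j 1) + norm ((1 / real (Suc n)) *\<^sub>R (axis j 1::real^'a))"
      by (metis add_diff_cancel_right' norm_triangle_ineq4)
    also have "norm ((1 / real (Suc n)) *\<^sub>R (axis j 1::real^'a)) \<le> 1" by simp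
    finally have "\<psi> (x + (1 / real (Suc n)) *\<^sub>R axis j 1) = 0" "\<psi> x = 0"
      using False R[of x] R[of "x + (1 / real (Suc n)) *\<^sub>R axis j 1"] by auto
    then show ?thesis by (simp add: q_def B)
  qed
  have "(\<lambda>n. \<integral>x. q n x \<partial>lborel) \<longlonglongrightarrow> (\<integral>x. partial j \<psi> x \<partial>lborel)"
  proof (rule integral_dominated_convergence[where w = "\<lambda>x. B * indicator (cball 0 (R + 1)) x"])
    show "integrable lborel (\<lambda>x. B * indicator (cball 0 (R + 1)) x :: real)"
      by (auto intro!: integrable_real_indicator emeasure_bounded_finite)
    show "AE x in lborel. (\<lambda>n. q n x) \<longlonglongrightarrow> partial j \<psi> x"
      unfolding q_def using C_infinity_difference_quotient[OF smooth] by simp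
    show "AE x in lborel. norm (q n x) \<le> B * indicator (cball 0 (R + 1)) x" for n
      using bound by simp
  qed (simp_all add: q_def[abs_def])
  moreover have "(\<integral>x. q n x \<partial>lborel) = 0" for n
    unfolding q_def using int int_shift by (simp add: integral_lborel_translate)
  ultimately show ?thesis by (simp add: LIMSEQ_const_iff)
qed

lemma integral_by_parts_test_function:
  assumes "\<phi> \<in> C_infinity" "\<psi> \<in> test_functions UNIV"
  shows "(\<integral>x. \<phi> x * partial j \<psi> x \<partial>lborel) = - (\<integral>x. partial j \<phi> x * \<psi> x \<partial>lborel)"
proof -
  have d: "\<phi> differentiable at x" "\<psi> differentiable at x" for x
    using assms by (auto intro: C_infinity_differentiable simp: test_functions_def)
  have "0 = (\<integral>x. partial j (\<lambda>x. \<phi> x * \<psi> x) x \<partial>lborel)"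
    using assms by (intro integral_partial_test_function[symmetric] test_functions_mult)
  also have "\<dots> = (\<integral>x. partial j \<phi> x * \<psi> x + \<phi> x * partial j \<psi> x \<partial>lborel)"
    by (simp add: partial_mult[OF d])
  also have "\<dots> = (\<integral>x. partial j \<phi> x * \<psi> x \<partial>lborel) + (\<integral>x. \<phi> x * partial j \<psi> x \<partial>lborel)"
    using assms by (intro Bochner_Integration.integral_add integrable_test_function[where \<Omega> = UNIV]) auto
  finally show ?thesis by simp
qed


subsection \<open>A smooth approximate identity\<close>

text \<open>With the constant polynomial 1 this is the classical function
  \<open>exp (- 1 / x)\<close>, extended by 0. The polynomial in \<open>1 / x\<close> makes the
  family closed under differentiation.\<close>

definition flat :: "real poly \<Rightarrow> real \<Rightarrow> real" where
  "flat P x = (if x > 0 then poly P (1 / x) * exp (- (1 / x)) else 0)"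

lemma poly_times_exp_minus_tendsto_0: "((\<lambda>t. poly P t * exp (- t)) \<longlongrightarrow> 0) (at_top :: real filter)"
proof -
  have "((\<lambda>t. \<Sum>i\<le>degree P. coeff P i * (t ^ i / exp t)) \<longlongrightarrow> (\<Sum>i\<le>degree P. coeff P i * 0)) at_top"
    by (intro tendsto_sum tendsto_mult tendsto_const tendsto_power_div_exp_0)
  then show ?thesis
    by (simp add: poly_altdef exp_minus divide_inverse sum_distrib_right mult.assoc)
qed

text \<open>Differentiating \<open>P (1 / x) exp (- 1 / x)\<close> multiplies \<open>P - P'\<close>
  by the square of its argument \<open>1 / x\<close>, that is, by the polynomial
  \<open>[:0, 0, 1:]\<close>. At 0 the exponential beats every power.\<close>

lemma flat_has_derivative: "(flat P has_real_derivative flat ((P - pderiv P) * [:0, 0, 1:]) x) (at x)"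
proof -
  consider "x > 0" | "x < 0" | "x = 0" by linarith
  then show ?thesis
  proof cases
    case 1
    have "((\<lambda>x. poly P (1 / x) * exp (- (1 / x))) has_real_derivative flat ((P - pderiv P) * [:0, 0, 1:]) x) (at x)"
      using 1 by (auto intro!: derivative_eq_intros poly_DERIV[THEN DERIV_chain2]
          simp: flat_def field_simps power2_eq_square)
    then show ?thesis
      by (rule DERIV_cong_ev[THEN iffD1, rotated 3, of _ _ _ x])
        (use 1 in \<open>auto intro!: eventually_nhds_in_open[of "{0<..}", THEN eventually_mono] simp: flat_def\<close>)
  next
    case 2
    have "((\<lambda>x. 0) has_real_derivative flat ((P - pderiv P) * [:0, 0, 1:]) x) (at x)"
      using 2 by (auto intro!: derivative_eq_intros simp: flat_def)
    then show ?thesis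
      by (rule DERIV_cong_ev[THEN iffD1, rotated 3, of _ _ _ x])
        (use 2 in \<open>auto intro!: eventually_nhds_in_open[of "{..<0}", THEN eventually_mono] simp: flat_def\<close>)
  next
    case 3
    have "((\<lambda>h. flat P h / h) \<longlongrightarrow> 0) (at_right 0)"
    proof (rule Lim_transform_eventually)
      show "((\<lambda>h. poly (P * [:0, 1:]) (inverse h) * exp (- inverse h)) \<longlongrightarrow> 0) (at_right 0)"
        by (rule filterlim_compose[OF poly_times_exp_minus_tendsto_0 filterlim_inverse_at_top_right])
      show "eventually (\<lambda>h. poly (P * [:0, 1:]) (inverse h) * exp (- inverse h) = flat P h / h) (at_right 0)"
        unfolding eventually_at_filter by (rule always_eventually) (simp add: flat_def field_simps)
    qed
    moreover have "((\<lambda>h. flat P h / h) \<longlongrightarrow> 0) (at_left 0)"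
      by (rule Lim_transform_eventually[OF tendsto_const])
        (simp add: eventually_at_filter flat_def)
    ultimately have "((\<lambda>h. flat P h / h) \<longlongrightarrow> 0) (at 0)"
      by (rule filterlim_split_at[rotated])
    then show ?thesis
      using 3 by (simp add: DERIV_def flat_def)
  qed
qed

lemma flat_coordinate_C_infinity: "(\<lambda>x::real^'n. flat P (s * x $ i + d)) \<in> C_infinity"
proof (rule C_infinity_coinduct[where S = "{\<lambda>x. c * flat P (s * x $ i + d) | c P. True}"])
  show "(\<lambda>x. flat P (s * x $ i + d)) \<in> {\<lambda>x::real^'n. c * flat P (s * x $ i + d) | c P. True}"
    by (auto intro!: exI[of _ 1] exI[of _ P])
  fix f :: "real^'n \<Rightarrow> real" and x j
  assume "f \<in> {\<lambda>x. c * flat P (s * x $ i + d) | c P. True}"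
  then obtain c P where f: "f = (\<lambda>x. c * flat P (s * x $ i + d))" by blast
  define P' where "P' = (P - pderiv P) * [:0, 0, 1:]"
  have D: "(f has_derivative (\<lambda>h. c * flat P' (s * x $ i + d) * (s * h $ i))) (at x)" for x
  proof -
    have "((\<lambda>x. s * x $ i + d) has_derivative (\<lambda>h. s * h $ i)) (at x)"
      by (auto intro!: derivative_eq_intros bounded_linear.has_derivative[OF bounded_linear_vec_nth])
    moreover have "(flat P has_derivative (*) (flat P' (s * x $ i + d))) (at (s * x $ i + d))"
      using flat_has_derivative[of P "s * x $ i + d"] by (simp add: has_field_derivative_def P'_def)
    ultimately have "((\<lambda>x. flat P (s * x $ i + d)) has_derivative (\<lambda>h. flat P' (s * x $ i + d) * (s * h $ i))) (at x)"
      by (rule has_derivative_compose)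
    from has_derivative_mult_right[OF this, of c] show ?thesis by (simp add: f mult.assoc)
  qed
  then show "f differentiable at x" by (rule differentiableI)
  have "partial j f = (\<lambda>x. (c * s * (if i = j then 1 else 0)) * flat P' (s * x $ i + d))"
    by (intro ext, subst partial_eqI[OF D]) (simp add: axis_def)
  then show "partial j f \<in> {\<lambda>x. c * flat P (s * x $ i + d) | c P. True}" by blast
qed

text \<open>A product of one-dimensional bumps, one for each coordinate. The half width
  \<open>r / CARD('n)\<close> of the cube keeps the l1 norm, hence the Euclidean norm, below
  \<open>r\<close> on the support.\<close>

definition bump :: "real \<Rightarrow> real^'n::finite \<Rightarrow> real" where
  "bump r x = (\<Prod>i\<in>UNIV. flat 1 (r / CARD('n) - x $ i) * flat 1 (r / CARD('n) + x $ i))"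

lemma flat_1_nonneg [simp]: "flat 1 x \<ge> 0"
  by (simp add: flat_def)

lemma flat_1_eq_0_iff [simp]: "flat 1 x = 0 \<longleftrightarrow> x \<le> 0"
  by (auto simp: flat_def)

lemma bump_nonneg [simp]: "bump r x \<ge> 0"
  by (auto simp: bump_def intro!: prod_nonneg)

lemma bump_nonzeroD:
  assumes "bump r (x :: real^'n::finite) \<noteq> 0" shows "norm x < r"
proof -
  have "\<bar>x $ i\<bar> < r / CARD('n)" for i
    using assms by (auto simp: bump_def not_le abs_less_iff dest!: spec[of _ i])
  then have "(\<Sum>i\<in>UNIV. \<bar>x $ i\<bar>) < (\<Sum>i\<in>(UNIV::'n set). r / CARD('n))"
    by (intro sum_strict_mono) auto
  then show ?thesis using norm_le_l1_cart[of x] by simp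
qed

lemma bump_C_infinity: "bump r \<in> C_infinity"
proof -
  have "(\<lambda>x::real^'n. flat 1 (r / CARD('n) - x $ i) * flat 1 (r / CARD('n) + x $ i)) \<in> C_infinity" for i
    using flat_coordinate_C_infinity[of 1 "-1" i "r / CARD('n)"] flat_coordinate_C_infinity[of 1 1 i "r / CARD('n)"]
    by (intro C_infinity_mult) (simp_all add: add.commute)
  then show ?thesis
    unfolding bump_def[abs_def] by (intro C_infinity_prod)
qed

lemma bump_test_function: "bump r \<in> test_functions UNIV"
  using bump_C_infinity bump_nonzeroD by (force simp: test_functions_UNIV_iff bounded_iff intro!: less_imp_le)

lemma bump_integral_pos:
  assumes "r > 0"
  shows "(\<integral>x. bump r (x :: real^'n::finite) \<partial>lborel) > 0"
proof (rule ccontr)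
  assume "\<not> ?thesis"
  then have "(\<integral>x. bump r (x::real^'n) \<partial>lborel) = 0"
    by (metis bump_nonneg integral_nonneg_AE AE_I2 order.order_iff_strict not_less)
  then have "AE x in lborel. bump r (x::real^'n) = 0"
    by (subst (asm) integral_nonneg_eq_0_iff_AE)
      (auto intro: integrable_test_function[OF bump_test_function])
  moreover have op: "open {x::real^'n. bump r x \<noteq> 0}"
    by (intro open_Collect_neq C_infinity_continuous bump_C_infinity continuous_intros)
  ultimately have "{x::real^'n. bump r x \<noteq> 0} \<in> null_sets lborel"
    by (subst AE_iff_null_sets) auto
  then have "negligible {x::real^'n. bump r x \<noteq> 0}"
    by (simp add: negligible_iff_null_sets null_sets_completionI)
  then have "{x::real^'n. bump r x \<noteq> 0} = {}"
    using open_not_negligible op by blast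
  moreover have "bump r (0::real^'n) \<noteq> 0"
    using divide_pos_pos[OF assms, of "real CARD('n)"] by (simp add: bump_def not_le)
  ultimately show False by blast
qed

definition mollifier :: "real \<Rightarrow> real^'n::finite \<Rightarrow> real" where
  "mollifier r x = bump r x / (\<integral>y. bump r (y :: real^'n) \<partial>lborel)"

lemma mollifier_test_function: "mollifier r \<in> test_functions UNIV"
  unfolding mollifier_def[abs_def] divide_inverse
  by (subst mult.commute) (rule test_functions_mult[OF C_infinity_const bump_test_function])

lemma mollifier_C_infinity: "mollifier r \<in> C_infinity"
  by (rule test_function_C_infinity[OF mollifier_test_function])

lemma mollifier_nonzeroD: "mollifier r x \<noteq> 0 \<Longrightarrow> norm x < r"
  by (auto simp: mollifier_def intro: bump_nonzeroD)

lemma mollifier_nonneg [simp]: "mollifier r x \<ge> 0"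
  by (auto simp: mollifier_def intro!: divide_nonneg_nonneg integral_nonneg_AE)

lemma integral_mollifier: "r > 0 \<Longrightarrow> (\<integral>x. mollifier r x \<partial>lborel) = 1"
  using bump_integral_pos[where 'n = 'a, of r] by (simp add: mollifier_def[abs_def])

lemma mollifier_reflect_test_function:
  assumes "cball x r \<subseteq> \<Omega>"
  shows "(\<lambda>y. mollifier r (x - y)) \<in> test_functions \<Omega>"
proof -
  have "{y. mollifier r (x - y) \<noteq> 0} \<subseteq> cball x r"
    using mollifier_nonzeroD by (force simp: dist_norm)
  then have sub: "closure {y. mollifier r (x - y) \<noteq> 0} \<subseteq> cball x r"
    by (rule closure_minimal) simp
  then have "compact (closure {y. mollifier r (x - y) \<noteq> 0})"
    by (auto simp: compact_eq_bounded_closed intro: bounded_subset[OF bounded_cball])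
  with sub assms show ?thesis
    by (auto simp: test_functions_def intro: C_infinity_reflect mollifier_C_infinity)
qed

subsection \<open>Convolution with test functions\<close>

definition conv :: "(real^'n::finite \<Rightarrow> real) \<Rightarrow> (real^'n \<Rightarrow> real) \<Rightarrow> real^'n \<Rightarrow> real" where
  "conv v \<phi> x = (\<integral>y. v y * \<phi> (x - y) \<partial>lborel)"

abbreviation mollify :: "real \<Rightarrow> (real^'n::finite \<Rightarrow> real) \<Rightarrow> real^'n \<Rightarrow> real" where
  "mollify r v \<equiv> conv v (mollifier r)"

lemma integrable_mult_bounded:
  fixes f g :: "'a \<Rightarrow> real"
  assumes "integrable M f" "g \<in> borel_measurable M" "\<And>x. \<bar>g x\<bar> \<le> B"
  shows "integrable M (\<lambda>x. f x * g x)"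
proof (rule Bochner_Integration.integrable_bound)
  show "integrable M (\<lambda>x. B * f x)" using assms(1) by simp
  show "(\<lambda>x. f x * g x) \<in> borel_measurable M" using assms by (auto intro: borel_measurable_integrable)
  have "\<bar>f x\<bar> * \<bar>g x\<bar> \<le> \<bar>f x\<bar> * \<bar>B\<bar>" for x
    using assms(3)[of x] by (intro mult_left_mono) auto
  then show "AE x in M. norm (f x * g x) \<le> norm (B * f x)"
    by (simp add: abs_mult mult.commute)
qed

lemma conv_integrable:
  assumes "integrable lborel v" "\<phi> \<in> test_functions UNIV"
  shows "integrable lborel (\<lambda>y. v y * \<phi> (x - y))"
proof -
  obtain B where "\<And>x. \<bar>\<phi> x\<bar> \<le> B" using test_function_bounded[OF assms(2)] by metis
  moreover have "(\<lambda>y. \<phi> (x - y)) \<in> borel_measurable lborel"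
    using C_infinity_measurable[OF C_infinity_reflect[OF test_function_C_infinity[OF assms(2)]]] by simp
  ultimately show ?thesis using assms(1) by (intro integrable_mult_bounded)
qed

lemma test_function_lipschitz:
  assumes "\<psi> \<in> test_functions UNIV"
  obtains K where "K \<ge> 0" "\<And>x y. \<bar>\<psi> x - \<psi> y\<bar> \<le> K * norm (x - y)"
proof -
  have smooth: "\<psi> \<in> C_infinity" using assms by (rule test_function_C_infinity)
  have "\<exists>B. B \<ge> 0 \<and> (\<forall>x. \<bar>partial j \<psi> x\<bar> \<le> B)" for j
    using test_function_bounded[OF test_functions_partial[OF assms]] by metis
  then obtain B where B: "\<And>j. B j \<ge> 0" "\<And>j x. \<bar>partial j \<psi> x\<bar> \<le> B j" by metis
  have "norm (\<psi> x - \<psi> y) \<le> (\<Sum>j\<in>UNIV. B j) * norm (x - y)" for x y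
  proof (rule differentiable_bound[of UNIV \<psi> "\<lambda>x h. \<Sum>j\<in>UNIV. h $ j * partial j \<psi> x"])
    fix x
    show "onorm (\<lambda>h. \<Sum>j\<in>UNIV. h $ j * partial j \<psi> x) \<le> (\<Sum>j\<in>UNIV. B j)"
    proof (rule onorm_bound)
      fix h
      have "norm (\<Sum>j\<in>UNIV. h $ j * partial j \<psi> x) \<le> (\<Sum>j\<in>UNIV. norm h * B j)"
        using B by (intro sum_norm_le) (auto simp: abs_mult intro!: mult_mono component_le_norm_cart)
      then show "norm (\<Sum>j\<in>UNIV. h $ j * partial j \<psi> x) \<le> (\<Sum>j\<in>UNIV. B j) * norm h"
        by (simp add: sum_distrib_right sum_distrib_left mult.commute)
    qed (simp add: B sum_nonneg)
  qed (use C_infinity_has_derivative[OF smooth] in auto)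
  then show ?thesis using B by (intro that[of "\<Sum>j\<in>UNIV. B j"]) (auto intro: sum_nonneg)
qed

text \<open>Lipschitz continuity of the first derivatives gives a quadratic remainder whose constant
  does not depend on the base point; this uniformity is what \<open>conv_has_derivative\<close>
  integrates.\<close>

lemma test_function_taylor:
  assumes "\<psi> \<in> test_functions UNIV"
  obtains K where "K \<ge> 0"
    "\<And>x h. \<bar>\<psi> (x + h) - \<psi> x - (\<Sum>j\<in>UNIV. h $ j * partial j \<psi> x)\<bar> \<le> K * (norm h)\<^sup>2"
proof -
  have smooth: "\<psi> \<in> C_infinity" using assms by (rule test_function_C_infinity)
  have "\<exists>B. B \<ge> 0 \<and> (\<forall>x y. \<bar>partial j \<psi> x - partial j \<psi> y\<bar> \<le> B * norm (x - y))" for j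
    using test_function_lipschitz[OF test_functions_partial[OF assms]] by metis
  then obtain B where B: "\<And>j. B j \<ge> 0" "\<And>j x y. \<bar>partial j \<psi> x - partial j \<psi> y\<bar> \<le> B j * norm (x - y)"
    by metis
  let ?D = "\<lambda>x h. \<Sum>j\<in>UNIV. h $ j * partial j \<psi> x"
  have "norm (\<psi> (x + h) - \<psi> x - ?D x (x + h - x)) \<le> norm (x + h - x) * ((\<Sum>j\<in>UNIV. B j) * norm h)" for x h
  proof (rule differentiable_bound_linearization[where S = "cball x (norm h)" and f = \<psi> and f' = ?D])
    show "x + t *\<^sub>R (x + h - x) \<in> cball x (norm h)" if "t \<in> {0..1}" for t
      using that mult_right_mono[of t 1 "norm h"] by (auto simp: dist_norm)
    show "(\<psi> has_derivative ?D y) (at y within cball x (norm h))" for y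
      using C_infinity_has_derivative[OF smooth] has_derivative_at_withinI by blast
    show "onorm (?D y - ?D x) \<le> (\<Sum>j\<in>UNIV. B j) * norm h" if y: "y \<in> cball x (norm h)" for y
    proof (rule onorm_bound)
      fix k
      have eq: "(?D y - ?D x) k = (\<Sum>j\<in>UNIV. k $ j * (partial j \<psi> y - partial j \<psi> x))"
        by (simp add: sum_subtractf right_diff_distrib)
      have "\<bar>partial j \<psi> y - partial j \<psi> x\<bar> \<le> B j * norm h" for j
        using B(2)[of j y x] mult_left_mono[OF _ B(1), of "norm (y - x)" "norm h" j] y
        by (auto simp: dist_norm norm_minus_commute)
      then have "norm ((?D y - ?D x) k) \<le> (\<Sum>j\<in>UNIV. norm k * (B j * norm h))"
        unfolding eq by (intro sum_norm_le) (auto simp: abs_mult intro!: mult_mono component_le_norm_cart)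
      then show "norm ((?D y - ?D x) k) \<le> (\<Sum>j\<in>UNIV. B j) * norm h * norm k"
        by (simp add: sum_distrib_left sum_distrib_right mult_ac)
    qed (simp add: B sum_nonneg)
  qed simp
  then show ?thesis
    using B by (intro that[of "\<Sum>j\<in>UNIV. B j"]) (auto intro: sum_nonneg simp: power2_eq_square mult_ac)
qed

text \<open>Integrating the uniform quadratic Taylor remainder of \<open>\<phi>\<close> against the
  modulus of \<open>v\<close> bounds the remainder of the convolution by the same power; this
  differentiates under the integral sign for every integrable \<open>v\<close>.\<close>

lemma conv_has_derivative:
  assumes v: "integrable lborel v" and \<phi>: "\<phi> \<in> test_functions UNIV"
  shows "(conv v \<phi> has_derivative (\<lambda>h. \<Sum>j\<in>UNIV. h $ j * conv v (partial j \<phi>) x)) (at x)"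
proof -
  obtain K where K: "K \<ge> 0"
    "\<And>x h. \<bar>\<phi> (x + h) - \<phi> x - (\<Sum>j\<in>UNIV. h $ j * partial j \<phi> x)\<bar> \<le> K * (norm h)\<^sup>2"
    using test_function_taylor[OF \<phi>] by metis
  define N where "N = (\<integral>y. \<bar>v y\<bar> \<partial>lborel)"
  have int: "integrable lborel (\<lambda>y. v y * \<psi> (x - y))" if "\<psi> \<in> test_functions UNIV" for \<psi> x
    using v that by (rule conv_integrable)
  let ?L = "\<lambda>h. \<Sum>j\<in>UNIV. h $ j * conv v (partial j \<phi>) x"
  have rem: "norm (conv v \<phi> y - conv v \<phi> x - ?L (y - x)) \<le> K * (norm (y - x))\<^sup>2 * N" for y
  proof -
    define h where "h = y - x"
    let ?r = "\<lambda>z. v z * (\<phi> ((x - z) + h) - \<phi> (x - z) - (\<Sum>j\<in>UNIV. h $ j * partial j \<phi> (x - z)))"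
    have y: "y - z = (x - z) + h" for z by (simp add: h_def)
    have "conv v \<phi> y - conv v \<phi> x - ?L h = (\<integral>z. v z * \<phi> (y - z) - v z * \<phi> (x - z)
        - (\<Sum>j\<in>UNIV. h $ j * (v z * partial j \<phi> (x - z))) \<partial>lborel)"
      using int[OF \<phi>] int[OF test_functions_partial[OF \<phi>]]
      by (simp add: conv_def)
    also have "\<dots> = (\<integral>z. ?r z \<partial>lborel)"
      by (simp add: y right_diff_distrib sum_distrib_left mult.left_commute)
    finally have eq: "conv v \<phi> y - conv v \<phi> x - ?L h = (\<integral>z. ?r z \<partial>lborel)" .
    have "norm (\<integral>z. ?r z \<partial>lborel) \<le> (\<integral>z. \<bar>v z\<bar> * (K * (norm h)\<^sup>2) \<partial>lborel)"
    proof (rule order_trans[OF integral_norm_bound integral_mono'])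
      show "norm (?r z) \<le> \<bar>v z\<bar> * (K * (norm h)\<^sup>2)" for z
        using K(2)[of "x - z" h] by (simp add: abs_mult mult_left_mono)
    qed (use v K(1) in auto)
    then show ?thesis unfolding eq[symmetric] h_def[symmetric] N_def by (simp add: mult.commute)
  qed
  have lin: "bounded_linear ?L"
    by (intro bounded_linear_sum bounded_linear_mult_left[THEN bounded_linear_compose] bounded_linear_vec_nth)
  show ?thesis
  proof (rule has_derivativeI_sandwich[of 1])
    show "norm ((conv v \<phi> y - conv v \<phi> x) - ?L (y - x)) / norm (y - x) \<le> (K * N) * norm (y - x)"
      if "y \<noteq> x" for y
      using rem[of y] that by (simp add: field_simps power2_eq_square)
    show "((\<lambda>y. (K * N) * norm (y - x)) \<longlongrightarrow> 0) (at x)"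
      by (auto intro!: tendsto_eq_intros)
  qed (use lin in auto)
qed

lemma partial_conv:
  assumes "integrable lborel v" "\<phi> \<in> test_functions UNIV"
  shows "partial j (conv v \<phi>) = conv v (partial j \<phi>)"
  by (intro ext, subst partial_eqI[OF conv_has_derivative[OF assms]])
    (simp add: axis_def if_distrib[of "\<lambda>a. a * _"] cong: if_cong)

lemma conv_C_infinity:
  assumes "integrable lborel v" "\<phi> \<in> test_functions UNIV"
  shows "conv v \<phi> \<in> C_infinity"
  by (rule C_infinity_coinduct[where S = "conv v ` test_functions UNIV"])
    (use assms in \<open>auto simp: partial_conv intro: differentiableI[OF conv_has_derivative]\<close>)

lemma conv_test_function:
  assumes "integrable lborel v" "\<phi> \<in> test_functions UNIV" "bounded {x. v x \<noteq> 0}"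
  shows "conv v \<phi> \<in> test_functions UNIV"
proof -
  have "{x. conv v \<phi> x \<noteq> 0} \<subseteq> (\<Union>y\<in>{x. v x \<noteq> 0}. \<Union>z\<in>{x. \<phi> x \<noteq> 0}. {y + z})"
  proof
    fix x assume "x \<in> {x. conv v \<phi> x \<noteq> 0}"
    moreover have "conv v \<phi> x = 0" if "\<forall>y. v y * \<phi> (x - y) = 0"
      unfolding conv_def by (simp only: that) simp
    ultimately obtain y where "v y \<noteq> 0" "\<phi> (x - y) \<noteq> 0"
      by fastforce
    then show "x \<in> (\<Union>y\<in>{x. v x \<noteq> 0}. \<Union>z\<in>{x. \<phi> x \<noteq> 0}. {y + z})"
      by (intro UN_I[of y] UN_I[of "x - y"]) auto
  qed
  moreover have "bounded (\<Union>y\<in>{x. v x \<noteq> 0}. \<Union>z\<in>{x. \<phi> x \<noteq> 0}. {y + z})"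
    using bounded_sums[OF assms(3), of "{x. \<phi> x \<noteq> 0}"] assms(2) by (auto simp: test_functions_UNIV_iff)
  ultimately show ?thesis
    using conv_C_infinity[OF assms(1,2)] by (auto simp: test_functions_UNIV_iff intro: bounded_subset)
qed

lemma conv_bounded:
  assumes "integrable lborel v" "\<phi> \<in> test_functions UNIV"
  obtains B where "\<And>x. \<bar>conv v \<phi> x\<bar> \<le> B"
proof -
  obtain B where B: "\<And>x. \<bar>\<phi> x\<bar> \<le> B" using test_function_bounded[OF assms(2)] by metis
  have "norm (\<integral>y. v y * \<phi> (x - y) \<partial>lborel) \<le> (\<integral>y. \<bar>v y\<bar> * B \<partial>lborel)" for x
    by (rule order_trans[OF integral_norm_bound integral_mono'])
      (use B assms(1) in \<open>auto simp: abs_mult intro!: mult_left_mono mult_nonneg_nonneg order_trans[OF abs_ge_zero B]\<close>)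
  then show ?thesis using that[of "\<integral>y. \<bar>v y\<bar> * B \<partial>lborel"] by (simp add: conv_def)
qed

lemma integral_mollifier_translate:
  fixes x y :: "real^'n::finite"
  assumes "r > 0"
  shows "(\<integral>x. mollifier r (x - y) \<partial>lborel) = 1" "(\<integral>y. mollifier r (x - y) \<partial>lborel) = 1"
    "integrable lborel (\<lambda>x. mollifier r (x - y))" "integrable lborel (\<lambda>y. mollifier r (x - y))"
proof -
  have [measurable]: "mollifier r \<in> borel_measurable borel"
    by (rule C_infinity_measurable[OF mollifier_C_infinity])
  have i: "integrable lborel (mollifier r :: real^'n \<Rightarrow> real)"
    by (rule integrable_test_function[OF mollifier_test_function])
  show "(\<integral>x. mollifier r (x - y) \<partial>lborel) = 1" "(\<integral>y. mollifier r (x - y) \<partial>lborel) = 1"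
    using integral_lborel_affine[of "mollifier r" 1 "- y"] integral_lborel_affine[of "mollifier r" "- 1" x]
      integral_mollifier[OF assms] by simp_all
  show "integrable lborel (\<lambda>x. mollifier r (x - y))" "integrable lborel (\<lambda>y. mollifier r (x - y))"
    using integrable_lborel_affine[of "mollifier r" 1 "- y"] integrable_lborel_affine[of "mollifier r" "- 1" x] i
    by simp_all
qed

text \<open>Jensen's inequality for the probability density \<open>mollifier r (x - y)\<close>, then
  Tonelli; the mollifier has integral 1 in either variable.\<close>

lemma mollify_square_le:
  assumes v: "integrable lborel v" "integrable lborel (\<lambda>x. (v x)\<^sup>2)" and r: "r > 0"
  shows "(\<integral>\<^sup>+x. ennreal ((mollify r v x)\<^sup>2) \<partial>lborel) \<le> (\<integral>\<^sup>+x. ennreal ((v x)\<^sup>2) \<partial>lborel)"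
proof -
  let ?\<rho> = "mollifier r"
  have [measurable]: "?\<rho> \<in> borel_measurable borel"
    by (rule C_infinity_measurable[OF mollifier_C_infinity])
  have [measurable]: "v \<in> borel_measurable borel" using v(1) by auto
  have jensen: "(mollify r v x)\<^sup>2 \<le> (\<integral>y. (v y)\<^sup>2 * ?\<rho> (x - y) \<partial>lborel)" for x
  proof -
    let ?m = "mollify r v x"
    have i: "integrable lborel (\<lambda>y. (v y)\<^sup>2 * ?\<rho> (x - y))" "integrable lborel (\<lambda>y. v y * ?\<rho> (x - y))"
      "integrable lborel (\<lambda>y. ?\<rho> (x - y))"
      using conv_integrable[OF v(2) mollifier_test_function] conv_integrable[OF v(1) mollifier_test_function]
        integral_mollifier_translate[OF r] by auto
    \<comment> \<open>The variance of \<open>v\<close> under this density is nonnegative.\<close>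
    have "0 \<le> (\<integral>y. (v y - ?m)\<^sup>2 * ?\<rho> (x - y) \<partial>lborel)"
      by (intro integral_nonneg_AE) simp
    also have "\<dots> = (\<integral>y. (v y)\<^sup>2 * ?\<rho> (x - y) - 2 * ?m * (v y * ?\<rho> (x - y)) + ?m\<^sup>2 * ?\<rho> (x - y) \<partial>lborel)"
      by (simp add: power2_diff algebra_simps)
    also have "\<dots> = (\<integral>y. (v y)\<^sup>2 * ?\<rho> (x - y) \<partial>lborel) - 2 * ?m * ?m + ?m\<^sup>2 * 1"
      using i by (subst integral_mollifier_translate(2)[OF r, of x, symmetric])
        (simp add: conv_def)
    finally show ?thesis by (simp add: power2_eq_square)
  qed
  have "(\<integral>\<^sup>+x. ennreal ((mollify r v x)\<^sup>2) \<partial>lborel)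
      \<le> (\<integral>\<^sup>+x. \<integral>\<^sup>+y. ennreal ((v y)\<^sup>2) * ennreal (?\<rho> (x - y)) \<partial>lborel \<partial>lborel)"
  proof (rule nn_integral_mono)
    fix x
    have "ennreal (\<integral>y. (v y)\<^sup>2 * ?\<rho> (x - y) \<partial>lborel) = (\<integral>\<^sup>+y. ennreal ((v y)\<^sup>2 * ?\<rho> (x - y)) \<partial>lborel)"
      by (rule nn_integral_eq_integral[symmetric])
        (use conv_integrable[OF v(2) mollifier_test_function] in auto)
    then show "ennreal ((mollify r v x)\<^sup>2) \<le> (\<integral>\<^sup>+y. ennreal ((v y)\<^sup>2) * ennreal (?\<rho> (x - y)) \<partial>lborel)"
      using ennreal_leI[OF jensen[of x]] by (simp add: ennreal_mult)
  qed
  also have "\<dots> = (\<integral>\<^sup>+y. \<integral>\<^sup>+x. ennreal ((v y)\<^sup>2) * ennreal (?\<rho> (x - y)) \<partial>lborel \<partial>lborel)"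
    by (rule lborel_pair.Fubini') measurable
  also have "\<dots> = (\<integral>\<^sup>+y. ennreal ((v y)\<^sup>2) * (\<integral>\<^sup>+x. ennreal (?\<rho> (x - y)) \<partial>lborel) \<partial>lborel)"
    by (subst nn_integral_cmult) measurable
  also have "\<dots> = (\<integral>\<^sup>+y. ennreal ((v y)\<^sup>2) \<partial>lborel)"
    by (subst nn_integral_eq_integral) (simp_all add: integral_mollifier_translate[OF r])
  finally show ?thesis .
qed

text \<open>Fubini moves the mollifier from \<open>v\<close> to \<open>\<phi>\<close>, whose uniform
  continuity makes the mollified \<open>\<phi>\<close> uniformly close to \<open>\<phi>\<close>.
  Thus \<open>v\<close> may be any integrable function.\<close>

lemma mollify_weak_limit:
  assumes v: "integrable lborel v" and \<phi>: "continuous_on UNIV \<phi>" "bounded {x. \<phi> x \<noteq> 0}" and "e > 0"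
  obtains d where "d > 0"
    "\<And>r. 0 < r \<Longrightarrow> r < d \<Longrightarrow> \<bar>(\<integral>x. mollify r v x * \<phi> x \<partial>lborel) - (\<integral>x. v x * \<phi> x \<partial>lborel)\<bar> \<le> e"
proof -
  define N where "N = (\<integral>y. \<bar>v y\<bar> \<partial>lborel)"
  have N: "N \<ge> 0" by (simp add: N_def)
  \<comment> \<open>Division by \<open>N + 1\<close> rather than \<open>N\<close> covers the case
    that \<open>v\<close> vanishes almost everywhere.\<close>
  define \<eta> where "\<eta> = e / (N + 1)"
  have \<eta>: "\<eta> > 0" using N assms(4) by (simp add: \<eta>_def)
  obtain R where R: "\<And>x. \<phi> x \<noteq> 0 \<Longrightarrow> norm x \<le> R" using \<phi>(2) by (auto simp: bounded_iff)
  have "uniformly_continuous_on (cball 0 (R + 1)) \<phi>"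
    using \<phi>(1) by (intro compact_uniformly_continuous) (auto intro: continuous_on_subset)
  then obtain d where d: "d > 0" "\<And>x y. x \<in> cball 0 (R + 1) \<Longrightarrow> y \<in> cball 0 (R + 1) \<Longrightarrow> dist x y < d \<Longrightarrow> dist (\<phi> x) (\<phi> y) < \<eta>"
    using \<eta> unfolding uniformly_continuous_on_def by metis
  have uc: "\<bar>\<phi> x - \<phi> y\<bar> \<le> \<eta>" if "norm (x - y) < min d 1" for x y
  proof (cases "x \<in> cball 0 (R + 1) \<and> y \<in> cball 0 (R + 1)")
    case True
    then show ?thesis using d(2)[of x y] that by (auto simp: dist_norm)
  next
    case False
    have "norm x \<le> norm y + norm (x - y)" "norm y \<le> norm x + norm (x - y)"
      using norm_triangle_sub[of x y] norm_triangle_sub[of y x] by (auto simp: norm_minus_commute)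
    with False that have "\<not> norm x \<le> R" "\<not> norm y \<le> R" by auto
    with R have "\<phi> x = 0" "\<phi> y = 0" by blast+
    then show ?thesis using \<eta> by simp
  qed
  obtain B where B: "B \<ge> 0" "\<And>x. \<bar>\<phi> x\<bar> \<le> B"
    using continuous_bounded_support_bounded[OF \<phi>] by metis
  have \<phi>_int: "integrable lborel \<phi>" by (rule integrable_continuous_bounded_support[OF \<phi>])
  have [measurable]: "v \<in> borel_measurable borel" "\<phi> \<in> borel_measurable borel"
    using v \<phi>(1) by (auto intro: borel_measurable_continuous_onI)
  have "\<bar>(\<integral>x. mollify r v x * \<phi> x \<partial>lborel) - (\<integral>x. v x * \<phi> x \<partial>lborel)\<bar> \<le> e" if r: "0 < r" "r < min d 1" for r
  proof -
    let ?\<rho> = "mollifier r"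
    have \<rho>_meas [measurable]: "?\<rho> \<in> borel_measurable borel"
      by (rule C_infinity_measurable[OF mollifier_C_infinity])
    have \<rho>\<phi>: "integrable lborel (\<lambda>x. ?\<rho> (x - y) * \<phi> x)" for y
      using integral_mollifier_translate(3)[OF r(1)] B(2) by (intro integrable_mult_bounded) auto
    have int: "integrable (lborel \<Otimes>\<^sub>M lborel) (\<lambda>(x, y). v y * ?\<rho> (x - y) * \<phi> x)"
    proof (rule lborel_pair.Fubini_integrable)
      show "(\<lambda>(x, y). v y * ?\<rho> (x - y) * \<phi> x) \<in> borel_measurable (lborel \<Otimes>\<^sub>M lborel)" by measurable
      have "conv (\<lambda>y. \<bar>v y\<bar>) ?\<rho> \<in> C_infinity"
        using v mollifier_test_function by (intro conv_C_infinity) auto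
      then have [measurable]: "conv (\<lambda>y. \<bar>v y\<bar>) ?\<rho> \<in> borel_measurable borel"
        by (rule C_infinity_measurable)
      obtain B' where "\<And>x. \<bar>conv (\<lambda>y. \<bar>v y\<bar>) ?\<rho> x\<bar> \<le> B'"
        using conv_bounded[of "\<lambda>y. \<bar>v y\<bar>" ?\<rho>] v mollifier_test_function by auto
      then have "integrable lborel (\<lambda>x. \<bar>\<phi> x\<bar> * conv (\<lambda>y. \<bar>v y\<bar>) ?\<rho> x)"
        using \<phi>_int by (intro integrable_mult_bounded) auto
      also have "(\<lambda>x. \<bar>\<phi> x\<bar> * conv (\<lambda>y. \<bar>v y\<bar>) ?\<rho> x)
          = (\<lambda>x. \<integral>y. norm (case (x, y) of (x, y) \<Rightarrow> v y * ?\<rho> (x - y) * \<phi> x) \<partial>lborel)"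
        by (simp add: conv_def abs_mult mult.commute)
      finally show "integrable lborel (\<lambda>x. \<integral>y. norm (case (x, y) of (x, y) \<Rightarrow> v y * ?\<rho> (x - y) * \<phi> x) \<partial>lborel)" .
      show "AE x in lborel. integrable lborel (\<lambda>y. case (x, y) of (x, y) \<Rightarrow> v y * ?\<rho> (x - y) * \<phi> x)"
        using conv_integrable[OF v mollifier_test_function] by simp
    qed
    have "(\<integral>x. mollify r v x * \<phi> x \<partial>lborel) = (\<integral>x. \<integral>y. v y * ?\<rho> (x - y) * \<phi> x \<partial>lborel \<partial>lborel)"
      by (simp add: conv_def)
    also have "\<dots> = (\<integral>y. \<integral>x. v y * ?\<rho> (x - y) * \<phi> x \<partial>lborel \<partial>lborel)"
      using lborel_pair.Fubini_integral[OF int] by simp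
    also have "\<dots> = (\<integral>y. v y * (\<integral>x. ?\<rho> (x - y) * \<phi> x \<partial>lborel) \<partial>lborel)"
      by (simp add: mult.assoc)
    finally have eq: "(\<integral>x. mollify r v x * \<phi> x \<partial>lborel) = (\<integral>y. v y * (\<integral>x. ?\<rho> (x - y) * \<phi> x \<partial>lborel) \<partial>lborel)" .
    have close: "\<bar>(\<integral>x. ?\<rho> (x - y) * \<phi> x \<partial>lborel) - \<phi> y\<bar> \<le> \<eta>" for y
    proof -
      have "(\<integral>x. ?\<rho> (x - y) * \<phi> x \<partial>lborel) - \<phi> y = (\<integral>x. ?\<rho> (x - y) * \<phi> x - ?\<rho> (x - y) * \<phi> y \<partial>lborel)"
        using \<rho>\<phi>[of y] by (simp add: integral_mollifier_translate[OF r(1)])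
      also have "\<bar>\<dots>\<bar> \<le> (\<integral>x. ?\<rho> (x - y) * \<eta> \<partial>lborel)"
        unfolding real_norm_def[symmetric]
      proof (rule order_trans[OF integral_norm_bound integral_mono'])
        show "integrable lborel (\<lambda>x. ?\<rho> (x - y) * \<eta>)"
          using integral_mollifier_translate(3)[OF r(1), of y] by simp
        show "norm (?\<rho> (x - y) * \<phi> x - ?\<rho> (x - y) * \<phi> y) \<le> ?\<rho> (x - y) * \<eta>" for x
        proof (cases "?\<rho> (x - y) = 0")
          case False
          then have "\<bar>\<phi> x - \<phi> y\<bar> \<le> \<eta>" using mollifier_nonzeroD r(2) by (intro uc) force
          then show ?thesis
            by (simp add: right_diff_distrib[symmetric] abs_mult mult_left_mono)
        qed simp
      qed (use \<eta> in simp)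
      finally show ?thesis by (simp add: integral_mollifier_translate[OF r(1)])
    qed
    have "integrable lborel (\<lambda>y. v y * (\<integral>x. ?\<rho> (x - y) * \<phi> x \<partial>lborel))"
      using lborel_pair.integrable_snd[OF int] by (simp add: mult.assoc)
    moreover have "integrable lborel (\<lambda>y. v y * \<phi> y)"
      using v B(2) by (intro integrable_mult_bounded) auto
    ultimately have "(\<integral>x. mollify r v x * \<phi> x \<partial>lborel) - (\<integral>x. v x * \<phi> x \<partial>lborel)
        = (\<integral>y. v y * (\<integral>x. ?\<rho> (x - y) * \<phi> x \<partial>lborel) - v y * \<phi> y \<partial>lborel)"
      unfolding eq by simp
    also have "\<bar>\<dots>\<bar> \<le> (\<integral>y. \<bar>v y\<bar> * \<eta> \<partial>lborel)"
      unfolding real_norm_def[symmetric]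
    proof (rule order_trans[OF integral_norm_bound integral_mono'])
      show "norm (v y * (\<integral>x. ?\<rho> (x - y) * \<phi> x \<partial>lborel) - v y * \<phi> y) \<le> norm (v y) * \<eta>" for y
        using close[of y] by (simp add: right_diff_distrib[symmetric] abs_mult mult_left_mono)
    qed (use v \<eta> in auto)
    also have "\<dots> = N * \<eta>" by (simp add: N_def)
    also have "\<dots> \<le> e" using N assms(4) by (simp add: \<eta>_def field_simps)
    finally show ?thesis .
  qed
  then show ?thesis using d(1) by (intro that[of "min d 1"]) auto
qed


subsection \<open>Reading off bounds from mollifications\<close>

text \<open>The inequality \<open>2ab <= a^2 + b^2\<close> for the mollifications, followed by the
  weak limit. The quadratic form of the bound lets \<open>\<phi>\<close> be chosen later as an
  approximate truncation of \<open>v\<close> itself, which closes the estimate.\<close>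

lemma integral_le_of_mollified_bound:
  fixes v :: "real^'n::finite \<Rightarrow> real"
  assumes v: "integrable lborel v"
    and bound: "\<And>K. compact K \<Longrightarrow> K \<subseteq> \<Omega> \<Longrightarrow>
      \<exists>d>0. \<forall>r. 0 < r \<and> r < d \<longrightarrow> (\<integral>\<^sup>+x\<in>K. ennreal ((mollify r v x)\<^sup>2) \<partial>lborel) \<le> ennreal B"
    and B: "B \<ge> 0"
    and \<phi>: "continuous_on UNIV \<phi>" "compact K" "K \<subseteq> \<Omega>" "{x. \<phi> x \<noteq> 0} \<subseteq> K"
  shows "2 * (\<integral>x. v x * \<phi> x \<partial>lborel) \<le> B + (\<integral>x. (\<phi> x)\<^sup>2 \<partial>lborel)"
proof (rule field_le_epsilon)
  fix e :: real assume "e > 0"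
  have bdd: "bounded {x. \<phi> x \<noteq> 0}" using \<phi> by (auto intro: bounded_subset compact_imp_bounded)
  obtain d1 where d1: "d1 > 0" "\<And>r. 0 < r \<Longrightarrow> r < d1 \<Longrightarrow>
      \<bar>(\<integral>x. mollify r v x * \<phi> x \<partial>lborel) - (\<integral>x. v x * \<phi> x \<partial>lborel)\<bar> \<le> e / 2"
    using mollify_weak_limit[OF v \<phi>(1) bdd, of "e / 2"] \<open>e > 0\<close> by auto
  obtain d2 where d2: "d2 > 0" "\<And>r. 0 < r \<Longrightarrow> r < d2 \<Longrightarrow>
      (\<integral>\<^sup>+x\<in>K. ennreal ((mollify r v x)\<^sup>2) \<partial>lborel) \<le> ennreal B"
    using bound[OF \<phi>(2,3)] by auto
  define r where "r = min d1 d2 / 2"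
  have r: "0 < r" "r < d1" "r < d2" using d1 d2 by (auto simp: r_def)
  have smooth: "mollify r v \<in> C_infinity" using v mollifier_test_function by (rule conv_C_infinity)
  have ind: "indicator K x * \<phi> x = \<phi> x" for x using \<phi>(4) by (auto simp: indicator_def)
  have i1: "integrable lborel (\<lambda>x. indicator K x *\<^sub>R (mollify r v x)\<^sup>2)"
    using \<phi>(2) C_infinity_continuous[OF smooth] by (intro borel_integrable_compact continuous_on_power)
  have i2: "integrable lborel (\<lambda>x. indicator K x *\<^sub>R (\<phi> x)\<^sup>2)"
    using \<phi>(2) continuous_on_subset[OF \<phi>(1)] by (intro borel_integrable_compact continuous_intros) auto
  have i3: "integrable lborel (\<lambda>x. indicator K x *\<^sub>R (mollify r v x * \<phi> x))"
    using \<phi>(2) continuous_on_subset[OF \<phi>(1)] C_infinity_continuous[OF smooth]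
    by (intro borel_integrable_compact continuous_on_mult) auto
  have eq: "indicator K x *\<^sub>R (mollify r v x * \<phi> x) = mollify r v x * \<phi> x"
    "indicator K x *\<^sub>R (\<phi> x)\<^sup>2 = (\<phi> x)\<^sup>2" for x
    using \<phi>(4) by (auto simp: indicator_def)
  have i2': "integrable lborel (\<lambda>x. (\<phi> x)\<^sup>2)" and i3': "integrable lborel (\<lambda>x. mollify r v x * \<phi> x)"
    using i2 i3 unfolding eq by auto
  have "2 * (\<integral>x. mollify r v x * \<phi> x \<partial>lborel) = (\<integral>x. 2 * (mollify r v x * \<phi> x) \<partial>lborel)" by simp
  also have "\<dots> \<le> (\<integral>x. indicator K x *\<^sub>R (mollify r v x)\<^sup>2 + (\<phi> x)\<^sup>2 \<partial>lborel)"
  proof (rule integral_mono)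
    show "2 * (mollify r v x * \<phi> x) \<le> indicator K x *\<^sub>R (mollify r v x)\<^sup>2 + (\<phi> x)\<^sup>2" for x
    proof (cases "x \<in> K")
      case True
      then show ?thesis using sum_squares_bound[of "mollify r v x" "\<phi> x"] by (simp add: mult.assoc)
    next
      case False
      then have "\<phi> x = 0" using \<phi>(4) by auto
      then show ?thesis by simp
    qed
  qed (use i1 i2' i3' in auto)
  also have "\<dots> = (\<integral>x. indicator K x *\<^sub>R (mollify r v x)\<^sup>2 \<partial>lborel) + (\<integral>x. (\<phi> x)\<^sup>2 \<partial>lborel)"
    using i1 i2' by simp
  also have "(\<integral>x. indicator K x *\<^sub>R (mollify r v x)\<^sup>2 \<partial>lborel) \<le> B"
  proof -
    have "ennreal (\<integral>x. indicator K x *\<^sub>R (mollify r v x)\<^sup>2 \<partial>lborel)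
        = (\<integral>\<^sup>+x. ennreal (indicator K x *\<^sub>R (mollify r v x)\<^sup>2) \<partial>lborel)"
      by (rule nn_integral_eq_integral[symmetric, OF i1]) simp
    also have "\<dots> = (\<integral>\<^sup>+x\<in>K. ennreal ((mollify r v x)\<^sup>2) \<partial>lborel)"
      by (intro nn_integral_cong) (auto simp: indicator_def)
    also have "\<dots> \<le> ennreal B" by (rule d2(2)[OF r(1,3)])
    finally show ?thesis using B by (simp add: ennreal_le_iff)
  qed
  finally have "2 * (\<integral>x. mollify r v x * \<phi> x \<partial>lborel) \<le> B + (\<integral>x. (\<phi> x)\<^sup>2 \<partial>lborel)" by simp
  with d1(2)[OF r(1,2)] show "2 * (\<integral>x. v x * \<phi> x \<partial>lborel) \<le> B + (\<integral>x. (\<phi> x)\<^sup>2 \<partial>lborel) + e" by linarith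
qed

text \<open>For positive \<open>m\<close>, equal to 1 at distance at least \<open>2 / m\<close> from
  the complement. The subtracted 1 makes it vanish within distance \<open>1 / m\<close>, so that its
  support is compact in a bounded open set.\<close>

definition cutoff :: "'a::metric_space set \<Rightarrow> nat \<Rightarrow> 'a \<Rightarrow> real" where
  "cutoff \<Omega> m x = max 0 (min 1 (real m * infdist x (- \<Omega>) - 1))"

lemma cutoff_range: "0 \<le> cutoff \<Omega> m x" "cutoff \<Omega> m x \<le> 1"
  by (auto simp: cutoff_def)

lemma continuous_on_cutoff: "continuous_on S (cutoff \<Omega> m)"
  unfolding cutoff_def[abs_def] by (intro continuous_intros)

lemma cutoff_support:
  fixes \<Omega> :: "'a::euclidean_space set"
  assumes "bounded \<Omega>" "open \<Omega>"
  obtains K where "compact K" "K \<subseteq> \<Omega>" "{x. cutoff \<Omega> m x \<noteq> 0} \<subseteq> K"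
proof
  let ?K = "{x. 1 \<le> real m * infdist x (- \<Omega>)}"
  show sub: "?K \<subseteq> \<Omega>"
  proof
    fix x assume x: "x \<in> ?K"
    show "x \<in> \<Omega>"
    proof (rule ccontr)
      assume "x \<notin> \<Omega>"
      then have "infdist x (- \<Omega>) = 0" by (intro infdist_zero) auto
      then show False using x by simp
    qed
  qed
  have "closed ?K" by (intro closed_Collect_le continuous_intros)
  then show "compact ?K"
    using sub assms by (auto simp: compact_eq_bounded_closed intro: bounded_subset)
  show "{x. cutoff \<Omega> m x \<noteq> 0} \<subseteq> ?K" by (auto simp: cutoff_def)
qed

lemma cutoff_tendsto:
  fixes \<Omega> :: "'a::euclidean_space set"
  assumes "bounded \<Omega>" "open \<Omega>" "x \<in> \<Omega>"
  shows "eventually (\<lambda>m. cutoff \<Omega> m x = 1) sequentially"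
proof -
  have "\<Omega> \<noteq> UNIV" using assms(1) not_bounded_UNIV by blast
  then have pos: "infdist x (- \<Omega>) > 0"
    using assms by (intro infdist_pos_not_in_closed) auto
  obtain k :: nat where k: "real k > 2 / infdist x (- \<Omega>)"
    using reals_Archimedean2 by blast
  have "cutoff \<Omega> m x = 1" if "m \<ge> k" for m
  proof -
    have "2 \<le> real k * infdist x (- \<Omega>)" using k pos by (simp add: field_simps)
    also have "\<dots> \<le> real m * infdist x (- \<Omega>)" using that pos by (intro mult_right_mono) auto
    finally show ?thesis by (simp add: cutoff_def)
  qed
  then show ?thesis by (auto simp: eventually_sequentially)
qed

definition clamp_real :: "real \<Rightarrow> real \<Rightarrow> real" where
  "clamp_real b t = max (- b) (min b t)"

text \<open>Truncation keeps the sign and does not increase the modulus.\<close>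

lemma clamp_real_mult_ge: "b \<ge> 0 \<Longrightarrow> (clamp_real b t)\<^sup>2 \<le> t * clamp_real b t"
proof -
  assume b: "b \<ge> 0"
  consider "t > b" | "t < - b" | "- b \<le> t" "t \<le> b" by linarith
  then show ?thesis
  proof cases
    case 1
    then show ?thesis using b by (auto simp: clamp_real_def power2_eq_square intro: mult_right_mono)
  next
    case 2
    then have "b * b \<le> (- t) * b" using b by (intro mult_right_mono) auto
    then show ?thesis using 2 b by (auto simp: clamp_real_def power2_eq_square)
  next
    case 3
    then have "clamp_real b t = t" by (simp add: clamp_real_def)
    then show ?thesis by (simp add: power2_eq_square)
  qed
qed

lemma clamp_real_bound: "b \<ge> 0 \<Longrightarrow> \<bar>clamp_real b t\<bar> \<le> b"
  by (auto simp: clamp_real_def)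

lemma continuous_on_clamp_real [continuous_intros]: "continuous_on S f \<Longrightarrow> continuous_on S (\<lambda>x. clamp_real b (f x))"
  unfolding clamp_real_def by (intro continuous_intros)

lemma isCont_clamp_real: "isCont (clamp_real b) t"
  unfolding clamp_real_def[abs_def] by (intro continuous_intros)

text \<open>By duality: \<open>v\<close> is tested against continuous approximations of its own truncation, so that
  no density theorem for \<open>L\<^sup>2\<close> is needed and \<open>v\<close> need not be square integrable beforehand.\<close>

lemma L2_bound_of_mollified_bound:
  fixes v :: "real^'n::finite \<Rightarrow> real"
  assumes v: "integrable lborel v"
    and \<Omega>: "open \<Omega>" "bounded \<Omega>"
    and B: "B \<ge> 0"
    and bound: "\<And>K. compact K \<Longrightarrow> K \<subseteq> \<Omega> \<Longrightarrow>
      \<exists>d>0. \<forall>r. 0 < r \<and> r < d \<longrightarrow> (\<integral>\<^sup>+x\<in>K. ennreal ((mollify r v x)\<^sup>2) \<partial>lborel) \<le> ennreal B"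
  shows "(\<integral>\<^sup>+x\<in>\<Omega>. ennreal ((v x)\<^sup>2) \<partial>lborel) \<le> ennreal B"
proof -
  have vm [measurable]: "v \<in> borel_measurable borel" using v by auto
  have om [measurable]: "\<Omega> \<in> sets borel" using \<Omega> by simp
  have cut_meas [measurable]: "cutoff \<Omega> m \<in> borel_measurable borel" for m
    by (intro borel_measurable_continuous_onI continuous_on_cutoff)
  have clamp_meas [measurable]: "clamp_real b \<in> borel_measurable borel" for b
    unfolding clamp_real_def[abs_def] by measurable
  have int_ind: "integrable lborel (\<lambda>x. c * indicator \<Omega> x :: real)" for c
    using emeasure_bounded_finite[OF \<Omega>(2)] by (intro integrable_mult_right integrable_real_indicator) auto
  have cut0: "cutoff \<Omega> m x = 0" if "x \<notin> \<Omega>" for m x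
    using that by (auto simp: cutoff_def infdist_zero)
  \<comment> \<open>\<open>measurable_on\<close> supplies continuous functions converging to
    \<open>v\<close> off a negligible set; their truncations stay bounded, so dominated convergence
    applies to them.\<close>
  have "v measurable_on UNIV"
    by (rule lebesgue_measurable_imp_measurable_on) (auto intro: measurable_completion)
  then obtain N g where N: "negligible N" and g: "\<And>n. continuous_on UNIV (g n)"
      and lim: "\<And>x. x \<notin> N \<Longrightarrow> (\<lambda>n. g n x) \<longlonglongrightarrow> v x"
    unfolding measurable_on_def by auto
  have gm [measurable]: "g n \<in> borel_measurable borel" for n
    using g by (intro borel_measurable_continuous_onI)
  have "AE x in lebesgue. x \<notin> N"
    using N by (simp add: negligible_iff_null_sets AE_not_in)
  then have AE_lim: "AE x in lborel. (\<lambda>n. g n x) \<longlonglongrightarrow> v x"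
    unfolding AE_completion_iff by eventually_elim (rule lim)
  have main: "(\<integral>x. (cutoff \<Omega> m x * clamp_real (real m) (v x))\<^sup>2 \<partial>lborel) \<le> B"
    and main_int: "integrable lborel (\<lambda>x. (cutoff \<Omega> m x * clamp_real (real m) (v x))\<^sup>2)" for m
  proof -
    let ?\<phi> = "\<lambda>n x. cutoff \<Omega> m x * clamp_real (real m) (g n x)"
    let ?\<psi> = "\<lambda>x. cutoff \<Omega> m x * clamp_real (real m) (v x)"
    obtain K where K: "compact K" "K \<subseteq> \<Omega>" "{x. cutoff \<Omega> m x \<noteq> 0} \<subseteq> K"
      using cutoff_support[OF \<Omega>(2,1)] by metis
    have ineq: "2 * (\<integral>x. v x * ?\<phi> n x \<partial>lborel) \<le> B + (\<integral>x. (?\<phi> n x)\<^sup>2 \<partial>lborel)" for n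
      using K g by (intro integral_le_of_mollified_bound[OF v bound B _ K(1,2)] continuous_intros
        continuous_on_cutoff) auto
    have conv_\<phi>: "AE x in lborel. (\<lambda>n. ?\<phi> n x) \<longlonglongrightarrow> ?\<psi> x"
      using AE_lim by eventually_elim (intro tendsto_intros isCont_tendsto_compose[OF isCont_clamp_real])
    have bnd: "\<bar>cutoff \<Omega> m x * clamp_real (real m) t\<bar> \<le> real m * indicator \<Omega> x" for x t
      using cutoff_range[of \<Omega> m x] clamp_real_bound[of "real m" t] cut0[of x m]
        mult_mono[of "cutoff \<Omega> m x" 1 "\<bar>clamp_real (real m) t\<bar>" "real m"]
      by (cases "x \<in> \<Omega>") (auto simp: abs_mult)
    have lim1: "(\<lambda>n. \<integral>x. v x * ?\<phi> n x \<partial>lborel) \<longlonglongrightarrow> (\<integral>x. v x * ?\<psi> x \<partial>lborel)"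
    proof (rule integral_dominated_convergence[where w = "\<lambda>x. real m * \<bar>v x\<bar>"])
      show "AE x in lborel. (\<lambda>n. v x * ?\<phi> n x) \<longlonglongrightarrow> v x * ?\<psi> x"
        using conv_\<phi> by eventually_elim (rule tendsto_mult_left)
      have "\<bar>cutoff \<Omega> m x * clamp_real (real m) t\<bar> \<le> real m" for x t
        by (rule order_trans[OF bnd]) (auto simp: indicator_def)
      then show "AE x in lborel. norm (v x * ?\<phi> n x) \<le> real m * \<bar>v x\<bar>" for n
        by (auto simp: abs_mult[of "v _"] mult.commute[of "real m"] intro!: AE_I2 mult_left_mono)
    qed (use v in \<open>auto\<close>)
    have sq: "(cutoff \<Omega> m x * clamp_real (real m) t)\<^sup>2 \<le> (real m)\<^sup>2 * indicator \<Omega> x" for x t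
      using power_mono[OF bnd abs_ge_zero, of x t 2] by (cases "x \<in> \<Omega>") auto
    have lim2: "(\<lambda>n. \<integral>x. (?\<phi> n x)\<^sup>2 \<partial>lborel) \<longlonglongrightarrow> (\<integral>x. (?\<psi> x)\<^sup>2 \<partial>lborel)"
    proof (rule integral_dominated_convergence[where w = "\<lambda>x. (real m)\<^sup>2 * indicator \<Omega> x"])
      show "AE x in lborel. (\<lambda>n. (?\<phi> n x)\<^sup>2) \<longlonglongrightarrow> (?\<psi> x)\<^sup>2"
        using conv_\<phi> by eventually_elim (rule tendsto_power)
      show "AE x in lborel. norm ((?\<phi> n x)\<^sup>2) \<le> (real m)\<^sup>2 * indicator \<Omega> x" for n
        using sq by (auto intro!: AE_I2)
    qed (use int_ind in \<open>auto\<close>)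
    show i: "integrable lborel (\<lambda>x. (?\<psi> x)\<^sup>2)"
      by (rule Bochner_Integration.integrable_bound[OF int_ind[of "(real m)\<^sup>2"]]) (use sq in \<open>auto intro!: AE_I2\<close>)
    have "(\<integral>x. (?\<psi> x)\<^sup>2 \<partial>lborel) \<le> (\<integral>x. v x * ?\<psi> x \<partial>lborel)"
    proof (rule integral_mono[OF i])
      have "\<bar>?\<psi> x\<bar> \<le> real m" for x by (rule order_trans[OF bnd]) (auto simp: indicator_def)
      then show "integrable lborel (\<lambda>x. v x * ?\<psi> x)" using v by (intro integrable_mult_bounded) auto
      fix x
      have "(?\<psi> x)\<^sup>2 = (cutoff \<Omega> m x)\<^sup>2 * (clamp_real (real m) (v x))\<^sup>2" by (simp add: power_mult_distrib)
      also have "\<dots> \<le> cutoff \<Omega> m x * (clamp_real (real m) (v x))\<^sup>2"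
        using cutoff_range[of \<Omega> m x] by (intro mult_right_mono) (auto simp: power2_eq_square mult_left_le_one_le)
      also have "\<dots> \<le> cutoff \<Omega> m x * (v x * clamp_real (real m) (v x))"
        using cutoff_range[of \<Omega> m x] by (intro mult_left_mono clamp_real_mult_ge) auto
      finally show "(?\<psi> x)\<^sup>2 \<le> v x * ?\<psi> x" by (simp add: mult_ac)
    qed
    \<comment> \<open>Combined with the preceding bound of the integral of \<open>\<psi>^2\<close>
      by that of \<open>v \<psi>\<close>, this has the integral of \<open>\<psi>^2\<close> on both
      sides, twice on the left and once on the right; being finite, it cancels.\<close>
    moreover have "2 * (\<integral>x. v x * ?\<psi> x \<partial>lborel) \<le> B + (\<integral>x. (?\<psi> x)\<^sup>2 \<partial>lborel)"
      by (rule LIMSEQ_le[OF tendsto_mult_left[OF lim1] tendsto_add[OF tendsto_const lim2]]) (use ineq in auto)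
    ultimately show "(\<integral>x. (?\<psi> x)\<^sup>2 \<partial>lborel) \<le> B" by linarith
  qed
  let ?h = "\<lambda>m x. ennreal ((cutoff \<Omega> m x * clamp_real (real m) (v x))\<^sup>2)"
  \<comment> \<open>Fatou's lemma: at each point of \<Omega> cut-off and truncation are eventually
    inactive.\<close>
  have "(\<integral>\<^sup>+x\<in>\<Omega>. ennreal ((v x)\<^sup>2) \<partial>lborel) \<le> (\<integral>\<^sup>+x. liminf (\<lambda>m. ?h m x) \<partial>lborel)"
  proof (rule nn_integral_mono)
    fix x
    show "ennreal ((v x)\<^sup>2) * indicator \<Omega> x \<le> liminf (\<lambda>m. ?h m x)"
    proof (cases "x \<in> \<Omega>")
      case True
      obtain k :: nat where k: "\<bar>v x\<bar> \<le> real k" using real_arch_simple by blast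
      have "eventually (\<lambda>m. cutoff \<Omega> m x = 1 \<and> m \<ge> k) sequentially"
        using cutoff_tendsto[OF \<Omega>(2,1) True] eventually_ge_at_top by (rule eventually_conj)
      then have "eventually (\<lambda>m. ennreal ((v x)\<^sup>2) \<le> ?h m x) sequentially"
      proof eventually_elim
        case (elim m)
        then have "clamp_real (real m) (v x) = v x" using k by (auto simp: clamp_real_def)
        then show ?case using elim by simp
      qed
      then show ?thesis using True by (simp add: Liminf_bounded)
    qed simp
  qed
  also have "\<dots> \<le> liminf (\<lambda>m. \<integral>\<^sup>+x. ?h m x \<partial>lborel)"
    by (rule nn_integral_liminf) measurable
  also have "\<dots> \<le> ennreal B"
  proof -
    have "(\<integral>\<^sup>+x. ?h m x \<partial>lborel) \<le> ennreal B" for m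
      using main[of m] main_int[of m] by (subst nn_integral_eq_integral) (auto intro: ennreal_leI)
    then have "liminf (\<lambda>m. \<integral>\<^sup>+x. ?h m x \<partial>lborel) \<le> liminf (\<lambda>m. ennreal B)"
      by (intro Liminf_mono) auto
    then show ?thesis by (simp add: Liminf_const)
  qed
  finally show ?thesis .
qed

text \<open>Convolution and Fubini's theorem live on \<open>lborel\<close>, while Sobolev functions
  are only Lebesgue measurable; a Borel function agreeing almost everywhere with the zero extension
  bridges the two.\<close>

lemma borel_representative:
  fixes v :: "'a::euclidean_space \<Rightarrow> real"
  assumes "integrable (lebesgue_on S) v" "S \<in> sets lebesgue"
  obtains v' where "v' \<in> borel_measurable borel" "integrable lborel v'"
    "AE x in lborel. v' x = indicator S x * v x"
proof -
  have "integrable lebesgue (\<lambda>x. indicator S x *\<^sub>R v x)"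
    using assms by (simp add: integrable_restrict_space)
  then have m: "(\<lambda>x. indicator S x * v x) \<in> borel_measurable lebesgue" and i: "integrable lebesgue (\<lambda>x. indicator S x * v x)"
    by auto
  obtain v' where v': "v' \<in> borel_measurable lborel" "AE x in lborel. indicator S x * v x = v' x"
    using completion_ex_borel_measurable_real[OF m] by auto
  have "integrable lebesgue v'"
    using i v' by (subst integrable_cong_AE[where g = "\<lambda>x. indicator S x * v x"])
      (auto simp: AE_completion_iff measurable_completion m)
  then have "integrable lborel v'" using v'(1) by (simp add: integrable_completion)
  with v' show ?thesis by (intro that) auto
qed

lemma integral_borel_representative:
  fixes v v' \<phi> :: "'a::euclidean_space \<Rightarrow> real"
  assumes "S \<in> sets lebesgue" "v' \<in> borel_measurable borel" "AE x in lborel. v' x = indicator S x * v x"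
    "v \<in> borel_measurable (lebesgue_on S)" "\<phi> \<in> borel_measurable borel"
  shows "(\<integral>x. v x * \<phi> x \<partial>lebesgue_on S) = (\<integral>x. v' x * \<phi> x \<partial>lborel)"
proof -
  have "(\<integral>x. v x * \<phi> x \<partial>lebesgue_on S) = (\<integral>x. indicator S x * v x * \<phi> x \<partial>lebesgue)"
    using assms(1) by (simp add: integral_restrict_space mult.assoc)
  also have "\<dots> = (\<integral>x. v' x * \<phi> x \<partial>lebesgue)"
  proof (rule integral_cong_AE)
    have "(\<lambda>x. indicator S x * v x) \<in> borel_measurable lebesgue"
      using assms(1,4) by (simp add: borel_measurable_restrict_space_iff mult.commute)
    then show "(\<lambda>x. indicator S x * v x * \<phi> x) \<in> borel_measurable lebesgue"
      using borel_measurable_times[OF _ measurable_completion, of "\<lambda>x. indicator S x * v x" lborel \<phi>] assms(5) by simp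
    show "(\<lambda>x. v' x * \<phi> x) \<in> borel_measurable lebesgue"
      using assms(2,5) by (intro borel_measurable_times) (auto intro: measurable_completion)
    show "AE x in lebesgue. indicator S x * v x * \<phi> x = v' x * \<phi> x"
      using assms(3) unfolding AE_completion_iff by eventually_elim simp
  qed
  also have "\<dots> = (\<integral>x. v' x * \<phi> x \<partial>lborel)"
    using assms(2,5) by (intro integral_completion) auto
  finally show ?thesis .
qed

section \<open>Weak derivatives\<close>

lemma integral_lebesgue_on_eq_lborel:
  fixes f :: "'a::euclidean_space \<Rightarrow> real"
  assumes "f \<in> borel_measurable borel" "S \<in> sets lebesgue" "\<And>x. x \<notin> S \<Longrightarrow> f x = 0"
  shows "(\<integral>x. f x \<partial>lebesgue_on S) = (\<integral>x. f x \<partial>lborel)"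
proof -
  have "(\<lambda>x. indicator S x *\<^sub>R f x) = f" using assms(3) by (auto simp: indicator_def fun_eq_iff)
  then show ?thesis
    using assms(1,2) integral_completion[of f lborel] by (simp add: integral_restrict_space)
qed

lemma integral_lebesgue_on_subset_eq:
  fixes f :: "'a::euclidean_space \<Rightarrow> real"
  assumes "K \<in> sets lebesgue" "\<Omega> \<in> sets lebesgue" "K \<subseteq> \<Omega>" "\<And>x. x \<in> \<Omega> - K \<Longrightarrow> f x = 0"
  shows "(\<integral>x. f x \<partial>lebesgue_on \<Omega>) = (\<integral>x. f x \<partial>lebesgue_on K)"
    "integrable (lebesgue_on \<Omega>) f \<longleftrightarrow> integrable (lebesgue_on K) f"
proof -
  have eq: "(\<lambda>x. indicator \<Omega> x *\<^sub>R f x) = (\<lambda>x. indicator K x *\<^sub>R f x)"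
    using assms(3,4) by (auto simp: indicator_def fun_eq_iff)
  have m: "\<Omega> \<inter> space lebesgue \<in> sets lebesgue" "K \<inter> space lebesgue \<in> sets lebesgue"
    using assms(1,2) by auto
  show "(\<integral>x. f x \<partial>lebesgue_on \<Omega>) = (\<integral>x. f x \<partial>lebesgue_on K)"
    unfolding integral_restrict_space[OF m(1)] integral_restrict_space[OF m(2)] eq ..
  show "integrable (lebesgue_on \<Omega>) f \<longleftrightarrow> integrable (lebesgue_on K) f"
    unfolding integrable_restrict_space[OF m(1)] integrable_restrict_space[OF m(2)] eq ..
qed

lemma borel_measurable_lebesgue_on:
  "f \<in> borel_measurable borel \<Longrightarrow> f \<in> borel_measurable (lebesgue_on S)"
  by (intro measurable_restrict_space1 measurable_completion) simp

lemma locally_integrable_mult_test_function: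
  assumes u: "locally_integrable \<Omega> u" and \<psi>: "\<psi> \<in> test_functions \<Omega>" and \<Omega>: "\<Omega> \<in> sets lebesgue"
  shows "integrable (lebesgue_on \<Omega>) (\<lambda>x. u x * \<psi> x)"
proof -
  define K where "K = closure {x. \<psi> x \<noteq> 0}"
  have K: "compact K" "K \<subseteq> \<Omega>" using \<psi> by (auto simp: K_def test_functions_def)
  have z: "u x * \<psi> x = 0" if "x \<in> \<Omega> - K" for x
    using that closure_subset[of "{x. \<psi> x \<noteq> 0}"] by (auto simp: K_def)
  obtain B where "\<And>x. \<bar>\<psi> x\<bar> \<le> B" using test_function_bounded[OF \<psi>] by metis
  then have "integrable (lebesgue_on K) (\<lambda>x. u x * \<psi> x)"
    using u K C_infinity_measurable[OF test_function_C_infinity[OF \<psi>]]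
    by (intro integrable_mult_bounded borel_measurable_lebesgue_on) (auto simp: locally_integrable_def)
  then show ?thesis
    using integral_lebesgue_on_subset_eq(2)[OF _ \<Omega> K(2) z] K(1) by (auto dest: borel_compact)
qed

text \<open>Local integrability gives integrability on compact sets; countably many balls turn
  statements about these into statements about \<Omega>, both for measurability and for equality
  almost everywhere.\<close>

lemma open_covered_by_countably_many_balls:
  fixes \<Omega> :: "'a::euclidean_space set"
  assumes "open \<Omega>"
  obtains D :: "('a \<times> real) set" where "countable D" "\<And>p. p \<in> D \<Longrightarrow> cball (fst p) (snd p) \<subseteq> \<Omega>"
    "\<Omega> \<subseteq> (\<Union>p\<in>D. ball (fst p) (snd p))"
proof -
  define P where "P = {p. cball (fst p) (snd p) \<subseteq> \<Omega>}"
  let ?B = "\<lambda>p. ball (fst p) (snd p)"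
  have cover: "\<Omega> \<subseteq> \<Union>(?B ` P)"
  proof
    fix x assume "x \<in> \<Omega>"
    then obtain s where "s > 0" "cball x s \<subseteq> \<Omega>" using assms open_contains_cball by blast
    then show "x \<in> \<Union>(?B ` P)" by (intro UnionI[of "ball x s"] image_eqI[of _ _ "(x, s)"]) (auto simp: P_def)
  qed
  obtain F where F: "F \<subseteq> ?B ` P" "countable F" "\<Union>F = \<Union>(?B ` P)"
    using Lindelof[of "?B ` P"] by auto
  obtain D where D: "D \<subseteq> P" "countable D" "F = ?B ` D"
    using countable_subset_image[THEN iffD1, OF conjI[OF F(2,1)]] by blast
  show ?thesis
  proof (rule that)
    show "\<Omega> \<subseteq> \<Union>(?B ` D)" using cover unfolding F(3)[symmetric] D(3) .
    show "cball (fst p) (snd p) \<subseteq> \<Omega>" if "p \<in> D" for p using D(1) that by (auto simp: P_def)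
  qed (rule D)
qed

text \<open>The fundamental lemma of the calculus of variations. A value of the mollified difference
  is a test against a translated mollifier, hence vanishes inside the ball, and
  \<open>L2_bound_of_mollified_bound\<close> with bound 0 does the rest.\<close>

lemma locally_integrable_eq_AE_local:
  assumes \<Omega>: "open \<Omega>" and v: "locally_integrable \<Omega> v" "locally_integrable \<Omega> v'"
    and eq: "\<And>\<psi>. \<psi> \<in> test_functions \<Omega> \<Longrightarrow>
      (\<integral>x. v x * \<psi> x \<partial>lebesgue_on \<Omega>) = (\<integral>x. v' x * \<psi> x \<partial>lebesgue_on \<Omega>)"
    and S: "cball a s \<subseteq> \<Omega>"
  shows "AE x in lborel. x \<in> ball a s \<longrightarrow> v x = v' x"
proof -
  let ?S = "cball a s"
  have \<Omega>m: "\<Omega> \<in> sets lebesgue" and Sm: "?S \<in> sets lebesgue" using \<Omega> by auto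
  have int: "integrable (lebesgue_on ?S) v" "integrable (lebesgue_on ?S) v'"
    using v S by (auto simp: locally_integrable_def)
  then have dint: "integrable (lebesgue_on ?S) (\<lambda>x. v x - v' x)" by simp
  then obtain d where d: "d \<in> borel_measurable borel" "integrable lborel d"
      "AE x in lborel. d x = indicator ?S x * (v x - v' x)"
    using Sm by (rule borel_representative)
  have zero: "mollify r d y = 0" if "cball y r \<subseteq> ball a s" for y r
  proof -
    let ?\<psi> = "\<lambda>z. mollifier r (y - z)"
    have sub: "cball y r \<subseteq> ?S" using that ball_subset_cball by blast
    then have \<psi>: "?\<psi> \<in> test_functions \<Omega>"
      using S by (intro mollifier_reflect_test_function) auto
    have out: "?\<psi> z = 0" if "z \<in> \<Omega> - ?S" for z
      using mollifier_nonzeroD[of r "y - z"] that sub by (force simp: dist_norm)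
    have m: "?\<psi> \<in> borel_measurable borel"
      by (rule C_infinity_measurable[OF test_function_C_infinity[OF \<psi>]])
    have on: "(\<integral>x. f x * ?\<psi> x \<partial>lebesgue_on \<Omega>) = (\<integral>x. f x * ?\<psi> x \<partial>lebesgue_on ?S)"
      "integrable (lebesgue_on ?S) (\<lambda>x. f x * ?\<psi> x)" if "locally_integrable \<Omega> f" for f
      using locally_integrable_mult_test_function[OF that \<psi> \<Omega>m] out
        integral_lebesgue_on_subset_eq[OF Sm \<Omega>m S, of "\<lambda>x. f x * ?\<psi> x"] by auto
    have "mollify r d y = (\<integral>z. (v z - v' z) * ?\<psi> z \<partial>lebesgue_on ?S)"
      unfolding conv_def using dint
      by (intro integral_borel_representative[OF Sm d(1,3) _ m, symmetric]) auto
    also have "\<dots> = (\<integral>z. v z * ?\<psi> z \<partial>lebesgue_on ?S) - (\<integral>z. v' z * ?\<psi> z \<partial>lebesgue_on ?S)"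
      using on(2)[OF v(1)] on(2)[OF v(2)] by (simp add: left_diff_distrib)
    also have "\<dots> = 0" using eq[OF \<psi>] on(1)[OF v(1)] on(1)[OF v(2)] by simp
    finally show ?thesis .
  qed
  have "(\<integral>\<^sup>+x\<in>ball a s. ennreal ((d x)\<^sup>2) \<partial>lborel) \<le> ennreal 0"
  proof (rule L2_bound_of_mollified_bound[OF d(2)])
    fix K assume K: "compact K" "K \<subseteq> ball a s"
    obtain \<epsilon> where \<epsilon>: "\<epsilon> > 0" "(\<Union>x\<in>K. cball x \<epsilon>) \<subseteq> ball a s"
      using compact_subset_open_imp_cball_epsilon_subset[OF K(1) open_ball K(2)] by metis
    have "(\<integral>\<^sup>+x\<in>K. ennreal ((mollify r d x)\<^sup>2) \<partial>lborel) = 0" if "r < \<epsilon>" for r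
    proof -
      have "ennreal ((mollify r d x)\<^sup>2) * indicator K x = 0" for x
      proof (cases "x \<in> K")
        case True
        then have "mollify r d x = 0"
          using \<epsilon>(2) that subset_cball[of r \<epsilon> x] by (intro zero) auto
        then show ?thesis by simp
      qed simp
      then show ?thesis by (simp only:) simp
    qed
    then show "\<exists>d'>0. \<forall>r. 0 < r \<and> r < d' \<longrightarrow> (\<integral>\<^sup>+x\<in>K. ennreal ((mollify r d x)\<^sup>2) \<partial>lborel) \<le> ennreal 0"
      using \<epsilon>(1) by auto
  qed auto
  moreover have "(\<lambda>x. ennreal ((d x)\<^sup>2) * indicator (ball a s) x) \<in> borel_measurable lborel"
    using d(1) by (intro borel_measurable_times_ennreal borel_measurable_indicator
      measurable_compose[OF _ measurable_ennreal] borel_measurable_power) simp_all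
  ultimately have "AE x in lborel. ennreal ((d x)\<^sup>2) * indicator (ball a s) x = 0"
    by (subst nn_integral_0_iff_AE[symmetric]) auto
  with d(3) show ?thesis
  proof eventually_elim
    case (elim x)
    then show ?case by (cases "x \<in> ball a s") auto
  qed
qed

lemma locally_integrable_eq_AE:
  assumes \<Omega>: "open \<Omega>" and v: "locally_integrable \<Omega> v" "locally_integrable \<Omega> v'"
    and eq: "\<And>\<psi>. \<psi> \<in> test_functions \<Omega> \<Longrightarrow>
      (\<integral>x. v x * \<psi> x \<partial>lebesgue_on \<Omega>) = (\<integral>x. v' x * \<psi> x \<partial>lebesgue_on \<Omega>)"
  shows "AE x in lebesgue_on \<Omega>. v x = v' x"
proof -
  obtain D :: "((real^'a) \<times> real) set" where D: "countable D" "\<And>p. p \<in> D \<Longrightarrow> cball (fst p) (snd p) \<subseteq> \<Omega>"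
    "\<Omega> \<subseteq> (\<Union>p\<in>D. ball (fst p) (snd p))"
    using open_covered_by_countably_many_balls[OF \<Omega>] by blast
  have "AE x in lborel. \<forall>p\<in>D. x \<in> ball (fst p) (snd p) \<longrightarrow> v x = v' x"
    using D(1,2) by (intro AE_ball_countable' locally_integrable_eq_AE_local[OF \<Omega> v eq])
  then have "AE x in lborel. x \<in> \<Omega> \<longrightarrow> v x = v' x"
  proof eventually_elim
    case (elim x)
    show ?case
    proof
      assume "x \<in> \<Omega>"
      then obtain p where "p \<in> D" "x \<in> ball (fst p) (snd p)" using D(3) by auto
      then show "v x = v' x" using elim by auto
    qed
  qed
  then show ?thesis
    using \<Omega> by (subst AE_restrict_space_iff) (auto simp: AE_completion_iff)
qed

text \<open>\<open>weak_partial\<close> is a choice among weak derivatives; through this uniqueness,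
  what is known of one of them, such as square integrability, passes to the chosen one.\<close>

lemma has_weak_partial_unique:
  assumes "open \<Omega>" "has_weak_partial \<Omega> j u v" "has_weak_partial \<Omega> j u v'"
  shows "AE x in lebesgue_on \<Omega>. v x = v' x"
proof (rule locally_integrable_eq_AE[OF assms(1)])
  fix \<psi> assume \<psi>: "\<psi> \<in> test_functions \<Omega>"
  have "(\<integral>x. u x * partial j \<psi> x \<partial>lebesgue_on \<Omega>) = - (\<integral>x. v x * \<psi> x \<partial>lebesgue_on \<Omega>)"
    "(\<integral>x. u x * partial j \<psi> x \<partial>lebesgue_on \<Omega>) = - (\<integral>x. v' x * \<psi> x \<partial>lebesgue_on \<Omega>)"
    using assms(2,3) \<psi> by (auto simp: has_weak_partial_def)
  then show "(\<integral>x. v x * \<psi> x \<partial>lebesgue_on \<Omega>) = (\<integral>x. v' x * \<psi> x \<partial>lebesgue_on \<Omega>)"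
    by simp
qed (use assms in \<open>auto simp: has_weak_partial_def\<close>)

lemma has_weak_partial_weak_partial: "has_weak_partial \<Omega> j u v \<Longrightarrow> has_weak_partial \<Omega> j u (weak_partial \<Omega> j u)"
  unfolding weak_partial_def by (rule someI[of "has_weak_partial \<Omega> j u"])

text \<open>The chosen weak derivative is by definition integrable on compact subsets only, whereas
  membership in \<open>L2\<close> asks for measurability on all of \<Omega>.\<close>

lemma locally_integrable_measurable:
  assumes "open \<Omega>" "locally_integrable \<Omega> u"
  shows "u \<in> borel_measurable (lebesgue_on \<Omega>)"
proof -
  obtain D :: "((real^'a) \<times> real) set" where D: "countable D" "\<And>p. p \<in> D \<Longrightarrow> cball (fst p) (snd p) \<subseteq> \<Omega>"
    "\<Omega> \<subseteq> (\<Union>p\<in>D. ball (fst p) (snd p))"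
    using open_covered_by_countably_many_balls[OF assms(1)] by blast
  have eq: "\<Omega> = (\<Union>p\<in>D. cball (fst p) (snd p))"
  proof
    show "\<Omega> \<subseteq> (\<Union>p\<in>D. cball (fst p) (snd p))" 
      by (rule order_trans[OF D(3)]) (intro UN_mono ball_subset_cball order_refl)
    show "(\<Union>p\<in>D. cball (fst p) (snd p)) \<subseteq> \<Omega>" using D(2) by (rule UN_least)
  qed
  have "u \<in> borel_measurable (lebesgue_on (cball (fst p) (snd p)))" if "p \<in> D" for p
    using assms(2) D(2)[OF that] by (intro borel_measurable_integrable) (simp add: locally_integrable_def)
  then have piece: "{x. x \<in> cball (fst p) (snd p) \<and> u x \<in> B} \<in> sets lebesgue" if "p \<in> D" "B \<in> sets borel" for p B
    using that measurable_sets[of u "lebesgue_on (cball (fst p) (snd p))" borel B]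
    by (auto simp: sets_restrict_space_iff vimage_def Int_def conj_commute space_restrict_space)
  show ?thesis
  proof (rule measurableI)
    fix B :: "real set" assume "B \<in> sets borel"
    then have "(\<Union>p\<in>D. {x. x \<in> cball (fst p) (snd p) \<and> u x \<in> B}) \<in> sets lebesgue"
      using D(1) piece by (intro sets.countable_UN'') auto
    also have "(\<Union>p\<in>D. {x. x \<in> cball (fst p) (snd p) \<and> u x \<in> B}) = u -` B \<inter> space (lebesgue_on \<Omega>)"
      using eq by (auto simp: space_restrict_space)
    finally show "u -` B \<inter> space (lebesgue_on \<Omega>) \<in> sets (lebesgue_on \<Omega>)"
      using assms(1) by (subst sets_restrict_space_iff) (auto simp: space_restrict_space)
  qed simp
qed

subsection \<open>Square integrable functions\<close>

lemma L2_cong_AE: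
  assumes "u \<in> L2 M" "u' \<in> borel_measurable M" "AE x in M. u x = u' x"
  shows "u' \<in> L2 M"
proof -
  have "integrable M (\<lambda>x. (norm (u' x))\<^sup>2)"
    using assms by (subst integrable_cong_AE[where g = "\<lambda>x. (norm (u x))\<^sup>2"]) (auto simp: L2_def)
  then show ?thesis using assms by (simp add: L2_def)
qed

lemma L2_norm_cong_AE:
  assumes "u \<in> borel_measurable M" "u' \<in> borel_measurable M" "AE x in M. u x = u' x"
  shows "L2_norm M u = L2_norm M u'"
  unfolding L2_norm_def using assms by (intro arg_cong[where f = sqrt] integral_cong_AE) auto

lemma L2_lincomb:
  fixes u v :: "'a \<Rightarrow> 'b::euclidean_space"
  assumes "u \<in> L2 M" "v \<in> L2 M"
  shows "(\<lambda>x. a *\<^sub>R u x + b *\<^sub>R v x) \<in> L2 M"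
proof -
  have [measurable]: "u \<in> borel_measurable M" "v \<in> borel_measurable M"
    using assms by (auto simp: L2_def)
  have "integrable M (\<lambda>x. (norm (a *\<^sub>R u x + b *\<^sub>R v x))\<^sup>2)"
  proof (rule Bochner_Integration.integrable_bound)
    show "integrable M (\<lambda>x. 2 * a\<^sup>2 * (norm (u x))\<^sup>2 + 2 * b\<^sup>2 * (norm (v x))\<^sup>2)"
      using assms by (auto simp: L2_def)
    have "(norm (a *\<^sub>R u x + b *\<^sub>R v x))\<^sup>2 \<le> 2 * a\<^sup>2 * (norm (u x))\<^sup>2 + 2 * b\<^sup>2 * (norm (v x))\<^sup>2" for x
    proof -
      have "(norm (a *\<^sub>R u x + b *\<^sub>R v x))\<^sup>2 \<le> (\<bar>a\<bar> * norm (u x) + \<bar>b\<bar> * norm (v x))\<^sup>2"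
        by (intro power_mono) (auto intro: norm_triangle_le)
      also have "\<dots> \<le> 2 * (\<bar>a\<bar> * norm (u x))\<^sup>2 + 2 * (\<bar>b\<bar> * norm (v x))\<^sup>2"
        using sum_squares_bound[of "\<bar>a\<bar> * norm (u x)" "\<bar>b\<bar> * norm (v x)"] by (simp add: power2_sum)
      finally show ?thesis by (simp add: power_mult_distrib)
    qed
    then show "AE x in M. norm ((norm (a *\<^sub>R u x + b *\<^sub>R v x))\<^sup>2)
        \<le> norm (2 * a\<^sup>2 * (norm (u x))\<^sup>2 + 2 * b\<^sup>2 * (norm (v x))\<^sup>2)"
      by (intro AE_I2) (simp add: abs_le_iff le_minus_iff add_nonneg_nonneg)
  qed measurable
  then show ?thesis by (simp add: L2_def)
qed

lemma L2_diff: "u \<in> L2 M \<Longrightarrow> v \<in> L2 M \<Longrightarrow> (\<lambda>x. u x - v x) \<in> L2 M"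
  using L2_lincomb[of u M v 1 "- 1"] by simp

context finite_measure
begin

lemma L2_integrable:
  assumes "u \<in> L2 M"
  shows "integrable M u"
proof (rule Bochner_Integration.integrable_bound)
  show "integrable M (\<lambda>x. 1 + (norm (u x))\<^sup>2)" using assms by (simp add: L2_def)
  have "norm (u x) \<le> 1 + (norm (u x))\<^sup>2" for x
    using sum_squares_bound[of "norm (u x)" 1] by (simp add: power2_eq_square) (smt (verit) mult_nonneg_nonneg norm_ge_zero)
  then show "AE x in M. norm (u x) \<le> norm (1 + (norm (u x))\<^sup>2)"
    by (intro AE_I2) (smt (verit) real_norm_def)
qed (use assms in \<open>auto simp: L2_def\<close>)

lemma L1_norm_le_L2_norm:
  assumes "u \<in> L2 M"
  shows "(\<integral>x. norm (u x) \<partial>M) \<le> sqrt (measure M (space M)) * L2_norm M u"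
proof -
  let ?\<mu> = "measure M (space M)"
  define I where "I = (\<integral>x. norm (u x) \<partial>M)"
  define Q where "Q = (\<integral>x. (norm (u x))\<^sup>2 \<partial>M)"
  have int: "integrable M (\<lambda>x. norm (u x))" "integrable M (\<lambda>x. (norm (u x))\<^sup>2)"
    using assms L2_integrable[OF assms] by (auto simp: L2_def)
  have nn: "I \<ge> 0" "Q \<ge> 0" by (simp_all add: I_def Q_def)
  \<comment> \<open>A quadratic polynomial in \<open>t\<close> that is nowhere negative:
    \<open>t = I / \<mu>\<close> gives the Cauchy-Schwarz inequality, and for
    \<open>\<mu> = 0\<close> a large \<open>t\<close> forces \<open>I = 0\<close>.\<close>
  have quad: "0 \<le> Q - 2 * t * I + t\<^sup>2 * ?\<mu>" for t
  proof -
    have "0 \<le> (\<integral>x. (norm (u x) - t)\<^sup>2 \<partial>M)" by (intro integral_nonneg_AE) simp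
    also have "\<dots> = (\<integral>x. (norm (u x))\<^sup>2 - 2 * t * norm (u x) + t\<^sup>2 \<partial>M)"
      by (simp add: power2_diff algebra_simps)
    also have "\<dots> = Q - 2 * t * I + t\<^sup>2 * ?\<mu>"
      using int by (simp add: I_def Q_def)
    finally show ?thesis .
  qed
  have "I\<^sup>2 \<le> ?\<mu> * Q"
  proof (cases "?\<mu> = 0")
    case True
    then have "2 * t * I \<le> Q" for t using quad[of t] by simp
    from this[of "(Q + 1) / (2 * I)"] have "I = 0" using nn by (cases "I = 0") (auto simp: field_simps)
    then show ?thesis using nn by simp
  next
    case False
    then have \<mu>: "?\<mu> > 0" by (simp add: zero_less_measure_iff)
    from quad[of "I / ?\<mu>"] \<mu> show ?thesis by (simp add: field_simps power2_eq_square)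
  qed
  then have "sqrt (I\<^sup>2) \<le> sqrt (?\<mu> * Q)" by (rule real_sqrt_le_mono)
  then show ?thesis using nn by (simp add: L2_norm_def I_def Q_def real_sqrt_mult)
qed

lemma L2_tendsto_integral_mult:
  fixes u :: "'a \<Rightarrow> real"
  assumes "\<And>n. U n \<in> L2 M" "u \<in> L2 M" "(\<lambda>n. L2_norm M (\<lambda>x. U n x - u x)) \<longlonglongrightarrow> 0"
    and \<phi>: "\<phi> \<in> borel_measurable M" "\<And>x. \<bar>\<phi> x\<bar> \<le> B"
  shows "(\<lambda>n. \<integral>x. U n x * \<phi> x \<partial>M) \<longlonglongrightarrow> (\<integral>x. u x * \<phi> x \<partial>M)"
proof -
  have int: "integrable M (\<lambda>x. f x * \<phi> x)" if "f \<in> L2 M" for f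
    using L2_integrable[OF that] \<phi> by (intro integrable_mult_bounded)
  have "norm ((\<integral>x. U n x * \<phi> x \<partial>M) - (\<integral>x. u x * \<phi> x \<partial>M)) \<le> (sqrt (measure M (space M)) * L2_norm M (\<lambda>x. U n x - u x)) * \<bar>B\<bar>" for n
  proof -
    have d: "(\<lambda>x. U n x - u x) \<in> L2 M" using assms(1,2) by (rule L2_diff)
    have "(\<integral>x. U n x * \<phi> x \<partial>M) - (\<integral>x. u x * \<phi> x \<partial>M) = (\<integral>x. (U n x - u x) * \<phi> x \<partial>M)"
      using int[OF assms(1)] int[OF assms(2)] by (simp add: left_diff_distrib)
    also have "norm \<dots> \<le> (\<integral>x. norm (U n x - u x) * \<bar>B\<bar> \<partial>M)"
    proof (rule order_trans[OF integral_norm_bound integral_mono'])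
      show "norm ((U n x - u x) * \<phi> x) \<le> norm (U n x - u x) * \<bar>B\<bar>" for x
        using \<phi>(2)[of x] by (auto simp: abs_mult intro!: mult_left_mono)
    qed (use L2_integrable[OF d] in auto)
    also have "\<dots> = (\<integral>x. norm (U n x - u x) \<partial>M) * \<bar>B\<bar>" by simp
    also have "\<dots> \<le> (sqrt (measure M (space M)) * L2_norm M (\<lambda>x. U n x - u x)) * \<bar>B\<bar>"
      using L1_norm_le_L2_norm[OF d] by (rule mult_right_mono) simp
    finally show ?thesis .
  qed
  moreover have "(\<lambda>n. (sqrt (measure M (space M)) * L2_norm M (\<lambda>x. U n x - u x)) * \<bar>B\<bar>) \<longlonglongrightarrow> 0"
    using tendsto_mult_left_zero[OF tendsto_mult_right_zero[OF assms(3)]] .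
  ultimately have "(\<lambda>n. (\<integral>x. U n x * \<phi> x \<partial>M) - (\<integral>x. u x * \<phi> x \<partial>M)) \<longlonglongrightarrow> 0"
    by (rule Lim_null_comparison[OF always_eventually, OF allI])
  then show ?thesis by (simp add: LIM_zero_iff)
qed

end

lemma finite_measure_lebesgue_on_bounded: "bounded \<Omega> \<Longrightarrow> \<Omega> \<in> sets lebesgue \<Longrightarrow> finite_measure (lebesgue_on \<Omega>)"
  by (rule finite_measure_lebesgue_on) (simp add: bounded_set_imp_lmeasurable)

lemma L2_locally_integrable:
  assumes "u \<in> L2 (lebesgue_on \<Omega>)" "bounded \<Omega>" "\<Omega> \<in> sets lebesgue"
  shows "locally_integrable \<Omega> u"
  unfolding locally_integrable_def
proof (intro allI impI)
  fix K assume K: "compact K \<and> K \<subseteq> \<Omega>"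
  interpret finite_measure "lebesgue_on \<Omega>" using assms by (intro finite_measure_lebesgue_on_bounded)
  have i: "integrable (lebesgue_on \<Omega>) u" using assms(1) by (rule L2_integrable)
  show "integrable (lebesgue_on K) u"
    using set_integrable_subset[of lebesgue \<Omega> u K] i K assms(3)
    by (auto simp: set_integrable_def integrable_restrict_space dest: borel_compact)
qed


subsection \<open>Weak derivatives of Sobolev functions\<close>

lemma has_weak_partial_lincomb:
  assumes \<Omega>: "open \<Omega>" and "has_weak_partial \<Omega> j u v" "has_weak_partial \<Omega> j u' v'"
  shows "has_weak_partial \<Omega> j (\<lambda>x. a * u x + b * u' x) (\<lambda>x. a * v x + b * v' x)"
  unfolding has_weak_partial_def
proof (intro conjI ballI)
  have lc: "locally_integrable \<Omega> u" "locally_integrable \<Omega> u'" "locally_integrable \<Omega> v" "locally_integrable \<Omega> v'"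
    using assms by (auto simp: has_weak_partial_def)
  then show "locally_integrable \<Omega> (\<lambda>x. a * u x + b * u' x)" "locally_integrable \<Omega> (\<lambda>x. a * v x + b * v' x)"
    by (auto simp: locally_integrable_def)
  fix \<psi> assume \<psi>: "\<psi> \<in> test_functions \<Omega>"
  have lin: "(\<integral>x. (a * f x + b * g x) * \<phi> x \<partial>lebesgue_on \<Omega>)
      = a * (\<integral>x. f x * \<phi> x \<partial>lebesgue_on \<Omega>) + b * (\<integral>x. g x * \<phi> x \<partial>lebesgue_on \<Omega>)"
    if "locally_integrable \<Omega> f" "locally_integrable \<Omega> g" "\<phi> \<in> test_functions \<Omega>" for f g \<phi>
    using locally_integrable_mult_test_function[OF that(1,3)] locally_integrable_mult_test_function[OF that(2,3)] \<Omega>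
    by (simp add: distrib_right mult.assoc)
  have "(\<integral>x. u x * partial j \<psi> x \<partial>lebesgue_on \<Omega>) = - (\<integral>x. v x * \<psi> x \<partial>lebesgue_on \<Omega>)"
    "(\<integral>x. u' x * partial j \<psi> x \<partial>lebesgue_on \<Omega>) = - (\<integral>x. v' x * \<psi> x \<partial>lebesgue_on \<Omega>)"
    using assms(2,3) \<psi> by (auto simp: has_weak_partial_def)
  then show "(\<integral>x. (a * u x + b * u' x) * partial j \<psi> x \<partial>lebesgue_on \<Omega>)
      = - (\<integral>x. (a * v x + b * v' x) * \<psi> x \<partial>lebesgue_on \<Omega>)"
    using lin[OF lc(1,2) test_functions_partial[OF \<psi>]] lin[OF lc(3,4) \<psi>] by simp
qed

lemma C_infinity_L2:
  assumes "U \<in> C_infinity" "bounded \<Omega>" "\<Omega> \<in> sets lebesgue"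
  shows "U \<in> L2 (lebesgue_on \<Omega>)"
proof -
  have m: "U \<in> borel_measurable (lebesgue_on \<Omega>)"
    using C_infinity_measurable[OF assms(1)] by (rule borel_measurable_lebesgue_on)
  interpret finite_measure "lebesgue_on \<Omega>" using assms(2,3) by (rule finite_measure_lebesgue_on_bounded)
  have "compact (U ` closure \<Omega>)"
    using assms by (intro compact_continuous_image C_infinity_continuous) (auto simp: compact_closure)
  then obtain B where B: "\<And>y. y \<in> U ` closure \<Omega> \<Longrightarrow> norm y \<le> B"
    using compact_imp_bounded bounded_iff by metis
  have "integrable (lebesgue_on \<Omega>) (\<lambda>x. (norm (U x))\<^sup>2)"
  proof (rule integrable_const_bound)
    show "AE x in lebesgue_on \<Omega>. norm ((norm (U x))\<^sup>2) \<le> B\<^sup>2"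
    proof (rule AE_I2)
      fix x assume "x \<in> space (lebesgue_on \<Omega>)"
      then have "norm (U x) \<le> B" using closure_subset[of \<Omega>] by (intro B) (auto simp: space_restrict_space)
      then show "norm ((norm (U x))\<^sup>2) \<le> B\<^sup>2" using power_mono[of "norm (U x)" B 2] by simp
    qed
  qed (use m in simp)
  then show ?thesis using m by (simp add: L2_def)
qed

lemma C_infinity_has_weak_partial:
  assumes U: "U \<in> C_infinity" and \<Omega>: "open \<Omega>" "bounded \<Omega>"
  shows "has_weak_partial \<Omega> j U (partial j U)"
  unfolding has_weak_partial_def
proof (intro conjI ballI)
  show "locally_integrable \<Omega> U" "locally_integrable \<Omega> (partial j U)"
    using U \<Omega> by (auto intro!: L2_locally_integrable C_infinity_L2)
  fix \<psi> assume \<psi>: "\<psi> \<in> test_functions \<Omega>"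
  have on: "(\<integral>x. F x * \<phi> x \<partial>lebesgue_on \<Omega>) = (\<integral>x. F x * \<phi> x \<partial>lborel)"
    if "F \<in> C_infinity" "\<phi> \<in> test_functions \<Omega>" for F \<phi>
  proof (rule integral_lebesgue_on_eq_lborel)
    show "(\<lambda>x. F x * \<phi> x) \<in> borel_measurable borel"
      using C_infinity_mult[OF that(1) test_function_C_infinity[OF that(2)]] by (rule C_infinity_measurable)
    show "F x * \<phi> x = 0" if "x \<notin> \<Omega>" for x
      using \<open>\<phi> \<in> test_functions \<Omega>\<close> that closure_subset[of "{x. \<phi> x \<noteq> 0}"] by (auto simp: test_functions_def)
  qed (use \<Omega> in auto)
  show "(\<integral>x. U x * partial j \<psi> x \<partial>lebesgue_on \<Omega>) = - (\<integral>x. partial j U x * \<psi> x \<partial>lebesgue_on \<Omega>)"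
    using integral_by_parts_test_function[OF U test_functions_subset_UNIV[OF \<psi>], of j]
      on[OF U test_functions_partial[OF \<psi>]] on[OF C_infinity_partial[OF U] \<psi>] by simp
qed

lemma H1_weak_partial:
  assumes "open \<Omega>" "u \<in> H1 \<Omega>"
  shows "has_weak_partial \<Omega> j u (weak_partial \<Omega> j u)" "weak_partial \<Omega> j u \<in> L2 (lebesgue_on \<Omega>)"
proof -
  obtain v where v: "v \<in> L2 (lebesgue_on \<Omega>)" "has_weak_partial \<Omega> j u v"
    using assms(2) by (auto simp: H1_def)
  show w: "has_weak_partial \<Omega> j u (weak_partial \<Omega> j u)"
    using v(2) by (rule has_weak_partial_weak_partial)
  show "weak_partial \<Omega> j u \<in> L2 (lebesgue_on \<Omega>)"
    using w assms(1) by (intro L2_cong_AE[OF v(1) _ has_weak_partial_unique[OF assms(1) v(2) w]]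
      locally_integrable_measurable) (auto simp: has_weak_partial_def)
qed

lemma weak_partial_AE_eq:
  assumes "open \<Omega>" "has_weak_partial \<Omega> j u v"
  shows "AE x in lebesgue_on \<Omega>. weak_partial \<Omega> j u x = v x"
  by (rule has_weak_partial_unique[OF assms(1) has_weak_partial_weak_partial[OF assms(2)] assms(2)])

lemma has_weak_partial_measurable:
  assumes "open \<Omega>" "has_weak_partial \<Omega> j u v"
  shows "v \<in> borel_measurable (lebesgue_on \<Omega>)"
  using assms by (intro locally_integrable_measurable) (auto simp: has_weak_partial_def)

lemma L2_norm_nonneg: "L2_norm M u \<ge> 0"
  by (auto simp: L2_norm_def intro!: integral_nonneg_AE)

lemma H1_norm_ge: "L2_norm (lebesgue_on \<Omega>) u \<le> H1_norm \<Omega> u"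
  "L2_norm (lebesgue_on \<Omega>) (weak_partial \<Omega> j u) \<le> H1_norm \<Omega> u"
proof -
  show "L2_norm (lebesgue_on \<Omega>) u \<le> H1_norm \<Omega> u"
    unfolding H1_norm_def by (intro real_le_rsqrt) (simp add: sum_nonneg)
  have "(L2_norm (lebesgue_on \<Omega>) (weak_partial \<Omega> j u))\<^sup>2
      \<le> (\<Sum>j\<in>UNIV. (L2_norm (lebesgue_on \<Omega>) (weak_partial \<Omega> j u))\<^sup>2)"
    by (rule member_le_sum) auto
  then show "L2_norm (lebesgue_on \<Omega>) (weak_partial \<Omega> j u) \<le> H1_norm \<Omega> u"
    unfolding H1_norm_def by (intro real_le_rsqrt) (simp add: add_increasing)
qed

lemma H1_approximation_tendsto:
  assumes \<Omega>: "open \<Omega>" "bounded \<Omega>" and u: "u \<in> H1 \<Omega>" and U: "\<And>n. U n \<in> C_infinity"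
    and lim: "(\<lambda>n. H1_norm \<Omega> (\<lambda>x. U n x - u x)) \<longlonglongrightarrow> 0"
    and \<phi>: "\<phi> \<in> borel_measurable (lebesgue_on \<Omega>)" "\<And>x. \<bar>\<phi> x\<bar> \<le> B"
  shows "(\<lambda>n. \<integral>x. U n x * \<phi> x \<partial>lebesgue_on \<Omega>) \<longlonglongrightarrow> (\<integral>x. u x * \<phi> x \<partial>lebesgue_on \<Omega>)"
    "(\<lambda>n. \<integral>x. partial j (U n) x * \<phi> x \<partial>lebesgue_on \<Omega>) \<longlonglongrightarrow> (\<integral>x. weak_partial \<Omega> j u x * \<phi> x \<partial>lebesgue_on \<Omega>)"
proof -
  interpret finite_measure "lebesgue_on \<Omega>"
    using \<Omega> by (intro finite_measure_lebesgue_on_bounded) auto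
  have L2: "U n \<in> L2 (lebesgue_on \<Omega>)" "partial j (U n) \<in> L2 (lebesgue_on \<Omega>)" for n
    using U \<Omega> by (auto intro!: C_infinity_L2)
  have "(\<lambda>n. L2_norm (lebesgue_on \<Omega>) (\<lambda>x. U n x - u x)) \<longlonglongrightarrow> 0"
    by (rule tendsto_sandwich[OF _ _ tendsto_const lim]) (auto intro!: always_eventually L2_norm_nonneg H1_norm_ge)
  then show "(\<lambda>n. \<integral>x. U n x * \<phi> x \<partial>lebesgue_on \<Omega>) \<longlonglongrightarrow> (\<integral>x. u x * \<phi> x \<partial>lebesgue_on \<Omega>)"
    using u L2(1) \<phi> by (intro L2_tendsto_integral_mult) (auto simp: H1_def)
  \<comment> \<open>\<open>H1_norm\<close> contains the chosen weak derivative of the difference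
    \<open>U n - u\<close>; almost everywhere it is the classical derivative of \<open>U n\<close>
    minus the chosen weak derivative of \<open>u\<close>.\<close>
  have "L2_norm (lebesgue_on \<Omega>) (\<lambda>x. partial j (U n) x - weak_partial \<Omega> j u x)
      = L2_norm (lebesgue_on \<Omega>) (weak_partial \<Omega> j (\<lambda>x. U n x - u x))" for n
  proof -
    have w: "has_weak_partial \<Omega> j (\<lambda>x. U n x - u x) (\<lambda>x. partial j (U n) x - weak_partial \<Omega> j u x)"
      using has_weak_partial_lincomb[OF \<Omega>(1) C_infinity_has_weak_partial[OF U \<Omega>] H1_weak_partial(1)[OF \<Omega>(1) u], of j 1 n "- 1"]
      by simp
    show ?thesis
      using weak_partial_AE_eq[OF \<Omega>(1) w] has_weak_partial_measurable[OF \<Omega>(1) w]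
        has_weak_partial_measurable[OF \<Omega>(1) has_weak_partial_weak_partial[OF w]]
      by (intro L2_norm_cong_AE) (auto elim: eventually_mono)
  qed
  then have "(\<lambda>n. L2_norm (lebesgue_on \<Omega>) (\<lambda>x. partial j (U n) x - weak_partial \<Omega> j u x)) \<longlonglongrightarrow> 0"
    using H1_norm_ge(2)
    by (intro tendsto_sandwich[OF _ _ tendsto_const lim]) (auto intro!: always_eventually L2_norm_nonneg)
  then show "(\<lambda>n. \<integral>x. partial j (U n) x * \<phi> x \<partial>lebesgue_on \<Omega>) \<longlonglongrightarrow> (\<integral>x. weak_partial \<Omega> j u x * \<phi> x \<partial>lebesgue_on \<Omega>)"
    using H1_weak_partial(2)[OF \<Omega>(1) u] L2(2) \<phi> by (intro L2_tendsto_integral_mult) auto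
qed

section \<open>Bounded convex domains\<close>

subsection \<open>The Minkowski functional\<close>

definition minkowski :: "'a::real_normed_vector set \<Rightarrow> 'a \<Rightarrow> real" where
  "minkowski \<Omega> x = Inf {t. 0 < t \<and> (1 / t) *\<^sub>R x \<in> \<Omega>}"

locale convex_nbhd =
  fixes \<Omega> :: "'a::euclidean_space set"
  assumes bounded: "bounded \<Omega>" and convex: "convex \<Omega>" and op: "open \<Omega>" and zero_mem: "0 \<in> \<Omega>"
begin

abbreviation p :: "'a \<Rightarrow> real" where "p \<equiv> minkowski \<Omega>"

lemma ex_radii: "\<exists>r R. 0 < r \<and> 0 < R \<and> ball 0 r \<subseteq> \<Omega> \<and> \<Omega> \<subseteq> ball 0 R"
proof -
  obtain r where "r > 0" "ball 0 r \<subseteq> \<Omega>" using op zero_mem open_contains_ball by blast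
  moreover obtain R where "R > 0" "\<Omega> \<subseteq> ball 0 R" using bounded bounded_subset_ballD by blast
  ultimately show ?thesis by blast
qed

definition rin :: real where "rin = (SOME r. 0 < r \<and> ball 0 r \<subseteq> \<Omega>)"
definition rout :: real where "rout = (SOME R. 0 < R \<and> \<Omega> \<subseteq> ball 0 R)"

lemma rin: "0 < rin" "ball 0 rin \<subseteq> \<Omega>"
proof -
  have "\<exists>r. 0 < r \<and> ball 0 r \<subseteq> \<Omega>" using ex_radii by blast
  from someI_ex[OF this] show "0 < rin" "ball 0 rin \<subseteq> \<Omega>" by (auto simp: rin_def)
qed

lemma rout: "0 < rout" "\<Omega> \<subseteq> ball 0 rout"
proof -
  have "\<exists>r. 0 < r \<and> \<Omega> \<subseteq> ball 0 r" using ex_radii by blast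
  from someI_ex[OF this] show "0 < rout" "\<Omega> \<subseteq> ball 0 rout" by (auto simp: rout_def)
qed

lemma scale_mem:
  assumes "0 < s" "s \<le> t" "(1 / s) *\<^sub>R x \<in> \<Omega>"
  shows "(1 / t) *\<^sub>R x \<in> \<Omega>"
proof -
  have "(1 - s / t) *\<^sub>R 0 + (s / t) *\<^sub>R ((1 / s) *\<^sub>R x) \<in> \<Omega>"
    using assms by (intro convexD[OF convex zero_mem]) auto
  then show ?thesis using assms(1) by simp
qed

lemma p_nonneg: "0 \<le> p x"
  and p_less_iff: "0 < t \<Longrightarrow> p x < t \<longleftrightarrow> (1 / t) *\<^sub>R x \<in> \<Omega>"
proof -
  let ?T = "{t. 0 < t \<and> (1 / t) *\<^sub>R x \<in> \<Omega>}"
  have bdd: "bdd_below ?T" by (intro bdd_belowI[of _ 0]) auto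
  have "norm x / rin + 1 \<in> ?T"
  proof -
    have pos: "0 < norm x / rin + 1" using rin(1) by (simp add: add_nonneg_pos)
    have "norm ((1 / (norm x / rin + 1)) *\<^sub>R x) < rin"
      using rin(1) pos by (simp add: field_simps)
    then show ?thesis using rin(2) pos by auto
  qed
  then have ne: "?T \<noteq> {}" by blast
  show "0 \<le> p x" unfolding minkowski_def using ne by (intro cInf_greatest) auto
  assume t: "0 < t"
  show "p x < t \<longleftrightarrow> (1 / t) *\<^sub>R x \<in> \<Omega>"
  proof
    assume "p x < t"
    then obtain s where "s \<in> ?T" "s < t" unfolding minkowski_def using cInf_lessD[OF ne] by blast
    then show "(1 / t) *\<^sub>R x \<in> \<Omega>" using scale_mem[of s t x] by auto
  next
    \<comment> \<open>Openness leaves room for a slightly smaller scaling, which makes the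
      inequality strict.\<close>
    assume mem: "(1 / t) *\<^sub>R x \<in> \<Omega>"
    have "((\<lambda>s. (1 / s) *\<^sub>R x) \<longlongrightarrow> (1 / t) *\<^sub>R x) (at_left t)"
      using t by (intro tendsto_intros) auto
    then have "eventually (\<lambda>s. (1 / s) *\<^sub>R x \<in> \<Omega>) (at_left t)"
      using op mem by (rule topological_tendstoD)
    moreover have "eventually (\<lambda>s. s \<in> {0<..<t}) (at_left t)"
      using t by (rule eventually_at_left_real)
    ultimately have "eventually (\<lambda>s. s \<in> ?T \<and> s < t) (at_left t)"
      by eventually_elim auto
    then obtain s where "s \<in> ?T" "s < t"
      using eventually_happens[of _ "at_left t"] by (auto simp: trivial_limit_at_left_real)
    then show "p x < t" unfolding minkowski_def using cInf_lower[OF _ bdd, of s] by auto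
  qed
qed

lemma p_less_1_iff: "p x < 1 \<longleftrightarrow> x \<in> \<Omega>"
  using p_less_iff[of 1 x] by simp

lemma p_eqI:
  assumes "\<And>t. 0 < t \<Longrightarrow> p x < t \<longleftrightarrow> c < t" "0 \<le> c"
  shows "p x = c"
proof (rule antisym)
  show "p x \<le> c" using assms(1)[of "p x"] assms(2) by linarith
  show "c \<le> p x" using assms(1)[of c] p_nonneg[of x] by linarith
qed

lemma p_scale: "0 \<le> c \<Longrightarrow> p (c *\<^sub>R x) = c * p x"
proof (cases "c = 0")
  case True
  have "p 0 = 0"
    by (rule p_eqI) (use p_less_iff[of _ 0] zero_mem in auto)
  then show ?thesis using True by simp
next
  case False
  moreover assume "0 \<le> c"
  ultimately have c: "c > 0" by simp
  show ?thesis
  proof (rule p_eqI)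
    fix t :: real assume t: "0 < t"
    have "p (c *\<^sub>R x) < t \<longleftrightarrow> (1 / (t / c)) *\<^sub>R x \<in> \<Omega>" using p_less_iff[OF t] by simp
    also have "\<dots> \<longleftrightarrow> p x < t / c" using c t by (subst p_less_iff) auto
    also have "\<dots> \<longleftrightarrow> c * p x < t" using c by (simp add: field_simps)
    finally show "p (c *\<^sub>R x) < t \<longleftrightarrow> c * p x < t" .
  qed (use c p_nonneg in auto)
qed

lemma p_add: "p (x + y) \<le> p x + p y"
proof (rule field_le_epsilon)
  fix e :: real assume e: "e > 0"
  define s where "s = p x + e / 2"
  define t where "t = p y + e / 2"
  have st: "s > 0" "t > 0" using e p_nonneg by (auto simp: s_def t_def add_nonneg_pos)
  have "(1 / s) *\<^sub>R x \<in> \<Omega>" "(1 / t) *\<^sub>R y \<in> \<Omega>"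
    using p_less_iff[OF st(1), of x] p_less_iff[OF st(2), of y] e by (simp_all add: s_def t_def)
  then have "(s / (s + t)) *\<^sub>R ((1 / s) *\<^sub>R x) + (t / (s + t)) *\<^sub>R ((1 / t) *\<^sub>R y) \<in> \<Omega>"
    using st by (intro convexD[OF convex]) (auto simp: add_divide_distrib[symmetric])
  then have "(1 / (s + t)) *\<^sub>R (x + y) \<in> \<Omega>" using st by (simp add: scaleR_add_right)
  then have "p (x + y) < s + t" using st by (subst p_less_iff) auto
  then show "p (x + y) \<le> p x + p y + e" by (simp add: s_def t_def)
qed

lemma p_sum: "finite I \<Longrightarrow> p (\<Sum>i\<in>I. f i) \<le> (\<Sum>i\<in>I. p (f i))"
proof (induction I rule: finite_induct)
  case empty
  then show ?case using p_scale[of 0 0] by simp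
next
  case (insert i I)
  then show ?case using p_add[of "f i" "\<Sum>i\<in>I. f i"] by simp
qed

lemma p_le_norm: "p x \<le> norm x / rin"
proof (rule field_le_epsilon)
  fix e :: real assume e: "e > 0"
  define t where "t = norm x / rin + e"
  have t: "t > 0" using e rin(1) by (simp add: t_def add_nonneg_pos)
  have "norm ((1 / t) *\<^sub>R x) < rin"
    using t e rin(1) by (simp add: t_def field_simps)
  then have "(1 / t) *\<^sub>R x \<in> \<Omega>" using rin(2) by auto
  then show "p x \<le> norm x / rin + e" using p_less_iff[OF t, of x] by (simp add: t_def)
qed

lemma norm_le_p: "norm x \<le> rout * p x"
proof -
  have le: "norm x \<le> rout * (p x + e)" if "e > 0" for e
  proof -
    have t: "p x + e > 0" using that p_nonneg[of x] by simp
    then have "(1 / (p x + e)) *\<^sub>R x \<in> \<Omega>" using p_less_iff[OF t, of x] that by simp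
    then have "norm ((1 / (p x + e)) *\<^sub>R x) < rout" using rout(2) by auto
    then show ?thesis using t by (simp add: field_simps)
  qed
  show ?thesis
  proof (rule field_le_epsilon)
    fix e :: real assume "e > 0"
    then have "norm x \<le> rout * (p x + e / rout)" using rout(1) by (intro le) simp
    then show "norm x \<le> rout * p x + e" using rout(1) by (simp add: distrib_left)
  qed
qed

lemma p_pos: "x \<noteq> 0 \<Longrightarrow> 0 < p x"
  using norm_le_p[of x] rout(1) p_nonneg[of x] by (cases "p x = 0") auto

lemma p_diff_le: "\<bar>p x - p y\<bar> \<le> norm (x - y) / rin"
proof -
  have "p x \<le> p y + p (x - y)" "p y \<le> p x + p (y - x)"
    using p_add[of y "x - y"] p_add[of x "y - x"] by auto
  then show ?thesis using p_le_norm[of "x - y"] p_le_norm[of "y - x"] by (simp add: norm_minus_commute)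
qed

lemma continuous_on_p: "continuous_on S p"
proof -
  have "(1 / rin)-lipschitz_on S p"
    using p_diff_le rin(1) by (intro lipschitz_onI) (auto simp: dist_norm)
  then show ?thesis by (rule lipschitz_on_continuous_on)
qed

lemma p_measurable [measurable]: "p \<in> borel_measurable borel"
  by (intro borel_measurable_continuous_onI continuous_on_p)

lemma p_eq_1_imp_frontier: "p x = 1 \<Longrightarrow> x \<in> frontier \<Omega>"
proof -
  assume x: "p x = 1"
  have "(\<lambda>n. (1 - 1 / real (Suc n)) *\<^sub>R x) \<longlonglongrightarrow> (1 - 0) *\<^sub>R x"
    using LIMSEQ_inverse_real_of_nat by (intro tendsto_intros) (simp add: inverse_eq_divide)
  moreover have "(1 - 1 / real (Suc n)) *\<^sub>R x \<in> \<Omega>" for n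
  proof -
    have "p ((1 - 1 / real (Suc n)) *\<^sub>R x) = 1 - 1 / real (Suc n)" using x by (subst p_scale) auto
    then show ?thesis using p_less_1_iff[of "(1 - 1 / real (Suc n)) *\<^sub>R x"] by simp
  qed
  ultimately have "x \<in> closure \<Omega>" unfolding closure_sequential by fastforce
  moreover have "x \<notin> interior \<Omega>" using x p_less_1_iff[of x] interior_open[OF op] by simp
  ultimately show ?thesis by (simp add: frontier_def)
qed

lemma radial_projection_frontier: "x \<noteq> 0 \<Longrightarrow> (1 / p x) *\<^sub>R x \<in> frontier \<Omega>"
  using p_pos[of x] by (intro p_eq_1_imp_frontier) (simp add: p_scale)

text \<open>Level sets are dilates of parts of the frontier, which is a null set because \<Omega> is
  convex. This disposes of the two levels at which the cut-off functions below have a kink.\<close>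

lemma p_level_null:
  assumes "t > 0"
  shows "AE x in lborel. p x \<noteq> t"
proof -
  have "{x. p x = t} \<subseteq> (\<lambda>x. t *\<^sub>R x) ` frontier \<Omega>"
  proof
    fix x assume "x \<in> {x. p x = t}"
    then have "(1 / t) *\<^sub>R x \<in> frontier \<Omega>" using assms by (intro p_eq_1_imp_frontier) (simp add: p_scale)
    then show "x \<in> (\<lambda>x. t *\<^sub>R x) ` frontier \<Omega>" using assms by (intro image_eqI[of _ _ "(1 / t) *\<^sub>R x"]) auto
  qed
  moreover have "negligible ((\<lambda>x. t *\<^sub>R x) ` frontier \<Omega>)"
    by (intro negligible_differentiable_image_negligible negligible_convex_frontier convex)
      (auto intro!: derivative_intros)
  ultimately have "negligible {x. p x = t}" by (rule negligible_subset[rotated])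
  then have "AE x in lebesgue. x \<notin> {x. p x = t}"
    by (intro AE_not_in) (simp add: negligible_iff_null_sets)
  then show ?thesis by (simp add: AE_completion_iff)
qed

subsection \<open>One-sided directional derivatives of the Minkowski functional\<close>

definition slope :: "'a \<Rightarrow> 'a \<Rightarrow> real \<Rightarrow> real" where
  "slope v x h = (p (x + h *\<^sub>R v) - p x) / h"

text \<open>Slopes of a convex function increase with the step (\<open>slope_mono\<close>), so the
  infimum is their limit at 0 from the right: a one-sided directional derivative, which exists at
  every point.\<close>

definition dp :: "'a \<Rightarrow> 'a \<Rightarrow> real" where
  "dp v x = (INF h\<in>{0<..}. slope v x h)"

lemma slope_bound: "h > 0 \<Longrightarrow> \<bar>slope v x h\<bar> \<le> norm v / rin"
  using p_diff_le[of "x + h *\<^sub>R v" x] by (simp add: slope_def divide_le_eq mult.commute)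

lemma slope_mono:
  assumes "0 < h" "h \<le> k"
  shows "slope v x h \<le> slope v x k"
proof -
  have "x + h *\<^sub>R v = (1 - h / k) *\<^sub>R x + (h / k) *\<^sub>R (x + k *\<^sub>R v)"
    using assms by (simp add: algebra_simps)
  then have "p (x + h *\<^sub>R v) \<le> (1 - h / k) * p x + (h / k) * p (x + k *\<^sub>R v)"
    using p_add[of "(1 - h / k) *\<^sub>R x" "(h / k) *\<^sub>R (x + k *\<^sub>R v)"] assms by (simp add: p_scale)
  then have "p (x + h *\<^sub>R v) - p x \<le> (h / k) * (p (x + k *\<^sub>R v) - p x)"
    by (simp add: algebra_simps)
  then show ?thesis using assms by (simp add: slope_def field_simps)
qed

lemma slope_bdd_below: "bdd_below (slope v x ` {0<..})"
proof (rule bdd_belowI[of _ "- (norm v / rin)"])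
  fix y assume "y \<in> slope v x ` {0<..}"
  then obtain h where "h > 0" "y = slope v x h" by auto
  then show "- (norm v / rin) \<le> y" using slope_bound[of h v x] by linarith
qed

lemma slope_tendsto: "(slope v x \<longlongrightarrow> dp v x) (at_right 0)"
proof (rule order_tendstoI)
  fix a assume "a < dp v x"
  then have "a < slope v x h" if "h > 0" for h
    using cINF_lower[OF slope_bdd_below, of h v x] that by (simp add: dp_def)
  then show "eventually (\<lambda>h. a < slope v x h) (at_right 0)"
    by (auto simp: eventually_at_filter intro: always_eventually)
next
  fix a assume "dp v x < a"
  then obtain k where k: "k > 0" "slope v x k < a"
    unfolding dp_def by (subst (asm) cINF_less_iff[OF _ slope_bdd_below]) auto
  have "eventually (\<lambda>h. h \<in> {0<..<k}) (at_right 0)" using k(1) by (rule eventually_at_right_real)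
  then show "eventually (\<lambda>h. slope v x h < a) (at_right 0)"
    by eventually_elim (use slope_mono[of _ k v x] k(2) in force)
qed

lemma dp_bound: "\<bar>dp v x\<bar> \<le> norm v / rin"
proof -
  have "eventually (\<lambda>h::real. h > 0) (at_right 0)" by (auto simp: eventually_at_filter)
  then have "eventually (\<lambda>h. \<bar>slope v x h\<bar> \<le> norm v / rin) (at_right 0)"
    by eventually_elim (rule slope_bound)
  with tendsto_rabs[OF slope_tendsto] show ?thesis
    by (rule tendsto_upperbound) (simp add: trivial_limit_at_right_real)
qed

lemma dp_homogeneous:
  assumes "t > 0"
  shows "dp v (t *\<^sub>R x) = dp v x"
proof -
  have eq: "slope v (t *\<^sub>R x) = (\<lambda>h. slope v x (h / t))"
  proof
    fix h
    have "t *\<^sub>R x + h *\<^sub>R v = t *\<^sub>R (x + (h / t) *\<^sub>R v)" using assms by (simp add: scaleR_add_right)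
    then have "p (t *\<^sub>R x + h *\<^sub>R v) = t * p (x + (h / t) *\<^sub>R v)" using assms by (simp only: p_scale)
    then show "slope v (t *\<^sub>R x) h = slope v x (h / t)"
      using assms by (simp add: slope_def p_scale right_diff_distrib[symmetric])
  qed
  have "filterlim (\<lambda>h. h / t) (at_right 0) (at_right 0)"
  proof -
    have "((\<lambda>h. h / t) \<longlongrightarrow> 0) (at_right 0)" using assms by (auto intro!: tendsto_eq_intros)
    then show ?thesis using assms by (auto simp: filterlim_at eventually_at_filter intro: always_eventually)
  qed
  then have "(slope v (t *\<^sub>R x) \<longlongrightarrow> dp v x) (at_right 0)"
    unfolding eq by (rule filterlim_compose[OF slope_tendsto])
  then show ?thesis
    using tendsto_unique[OF _ slope_tendsto] by (simp add: trivial_limit_at_right_real)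
qed

lemma inverse_Suc_at_right: "filterlim (\<lambda>n. 1 / real (Suc n)) (at_right 0) sequentially"
  using LIMSEQ_inverse_real_of_nat by (auto simp: filterlim_at inverse_eq_divide)

lemma dp_measurable [measurable]: "dp v \<in> borel_measurable borel"
proof (rule borel_measurable_LIMSEQ_real)
  show "(\<lambda>n. slope v x (1 / real (Suc n))) \<longlonglongrightarrow> dp v x" for x
    using filterlim_compose[OF slope_tendsto inverse_Suc_at_right] .
  show "(\<lambda>x. slope v x (1 / real (Suc n))) \<in> borel_measurable borel" for n
    unfolding slope_def by measurable
qed

lemma dp_add_opposite: "0 \<le> dp v x + dp (- v) x"
proof -
  have "eventually (\<lambda>h::real. h > 0) (at_right 0)" by (auto simp: eventually_at_filter)
  then have "eventually (\<lambda>h. 0 \<le> slope v x h + slope (- v) x h) (at_right 0)"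
  proof eventually_elim
    case (elim h)
    have "2 * p x = p ((x + h *\<^sub>R v) + (x + h *\<^sub>R (- v)))"
      using p_scale[of 2 x] by (simp add: scaleR_2)
    also have "\<dots> \<le> p (x + h *\<^sub>R v) + p (x + h *\<^sub>R (- v))" by (rule p_add)
    finally show ?case using elim by (simp add: slope_def add_divide_distrib[symmetric])
  qed
  with tendsto_add[OF slope_tendsto slope_tendsto] show ?thesis
    by (rule tendsto_lowerbound) (simp add: trivial_limit_at_right_real)
qed

end

subsection \<open>Integration by parts with radial traces\<close>

lemma C_infinity_bounded_on_bounded:
  assumes "U \<in> C_infinity" "bounded S"
  obtains B where "B \<ge> 0" "\<And>x. x \<in> S \<Longrightarrow> \<bar>U x\<bar> \<le> B"
proof -
  have "compact (U ` closure S)"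
    using assms by (intro compact_continuous_image C_infinity_continuous) (auto simp: compact_closure)
  then obtain B where B: "\<And>y. y \<in> U ` closure S \<Longrightarrow> norm y \<le> B"
    using compact_imp_bounded bounded_iff by metis
  have "\<bar>U x\<bar> \<le> max 0 B" if "x \<in> S" for x
    using B[of "U x"] closure_subset[of S] that by force
  then show ?thesis by (intro that[of "max 0 B"]) auto
qed

lemma C_infinity_lipschitz_on_cball:
  fixes U :: "real^'n::finite \<Rightarrow> real"
  assumes "U \<in> C_infinity"
  obtains B where "B \<ge> 0" "\<And>x y. x \<in> cball 0 R \<Longrightarrow> y \<in> cball 0 R \<Longrightarrow> \<bar>U x - U y\<bar> \<le> B * norm (x - y)"
proof -
  have "\<exists>B. B \<ge> 0 \<and> (\<forall>x\<in>cball 0 R. \<bar>partial j U x\<bar> \<le> B)" for j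
    using C_infinity_bounded_on_bounded[OF C_infinity_partial[OF assms] bounded_cball] by metis
  then obtain B where B: "\<And>j. B j \<ge> 0" "\<And>j x. x \<in> cball 0 R \<Longrightarrow> \<bar>partial j U x\<bar> \<le> B j" by metis
  have "norm (U x - U y) \<le> (\<Sum>j\<in>UNIV. B j) * norm (x - y)"
    if "x \<in> cball 0 R" "y \<in> cball 0 R" for x y
  proof (rule differentiable_bound[of "cball 0 R" U "\<lambda>x h. \<Sum>j\<in>UNIV. h $ j * partial j U x"])
    fix x :: "real^'n" assume x: "x \<in> cball 0 R"
    show "(U has_derivative (\<lambda>h. \<Sum>j\<in>UNIV. h $ j * partial j U x)) (at x within cball 0 R)"
      using C_infinity_has_derivative[OF assms] has_derivative_at_withinI by blast
    show "onorm (\<lambda>h. \<Sum>j\<in>UNIV. h $ j * partial j U x) \<le> (\<Sum>j\<in>UNIV. B j)"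
    proof (rule onorm_bound)
      fix h :: "real^'n"
      have "norm (\<Sum>j\<in>UNIV. h $ j * partial j U x) \<le> (\<Sum>j\<in>UNIV. norm h * B j)"
        using B x by (intro sum_norm_le) (auto simp: abs_mult intro!: mult_mono component_le_norm_cart)
      then show "norm (\<Sum>j\<in>UNIV. h $ j * partial j U x) \<le> (\<Sum>j\<in>UNIV. B j) * norm h"
        by (simp add: sum_distrib_right sum_distrib_left mult.commute)
    qed (simp add: B sum_nonneg)
  qed (use that in auto)
  then show ?thesis using B by (intro that[of "\<Sum>j\<in>UNIV. B j"]) (auto intro: sum_nonneg)
qed

definition dirderiv :: "real^'n::finite \<Rightarrow> (real^'n \<Rightarrow> real) \<Rightarrow> real^'n \<Rightarrow> real" where
  "dirderiv v U x = (\<Sum>j\<in>UNIV. v $ j * partial j U x)"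

lemma dirderiv_C_infinity: "U \<in> C_infinity \<Longrightarrow> dirderiv v U \<in> C_infinity"
  unfolding dirderiv_def[abs_def] by (intro C_infinity_sum C_infinity_cmult C_infinity_partial)

lemma C_infinity_directional_quotient:
  assumes "U \<in> C_infinity"
  shows "(\<lambda>n. real (Suc n) * (U (x + (1 / real (Suc n)) *\<^sub>R v) - U x)) \<longlonglongrightarrow> dirderiv v U x"
proof -
  have "((\<lambda>t. x + t *\<^sub>R v) has_derivative (\<lambda>s. s *\<^sub>R v)) (at 0)"
    by (auto intro!: derivative_eq_intros)
  from has_derivative_compose[OF this C_infinity_has_derivative[OF assms]]
  have "((\<lambda>t. U (x + t *\<^sub>R v)) has_derivative
     (\<lambda>s. \<Sum>i\<in>UNIV. (s *\<^sub>R v) $ i * partial i U (x + 0 *\<^sub>R v))) (at 0)" .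
  also have "(\<lambda>s. \<Sum>i\<in>UNIV. (s *\<^sub>R v) $ i * partial i U (x + 0 *\<^sub>R v)) = (*) (dirderiv v U x)"
    by (auto simp: dirderiv_def sum_distrib_left sum_distrib_right mult_ac)
  finally have "((\<lambda>t. U (x + t *\<^sub>R v)) has_real_derivative dirderiv v U x) (at 0)"
    by (simp add: has_field_derivative_def)
  then have "(\<lambda>h. (U (x + h *\<^sub>R v) - U x) / h) \<midarrow>0\<rightarrow> dirderiv v U x" by (simp add: DERIV_def)
  moreover have "filterlim (\<lambda>n. 1 / real (Suc n)) (at 0) sequentially"
    using LIMSEQ_inverse_real_of_nat by (auto simp: filterlim_at inverse_eq_divide)
  ultimately show ?thesis
    by (auto dest: filterlim_compose simp: mult.commute)
qed

section \<open>Radial projection, cut-offs by the Minkowski functional, and thin boundary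
  layers\<close>

locale convex_nbhd_cart = convex_nbhd \<Omega> for \<Omega> :: "(real^'n::finite) set"
begin

definition radial :: "real^'n \<Rightarrow> real^'n" where
  "radial x = (1 / p x) *\<^sub>R x"

definition chi :: "nat \<Rightarrow> real^'n \<Rightarrow> real" where
  "chi m x = max 0 (min 1 (real m * (1 - p x)))"

lemma radial_measurable [measurable]: "radial \<in> borel_measurable borel"
  unfolding radial_def[abs_def] by measurable

lemma mem_iff: "x \<in> \<Omega> \<longleftrightarrow> p x < 1"
  using p_less_1_iff by simp

lemma mem_borel [measurable]: "\<Omega> \<in> sets borel"
  using op by simp

lemma norm_less_rout: "x \<in> \<Omega> \<Longrightarrow> norm x < rout"
  using rout(2) by auto

lemma norm_radial_le: "norm (radial x) \<le> rout"
proof (cases "x = 0")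
  case False
  then show ?thesis using norm_le_p[of "radial x"] p_pos[of x] by (simp add: radial_def p_scale)
qed (use rout in \<open>simp add: radial_def\<close>)

lemma chi_range: "0 \<le> chi m x" "chi m x \<le> 1"
  by (auto simp: chi_def)

lemma chi_eq_0: "x \<notin> \<Omega> \<Longrightarrow> chi m x = 0"
  using mult_nonneg_nonpos[of "real m" "1 - p x"] by (auto simp: chi_def mem_iff)

lemma continuous_on_chi: "continuous_on S (chi m)"
  unfolding chi_def[abs_def] by (intro continuous_intros continuous_on_p)

lemma chi_measurable [measurable]: "chi m \<in> borel_measurable borel"
  by (intro borel_measurable_continuous_onI continuous_on_chi)

lemma chi_lipschitz: "\<bar>chi m x - chi m y\<bar> \<le> real m * (norm (x - y) / rin)"
proof -
  have "\<bar>chi m x - chi m y\<bar> \<le> \<bar>real m * (1 - p x) - real m * (1 - p y)\<bar>"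
    by (auto simp: chi_def)
  also have "\<dots> = real m * \<bar>p x - p y\<bar>"
    by (simp add: right_diff_distrib[symmetric] abs_mult abs_minus_commute)
  also have "\<dots> \<le> real m * (norm (x - y) / rin)"
    by (intro mult_left_mono p_diff_le) simp
  finally show ?thesis .
qed

lemma integrable_chi_mult:
  assumes "continuous_on UNIV F"
  shows "integrable lborel (\<lambda>x. chi m x * F x)"
proof (rule integrable_continuous_bounded_support)
  show "bounded {x. chi m x * F x \<noteq> 0}"
    using chi_eq_0 by (intro bounded_subset[OF bounded]) auto
qed (intro continuous_intros continuous_on_chi assms)

lemma integrable_bounded_on_cball:
  fixes f :: "real^'n \<Rightarrow> real"
  assumes "f \<in> borel_measurable borel" "\<And>x. \<bar>f x\<bar> \<le> B * indicator (cball 0 R) x"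
  shows "integrable lborel f"
proof (rule Bochner_Integration.integrable_bound)
  show "integrable lborel (\<lambda>x. B * indicator (cball 0 R) x :: real)"
    by (auto intro!: integrable_real_indicator emeasure_bounded_finite)
qed (use assms in \<open>auto intro!: AE_I2 order_trans[OF _ abs_ge_self]\<close>)

text \<open>The layer where \<open>chi m\<close> is strictly between its two constant values; there
  its derivatives are \<open>- m\<close> times those of \<open>p\<close>.\<close>

definition shell :: "nat \<Rightarrow> (real^'n) set" where
  "shell m = {x. 1 - 1 / real m < p x \<and> p x < 1}"

lemma shell_measurable [measurable]: "shell m \<in> sets borel"
  unfolding shell_def by measurable

text \<open>The two excluded levels are those where \<open>chi m\<close>, as a function of
  \<open>p\<close>, has a kink; elsewhere a small shift stays on the same affine or constant
  branch.\<close>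

lemma chi_quotient_tendsto:
  assumes m: "m \<ge> 1" and x: "p x \<noteq> 1" "p x \<noteq> 1 - 1 / real m"
  shows "(\<lambda>n. real (Suc n) * (chi m (x + (1 / real (Suc n)) *\<^sub>R v) - chi m x))
    \<longlonglongrightarrow> - (real m * (indicator (shell m) x * dp v x))"
proof -
  let ?y = "\<lambda>n. x + (1 / real (Suc n)) *\<^sub>R v"
  have "?y \<longlonglongrightarrow> x + 0 *\<^sub>R v"
    using LIMSEQ_inverse_real_of_nat by (intro tendsto_intros) (simp add: inverse_eq_divide)
  then have py: "(\<lambda>n. p (?y n)) \<longlonglongrightarrow> p x"
    using continuous_on_p[of UNIV] by (auto intro: continuous_on_tendsto_compose)
  have m1: "real m * (1 - t) \<ge> 1 \<longleftrightarrow> t \<le> 1 - 1 / real m" for t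
    using m by (auto simp: field_simps)
  consider "p x < 1 - 1 / real m" | "1 - 1 / real m < p x" "p x < 1" | "p x > 1" using x by linarith
  then show ?thesis
  proof cases
    case 1
    have ev: "eventually (\<lambda>n. p (?y n) < 1 - 1 / real m) sequentially"
      using py 1 by (rule order_tendstoD)
    have one: "chi m z = 1" if "p z < 1 - 1 / real m" for z
      using m1[of "p z"] that by (auto simp: chi_def)
    have "eventually (\<lambda>n. real (Suc n) * (chi m (?y n) - chi m x) = 0) sequentially"
      using ev by eventually_elim (use one 1 in simp)
    moreover have "indicator (shell m) x = (0::real)" using 1 by (simp add: shell_def)
    ultimately show ?thesis by (simp add: tendsto_eventually)
  next
    case 2
    have lin: "chi m z = real m * (1 - p z)" if "1 - 1 / real m < p z" "p z < 1" for z
      using m1[of "p z"] that by (auto simp: chi_def)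
    have "eventually (\<lambda>n. 1 - 1 / real m < p (?y n)) sequentially" "eventually (\<lambda>n. p (?y n) < 1) sequentially"
      using py 2 by (auto intro: order_tendstoD)
    then have ev: "eventually (\<lambda>n. - (real m * slope v x (1 / real (Suc n)))
        = real (Suc n) * (chi m (?y n) - chi m x)) sequentially"
    proof eventually_elim
      case (elim n)
      then show ?case using lin[of "?y n"] lin[of x] 2
        by (simp only: slope_def) (simp add: algebra_simps)
    qed
    have "(\<lambda>n. - (real m * slope v x (1 / real (Suc n)))) \<longlonglongrightarrow> - (real m * dp v x)"
      using filterlim_compose[OF slope_tendsto inverse_Suc_at_right] by (intro tendsto_intros)
    from Lim_transform_eventually[OF this ev] show ?thesis using 2 by (simp add: shell_def)
  next
    case 3
    have ev: "eventually (\<lambda>n. 1 < p (?y n)) sequentially"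
      using py 3 by (rule order_tendstoD)
    have zero: "chi m z = 0" if "1 < p z" for z
      using that by (intro chi_eq_0) (simp add: mem_iff)
    have "eventually (\<lambda>n. real (Suc n) * (chi m (?y n) - chi m x) = 0) sequentially"
      using ev by eventually_elim (use zero 3 in simp)
    moreover have "indicator (shell m) x = (0::real)" using 3 by (simp add: shell_def)
    ultimately show ?thesis by (simp add: tendsto_eventually)
  qed
qed

text \<open>Integration by parts for the Lipschitz function \<open>chi m\<close>: translation
  invariance moves the shift in a difference quotient of \<open>U\<close> onto \<open>chi m\<close>,
  and both sides converge by domination. The shift reverses its direction, which is why the
  one-sided derivative along \<open>- v\<close> appears.\<close>

lemma integral_chi_dirderiv:
  assumes U: "U \<in> C_infinity" and m: "m \<ge> 2"
  shows "(\<integral>x. chi m x * dirderiv v U x \<partial>lborel)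
    = - (real m * (\<integral>x. indicator (shell m) x * (U x * dp (- v) x) \<partial>lborel))"
proof -
  define h where "h n = 1 / real (Suc n)" for n
  have h: "0 < h n" "h n \<le> 1" "real (Suc n) * h n = 1" for n by (auto simp: h_def)
  \<comment> \<open>The ball of this radius contains \<Omega> and all its translates by
    \<open>h n\<close> times \<open>v\<close> or \<open>- v\<close>.\<close>
  define R where "R = rout + norm v"
  have [measurable]: "U \<in> borel_measurable borel" "dirderiv v U \<in> borel_measurable borel"
    using U by (auto intro: C_infinity_measurable dirderiv_C_infinity)
  have [measurable]: "(\<lambda>x. U (x + c)) \<in> borel_measurable borel" for c by measurable
  have contU: "continuous_on UNIV (\<lambda>x. U (x + c))" for c
    by (rule continuous_on_compose2[OF C_infinity_continuous[OF U, of UNIV]]) (auto intro!: continuous_intros)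
  obtain B where B: "B \<ge> 0" "\<And>x y. x \<in> cball 0 R \<Longrightarrow> y \<in> cball 0 R \<Longrightarrow> \<bar>U x - U y\<bar> \<le> B * norm (x - y)"
    using C_infinity_lipschitz_on_cball[OF U] by metis
  obtain B' where B': "B' \<ge> 0" "\<And>x. x \<in> cball 0 R \<Longrightarrow> \<bar>U x\<bar> \<le> B'"
    using C_infinity_bounded_on_bounded[OF U bounded_cball] by metis
  let ?A = "\<lambda>n x. chi m x * (real (Suc n) * (U (x + h n *\<^sub>R v) - U x))"
  let ?B = "\<lambda>n x. (real (Suc n) * (chi m (x + h n *\<^sub>R (- v)) - chi m x)) * U x"
  have eq: "(\<integral>x. ?A n x \<partial>lborel) = (\<integral>x. ?B n x \<partial>lborel)" for n
  proof -
    let ?F = "\<lambda>x. chi m x * U (x + h n *\<^sub>R v)"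
    have i: "integrable lborel ?F" "integrable lborel (\<lambda>x. chi m x * U x)"
      using integrable_chi_mult[OF contU[of "h n *\<^sub>R v"]] integrable_chi_mult[OF contU[of 0]] by simp_all
    have Fm: "?F \<in> borel_measurable borel" by measurable
    have tr: "?F (x + - (h n *\<^sub>R v)) = chi m (x + h n *\<^sub>R (- v)) * U x" for x by simp
    have i': "integrable lborel (\<lambda>x. chi m (x + h n *\<^sub>R (- v)) * U x)"
      unfolding tr[symmetric]
      using integrable_lborel_affine[OF Fm, of 1 "- (h n *\<^sub>R v)"] i(1) by (simp add: add.commute)
    have "(\<integral>x. ?A n x \<partial>lborel) = (\<integral>x. real (Suc n) * (?F x - chi m x * U x) \<partial>lborel)"
      by (intro Bochner_Integration.integral_cong refl) (simp only: right_diff_distrib mult.left_commute)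
    also have "\<dots> = real (Suc n) * ((\<integral>x. ?F x \<partial>lborel) - (\<integral>x. chi m x * U x \<partial>lborel))"
      unfolding integral_mult_right_zero using i by simp
    also have "(\<integral>x. ?F x \<partial>lborel) = (\<integral>x. chi m (x + h n *\<^sub>R (- v)) * U x \<partial>lborel)"
      unfolding tr[symmetric] by (rule integral_lborel_translate[OF Fm, symmetric])
    also have "real (Suc n) * ((\<integral>x. chi m (x + h n *\<^sub>R (- v)) * U x \<partial>lborel) - (\<integral>x. chi m x * U x \<partial>lborel))
        = (\<integral>x. real (Suc n) * (chi m (x + h n *\<^sub>R (- v)) * U x - chi m x * U x) \<partial>lborel)"
      unfolding integral_mult_right_zero using i i' by simp
    also have "\<dots> = (\<integral>x. ?B n x \<partial>lborel)"
      by (intro Bochner_Integration.integral_cong refl) (simp only: left_diff_distrib mult.assoc right_diff_distrib)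
    finally show ?thesis .
  qed
  have hv: "norm (h n *\<^sub>R w) \<le> norm w" for n and w :: "real^'n"
    using h[of n] mult_right_mono[of "h n" 1 "norm w"] by simp
  have inR: "x + h n *\<^sub>R v \<in> cball 0 R" "x \<in> cball 0 R" if "x \<in> \<Omega>" for x n
    using norm_less_rout[OF that] hv[of n v] norm_triangle_ineq[of x "h n *\<^sub>R v"] norm_ge_zero[of v]
    by (auto simp: R_def simp del: norm_scaleR norm_ge_zero)
  have "(\<lambda>n. \<integral>x. ?A n x \<partial>lborel) \<longlonglongrightarrow> (\<integral>x. chi m x * dirderiv v U x \<partial>lborel)"
  proof (rule integral_dominated_convergence[where w = "\<lambda>x. (B * norm v) * indicator (cball 0 R) x"])
    show "AE x in lborel. (\<lambda>n. ?A n x) \<longlonglongrightarrow> chi m x * dirderiv v U x"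
      unfolding h_def using C_infinity_directional_quotient[OF U] by (intro AE_I2 tendsto_mult_left)
    show "AE x in lborel. norm (?A n x) \<le> (B * norm v) * indicator (cball 0 R) x" for n
    proof (rule AE_I2)
      fix x :: "real^'n"
      show "norm (?A n x) \<le> (B * norm v) * indicator (cball 0 R) x"
      proof (cases "x \<in> \<Omega>")
        case True
        have "\<bar>U (x + h n *\<^sub>R v) - U x\<bar> \<le> B * norm (h n *\<^sub>R v)"
          using B(2)[OF inR[OF True]] by simp
        then have "real (Suc n) * \<bar>U (x + h n *\<^sub>R v) - U x\<bar> \<le> real (Suc n) * (B * (h n * norm v))"
          using h[of n] by (intro mult_left_mono) auto
        also have "\<dots> = B * norm v * (real (Suc n) * h n)" by (simp only: mult_ac)
        also have "\<dots> = B * norm v" by (simp only: h mult_1_right)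
        finally have "chi m x * (real (Suc n) * \<bar>U (x + h n *\<^sub>R v) - U x\<bar>) \<le> 1 * (B * norm v)"
          by (rule mult_mono[OF chi_range(2)]) (use B in auto)
        then show ?thesis using chi_range[of m x] inR(2)[OF True] by (simp add: abs_mult del: of_nat_Suc)
      qed (use B in \<open>simp add: chi_eq_0\<close>)
    qed
    show "integrable lborel (\<lambda>x. (B * norm v) * indicator (cball (0 :: real^'n) R) x)"
      by (rule integrable_bounded_on_cball) (use B in \<open>auto simp: indicator_def\<close>)
  qed measurable
  moreover have "(\<lambda>n. \<integral>x. ?B n x \<partial>lborel) \<longlonglongrightarrow> (\<integral>x. - (real m * (indicator (shell m) x * dp (- v) x)) * U x \<partial>lborel)"
  proof (rule integral_dominated_convergence[where w = "\<lambda>x. (real m * (norm v / rin) * B') * indicator (cball 0 R) x"])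
    have "AE x in lborel. p x \<noteq> 1" "AE x in lborel. p x \<noteq> 1 - 1 / real m"
      using m by (auto intro!: p_level_null)
    then show "AE x in lborel. (\<lambda>n. ?B n x) \<longlonglongrightarrow> - (real m * (indicator (shell m) x * dp (- v) x)) * U x"
      unfolding h_def by eventually_elim (use m in \<open>intro tendsto_mult_right chi_quotient_tendsto; simp\<close>)
    show "AE x in lborel. norm (?B n x) \<le> (real m * (norm v / rin) * B') * indicator (cball 0 R) x" for n
    proof (rule AE_I2)
      fix x :: "real^'n"
      show "norm (?B n x) \<le> (real m * (norm v / rin) * B') * indicator (cball 0 R) x"
      proof (cases "x \<in> cball 0 R")
        case True
        have "\<bar>chi m (x + h n *\<^sub>R (- v)) - chi m x\<bar> \<le> real m * (h n * norm v / rin)"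
          using chi_lipschitz[of m "x + h n *\<^sub>R (- v)" x] h[of n] by simp
        then have "real (Suc n) * \<bar>chi m (x + h n *\<^sub>R (- v)) - chi m x\<bar> \<le> real (Suc n) * (real m * (h n * norm v / rin))"
          by (intro mult_left_mono) auto
        also have "\<dots> = (real m * (norm v / rin)) * (real (Suc n) * h n)" by simp
        also have "\<dots> = real m * (norm v / rin)" by (simp only: h mult_1_right)
        finally have "(real (Suc n) * \<bar>chi m (x + h n *\<^sub>R (- v)) - chi m x\<bar>) * \<bar>U x\<bar> \<le> (real m * (norm v / rin)) * B'"
          by (rule mult_mono) (use B' True rin in auto)
        then show ?thesis using True by (simp add: abs_mult del: of_nat_Suc)
      next
        case False
        then have "x \<notin> \<Omega>" using inR(2) by blast
        moreover have "x + h n *\<^sub>R (- v) \<notin> \<Omega>"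
        proof
          assume "x + h n *\<^sub>R (- v) \<in> \<Omega>"
          from inR(1)[OF this, of n] False show False by simp
        qed
        ultimately show ?thesis using False by (simp add: chi_eq_0)
      qed
    qed
    show "integrable lborel (\<lambda>x. (real m * (norm v / rin) * B') * indicator (cball (0 :: real^'n) R) x)"
      by (rule integrable_bounded_on_cball) (use B' rin in \<open>auto simp: indicator_def\<close>)
  qed measurable
  ultimately have "(\<integral>x. chi m x * dirderiv v U x \<partial>lborel)
      = (\<integral>x. - (real m * (indicator (shell m) x * dp (- v) x)) * U x \<partial>lborel)"
    unfolding eq by (rule LIMSEQ_unique)
  also have "\<dots> = - (real m * (\<integral>x. indicator (shell m) x * (U x * dp (- v) x) \<partial>lborel))"
    unfolding integral_mult_right_zero[symmetric] integral_minus[symmetric]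
    by (intro Bochner_Integration.integral_cong) (simp_all add: mult_ac)
  finally show ?thesis .
qed

lemma integral_sublevel:
  fixes G :: "real^'n \<Rightarrow> real"
  assumes [measurable]: "G \<in> borel_measurable borel" and t: "t > 0"
    and hom: "\<And>x. G (t *\<^sub>R x) = G x"
  shows "(\<integral>x. indicator {x. p x < t} x * G x \<partial>lborel) = t ^ CARD('n) * (\<integral>x. indicator \<Omega> x * G x \<partial>lborel)"
proof -
  have "indicator {x. p x < t} (0 + t *\<^sub>R x) * G (0 + t *\<^sub>R x) = indicator \<Omega> x * G x" for x
    using t by (auto simp: indicator_def p_scale hom mem_iff)
  then show ?thesis
    using integral_lborel_affine[of "\<lambda>x. indicator {x. p x < t} x * G x" t 0] t
    by (simp del: add_0_left scaleR_zero_left)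
qed

text \<open>For a function constant along rays, the integral over the sublevel set
  \<open>p < t\<close> is \<open>t ^ CARD('n)\<close> times that over \<Omega>, and the shell is the
  difference of two sublevel sets up to a null level.\<close>

lemma integral_shell:
  fixes G :: "real^'n \<Rightarrow> real"
  assumes [measurable]: "G \<in> borel_measurable borel" and m: "m \<ge> 2"
    and hom: "\<And>t x. t > 0 \<Longrightarrow> G (t *\<^sub>R x) = G x" and int: "integrable lborel (\<lambda>x. indicator \<Omega> x * G x)"
  shows "(\<integral>x. indicator (shell m) x * G x \<partial>lborel)
    = (1 - (1 - 1 / real m) ^ CARD('n)) * (\<integral>x. indicator \<Omega> x * G x \<partial>lborel)"
proof -
  let ?t = "1 - 1 / real m"
  have t: "?t > 0" "?t \<le> 1" using m by auto
  have sub: "x \<in> \<Omega>" if "p x < ?t" for x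
    using that t(2) mem_iff[of x] by linarith
  have int': "integrable lborel (\<lambda>x. indicator {x. p x < ?t} x * G x)"
    by (rule Bochner_Integration.integrable_bound[OF int])
      (use sub in \<open>auto intro!: AE_I2 simp: indicator_def\<close>)
  have "(\<integral>x. indicator (shell m) x * G x \<partial>lborel)
      = (\<integral>x. indicator \<Omega> x * G x - indicator {x. p x < ?t} x * G x \<partial>lborel)"
  proof (rule integral_cong_AE)
    show "AE x in lborel. indicator (shell m) x * G x = indicator \<Omega> x * G x - indicator {x. p x < ?t} x * G x"
      using p_level_null[OF t(1)] by eventually_elim (use sub in \<open>auto simp: shell_def mem_iff indicator_def\<close>)
  qed measurable
  also have "\<dots> = (1 - ?t ^ CARD('n)) * (\<integral>x. indicator \<Omega> x * G x \<partial>lborel)"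
    using int int' integral_sublevel[of G ?t] hom[OF t(1)] t by (simp add: left_diff_distrib)
  finally show ?thesis .
qed

text \<open>The limit is the derivative of \<open>1 - (1 - h) ^ N\<close> at 0, taken along
  \<open>h = 1 / (k + 2)\<close>; it is the origin of the dimension factor in Green's
  formula.\<close>

lemma shell_factor_tendsto: "(\<lambda>k. real (k + 2) * (1 - (1 - 1 / real (k + 2)) ^ N)) \<longlonglongrightarrow> real N"
proof -
  have "((\<lambda>h. - ((1 - h) ^ N)) has_real_derivative real N) (at 0)"
    by (auto intro!: derivative_eq_intros)
  then have "(\<lambda>h. (1 - (1 - h) ^ N) / h) \<midarrow>0\<rightarrow> real N" by (simp add: DERIV_def)
  moreover have "filterlim (\<lambda>k. 1 / real (k + 2)) (at 0) sequentially"
    using LIMSEQ_ignore_initial_segment[OF LIMSEQ_inverse_real_of_nat, of 1]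
    by (auto simp: filterlim_at inverse_eq_divide add.commute)
  ultimately show ?thesis by (auto dest: filterlim_compose simp: mult.commute)
qed

text \<open>The boundary integral appears as an integral over \<open>\<Omega>\<close> of the boundary values extended
  along rays; this replaces the surface measure in Green's formula.\<close>

lemma integral_dirderiv:
  assumes U: "U \<in> C_infinity"
  shows "(\<integral>x. indicator \<Omega> x * dirderiv v U x \<partial>lborel)
    = - (real CARD('n) * (\<integral>x. indicator \<Omega> x * (U (radial x) * dp (- v) x) \<partial>lborel))"
proof -
  define L where "L = norm v / rin"
  have L: "L \<ge> 0" "\<And>x. \<bar>dp (- v) x\<bar> \<le> L" using dp_bound[of "- v"] rin by (simp_all add: L_def)
  have [measurable]: "U \<in> borel_measurable borel" "dirderiv v U \<in> borel_measurable borel"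
    using U by (auto intro: C_infinity_measurable dirderiv_C_infinity)
  obtain B where B: "B \<ge> 0" "\<And>x y. x \<in> cball 0 rout \<Longrightarrow> y \<in> cball 0 rout \<Longrightarrow> \<bar>U x - U y\<bar> \<le> B * norm (x - y)"
    using C_infinity_lipschitz_on_cball[OF U] by metis
  obtain B' where B': "B' \<ge> 0" "\<And>x. x \<in> cball 0 rout \<Longrightarrow> \<bar>U x\<bar> \<le> B'"
    using C_infinity_bounded_on_bounded[OF U bounded_cball] by metis
  obtain B'' where B'': "B'' \<ge> 0" "\<And>x. x \<in> cball 0 rout \<Longrightarrow> \<bar>dirderiv v U x\<bar> \<le> B''"
    using C_infinity_bounded_on_bounded[OF dirderiv_C_infinity[OF U] bounded_cball] by metis
  define G where "G x = U (radial x) * dp (- v) x" for x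
  have [measurable]: "G \<in> borel_measurable borel" unfolding G_def by measurable
  have radial_in: "radial x \<in> cball 0 rout" for x using norm_radial_le by simp
  have mem_in: "x \<in> cball 0 rout" if "x \<in> \<Omega>" for x using norm_less_rout[OF that] by simp
  have G_bound: "\<bar>G x\<bar> \<le> B' * L" for x
    unfolding G_def abs_mult using B' L radial_in by (intro mult_mono) auto
  have G_hom: "G (t *\<^sub>R x) = G x" if "t > 0" for t x
    using that by (simp add: G_def dp_homogeneous radial_def p_scale)
  have G_int: "integrable lborel (\<lambda>x. indicator \<Omega> x * G x)"
    by (rule integrable_bounded_on_cball[where B = "B' * L" and R = rout])
      (use G_bound mem_in B'(1) L(1) in \<open>auto simp: indicator_def\<close>)
  have one_int: "integrable lborel (\<lambda>x. indicator \<Omega> x * 1 :: real)"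
    by (rule integrable_bounded_on_cball[where B = 1 and R = rout]) (use mem_in in \<open>auto simp: indicator_def\<close>)
  let ?I = "\<integral>x. indicator \<Omega> x * G x \<partial>lborel"
  let ?m = "\<lambda>k. k + 2 :: nat"
  let ?UG = "\<lambda>k. \<integral>x. indicator (shell (?m k)) x * (U x * dp (- v) x) \<partial>lborel"
  have "(\<lambda>k. \<integral>x. chi (?m k) x * dirderiv v U x \<partial>lborel) \<longlonglongrightarrow> (\<integral>x. indicator \<Omega> x * dirderiv v U x \<partial>lborel)"
  proof (rule integral_dominated_convergence[where w = "\<lambda>x. B'' * indicator (cball 0 rout) x"])
    show "AE x in lborel. (\<lambda>k. chi (?m k) x * dirderiv v U x) \<longlonglongrightarrow> indicator \<Omega> x * dirderiv v U x"
    proof (intro AE_I2 tendsto_mult_right)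
      fix x :: "real^'n"
      show "(\<lambda>k. chi (?m k) x) \<longlonglongrightarrow> indicator \<Omega> x"
      proof (cases "x \<in> \<Omega>")
        case True
        then have pos: "1 - p x > 0" by (simp add: mem_iff)
        obtain k0 :: nat where k0: "real k0 > 1 / (1 - p x)" using reals_Archimedean2 by blast
        have "chi (?m k) x = 1" if "k \<ge> k0" for k
        proof -
          have "1 \<le> real k0 * (1 - p x)" using k0 pos by (simp add: field_simps)
          also have "\<dots> \<le> real (?m k) * (1 - p x)" using that pos by (intro mult_right_mono) auto
          finally show ?thesis by (simp add: chi_def)
        qed
        then have "eventually (\<lambda>k. chi (?m k) x = indicator \<Omega> x) sequentially"
          using True by (auto simp: eventually_sequentially)
        then show ?thesis by (rule tendsto_eventually)
      qed (simp add: chi_eq_0)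
    qed
    show "AE x in lborel. norm (chi (?m k) x * dirderiv v U x) \<le> B'' * indicator (cball 0 rout) x" for k
    proof (rule AE_I2)
      fix x :: "real^'n"
      show "norm (chi (?m k) x * dirderiv v U x) \<le> B'' * indicator (cball 0 rout) x"
      proof (cases "x \<in> \<Omega>")
        case True
        have "chi (?m k) x * \<bar>dirderiv v U x\<bar> \<le> 1 * B''"
          using chi_range[of "?m k" x] B''(2)[OF mem_in[OF True]] by (intro mult_mono) auto
        then show ?thesis using chi_range[of "?m k" x] mem_in[OF True] by (simp add: abs_mult)
      qed (use B'' in \<open>simp add: chi_eq_0\<close>)
    qed
    show "integrable lborel (\<lambda>x. B'' * indicator (cball (0 :: real^'n) rout) x)"
      by (rule integrable_bounded_on_cball) (use B'' in \<open>auto simp: indicator_def\<close>)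
  qed measurable
  moreover have "(\<lambda>k. \<integral>x. chi (?m k) x * dirderiv v U x \<partial>lborel) \<longlonglongrightarrow> - (real CARD('n) * ?I)"
  proof -
    have shell_mem: "x \<in> \<Omega>" if "x \<in> shell m" for x m using that by (simp add: shell_def mem_iff)
    \<comment> \<open>On the shell, \<open>U x\<close> and \<open>U (radial x)\<close> differ by at
      most a multiple of \<open>1 / m\<close>, and the shell has measure of order
      \<open>1 / m\<close>; multiplied by \<open>m\<close>, the error still tends to 0.\<close>
    have err: "\<bar>real (?m k) * (?UG k - (\<integral>x. indicator (shell (?m k)) x * G x \<partial>lborel))\<bar>
        \<le> (1 - (1 - 1 / real (?m k)) ^ CARD('n)) * (B * rout * L * (\<integral>x. indicator \<Omega> x * 1 \<partial>lborel))" for k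
    proof -
      let ?S = "shell (?m k)"
      have m: "?m k \<ge> 2" by simp
      have i1: "integrable lborel (\<lambda>x. indicator ?S x * (U x * dp (- v) x))"
      proof (rule integrable_bounded_on_cball[where B = "B' * L" and R = rout])
        fix x :: "real^'n"
        show "\<bar>indicator ?S x * (U x * dp (- v) x)\<bar> \<le> B' * L * indicator (cball 0 rout) x"
        proof (cases "x \<in> ?S")
          case True
          then have "x \<in> cball 0 rout" using mem_in shell_mem by blast
          moreover from this have "\<bar>U x\<bar> * \<bar>dp (- v) x\<bar> \<le> B' * L" using B' L by (intro mult_mono) auto
          ultimately show ?thesis using True by (simp add: abs_mult)
        qed (use B' L in simp)
      qed measurable
      have i2: "integrable lborel (\<lambda>x. indicator ?S x * G x)"
        by (rule integrable_bounded_on_cball[where B = "B' * L" and R = rout])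
          (use G_bound mem_in shell_mem B'(1) L(1) in \<open>auto simp: indicator_def\<close>)
      have i3: "integrable lborel (\<lambda>x. indicator ?S x * 1 :: real)"
        by (rule integrable_bounded_on_cball[where B = 1 and R = rout])
          (use mem_in shell_mem in \<open>auto simp: indicator_def\<close>)
      have "\<bar>?UG k - (\<integral>x. indicator ?S x * G x \<partial>lborel)\<bar> = norm (\<integral>x. indicator ?S x * (U x * dp (- v) x) - indicator ?S x * G x \<partial>lborel)"
        using i1 i2 by simp
      also have "\<dots> \<le> (\<integral>x. (B * rout * L / real (?m k)) * (indicator ?S x * 1) \<partial>lborel)"
      proof (rule order_trans[OF integral_norm_bound integral_mono'])
        fix x :: "real^'n"
        show "norm (indicator ?S x * (U x * dp (- v) x) - indicator ?S x * G x) \<le> (B * rout * L / real (?m k)) * (indicator ?S x * 1)"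
        proof (cases "x \<in> ?S")
          case True
          have "0 < 1 - 1 / real (?m k)" by (simp add: field_simps)
          moreover have px': "1 - 1 / real (?m k) < p x" "p x < 1"
            using True by (auto simp: shell_def)
          ultimately have px: "0 < p x" "1 - 1 / real (?m k) < p x" "p x < 1"
            by linarith+
          have "x - radial x = (1 - 1 / p x) *\<^sub>R x" by (simp add: radial_def scaleR_left_diff_distrib)
          then have "norm (x - radial x) = \<bar>1 - 1 / p x\<bar> * norm x" by simp
          also have "\<dots> = ((1 - p x) / p x) * norm x" using px by (simp add: abs_if field_simps)
          also have "\<dots> \<le> ((1 - p x) / p x) * (rout * p x)"
            using px by (intro mult_left_mono norm_le_p) auto
          also have "\<dots> = (1 - p x) * rout" using px by simp
          also have "\<dots> \<le> (1 / real (?m k)) * rout" using px rout by (intro mult_right_mono) auto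
          finally have d: "norm (x - radial x) \<le> rout / real (?m k)" by simp
          have "\<bar>U x - U (radial x)\<bar> \<le> B * norm (x - radial x)"
            using mem_in[OF shell_mem[OF True]] radial_in by (rule B(2))
          also have "\<dots> \<le> B * (rout / real (?m k))" using d B(1) by (rule mult_left_mono)
          finally have "\<bar>U x - U (radial x)\<bar> * \<bar>dp (- v) x\<bar> \<le> B * (rout / real (?m k)) * L"
            using L B rout by (intro mult_mono) auto
          then show ?thesis using True
            by (simp add: G_def left_diff_distrib[symmetric] abs_mult mult_ac)
        next
          case False
          then show ?thesis by simp
        qed
      next
        show "integrable lborel (\<lambda>x. (B * rout * L / real (?m k)) * (indicator ?S x * 1))"
          using i3 by (rule integrable_mult_right)
        show "0 \<le> (B * rout * L / real (?m k)) * (indicator ?S x * 1)" for x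
          using B L rout by simp
      qed
      also have "\<dots> = (B * rout * L / real (?m k)) * (\<integral>x. indicator ?S x * 1 \<partial>lborel)"
        by (rule integral_mult_right_zero)
      also have "\<dots> = (B * rout * L / real (?m k)) * ((1 - (1 - 1 / real (?m k)) ^ CARD('n)) * (\<integral>x. indicator \<Omega> x * 1 \<partial>lborel))"
        by (subst integral_shell[OF _ m _ one_int]) simp_all
      finally have "real (?m k) * \<bar>?UG k - (\<integral>x. indicator ?S x * G x \<partial>lborel)\<bar> \<le> real (?m k) * \<dots>"
        by (rule mult_left_mono) simp
      then show ?thesis by (simp add: abs_mult mult_ac)
    qed
    have "(\<lambda>k. 1 - (1 - 1 / real (?m k)) ^ CARD('n)) \<longlonglongrightarrow> 1 - (1 - 0) ^ CARD('n)"
      using LIMSEQ_ignore_initial_segment[OF LIMSEQ_inverse_real_of_nat, of 1]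
      by (intro tendsto_intros) (simp add: inverse_eq_divide add.commute)
    then have "(\<lambda>k. (1 - (1 - 1 / real (?m k)) ^ CARD('n)) * (B * rout * L * (\<integral>x. indicator \<Omega> x * 1 \<partial>lborel))) \<longlonglongrightarrow> 0"
      by (intro tendsto_mult_left_zero) simp
    then have lim0: "(\<lambda>k. real (?m k) * (?UG k - (\<integral>x. indicator (shell (?m k)) x * G x \<partial>lborel))) \<longlonglongrightarrow> 0"
      by (rule Lim_null_comparison[OF always_eventually, OF allI, rotated]) (use err in simp)
    have "(\<lambda>k. real (?m k) * (1 - (1 - 1 / real (?m k)) ^ CARD('n)) * ?I) \<longlonglongrightarrow> real CARD('n) * ?I"
      by (intro tendsto_mult_right shell_factor_tendsto)
    also have "(\<lambda>k. real (?m k) * (1 - (1 - 1 / real (?m k)) ^ CARD('n)) * ?I)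
        = (\<lambda>k. real (?m k) * (\<integral>x. indicator (shell (?m k)) x * G x \<partial>lborel))"
      by (subst integral_shell[OF _ _ G_hom G_int]) (simp_all add: mult_ac)
    finally have "(\<lambda>k. real (?m k) * ?UG k) \<longlonglongrightarrow> real CARD('n) * ?I"
      using tendsto_add[OF lim0] by (fastforce simp: right_diff_distrib)
    then have "(\<lambda>k. - (real (?m k) * ?UG k)) \<longlonglongrightarrow> - (real CARD('n) * ?I)" by (rule tendsto_minus)
    then show ?thesis by (subst integral_chi_dirderiv[OF U]) simp_all
  qed
  ultimately have "(\<integral>x. indicator \<Omega> x * dirderiv v U x \<partial>lborel) = - (real CARD('n) * ?I)"
    by (rule LIMSEQ_unique)
  then show ?thesis by (simp add: G_def)
qed

end

subsection \<open>Almost everywhere existence of the normal\<close>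

context convex_nbhd
begin

lemma p_one_sided_expansion:
  assumes "e > 0"
  obtains k where "k > 0" "\<And>h. 0 \<le> h \<Longrightarrow> h < k \<Longrightarrow> \<bar>p (x + h *\<^sub>R v) - p x - h * dp v x\<bar> \<le> e * h"
proof -
  have "eventually (\<lambda>h. dist (slope v x h) (dp v x) < e) (at_right 0)"
    using slope_tendsto assms by (rule tendstoD)
  then obtain k where k: "k > 0" "\<And>h. 0 < h \<Longrightarrow> h < k \<Longrightarrow> dist (slope v x h) (dp v x) < e"
    unfolding eventually_at_right_field by auto
  have "\<bar>p (x + h *\<^sub>R v) - p x - h * dp v x\<bar> \<le> e * h" if "0 \<le> h" "h < k" for h
  proof (cases "h = 0")
    case False
    then have h: "h > 0" using that by simp
    have "p (x + h *\<^sub>R v) - p x - h * dp v x = h * (slope v x h - dp v x)"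
      using h by (simp add: slope_def field_simps)
    also have "\<bar>\<dots>\<bar> \<le> h * e"
      using k(2)[OF h that(2)] h by (simp add: abs_mult dist_real_def)
    finally show ?thesis by (simp add: mult.commute)
  qed simp
  with k(1) show ?thesis by (rule that)
qed

lemma p_two_sided_expansion:
  assumes "e > 0" "dp v x + dp (- v) x = 0"
  obtains k where "k > 0" "\<And>s. \<bar>s\<bar> < k \<Longrightarrow> \<bar>p (x + s *\<^sub>R v) - p x - s * dp v x\<bar> \<le> e * \<bar>s\<bar>"
proof -
  obtain k1 where k1: "k1 > 0" "\<And>h. 0 \<le> h \<Longrightarrow> h < k1 \<Longrightarrow> \<bar>p (x + h *\<^sub>R v) - p x - h * dp v x\<bar> \<le> e * h"
    using p_one_sided_expansion[OF assms(1)] by metis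
  obtain k2 where k2: "k2 > 0" "\<And>h. 0 \<le> h \<Longrightarrow> h < k2 \<Longrightarrow> \<bar>p (x + h *\<^sub>R (- v)) - p x - h * dp (- v) x\<bar> \<le> e * h"
    using p_one_sided_expansion[OF assms(1)] by metis
  have op: "dp (- v) x = - dp v x" using assms(2) by simp
  have "\<bar>p (x + s *\<^sub>R v) - p x - s * dp v x\<bar> \<le> e * \<bar>s\<bar>" if "\<bar>s\<bar> < min k1 k2" for s
  proof (cases "s \<ge> 0")
    case True
    then show ?thesis using k1(2)[of s] that by simp
  next
    case False
    then show ?thesis using k2(2)[of "- s"] that by (simp add: op)
  qed
  with k1(1) k2(1) show ?thesis by (intro that[of "min k1 k2"]) auto
qed

end

context convex_nbhd_cart
begin

text \<open>Built from right derivatives along the axes and hence defined everywhere; it is the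
  gradient of \<open>p\<close> at the points called \<open>regular\<close>.\<close>

definition grad :: "real^'n \<Rightarrow> real^'n" where
  "grad x = (\<chi> j. dp (axis j 1) x)"

definition regular :: "real^'n \<Rightarrow> bool" where
  "regular x \<longleftrightarrow> x \<noteq> 0 \<and> (\<forall>j. dp (axis j 1) x + dp (- axis j 1) x = 0)"

text \<open>Convexity upgrades two-sided partial derivatives to differentiability: averaging over
  the axes bounds the increment from above, and the midpoint inequality turns the upper bound for
  \<open>- h\<close> into a lower bound for \<open>h\<close>.\<close>

lemma p_differentiable:
  assumes reg: "regular x" and "e > 0"
  obtains d where "d > 0" "\<And>h. norm h < d \<Longrightarrow> \<bar>p (x + h) - p x - grad x \<bullet> h\<bar> \<le> e * norm h"
proof -
  define N where "N = real CARD('n)"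
  have N: "N \<ge> 1" by (simp add: N_def Suc_leI)
  define e' where "e' = e / N"
  have e': "e' > 0" using assms(2) N by (simp add: e'_def)
  have "\<exists>k. k > 0 \<and> (\<forall>s. \<bar>s\<bar> < k \<longrightarrow>
      \<bar>p (x + s *\<^sub>R axis j 1) - p x - s * dp (axis j 1) x\<bar> \<le> e' * \<bar>s\<bar>)" for j
    using p_two_sided_expansion[OF e', of "axis j 1" x] reg unfolding regular_def by metis
  then obtain k where k: "\<And>j. k j > 0" "\<And>j s. \<bar>s\<bar> < k j \<Longrightarrow>
      \<bar>p (x + s *\<^sub>R axis j 1) - p x - s * dp (axis j 1) x\<bar> \<le> e' * \<bar>s\<bar>" by metis
  define d where "d = Min (range k) / N"
  have d: "d > 0" using k(1) N by (simp add: d_def)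
  have upper: "p (x + h) - p x \<le> grad x \<bullet> h + e * norm h" if h: "norm h < d" for h
  proof -
    have small: "\<bar>N * h $ j\<bar> < k j" for j
    proof -
      have "\<bar>N * h $ j\<bar> \<le> N * norm h"
        using component_le_norm_cart[of h j] N by (simp add: abs_mult mult_left_mono)
      also have "\<dots> < N * d" using h N by simp
      also have "\<dots> \<le> k j" using N by (simp add: d_def)
      finally show ?thesis .
    qed
    \<comment> \<open>\<open>x + h\<close> is the mean of the points displaced by \<open>N\<close>
      times a single coordinate of \<open>h\<close>, and \<open>p\<close> is sublinear.\<close>
    have "N *\<^sub>R (x + h) = (\<Sum>j\<in>UNIV. x + (N * h $ j) *\<^sub>R axis j 1)"
      by (simp add: vec_eq_iff axis_def sum.distrib N_def distrib_left if_distrib[of "\<lambda>a. _ * a"]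
          sum_constant_scaleR del: sum_constant cong: if_cong)
    then have "N * p (x + h) = p (\<Sum>j\<in>UNIV. x + (N * h $ j) *\<^sub>R axis j 1)"
      using p_scale[of N "x + h"] N by simp
    also have "\<dots> \<le> (\<Sum>j\<in>UNIV. p (x + (N * h $ j) *\<^sub>R axis j 1))" by (rule p_sum) simp
    also have "\<dots> \<le> (\<Sum>j\<in>UNIV. p x + N * h $ j * dp (axis j 1) x + e' * (N * norm h))"
    proof (rule sum_mono)
      fix j
      have "e' * \<bar>N * h $ j\<bar> \<le> e' * (N * norm h)"
        using component_le_norm_cart[of h j] N e' by (simp add: abs_mult)
      then show "p (x + (N * h $ j) *\<^sub>R axis j 1) \<le> p x + N * h $ j * dp (axis j 1) x + e' * (N * norm h)"
        using k(2)[OF small[of j]] by linarith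
    qed
    also have "\<dots> = N * (p x + grad x \<bullet> h + e' * (N * norm h))"
      by (simp add: sum.distrib N_def grad_def inner_vec_def distrib_left sum_distrib_left mult_ac)
    finally have "p (x + h) \<le> p x + grad x \<bullet> h + e' * (N * norm h)" using N by simp
    then show ?thesis using N by (simp add: e'_def)
  qed
  have "\<bar>p (x + h) - p x - grad x \<bullet> h\<bar> \<le> e * norm h" if h: "norm h < d" for h
  proof -
    have "2 * p x \<le> p (x + h) + p (x - h)"
      using p_add[of "x + h" "x - h"] p_scale[of 2 x] by (simp add: scaleR_2)
    with upper[of h] upper[of "- h"] h show ?thesis by (simp add: abs_le_iff)
  qed
  with d show ?thesis by (rule that)
qed

lemma grad_radial: "x \<noteq> 0 \<Longrightarrow> grad (radial x) = grad x"
  using p_pos[of x] by (simp add: grad_def radial_def dp_homogeneous)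

lemma regular_radial:
  assumes "regular x"
  shows "regular (radial x)"
  using assms p_pos[of x] by (auto simp: regular_def radial_def dp_homogeneous)

text \<open>Euler's identity for a function homogeneous of degree 1, read off along the ray, where
  \<open>p\<close> is exactly linear. In particular the gradient does not vanish.\<close>

lemma grad_inner_radial:
  assumes "regular x"
  shows "grad x \<bullet> radial x = 1"
proof -
  let ?z = "radial x"
  have x: "x \<noteq> 0" using assms by (simp add: regular_def)
  have pz: "p ?z = 1" using p_pos[OF x] by (simp add: radial_def p_scale)
  have z: "norm ?z > 0" using x p_pos[OF x] by (simp add: radial_def)
  have small: "\<bar>1 - grad x \<bullet> ?z\<bar> \<le> e" if e: "e > 0" for e
  proof -
    have e': "e / norm ?z > 0" using e z by simp
    obtain d where d: "d > 0" "\<And>h. norm h < d \<Longrightarrow> \<bar>p (?z + h) - p ?z - grad ?z \<bullet> h\<bar> \<le> e / norm ?z * norm h"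
      using p_differentiable[OF regular_radial[OF assms] e'] by metis
    define t where "t = d / (2 * norm ?z)"
    have t: "t > 0" using d z by (simp add: t_def)
    have "norm (t *\<^sub>R ?z) < d" using d z t by (simp add: t_def)
    from d(2)[OF this] have "\<bar>p (?z + t *\<^sub>R ?z) - p ?z - grad ?z \<bullet> (t *\<^sub>R ?z)\<bar> \<le> e * t"
      using z t by simp
    moreover have "p (?z + t *\<^sub>R ?z) = 1 + t"
      using p_scale[of "1 + t" ?z] t pz by (simp add: scaleR_add_left)
    ultimately have "\<bar>t * (1 - grad x \<bullet> ?z)\<bar> \<le> e * t"
      using pz by (simp add: grad_radial[OF x] right_diff_distrib)
    then show ?thesis using t by (simp add: abs_mult mult.commute)
  qed
  define t where "t = \<bar>1 - grad x \<bullet> ?z\<bar>"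
  have "t \<le> e" if "e > 0" for e using small[OF that] by (simp add: t_def)
  from this[of "t / 2"] have "t \<le> 0" by (cases "t > 0") auto
  then show ?thesis by (simp add: t_def)
qed

text \<open>The sign of \<open>p - 1\<close> decides membership in \<Omega>, and near the boundary
  point \<open>p - 1\<close> is the linear function given by \<open>grad x\<close> up to an error
  smaller than any cone opening.\<close>

lemma outward_normal_radial:
  assumes "regular x"
  shows "is_outward_normal \<Omega> (radial x) ((1 / norm (grad x)) *\<^sub>R grad x)" "grad x \<noteq> 0"
proof -
  let ?z = "radial x" and ?g = "grad x"
  have x: "x \<noteq> 0" using assms by (simp add: regular_def)
  have pz: "p ?z = 1" using p_pos[OF x] by (simp add: radial_def p_scale)
  show g: "?g \<noteq> 0" using grad_inner_radial[OF assms] by auto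
  have ng: "norm ?g > 0" using g by simp
  show "is_outward_normal \<Omega> ?z ((1 / norm ?g) *\<^sub>R ?g)"
    unfolding is_outward_normal_def
  proof (intro conjI allI impI)
    show "norm ((1 / norm ?g) *\<^sub>R ?g) = 1" using ng by simp
    fix e :: real assume "e > 0"
    then have e': "e * norm ?g > 0" using ng by simp
    obtain d where d: "d > 0" "\<And>h. norm h < d \<Longrightarrow> \<bar>p (?z + h) - p ?z - grad ?z \<bullet> h\<bar> \<le> e * norm ?g * norm h"
      using p_differentiable[OF regular_radial[OF assms] e'] by metis
    show "\<exists>d>0. \<forall>y\<in>ball ?z d.
        ((y - ?z) \<bullet> (1 / norm ?g) *\<^sub>R ?g < - e * norm (y - ?z) \<longrightarrow> y \<in> \<Omega>) \<and>
        (e * norm (y - ?z) < (y - ?z) \<bullet> (1 / norm ?g) *\<^sub>R ?g \<longrightarrow> y \<notin> \<Omega>)"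
    proof (intro exI[of _ d] conjI ballI d(1))
      fix y assume "y \<in> ball ?z d"
      then have "norm (y - ?z) < d" by (simp add: dist_norm norm_minus_commute)
      from d(2)[OF this] have y: "\<bar>p y - 1 - ?g \<bullet> (y - ?z)\<bar> \<le> e * norm ?g * norm (y - ?z)"
        by (simp add: pz grad_radial[OF x])
      have eq: "(y - ?z) \<bullet> (1 / norm ?g) *\<^sub>R ?g = (?g \<bullet> (y - ?z)) / norm ?g"
        by (simp add: inner_commute)
      show "(y - ?z) \<bullet> (1 / norm ?g) *\<^sub>R ?g < - e * norm (y - ?z) \<longrightarrow> y \<in> \<Omega>"
      proof
        assume "(y - ?z) \<bullet> (1 / norm ?g) *\<^sub>R ?g < - e * norm (y - ?z)"
        then have "?g \<bullet> (y - ?z) < - (e * norm ?g * norm (y - ?z))"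
          unfolding eq using ng by (simp add: divide_less_eq mult_ac)
        then have "p y < 1" using y by linarith
        then show "y \<in> \<Omega>" by (simp add: mem_iff)
      qed
      show "e * norm (y - ?z) < (y - ?z) \<bullet> (1 / norm ?g) *\<^sub>R ?g \<longrightarrow> y \<notin> \<Omega>"
      proof
        assume "e * norm (y - ?z) < (y - ?z) \<bullet> (1 / norm ?g) *\<^sub>R ?g"
        then have "e * norm ?g * norm (y - ?z) < ?g \<bullet> (y - ?z)"
          unfolding eq using ng by (simp add: less_divide_eq mult_ac)
        then have "p y > 1" using y by linarith
        then show "y \<notin> \<Omega>" by (simp add: mem_iff)
      qed
    qed
  qed
qed

lemma integrable_mem_dp: "integrable lborel (\<lambda>x. indicator \<Omega> x * dp v x)"
  by (rule integrable_bounded_on_cball[where B = "norm v / rin" and R = rout])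
    (use dp_bound norm_less_rout rin in \<open>auto simp: indicator_def intro: less_imp_le\<close>)

text \<open>Green's formula for constant functions forces the two one-sided derivatives, whose sum is
  nonnegative by convexity, to be opposite: no theorem of Rademacher type is needed.\<close>

lemma AE_regular: "AE x in lborel. x \<in> \<Omega> \<longrightarrow> regular x"
proof -
  have z: "(\<integral>x. indicator \<Omega> x * dp v x \<partial>lborel) = 0" for v
    using integral_dirderiv[OF C_infinity_const[of 1], of "- v"] by (simp add: dirderiv_def)
  have "AE x in lborel. x \<in> \<Omega> \<longrightarrow> dp (axis j 1) x + dp (- axis j 1) x = 0" for j
  proof -
    let ?f = "\<lambda>x. indicator \<Omega> x * dp (axis j 1) x + indicator \<Omega> x * dp (- axis j 1) x"
    have "(\<integral>x. ?f x \<partial>lborel) = 0"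
      using z integrable_mem_dp by simp
    moreover have "integrable lborel ?f" using integrable_mem_dp by simp
    moreover have "AE x in lborel. 0 \<le> ?f x"
      using dp_add_opposite by (intro AE_I2) (simp add: distrib_left[symmetric])
    ultimately have "AE x in lborel. ?f x = 0"
      by (subst (asm) integral_nonneg_eq_0_iff_AE)
    then show ?thesis
    proof eventually_elim
      case (elim x)
      then show ?case by (cases "x \<in> \<Omega>") simp_all
    qed
  qed
  then have "AE x in lborel. \<forall>j\<in>UNIV. x \<in> \<Omega> \<longrightarrow> dp (axis j 1) x + dp (- axis j 1) x = 0"
    by (subst AE_ball_countable) auto
  moreover have "AE x in lborel. x \<noteq> (0 :: real^'n)"
    by (rule AE_lborel_singleton)
  ultimately show ?thesis by eventually_elim (auto simp: regular_def)
qed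

text \<open>At almost every point the right derivative along the negative axis is minus that along
  the axis, which removes the sign in \<open>integral_dirderiv\<close>.\<close>

lemma integral_partial_radial:
  assumes U: "U \<in> C_infinity"
  shows "(\<integral>x. indicator \<Omega> x * partial j U x \<partial>lborel)
    = real CARD('n) * (\<integral>x. indicator \<Omega> x * (U (radial x) * grad x $ j) \<partial>lborel)"
proof -
  have [measurable]: "U \<in> borel_measurable borel" using U by (rule C_infinity_measurable)
  have dir: "dirderiv (axis j 1) U x = partial j U x" for x
    by (simp add: dirderiv_def axis_def if_distrib[of "\<lambda>a. a * _"] cong: if_cong)
  have "(\<integral>x. indicator \<Omega> x * (U (radial x) * dp (- axis j 1) x) \<partial>lborel)
      = (\<integral>x. - (indicator \<Omega> x * (U (radial x) * grad x $ j)) \<partial>lborel)"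
  proof (rule integral_cong_AE)
    show "AE x in lborel. indicator \<Omega> x * (U (radial x) * dp (- axis j 1) x) = - (indicator \<Omega> x * (U (radial x) * grad x $ j))"
      using AE_regular
    proof eventually_elim
      case (elim x)
      show ?case
      proof (cases "x \<in> \<Omega>")
        case True
        then have "dp (- axis j 1) x = - dp (axis j 1) x" using elim by (simp add: regular_def add_eq_0_iff)
        then show ?thesis by (simp add: grad_def)
      qed simp
    qed
    show "(\<lambda>x. - (indicator \<Omega> x * (U (radial x) * grad x $ j))) \<in> borel_measurable lborel"
      unfolding grad_def by simp measurable
  qed measurable
  then show ?thesis
    using integral_dirderiv[OF U, of "axis j 1"] by (simp add: dir)
qed

end

subsection \<open>Boundary measure and Lebesgue measure of cones\<close>

definition rot :: "real^2 \<Rightarrow> real^2" where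
  "rot u = vector [- u $ 2, u $ 1]"

text \<open>The strip lies in the image of a box under the rotation that takes the axes to
  \<open>u\<close> and \<open>rot u\<close>, which has determinant 1.\<close>

lemma emeasure_strip:
  fixes u :: "real^2"
  assumes u: "norm u = 1" and ab: "a \<le> b" "0 \<le> d"
  shows "emeasure lborel {x. x \<bullet> u \<in> {a..b} \<and> x \<bullet> rot u \<in> {- d..d}} \<le> ennreal ((b - a) * (2 * d))"
proof -
  define f :: "real^2 \<Rightarrow> real^2" where "f y = (y $ 1) *\<^sub>R u + (y $ 2) *\<^sub>R rot u" for y
  have lin: "linear f"
    by (rule linearI) (simp_all add: f_def algebra_simps scaleR_add_left)
  have u2: "u $ 1 * u $ 1 + u $ 2 * u $ 2 = 1"
    using u by (simp add: norm_eq_1 inner_vec_def sum_2)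
  have det: "det (matrix f) = 1"
    using u2 by (simp add: det_2 matrix_def f_def axis_def rot_def)
  let ?B = "cbox (vector [a, - d]) (vector [b, d]) :: (real^2) set"
  have "{x. x \<bullet> u \<in> {a..b} \<and> x \<bullet> rot u \<in> {- d..d}} \<subseteq> f ` ?B"
  proof
    fix x assume x: "x \<in> {x. x \<bullet> u \<in> {a..b} \<and> x \<bullet> rot u \<in> {- d..d}}"
    have "x = f (vector [x \<bullet> u, x \<bullet> rot u])"
    proof -
      have "x $ 1 = (x \<bullet> u) * u $ 1 - (x \<bullet> rot u) * u $ 2" "x $ 2 = (x \<bullet> u) * u $ 2 + (x \<bullet> rot u) * u $ 1"
        using u2 by (simp_all add: inner_vec_def sum_2 rot_def) algebra+
      then show ?thesis by (simp add: vec_eq_iff forall_2 f_def rot_def)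
    qed
    moreover have "vector [x \<bullet> u, x \<bullet> rot u] \<in> ?B" using x by (simp add: mem_box_cart forall_2)
    ultimately show "x \<in> f ` ?B" by blast
  qed
  moreover have "compact (f ` ?B)" using lin by (intro compact_continuous_image linear_continuous_on linear_conv_bounded_linear[THEN iffD1]) auto
  ultimately have "emeasure lborel {x. x \<bullet> u \<in> {a..b} \<and> x \<bullet> rot u \<in> {- d..d}} \<le> emeasure lborel (f ` ?B)"
    by (intro emeasure_mono) (auto intro: borel_compact)
  also have "\<dots> = emeasure lebesgue (f ` ?B)"
    using \<open>compact (f ` ?B)\<close> by (simp add: borel_compact)
  also have "\<dots> = ennreal (measure lebesgue (f ` ?B))"
    using \<open>compact (f ` ?B)\<close> by (intro emeasure_eq_measure2 lmeasurable_compact)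
  also have "measure lebesgue (f ` ?B) = (b - a) * (2 * d)"
    using ab det lin by (subst measure_linear_image)
      (auto simp: content_cbox_cart interval_ne_empty_cart forall_2 prod_2 UNIV_2)
  finally show ?thesis by simp
qed

lemma inner_rot_self [simp]: "u \<bullet> rot u = 0"
  by (simp add: rot_def inner_vec_def sum_2)

lemma norm_rot [simp]: "norm (rot u) = norm u"
  by (simp add: rot_def norm_eq_sqrt_inner inner_vec_def sum_2)

lemma (in convex_nbhd_cart) radial_facts:
  assumes "x \<in> \<Omega>" "x \<noteq> 0"
  shows "x = p x *\<^sub>R radial x" "0 < p x" "p x < 1" "radial x \<noteq> 0"
  using assms p_pos[of x] by (auto simp: radial_def mem_iff)

locale convex_nbhd_plane = convex_nbhd_cart \<Omega> for \<Omega> :: "(real^2) set"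
begin

text \<open>The cone over a set of diameter at most \<open>d\<close> lies in a strip of half width
  \<open>d\<close> around the ray through one of its points, since lateral distances shrink towards
  the centre. Length \<open>2 * rout\<close> and width \<open>2 * d\<close> give the constant. A
  measurable superset is returned because \<open>U\<close> is arbitrary, as are the sets of a
  Hausdorff cover.\<close>

lemma cone_cover:
  assumes "d \<ge> 0" and U: "\<And>z z'. z \<in> U \<Longrightarrow> z' \<in> U \<Longrightarrow> norm (z - z') \<le> d"
  shows "\<exists>T\<in>sets lborel. {x \<in> \<Omega>. x \<noteq> 0 \<and> radial x \<in> U} \<subseteq> T \<and> emeasure lborel T \<le> ennreal (4 * rout * d)"
proof (cases "{x \<in> \<Omega>. x \<noteq> 0 \<and> radial x \<in> U} = {}")
  case True
  then show ?thesis by (intro bexI[of _ "{}"]) auto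
next
  case False
  then obtain x0 where x0: "x0 \<in> \<Omega>" "x0 \<noteq> 0" "radial x0 \<in> U" by blast
  let ?z = "radial x0"
  define u where "u = (1 / norm ?z) *\<^sub>R ?z"
  have nz: "norm ?z > 0" using radial_facts(4)[OF x0(1,2)] by simp
  have u: "norm u = 1" using nz by (simp add: u_def)
  have zu: "?z \<bullet> rot u = 0"
  proof -
    have "?z = norm ?z *\<^sub>R u" using nz by (simp add: u_def)
    then show ?thesis by (metis inner_rot_self inner_scaleR_left mult_zero_right)
  qed
  let ?T = "{x. x \<bullet> u \<in> {- rout..rout} \<and> x \<bullet> rot u \<in> {- d..d}}"
  have "x \<in> ?T" if x: "x \<in> \<Omega>" "x \<noteq> 0" "radial x \<in> U" for x
  proof -
    have "\<bar>x \<bullet> u\<bar> \<le> norm x * norm u" by (rule Cauchy_Schwarz_ineq2)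
    also have "\<dots> \<le> rout" using norm_less_rout[OF x(1)] u by simp
    finally have 1: "\<bar>x \<bullet> u\<bar> \<le> rout" .
    have "x \<bullet> rot u = p x * (radial x \<bullet> rot u)"
      by (subst radial_facts(1)[OF x(1,2)]) simp
    also have "radial x \<bullet> rot u = (radial x - ?z) \<bullet> rot u" using zu by (simp add: inner_diff_left)
    finally have "\<bar>x \<bullet> rot u\<bar> = p x * \<bar>(radial x - ?z) \<bullet> rot u\<bar>"
      using radial_facts(2)[OF x(1,2)] by (simp add: abs_mult)
    also have "\<dots> \<le> 1 * (norm (radial x - ?z) * norm (rot u))"
      using radial_facts[OF x(1,2)] by (intro mult_mono Cauchy_Schwarz_ineq2) auto
    also have "\<dots> \<le> d" using U[OF x(3) x0(3)] u by simp
    finally show ?thesis using 1 by (simp add: abs_le_iff)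
  qed
  moreover have "emeasure lborel ?T \<le> ennreal (4 * rout * d)"
    using emeasure_strip[OF u, of "- rout" rout d] rout assms(1) by (simp add: mult_ac)
  moreover have "closed ?T"
    by (simp add: closed_Collect_conj closed_Collect_le continuous_intros)
  ultimately show ?thesis by (intro bexI[of _ ?T]) auto
qed

end

section \<open>Moving an interior point to the origin, and the resulting boundary
  representation\<close>

lemma is_outward_normal_translate:
  assumes "is_outward_normal ((\<lambda>x. x - a) ` \<Omega>) z n"
  shows "is_outward_normal \<Omega> (a + z) n"
  unfolding is_outward_normal_def
proof (intro conjI allI impI)
  show "norm n = 1" using assms by (simp add: is_outward_normal_def)
  fix e :: real assume "e > 0"
  then obtain d where d: "d > 0" and y: "\<And>y. y \<in> ball z d \<Longrightarrow>
      ((y - z) \<bullet> n < - e * norm (y - z) \<longrightarrow> y \<in> (\<lambda>x. x - a) ` \<Omega>) \<and>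
      ((y - z) \<bullet> n > e * norm (y - z) \<longrightarrow> y \<notin> (\<lambda>x. x - a) ` \<Omega>)"
    using assms unfolding is_outward_normal_def by blast
  have mem: "y - a \<in> (\<lambda>x. x - a) ` \<Omega> \<longleftrightarrow> y \<in> \<Omega>" for y by auto
  show "\<exists>d>0. \<forall>y\<in>ball (a + z) d.
      ((y - (a + z)) \<bullet> n < - e * norm (y - (a + z)) \<longrightarrow> y \<in> \<Omega>) \<and>
      ((y - (a + z)) \<bullet> n > e * norm (y - (a + z)) \<longrightarrow> y \<notin> \<Omega>)"
  proof (intro exI[of _ d] conjI[OF d] ballI)
    fix w assume "w \<in> ball (a + z) d"
    then have "w - a \<in> ball z d" by (simp add: dist_norm algebra_simps)
    from y[OF this] show "((w - (a + z)) \<bullet> n < - e * norm (w - (a + z)) \<longrightarrow> w \<in> \<Omega>) \<and>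
      ((w - (a + z)) \<bullet> n > e * norm (w - (a + z)) \<longrightarrow> w \<notin> \<Omega>)"
      unfolding mem by (simp add: diff_diff_eq)
  qed
qed

lemma AE_lborel_translate:
  fixes a :: "'a::euclidean_space"
  assumes "AE x in lborel. P x"
  shows "AE x in lborel. P (x - a)"
proof -
  obtain N where N: "{x. \<not> P x} \<subseteq> N" "N \<in> null_sets lborel"
    using assms by (auto elim: AE_E2 simp: eventually_ae_filter)
  have "{x. x - a \<in> N} \<in> null_sets lborel" by (rule null_sets_translation[OF N(2)])
  then show ?thesis by (rule AE_I') (use N(1) in auto)
qed

lemma emeasure_lborel_translate:
  fixes a :: "'a::euclidean_space"
  assumes "T \<in> sets lborel"
  shows "emeasure lborel {x. x - a \<in> T} = emeasure lborel T" "{x. x - a \<in> T} \<in> sets lborel"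
proof -
  have eq: "{x. x - a \<in> T} = (+) (- a) -` T" by auto
  have "emeasure lborel T = emeasure (distr lborel borel ((+) (- a))) T"
    by (simp only: lborel_distr_plus)
  also have "\<dots> = emeasure lborel ((+) (- a) -` T)"
    using assms by (subst emeasure_distr) auto
  finally show "emeasure lborel {x. x - a \<in> T} = emeasure lborel T" unfolding eq ..
  show "{x. x - a \<in> T} \<in> sets lborel"
    unfolding eq using assms measurable_sets[of "(+) (- a)" lborel borel T] by simp
qed

text \<open>The outer measure is the supremum over all scales, so a comparison with covers by sets
  of diameter at most 1 suffices.\<close>

lemma emeasure_le_hausdorff1_outer:
  fixes \<nu> :: "'a::metric_space set \<Rightarrow> ennreal"
  assumes "C > 0" and cover: "\<And>U :: nat \<Rightarrow> 'a set. A \<subseteq> (\<Union>n. U n) \<Longrightarrow> (\<And>n. bounded (U n)) \<Longrightarrow>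
      M \<le> (\<Sum>n. ennreal (C * diameter (U n)))"
  shows "M \<le> ennreal C * hausdorff1_outer A"
proof -
  have C: "ennreal C * ennreal (1 / C) = 1"
    using assms(1) by (simp flip: ennreal_mult)
  have "ennreal (1 / C) * M \<le> hausdorff1_pre 1 A"
    unfolding hausdorff1_pre_def
  proof (rule INF_greatest)
    fix U :: "nat \<Rightarrow> 'a set"
    assume "U \<in> {U. A \<subseteq> (\<Union>n. U n) \<and> (\<forall>n. bounded (U n) \<and> diameter (U n) \<le> 1)}"
    then have U: "A \<subseteq> (\<Union>n. U n)" "\<And>n. bounded (U n)" by auto
    have "M \<le> (\<Sum>n. ennreal (C * diameter (U n)))" by (rule cover[OF U])
    also have "\<dots> = ennreal C * (\<Sum>n. ennreal (diameter (U n)))"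
      using assms(1) U(2) by (simp add: ennreal_mult diameter_ge_0)
    finally have "ennreal (1 / C) * M \<le> ennreal (1 / C) * (ennreal C * (\<Sum>n. ennreal (diameter (U n))))"
      by (rule mult_left_mono) simp
    then show "ennreal (1 / C) * M \<le> (\<Sum>n. ennreal (diameter (U n)))"
      using C by (simp add: mult.assoc[symmetric] mult.commute)
  qed
  also have "\<dots> \<le> hausdorff1_outer A"
    unfolding hausdorff1_outer_def by (rule SUP_upper) simp
  finally have "ennreal C * (ennreal (1 / C) * M) \<le> ennreal C * hausdorff1_outer A"
    by (rule mult_left_mono) simp
  then show ?thesis using C by (simp add: mult.assoc[symmetric])
qed

text \<open>Collects what the later sections use of the Minkowski functional: \<open>\<pi>\<close>
  projects from an interior point onto the boundary along rays, and \<open>\<gamma>\<close> is a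
  normal vector weighted so that \<open>\<gamma> dx\<close>, transported by \<open>\<pi>\<close>,
  acts as the normal times the surface measure.\<close>

lemma convex_boundary_representation:
  fixes \<Omega> :: "(real^2) set"
  assumes \<Omega>: "bounded \<Omega>" "convex \<Omega>" "open \<Omega>" "\<Omega> \<noteq> {}"
  obtains \<pi> \<gamma> :: "real^2 \<Rightarrow> real^2" and B C :: real where
    "\<pi> \<in> borel_measurable borel" "\<gamma> \<in> borel_measurable borel" "\<And>x j. \<bar>\<gamma> x $ j\<bar> \<le> B"
    "AE x in lborel. x \<in> \<Omega> \<longrightarrow> \<pi> x \<in> frontier \<Omega> \<and> \<gamma> x \<noteq> 0 \<and>
      is_outward_normal \<Omega> (\<pi> x) ((1 / norm (\<gamma> x)) *\<^sub>R \<gamma> x)"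
    "\<And>U j. U \<in> C_infinity \<Longrightarrow> (\<integral>x. indicator \<Omega> x * partial j U x \<partial>lborel)
      = (\<integral>x. indicator \<Omega> x * (U (\<pi> x) * \<gamma> x $ j) \<partial>lborel)"
    "C > 0" "\<And>A. A \<in> sets borel \<Longrightarrow> emeasure lborel {x \<in> \<Omega>. \<pi> x \<in> A} \<le> ennreal C * hausdorff1_outer A"
proof -
  obtain a where a: "a \<in> \<Omega>" using \<Omega>(4) by blast
  define \<Omega>0 where "\<Omega>0 = (\<lambda>x. x - a) ` \<Omega>"
  have \<Omega>0_eq: "\<Omega>0 = (+) (- a) ` \<Omega>" by (auto simp: \<Omega>0_def)
  have mem: "x - a \<in> \<Omega>0 \<longleftrightarrow> x \<in> \<Omega>" for x by (auto simp: \<Omega>0_def)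
  interpret convex_nbhd_plane \<Omega>0
  proof unfold_locales
    show "bounded \<Omega>0" unfolding \<Omega>0_eq by (rule bounded_translation[OF \<Omega>(1)])
    show "convex \<Omega>0" unfolding \<Omega>0_eq by (rule convex_translation[OF \<Omega>(2)])
    show "open \<Omega>0" unfolding \<Omega>0_eq by (rule open_translation[OF \<Omega>(3)])
    show "0 \<in> \<Omega>0" using a mem[of a] by simp
  qed
  define \<pi> where "\<pi> x = a + radial (x - a)" for x
  \<comment> \<open>The factor 2 is the dimension factor of
    \<open>integral_partial_radial\<close>.\<close>
  define \<gamma> where "\<gamma> x = 2 *\<^sub>R grad (x - a)" for x
  have [measurable]: "grad \<in> borel_measurable borel"
    unfolding grad_def[abs_def]
    by (subst borel_measurable_euclidean_space) (auto simp: Basis_vec_def inner_axis)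
  show ?thesis
  proof (rule that[of \<pi> \<gamma> "2 * (1 / rin)" "4 * rout"])
    show "\<pi> \<in> borel_measurable borel" unfolding \<pi>_def[abs_def] by measurable
    show "\<gamma> \<in> borel_measurable borel" unfolding \<gamma>_def[abs_def] by measurable
    show "\<bar>\<gamma> x $ j\<bar> \<le> 2 * (1 / rin)" for x j
      using dp_bound[of "axis j 1" "x - a"] by (simp add: \<gamma>_def grad_def abs_mult)
    show "AE x in lborel. x \<in> \<Omega> \<longrightarrow> \<pi> x \<in> frontier \<Omega> \<and> \<gamma> x \<noteq> 0 \<and>
      is_outward_normal \<Omega> (\<pi> x) ((1 / norm (\<gamma> x)) *\<^sub>R \<gamma> x)"
      using AE_lborel_translate[OF AE_regular, of a]
    proof eventually_elim
      case (elim x)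
      show ?case
      proof
        assume "x \<in> \<Omega>"
        then have r: "regular (x - a)" using elim mem by simp
        then have "radial (x - a) \<in> frontier \<Omega>0"
          unfolding radial_def by (intro radial_projection_frontier) (simp add: regular_def)
        moreover have "frontier \<Omega>0 = (+) (- a) ` frontier \<Omega>"
          unfolding \<Omega>0_eq by (rule frontier_translation)
        ultimately obtain y where "y \<in> frontier \<Omega>" "radial (x - a) = - a + y" by auto
        then have "\<pi> x \<in> frontier \<Omega>" by (simp add: \<pi>_def)
        moreover have "is_outward_normal \<Omega> (\<pi> x) ((1 / norm (\<gamma> x)) *\<^sub>R \<gamma> x)"
          using is_outward_normal_translate[of a \<Omega>, folded \<Omega>0_def, OF outward_normal_radial(1)[OF r]]
          by (simp add: \<pi>_def \<gamma>_def)
        moreover have "\<gamma> x \<noteq> 0" using outward_normal_radial(2)[OF r] by (simp add: \<gamma>_def)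
        ultimately show "\<pi> x \<in> frontier \<Omega> \<and> \<gamma> x \<noteq> 0 \<and>
          is_outward_normal \<Omega> (\<pi> x) ((1 / norm (\<gamma> x)) *\<^sub>R \<gamma> x)" by blast
      qed
    qed
    show "(\<integral>x. indicator \<Omega> x * partial j U x \<partial>lborel)
        = (\<integral>x. indicator \<Omega> x * (U (\<pi> x) * \<gamma> x $ j) \<partial>lborel)" if U: "U \<in> C_infinity" for U j
    proof -
      define U' where "U' x = U (a + x)" for x
      have U': "U' \<in> C_infinity"
        using C_infinity_affine[OF U, of a 1] by (simp add: U'_def[abs_def])
      have [measurable]: "U' \<in> borel_measurable borel" "partial j U' \<in> borel_measurable borel"
        using U' by (auto intro: C_infinity_measurable)
      have [measurable]: "(\<lambda>x. grad x $ j) \<in> borel_measurable borel"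
        by (simp add: grad_def)
      have pU': "partial j U' x = partial j U (a + x)" for x
        using partial_affine[OF C_infinity_differentiable[OF U], of j a 1 x] by (simp add: U'_def[abs_def])
      have ind: "indicator \<Omega>0 (x + - a) = (indicator \<Omega> x :: real)" for x
        using mem[of x] by (auto simp: indicator_def)
      have "(\<integral>x. indicator \<Omega> x * partial j U x \<partial>lborel) = (\<integral>x. indicator \<Omega>0 (x + - a) * partial j U' (x + - a) \<partial>lborel)"
        unfolding ind pU' by simp
      also have "\<dots> = (\<integral>x. indicator \<Omega>0 x * partial j U' x \<partial>lborel)"
        by (rule integral_lborel_translate) measurable
      also have "\<dots> = (\<integral>x. 2 * (indicator \<Omega>0 x * (U' (radial x) * grad x $ j)) \<partial>lborel)"
        using integral_partial_radial[OF U'] by simp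
      also have "\<dots> = (\<integral>x. 2 * (indicator \<Omega>0 (x + - a) * (U' (radial (x + - a)) * grad (x + - a) $ j)) \<partial>lborel)"
        by (rule integral_lborel_translate[symmetric]) measurable
      also have "\<dots> = (\<integral>x. indicator \<Omega> x * (U (\<pi> x) * \<gamma> x $ j) \<partial>lborel)"
        unfolding ind by (intro Bochner_Integration.integral_cong) (auto simp: U'_def \<pi>_def \<gamma>_def)
      finally show ?thesis .
    qed
    show "4 * rout > 0" using rout by simp
    fix A :: "(real^2) set" assume A: "A \<in> sets borel"
    show "emeasure lborel {x \<in> \<Omega>. \<pi> x \<in> A} \<le> ennreal (4 * rout) * hausdorff1_outer A"
    proof (rule emeasure_le_hausdorff1_outer)
      fix U :: "nat \<Rightarrow> (real^2) set" assume U: "A \<subseteq> (\<Union>n. U n)" "\<And>n. bounded (U n)"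
      have ex: "\<exists>T\<in>sets lborel. {y \<in> \<Omega>0. y \<noteq> 0 \<and> radial y \<in> (\<lambda>x. x - a) ` U n} \<subseteq> T \<and>
          emeasure lborel T \<le> ennreal (4 * rout * diameter (U n))" for n
      proof (rule cone_cover)
        fix z z' assume "z \<in> (\<lambda>x. x - a) ` U n" "z' \<in> (\<lambda>x. x - a) ` U n"
        then obtain y y' where "y \<in> U n" "y' \<in> U n" "z = y - a" "z' = y' - a" by blast
        then show "norm (z - z') \<le> diameter (U n)"
          using diameter_bounded_bound[OF U(2)[of n], of y y'] by (simp add: dist_norm)
      qed (rule diameter_ge_0[OF U(2)])
      have "\<forall>n. \<exists>T. T \<in> sets lborel \<and> {y \<in> \<Omega>0. y \<noteq> 0 \<and> radial y \<in> (\<lambda>x. x - a) ` U n} \<subseteq> T \<and>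
          emeasure lborel T \<le> ennreal (4 * rout * diameter (U n))"
        using ex unfolding Bex_def by blast
      from choice[OF this] obtain T where "\<forall>n. T n \<in> sets lborel \<and>
          {y \<in> \<Omega>0. y \<noteq> 0 \<and> radial y \<in> (\<lambda>x. x - a) ` U n} \<subseteq> T n \<and>
          emeasure lborel (T n) \<le> ennreal (4 * rout * diameter (U n))" ..
      then have T: "\<And>n. T n \<in> sets lborel"
        "\<And>n. {y \<in> \<Omega>0. y \<noteq> 0 \<and> radial y \<in> (\<lambda>x. x - a) ` U n} \<subseteq> T n"
        "\<And>n. emeasure lborel (T n) \<le> ennreal (4 * rout * diameter (U n))" by blast+
      let ?T = "\<lambda>n. {x. x - a \<in> T n}"
      \<comment> \<open>The centre \<open>a\<close> has no radial projection; it is covered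
        separately by a null set.\<close>
      have "{x \<in> \<Omega>. \<pi> x \<in> A} \<subseteq> {a} \<union> (\<Union>n. ?T n)"
      proof
        fix x assume x: "x \<in> {x \<in> \<Omega>. \<pi> x \<in> A}"
        then obtain n where "\<pi> x \<in> U n" using U(1) by blast
        then have "radial (x - a) \<in> (\<lambda>x. x - a) ` U n" by (auto simp: \<pi>_def intro!: image_eqI[of _ _ "a + radial (x - a)"])
        then have "x \<noteq> a \<Longrightarrow> x - a \<in> T n" using T(2)[of n] x mem[of x] by auto
        then show "x \<in> {a} \<union> (\<Union>n. ?T n)" by blast
      qed
      then have "emeasure lborel {x \<in> \<Omega>. \<pi> x \<in> A} \<le> emeasure lborel ({a} \<union> (\<Union>n. ?T n))"
        using emeasure_lborel_translate(2)[OF T(1)] by (intro emeasure_mono) (auto intro!: sets.Un sets.countable_UN)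
      also have "\<dots> \<le> emeasure lborel {a} + emeasure lborel (\<Union>n. ?T n)"
        using emeasure_lborel_translate(2)[OF T(1)] by (intro emeasure_subadditive) (auto intro!: sets.countable_UN)
      also have "\<dots> = emeasure lborel (\<Union>n. ?T n)" by simp
      also have "\<dots> \<le> (\<Sum>n. emeasure lborel (?T n))"
        using emeasure_lborel_translate(2)[OF T(1)] by (intro emeasure_subadditive_countably) auto
      also have "\<dots> \<le> (\<Sum>n. ennreal (4 * rout * diameter (U n)))"
        by (intro suminf_le) (auto simp: emeasure_lborel_translate(1)[OF T(1)] T(3))
      finally show "emeasure lborel {x \<in> \<Omega>. \<pi> x \<in> A} \<le> (\<Sum>n. ennreal (4 * rout * diameter (U n)))" .
    qed (use rout in simp)
  qed
qed

section \<open>One-dimensional Hausdorff measure\<close>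

definition covers1 :: "real \<Rightarrow> 'a::metric_space set \<Rightarrow> (nat \<Rightarrow> 'a set) set" where
  "covers1 d A = {U. A \<subseteq> (\<Union>n. U n) \<and> (\<forall>n. bounded (U n) \<and> diameter (U n) \<le> d)}"

lemma hausdorff1_pre_eq: "hausdorff1_pre d A = (INF U\<in>covers1 d A. \<Sum>n. ennreal (diameter (U n)))"
  by (simp add: hausdorff1_pre_def covers1_def)

lemma hausdorff1_pre_le: "U \<in> covers1 d A \<Longrightarrow> hausdorff1_pre d A \<le> (\<Sum>n. ennreal (diameter (U n)))"
  unfolding hausdorff1_pre_eq by (rule INF_lower)

lemma hausdorff1_pre_empty: "d > 0 \<Longrightarrow> hausdorff1_pre d {} = 0"
  using hausdorff1_pre_le[of "\<lambda>_. {}" d "{}"] by (simp add: covers1_def)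

lemma hausdorff1_pre_mono: "A \<subseteq> B \<Longrightarrow> hausdorff1_pre d A \<le> hausdorff1_pre d B"
  unfolding hausdorff1_pre_eq by (rule INF_superset_mono) (auto simp: covers1_def)

lemma hausdorff1_pre_antimono: "c \<le> d \<Longrightarrow> hausdorff1_pre d A \<le> hausdorff1_pre c A"
  unfolding hausdorff1_pre_eq by (rule INF_superset_mono) (auto simp: covers1_def intro: order_trans)

lemma hausdorff1_pre_countably_subadditive:
  "hausdorff1_pre d (\<Union>n. A n) \<le> (\<Sum>n. hausdorff1_pre d (A n))"
proof (rule ennreal_le_epsilon)
  fix e :: real assume fin: "(\<Sum>n. hausdorff1_pre d (A n)) < top" and e: "0 < e"
  have "\<exists>U\<in>covers1 d (A n). (\<Sum>k. ennreal (diameter (U k))) \<le> hausdorff1_pre d (A n) + ennreal (e * (1/2) ^ Suc n)" for n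
  proof -
    have "hausdorff1_pre d (A n) < top"
      using sum_le_suminf[OF summableI, of "{n}" "\<lambda>n. hausdorff1_pre d (A n)"] fin by (simp add: le_less_trans)
    moreover have "ennreal (e * (1/2) ^ Suc n) > 0" using e by simp
    ultimately have "hausdorff1_pre d (A n) < hausdorff1_pre d (A n) + ennreal (e * (1/2) ^ Suc n)"
      by (cases "hausdorff1_pre d (A n)" rule: ennreal_cases)
        (use e in \<open>auto simp: ennreal_plus[symmetric] ennreal_less_iff simp del: ennreal_plus power_Suc\<close>)
    then show ?thesis
      unfolding hausdorff1_pre_eq[of d "A n"] by (subst (asm) INF_less_iff) (auto intro: less_imp_le)
  qed
  then obtain U where U: "\<And>n. U n \<in> covers1 d (A n)"
    "\<And>n. (\<Sum>k. ennreal (diameter (U n k))) \<le> hausdorff1_pre d (A n) + ennreal (e * (1/2) ^ Suc n)" by metis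
  let ?W = "\<lambda>i. case prod_decode i of (n, k) \<Rightarrow> U n k"
  have "?W \<in> covers1 d (\<Union>n. A n)"
  proof -
    have "(\<Union>n. A n) \<subseteq> (\<Union>i. ?W i)"
    proof
      fix x assume "x \<in> (\<Union>n. A n)"
      then obtain n k where "x \<in> U n k" using U(1) by (fastforce simp: covers1_def)
      then show "x \<in> (\<Union>i. ?W i)" by (intro UN_I[of "prod_encode (n, k)"]) auto
    qed
    then show ?thesis using U(1) by (auto simp: covers1_def split: prod.split)
  qed
  then have "hausdorff1_pre d (\<Union>n. A n) \<le> (\<Sum>i. ennreal (diameter (?W i)))"
    by (rule hausdorff1_pre_le)
  also have "\<dots> = (\<Sum>i. (\<lambda>(n, k). ennreal (diameter (U n k))) (prod_decode i))"
    by (intro suminf_cong) (simp split: prod.split)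
  also have "\<dots> = (\<Sum>n. \<Sum>k. ennreal (diameter (U n k)))"
    by (rule suminf_ennreal_2dimen) simp
  also have "\<dots> \<le> (\<Sum>n. hausdorff1_pre d (A n) + ennreal (e * (1/2) ^ Suc n))"
    using U(2) by (intro suminf_le) auto
  also have "\<dots> = (\<Sum>n. hausdorff1_pre d (A n)) + (\<Sum>n. ennreal (e * (1/2) ^ Suc n))"
    by (rule suminf_add[symmetric]) auto
  also have "(\<Sum>n. ennreal (e * (1/2) ^ Suc n)) = ennreal e"
    using sums_mult[OF power_half_series, of e] e
    by (subst suminf_ennreal2) (auto simp: sums_iff simp del: power_Suc)
  finally show "hausdorff1_pre d (\<Union>n. A n) \<le> (\<Sum>n. hausdorff1_pre d (A n)) + ennreal e" .
qed

text \<open>A set of diameter at most \<open>d\<close> cannot meet both \<open>A\<close> and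
  \<open>B\<close>, so a cover of the union splits into a cover of each.\<close>

lemma hausdorff1_pre_separated:
  assumes sep: "\<And>x y. x \<in> A \<Longrightarrow> y \<in> B \<Longrightarrow> d < dist x y" and d: "d > 0"
  shows "hausdorff1_pre d A + hausdorff1_pre d B \<le> hausdorff1_pre d (A \<union> B)"
  unfolding hausdorff1_pre_eq[of d "A \<union> B"]
proof (rule INF_greatest)
  fix U assume U: "U \<in> covers1 d (A \<union> B)"
  define U1 where "U1 S n = (if U n \<inter> S = {} then {} else U n)" for S n
  have cov: "U1 S \<in> covers1 d S" if "S \<subseteq> A \<union> B" for S
  proof -
    have "S \<subseteq> (\<Union>n. U1 S n)"
    proof
      fix x assume x: "x \<in> S"
      then have "x \<in> (\<Union>n. U n)" using that U unfolding covers1_def by blast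
      then obtain n where "x \<in> U n" by blast
      with x have "x \<in> U1 S n" by (auto simp: U1_def)
      then show "x \<in> (\<Union>n. U1 S n)" by blast
    qed
    moreover have "bounded (U1 S n) \<and> diameter (U1 S n) \<le> d" for n
      using U d by (simp add: covers1_def U1_def)
    ultimately show ?thesis by (simp add: covers1_def)
  qed
  have "U n \<inter> A = {} \<or> U n \<inter> B = {}" for n
  proof (rule ccontr)
    assume "\<not> ?thesis"
    then obtain x y where xy: "x \<in> U n" "x \<in> A" "y \<in> U n" "y \<in> B" by blast
    then have "dist x y \<le> diameter (U n)" using U by (intro diameter_bounded_bound) (auto simp: covers1_def)
    also have "\<dots> \<le> d" using U by (simp add: covers1_def)
    finally show False using sep[OF xy(2,4)] by simp
  qed
  then have "ennreal (diameter (U1 A n)) + ennreal (diameter (U1 B n)) \<le> ennreal (diameter (U n))" for n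
    by (auto simp: U1_def dest: spec[of _ n])
  then have "(\<Sum>n. ennreal (diameter (U1 A n)) + ennreal (diameter (U1 B n))) \<le> (\<Sum>n. ennreal (diameter (U n)))"
    by (intro suminf_le) auto
  moreover have "(\<Sum>n. ennreal (diameter (U1 A n)) + ennreal (diameter (U1 B n)))
      = (\<Sum>n. ennreal (diameter (U1 A n))) + (\<Sum>n. ennreal (diameter (U1 B n)))"
    by (rule suminf_add[symmetric]) auto
  moreover have "hausdorff1_pre d A + hausdorff1_pre d B
      \<le> (\<Sum>n. ennreal (diameter (U1 A n))) + (\<Sum>n. ennreal (diameter (U1 B n)))"
    by (intro add_mono hausdorff1_pre_le cov) auto
  ultimately show "hausdorff1_pre d A + hausdorff1_pre d B \<le> (\<Sum>n. ennreal (diameter (U n)))"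
    by simp
qed

lemma hausdorff1_outer_empty [simp]: "hausdorff1_outer {} = 0"
  unfolding hausdorff1_outer_def by (simp add: hausdorff1_pre_empty)

lemma hausdorff1_outer_mono: "A \<subseteq> B \<Longrightarrow> hausdorff1_outer A \<le> hausdorff1_outer B"
  unfolding hausdorff1_outer_def by (intro SUP_mono) (auto intro: hausdorff1_pre_mono)

lemma hausdorff1_pre_le_outer: "d > 0 \<Longrightarrow> hausdorff1_pre d A \<le> hausdorff1_outer A"
  unfolding hausdorff1_outer_def by (rule SUP_upper) simp

lemma hausdorff1_outer_countably_subadditive:
  "hausdorff1_outer (\<Union>n. A n) \<le> (\<Sum>n. hausdorff1_outer (A n))"
  unfolding hausdorff1_outer_def[of "\<Union>n. A n"]
proof (rule SUP_least)
  fix d :: real assume "d \<in> {0<..}"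
  then show "hausdorff1_pre d (\<Union>n. A n) \<le> (\<Sum>n. hausdorff1_outer (A n))"
    by (intro order_trans[OF hausdorff1_pre_countably_subadditive suminf_le] hausdorff1_pre_le_outer) auto
qed

lemma hausdorff1_outer_Un: "hausdorff1_outer (A \<union> B) \<le> hausdorff1_outer A + hausdorff1_outer B"
proof -
  define S where "S n = (if n = 0 then A else if n = 1 then B else {})" for n :: nat
  have "A \<union> B \<subseteq> (\<Union>n. S n)"
    by (auto simp: S_def intro: UN_I[of 0] UN_I[of 1])
  then have "hausdorff1_outer (A \<union> B) \<le> (\<Sum>n. hausdorff1_outer (S n))"
    by (rule order_trans[OF hausdorff1_outer_mono hausdorff1_outer_countably_subadditive])
  also have "\<dots> = (\<Sum>n\<in>{0, 1}. hausdorff1_outer (S n))"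
    by (rule suminf_finite) (auto simp: S_def)
  finally show ?thesis by (simp add: S_def)
qed

text \<open>The two outer measures are suprema over independent scales; both scales may be refined
  to a common one below the distance, where \<open>hausdorff1_pre_separated\<close> applies.\<close>

lemma hausdorff1_outer_separated:
  assumes sep: "\<And>x y. x \<in> A \<Longrightarrow> y \<in> B \<Longrightarrow> e \<le> dist x y" and e: "e > 0"
  shows "hausdorff1_outer A + hausdorff1_outer B \<le> hausdorff1_outer (A \<union> B)"
proof -
  have le: "hausdorff1_pre c A + hausdorff1_pre d B \<le> hausdorff1_outer (A \<union> B)"
    if "c > 0" "d > 0" for c d
  proof -
    define \<delta> where "\<delta> = min (min c d) (e / 2)"
    have \<delta>: "\<delta> > 0" "\<delta> \<le> c" "\<delta> \<le> d" "\<delta> < e" using that e by (auto simp: \<delta>_def)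
    have "hausdorff1_pre c A + hausdorff1_pre d B \<le> hausdorff1_pre \<delta> A + hausdorff1_pre \<delta> B"
      using \<delta> by (intro add_mono hausdorff1_pre_antimono)
    also have "\<dots> \<le> hausdorff1_pre \<delta> (A \<union> B)"
      using \<delta> sep by (intro hausdorff1_pre_separated) (auto intro: less_le_trans)
    also have "\<dots> \<le> hausdorff1_outer (A \<union> B)" using \<delta>(1) by (rule hausdorff1_pre_le_outer)
    finally show ?thesis .
  qed
  have ne: "{0 :: real<..} \<noteq> {}" by (simp add: ex_gt_or_lt gt_ex)
  have "hausdorff1_outer A + hausdorff1_outer B
      = (SUP c\<in>{0<..}. SUP d\<in>{0<..}. hausdorff1_pre c A + hausdorff1_pre d B)"
    unfolding hausdorff1_outer_def
    by (subst ennreal_SUP_add_right[OF ne, symmetric], subst ennreal_SUP_add_left[OF ne]) simp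
  also have "\<dots> \<le> hausdorff1_outer (A \<union> B)"
    using le by (intro SUP_least) auto
  finally show ?thesis .
qed

text \<open>The gaps may shrink with \<open>m\<close>: the sets are split off one at a time, so only
  finitely many gaps enter each partial sum.\<close>

lemma hausdorff1_outer_sum_separated:
  fixes R :: "nat \<Rightarrow> 'a::metric_space set"
  assumes sep: "\<And>m. \<exists>e>0. \<forall>k<m. \<forall>x\<in>R k. \<forall>y\<in>R m. e \<le> dist x y" and sub: "\<And>k. R k \<subseteq> X"
  shows "(\<Sum>k. hausdorff1_outer (R k)) \<le> hausdorff1_outer X"
proof -
  have fin: "(\<Sum>k<m. hausdorff1_outer (R k)) \<le> hausdorff1_outer (\<Union>k<m. R k)" for m
  proof (induction m)
    case (Suc m)
    obtain e where e: "e > 0" "\<And>k x y. k < m \<Longrightarrow> x \<in> R k \<Longrightarrow> y \<in> R m \<Longrightarrow> e \<le> dist x y"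
      using sep[of m] by blast
    have "(\<Sum>k<Suc m. hausdorff1_outer (R k)) \<le> hausdorff1_outer (\<Union>k<m. R k) + hausdorff1_outer (R m)"
      using Suc by (simp add: add_right_mono)
    also have "\<dots> \<le> hausdorff1_outer ((\<Union>k<m. R k) \<union> R m)"
      using e by (intro hausdorff1_outer_separated[of _ _ e]) auto
    also have "(\<Union>k<m. R k) \<union> R m = (\<Union>k<Suc m. R k)" by (auto simp: less_Suc_eq)
    finally show ?case .
  qed simp
  show ?thesis
    by (intro suminf_le_const summableI order_trans[OF fin hausdorff1_outer_mono]) (use sub in auto)
qed

lemma ennreal_suminf_tail_small:
  fixes r :: "nat \<Rightarrow> ennreal"
  assumes fin: "(\<Sum>k. r k) < top" and e: "e > 0"
  obtains n where "(\<Sum>k. r (k + n)) \<le> ennreal e"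
proof -
  have lt: "r k < top" for k
    using sum_le_suminf[OF summableI, of "{k}" r] fin by (simp add: le_less_trans)
  define s where "s k = enn2real (r k)" for k
  have s: "r k = ennreal (s k)" "s k \<ge> 0" for k
    using lt[of k] by (auto simp: s_def)
  have "(\<Sum>k. ennreal (s k)) = (\<Sum>k. r k)"
    by (simp only: s(1)[symmetric])
  then have "summable s"
    using fin s(2) by (intro summable_suminf_not_top) auto
  then obtain n where "norm (\<Sum>k. s (k + n)) < e" using suminf_exist_split[OF e] by blast
  moreover have "(\<Sum>k. r (k + n)) = ennreal (\<Sum>k. s (k + n))"
    unfolding s(1) using \<open>summable s\<close> s(2) by (intro suminf_ennreal2) (simp_all add: summable_ignore_initial_segment)
  ultimately show ?thesis by (intro that[of n]) (auto intro: ennreal_leI)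
qed

text \<open>Caratheodory's criterion: the part of \<open>X\<close> off \<open>F\<close> is exhausted by the sets at positive
  distance from \<open>F\<close>, the rings in between having summable outer measure because alternate rings
  are separated.\<close>

lemma closed_lambda_system_hausdorff1_outer:
  fixes F :: "'a::metric_space set"
  assumes F: "closed F"
  shows "hausdorff1_outer (F \<inter> X) + hausdorff1_outer (- F \<inter> X) = hausdorff1_outer X"
proof (rule antisym)
  have "hausdorff1_outer ((F \<inter> X) \<union> (- F \<inter> X)) \<le> hausdorff1_outer (F \<inter> X) + hausdorff1_outer (- F \<inter> X)"
    by (rule hausdorff1_outer_Un)
  also have "(F \<inter> X) \<union> (- F \<inter> X) = X" by auto
  finally show "hausdorff1_outer X \<le> hausdorff1_outer (F \<inter> X) + hausdorff1_outer (- F \<inter> X)" .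
  show "hausdorff1_outer (F \<inter> X) + hausdorff1_outer (- F \<inter> X) \<le> hausdorff1_outer X"
  proof (cases "F = {}")
    case False
    define f where "f x = infdist x F" for x
    have f_lip: "f x \<le> f y + dist x y" for x y
      unfolding f_def by (rule infdist_triangle)
    define R where "R k = {x \<in> X. 1 / (real k + 2) \<le> f x \<and> f x < 1 / (real k + 1)}" for k
    define T where "T n = {x \<in> X. 1 / (real n + 1) \<le> f x}" for n
    have R_sep: "1 / (real k + 2) - 1 / (real m + 1) \<le> dist x y" if "x \<in> R k" "y \<in> R m" for k m x y
      using f_lip[of x y] that by (auto simp: R_def)
    show ?thesis
    proof (rule ennreal_le_epsilon)
      fix e :: real assume fin: "hausdorff1_outer X < top" and e: "e > 0"
      have par: "(\<Sum>k. hausdorff1_outer (R (2 * k + c))) \<le> hausdorff1_outer X" for c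
      proof (rule hausdorff1_outer_sum_separated)
        fix m
        show "\<exists>e>0. \<forall>k<m. \<forall>x\<in>R (2 * k + c). \<forall>y\<in>R (2 * m + c). e \<le> dist x y"
        proof (cases "m = 0")
          case m: False
          \<comment> \<open>The width of the ring just before number \<open>2 * m + c\<close>, which
            separates this ring from all earlier ones of the same parity.\<close>
          let ?e = "1 / (real (2 * m + c)) - 1 / (real (2 * m + c) + 1)"
          have "0 < real (2 * m + c)" using m by simp
          then have "1 / (real (2 * m + c) + 1) < 1 / real (2 * m + c)"
            by (intro divide_strict_left_mono) auto
          then have "?e > 0" by linarith
          moreover have "?e \<le> dist x y" if k: "k < m" "x \<in> R (2 * k + c)" "y \<in> R (2 * m + c)" for k x y
          proof -
            have "real (2 * k + c) + 2 \<le> real (2 * m + c)" using k(1) by simp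
            then have "1 / real (2 * m + c) \<le> 1 / (real (2 * k + c) + 2)" by (intro divide_left_mono) auto
            then show ?thesis using R_sep[OF k(2,3)] by linarith
          qed
          ultimately show ?thesis by blast
        qed (auto intro: exI[of _ 1])
      qed (auto simp: R_def)
      have "(\<Sum>k. hausdorff1_outer (R k)) \<le> hausdorff1_outer X + hausdorff1_outer X"
      proof (rule suminf_le_const[OF summableI])
        fix n
        have "(\<Sum>k<n. hausdorff1_outer (R k)) \<le> (\<Sum>k<2 * n. hausdorff1_outer (R k))"
          by (rule sum_mono2) auto
        also have "\<dots> = (\<Sum>k<n. hausdorff1_outer (R (2 * k + 0))) + (\<Sum>k<n. hausdorff1_outer (R (2 * k + 1)))"
          by (induction n) (simp_all add: add_ac)
        also have "\<dots> \<le> hausdorff1_outer X + hausdorff1_outer X"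
          by (intro add_mono order_trans[OF sum_le_suminf par] summableI) auto
        finally show "(\<Sum>k<n. hausdorff1_outer (R k)) \<le> hausdorff1_outer X + hausdorff1_outer X" .
      qed
      also have "\<dots> < top" using fin by simp
      finally obtain n where n: "(\<Sum>k. hausdorff1_outer (R (k + n))) \<le> ennreal e"
        using ennreal_suminf_tail_small[OF _ e] by blast
      have pos: "f x > 0" if "x \<notin> F" for x
        unfolding f_def using F False that by (rule infdist_pos_not_in_closed)
      have "- F \<inter> X \<subseteq> T n \<union> (\<Union>k. R (k + n))"
      proof
        fix x assume x: "x \<in> - F \<inter> X"
        show "x \<in> T n \<union> (\<Union>k. R (k + n))"
        proof (cases "x \<in> T n")
          case notT: False
          \<comment> \<open>The least \<open>k\<close> satisfying the lower bound of ring
            \<open>k\<close> is the index of the ring containing \<open>x\<close>. It is at least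
            \<open>n\<close> because \<open>x\<close> lies outside \<open>T n\<close>, and for index
            0 the upper bound 1 comes from the same fact.\<close>
          let ?P = "\<lambda>k. 1 / (real k + 2) \<le> f x"
          have fx: "f x > 0" using pos x by simp
          obtain k0 :: nat where "real k0 > 1 / f x" using reals_Archimedean2 by blast
          then have "?P k0" using fx by (simp add: field_simps)
          then have P: "?P (LEAST k. ?P k)" by (rule LeastI)
          let ?k = "LEAST k. ?P k"
          have fn: "f x < 1 / (real n + 1)" using notT x by (simp add: T_def)
          have ub: "f x < 1 / (real ?k + 1)"
          proof (cases ?k)
            case 0
            have "1 / (real n + 1) \<le> 1" by simp
            then have "f x < 1" using fn by linarith
            then show ?thesis using 0 by simp
          next
            case (Suc j)
            then have "\<not> ?P j" by (intro not_less_Least) simp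
            then have "f x < 1 / (real j + 2)" by (simp only: not_le)
            then show ?thesis using Suc by (simp add: add.commute)
          qed
          have "n \<le> ?k"
          proof (rule ccontr)
            assume "\<not> n \<le> ?k"
            then have "real ?k + 2 \<le> real n + 1" by simp
            then have "1 / (real n + 1) \<le> 1 / (real ?k + 2)" by (intro divide_left_mono) auto
            then show False using P fn by linarith
          qed
          then have "x \<in> R ((?k - n) + n)" using P ub x by (simp add: R_def)
          then show ?thesis by blast
        qed simp
      qed
      then have "hausdorff1_outer (- F \<inter> X) \<le> hausdorff1_outer (T n \<union> (\<Union>k. R (k + n)))"
        by (rule hausdorff1_outer_mono)
      also have "\<dots> \<le> hausdorff1_outer (T n) + hausdorff1_outer (\<Union>k. R (k + n))"
        by (rule hausdorff1_outer_Un)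
      also have "\<dots> \<le> hausdorff1_outer (T n) + ennreal e"
        using hausdorff1_outer_countably_subadditive[of "\<lambda>k. R (k + n)"] n by (intro add_left_mono) (rule order_trans)
      finally have "hausdorff1_outer (F \<inter> X) + hausdorff1_outer (- F \<inter> X)
          \<le> (hausdorff1_outer (F \<inter> X) + hausdorff1_outer (T n)) + ennreal e"
        by (simp add: add.assoc add_left_mono)
      also have "hausdorff1_outer (F \<inter> X) + hausdorff1_outer (T n) \<le> hausdorff1_outer ((F \<inter> X) \<union> T n)"
      proof (rule hausdorff1_outer_separated)
        fix x y assume xy: "x \<in> F \<inter> X" "y \<in> T n"
        then have "f x = 0" by (simp add: f_def infdist_zero)
        then show "1 / (real n + 1) \<le> dist x y"
          using f_lip[of y x] xy by (simp add: T_def dist_commute)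
      qed simp
      also have "\<dots> \<le> hausdorff1_outer X" by (rule hausdorff1_outer_mono) (auto simp: T_def)
      finally show "hausdorff1_outer (F \<inter> X) + hausdorff1_outer (- F \<inter> X) \<le> hausdorff1_outer X + ennreal e"
        by (simp add: add_right_mono)
    qed
  qed simp
qed

text \<open>\<open>measure_of\<close> assigns 0 to every set unless its set function is a measure,
  so this is what gives \<open>hausdorff1\<close> the values of the outer measure. The sets
  measurable in Caratheodory's sense form a sigma-algebra, and it contains all closed sets.\<close>

lemma measure_space_hausdorff1_outer:
  "measure_space UNIV (sets (borel :: 'a::metric_space measure)) hausdorff1_outer"
proof -
  interpret P: sigma_algebra "UNIV :: 'a set" "UNIV :: 'a set set"
    using sigma_algebra_Pow[of UNIV] by simp
  let ?L = "lambda_system (UNIV :: 'a set) UNIV hausdorff1_outer"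
  have oms: "outer_measure_space (UNIV :: 'a set set) hausdorff1_outer"
    unfolding outer_measure_space_def
    by (auto simp: positive_def increasing_def countably_subadditive_def
        intro: hausdorff1_outer_mono hausdorff1_outer_countably_subadditive)
  have m: "measure_space UNIV ?L hausdorff1_outer" by (rule P.caratheodory_lemma[OF oms])
  then have L: "sigma_algebra UNIV ?L" by (simp add: measure_space_def)
  have "F \<in> ?L" if "closed F" for F
    using closed_lambda_system_hausdorff1_outer[OF that] by (simp add: lambda_system_def Compl_eq_Diff_UNIV)
  then have "sigma_sets UNIV (Collect closed) \<subseteq> ?L"
    by (intro sigma_algebra.sigma_sets_subset[OF L]) auto
  then have "sets (borel :: 'a measure) \<subseteq> ?L"
    by (subst borel_eq_closed) simp
  moreover have "sigma_algebra UNIV (sets (borel :: 'a measure))"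
    using sets.sigma_algebra_axioms[of "borel :: 'a measure"] by simp
  ultimately show ?thesis using m by (intro measure_down[OF m])
qed

lemma sets_hausdorff1 [simp, measurable_cong]: "sets hausdorff1 = sets borel"
  unfolding hausdorff1_def using sets.sigma_sets_eq[of borel] by simp

lemma space_hausdorff1 [simp]: "space hausdorff1 = UNIV"
  by (simp add: hausdorff1_def space_measure_of_conv)

lemma emeasure_hausdorff1:
  assumes "A \<in> sets borel"
  shows "emeasure hausdorff1 A = hausdorff1_outer A"
  unfolding hausdorff1_def
  using measure_space_hausdorff1_outer assms sets.sigma_algebra_axioms[of borel]
  by (intro emeasure_measure_of_sigma) (auto simp: measure_space_def)

subsection \<open>The boundary of a bounded convex set has finite length\<close>

lemma hausdorff1_outer_lipschitz_arc:
  fixes f :: "real \<Rightarrow> 'a::real_normed_vector"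
  assumes b: "b > 0" and L: "L \<ge> 0" and lip: "\<And>s t. norm (f s - f t) \<le> L * \<bar>s - t\<bar>"
  shows "hausdorff1_outer (f ` {0..b}) \<le> ennreal (2 * (L * b))"
  unfolding hausdorff1_outer_def
proof (rule SUP_least)
  fix d :: real assume "d \<in> {0<..}"
  then have d: "d > 0" by simp
  obtain N0 :: nat where N0: "real N0 > L * b / d" using reals_Archimedean2 by blast
  define N where "N = Suc N0"
  have N: "N \<ge> 1" "real N > L * b / d" using N0 by (auto simp: N_def)
  define h where "h = b / real N"
  have h: "h > 0" using b N by (simp add: h_def)
  \<comment> \<open>Arc number \<open>N\<close> is included because \<open>t = b\<close> has
    \<open>t / h = N\<close>. These \<open>N + 1\<close> arcs of diameter at most
    \<open>L * b / N\<close> account for the factor 2.\<close>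
  define U where "U n = (if n \<le> N then f ` {real n * h..real (Suc n) * h} else {})" for n
  have diam: "diameter (U n) \<le> L * h" and bdd: "bounded (U n)" for n
  proof -
    have dist: "norm (x - y) \<le> L * h" if xy: "x \<in> U n" "y \<in> U n" for x y
    proof -
      obtain s t where st: "x = f s" "y = f t" "s \<in> {real n * h..real (Suc n) * h}" "t \<in> {real n * h..real (Suc n) * h}"
        using xy by (auto simp: U_def split: if_splits)
      have "real (Suc n) * h = real n * h + h" by (simp add: algebra_simps)
      then have "\<bar>s - t\<bar> \<le> h" using st(3,4) unfolding atLeastAtMost_iff abs_le_iff by linarith
      then have "L * \<bar>s - t\<bar> \<le> L * h" using L by (rule mult_left_mono)
      then show ?thesis using lip[of s t] st by simp
    qed
    then show "diameter (U n) \<le> L * h" using L h by (intro diameter_le) auto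
    show "bounded (U n)"
      unfolding bounded_two_points using dist by (intro exI[of _ "L * h"]) (auto simp: dist_norm)
  qed
  have small: "L * h \<le> d"
  proof -
    have "L * b \<le> real N * d" using N d by (simp add: field_simps)
    then show ?thesis using N by (simp add: h_def field_simps)
  qed
  have cover: "f ` {0..b} \<subseteq> (\<Union>n. U n)"
  proof
    fix x assume "x \<in> f ` {0..b}"
    then obtain t where t: "0 \<le> t" "t \<le> b" "x = f t" by auto
    define n where "n = nat \<lfloor>t / h\<rfloor>"
    have q: "0 \<le> t / h" using t h by simp
    have fl: "real n \<le> t / h" "t / h < real n + 1"
      using q by (simp_all add: n_def)
    then have r: "real n * h \<le> t" "t \<le> real (Suc n) * h"
      using h by (simp_all add: pos_le_divide_eq[OF h] pos_divide_less_eq[OF h] add.commute)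
    have "t / h \<le> b / h" using t h by (intro divide_right_mono) auto
    also have "\<dots> = real N" using b N by (simp add: h_def)
    finally have "n \<le> N" using fl(1) by linarith
    then have "x \<in> U n" using r t(3) by (auto simp: U_def)
    then show "x \<in> (\<Union>n. U n)" by blast
  qed
  have "U \<in> covers1 d (f ` {0..b})"
    using cover diam bdd small by (auto simp: covers1_def intro: order_trans)
  then have "hausdorff1_pre d (f ` {0..b}) \<le> (\<Sum>n. ennreal (diameter (U n)))"
    by (rule hausdorff1_pre_le)
  also have "\<dots> = (\<Sum>n\<in>{..N}. ennreal (diameter (U n)))"
    by (rule suminf_finite) (auto simp: U_def)
  also have "\<dots> \<le> (\<Sum>n\<in>{..N}. ennreal (L * h))"
    by (intro sum_mono ennreal_leI diam)
  also have "\<dots> = ennreal (real (Suc N) * (L * h))"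
    using L h by (simp add: ennreal_of_nat_eq_real_of_nat ennreal_mult[symmetric] del: of_nat_Suc)
  also have "\<dots> \<le> ennreal (2 * (L * b))"
  proof (rule ennreal_leI)
    have "real (Suc N) * (L * h) = (real (Suc N) / real N) * (L * b)" by (simp add: h_def)
    also have "\<dots> \<le> 2 * (L * b)"
      using N b L by (intro mult_right_mono) (auto simp: field_simps)
    finally show "real (Suc N) * (L * h) \<le> 2 * (L * b)" .
  qed
  finally show "hausdorff1_pre d (f ` {0..b}) \<le> ennreal (2 * (L * b))" .
qed

text \<open>The nearest-point projection onto the closure does not increase distances, and the image
  of a surrounding circle covers the frontier; so the frontier lies on a Lipschitz arc. Finite
  length is what puts smooth functions into \<open>L2\<close> of the surface measure.\<close>

lemma hausdorff1_frontier_finite: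
  fixes \<Omega> :: "(real^2) set"
  assumes \<Omega>: "bounded \<Omega>" "convex \<Omega>" "open \<Omega>" "\<Omega> \<noteq> {}"
  shows "hausdorff1_outer (frontier \<Omega>) < top"
proof -
  obtain R where R: "R > 0" "closure \<Omega> \<subseteq> ball 0 R"
    using bounded_subset_ballD[OF bounded_closure[OF \<Omega>(1)]] by blast
  define circ :: "real \<Rightarrow> real^2" where "circ t = vector [R * cos t, R * sin t]" for t
  define f where "f t = closest_point (closure \<Omega>) (circ t)" for t
  have circ: "norm (circ s - circ t) \<le> (2 * R) * \<bar>s - t\<bar>" for s t
  proof -
    have c: "\<bar>cos s - cos t\<bar> \<le> \<bar>s - t\<bar>"
    proof -
      have "\<bar>cos s - cos t\<bar> = 2 * (\<bar>sin ((s + t) / 2)\<bar> * \<bar>sin ((t - s) / 2)\<bar>)"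
        by (simp add: cos_diff_cos abs_mult)
      also have "\<dots> \<le> 2 * (1 * \<bar>(t - s) / 2\<bar>)"
        by (intro mult_left_mono mult_mono abs_sin_le_one abs_sin_x_le_abs_x) auto
      finally show ?thesis by (simp add: abs_minus_commute)
    qed
    have s: "\<bar>sin s - sin t\<bar> \<le> \<bar>s - t\<bar>"
    proof -
      have "\<bar>sin s - sin t\<bar> = 2 * (\<bar>sin ((s - t) / 2)\<bar> * \<bar>cos ((s + t) / 2)\<bar>)"
        by (simp add: sin_diff_sin abs_mult)
      also have "\<dots> \<le> 2 * (\<bar>(s - t) / 2\<bar> * 1)"
        by (intro mult_left_mono mult_mono abs_cos_le_one abs_sin_x_le_abs_x) auto
      finally show ?thesis by simp
    qed
    have "norm (circ s - circ t) \<le> \<bar>R * cos s - R * cos t\<bar> + \<bar>R * sin s - R * sin t\<bar>"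
      using norm_le_l1_cart[of "circ s - circ t"] by (simp add: sum_2 circ_def)
    also have "\<dots> = R * \<bar>cos s - cos t\<bar> + R * \<bar>sin s - sin t\<bar>"
      using R by (simp add: right_diff_distrib[symmetric] abs_mult)
    also have "\<dots> \<le> R * \<bar>s - t\<bar> + R * \<bar>s - t\<bar>"
      using R c s by (intro add_mono mult_left_mono) auto
    finally show ?thesis by simp
  qed
  have cl: "convex (closure \<Omega>)" "closed (closure \<Omega>)" "closure \<Omega> \<noteq> {}"
    using \<Omega> by (auto intro: convex_closure)
  have lip: "norm (f s - f t) \<le> (2 * R) * \<bar>s - t\<bar>" for s t
    using closest_point_lipschitz[OF cl, of "circ s" "circ t"] circ[of s t] by (simp add: f_def dist_norm)
  have "frontier \<Omega> \<subseteq> f ` {0..2 * pi}"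
  proof
    fix x assume x: "x \<in> frontier \<Omega>"
    have xc: "x \<in> closure \<Omega>" "x \<notin> rel_interior \<Omega>"
      using x \<Omega>(3) by (auto simp: frontier_def rel_interior_open interior_open)
    then obtain a where a: "a \<noteq> 0" "\<And>y. y \<in> closure \<Omega> \<Longrightarrow> a \<bullet> x \<le> a \<bullet> y"
      using supporting_hyperplane_rel_boundary[of "closure \<Omega>" x] cl(1) \<Omega>(2)
      by (metis convex_rel_interior_closure)
    \<comment> \<open>From the boundary point one moves against the inward normal \<open>a\<close>
      of a supporting line until the circle of radius \<open>R\<close> is reached; the point reached
      there projects back to \<open>x\<close>.\<close>
    have "\<exists>t\<ge>0. t \<le> 2 * R / norm a \<and> norm (x - t *\<^sub>R a) = R"
    proof (rule IVT')
      show "norm (x - 0 *\<^sub>R a) \<le> R" using xc R by auto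
      have "norm ((2 * R / norm a) *\<^sub>R a) \<le> norm x + norm (x - (2 * R / norm a) *\<^sub>R a)"
        using norm_triangle_ineq4[of x "x - (2 * R / norm a) *\<^sub>R a"] by simp
      moreover have "norm x < R" using xc R by auto
      ultimately show "R \<le> norm (x - (2 * R / norm a) *\<^sub>R a)" using a R by simp
      show "continuous_on {0..2 * R / norm a} (\<lambda>t. norm (x - t *\<^sub>R a))" by (intro continuous_intros)
    qed (use R a in simp)
    then obtain t where t: "t \<ge> 0" "norm (x - t *\<^sub>R a) = R" by auto
    let ?y = "x - t *\<^sub>R a"
    have "(?y $ 1 / R)\<^sup>2 + (?y $ 2 / R)\<^sup>2 = 1"
    proof -
      have eq: "R\<^sup>2 = (?y $ 1)\<^sup>2 + (?y $ 2)\<^sup>2"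
        unfolding t(2)[symmetric] power2_norm_eq_inner by (simp add: inner_vec_def sum_2 power2_eq_square)
      have "(?y $ 1 / R)\<^sup>2 + (?y $ 2 / R)\<^sup>2 = ((?y $ 1)\<^sup>2 + (?y $ 2)\<^sup>2) / R\<^sup>2"
        by (simp only: power_divide add_divide_distrib)
      also have "\<dots> = 1" unfolding eq[symmetric] using R by simp
      finally show ?thesis .
    qed
    then obtain \<theta> where \<theta>: "0 \<le> \<theta>" "\<theta> < 2 * pi" "?y $ 1 / R = cos \<theta>" "?y $ 2 / R = sin \<theta>"
      using sincos_total_2pi by metis
    have "circ \<theta> = ?y"
      using \<theta>(3,4)[symmetric] R by (simp add: circ_def vec_eq_iff forall_2)
    moreover have "x = closest_point (closure \<Omega>) ?y"
    proof (rule closest_point_unique[OF cl(1,2) xc(1)], rule ballI)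
      fix z assume z: "z \<in> closure \<Omega>"
      have "(norm (t *\<^sub>R a))\<^sup>2 \<le> (norm ((x - z) - t *\<^sub>R a))\<^sup>2"
      proof -
        have "(norm ((x - z) - t *\<^sub>R a))\<^sup>2 = (norm (x - z))\<^sup>2 - 2 * (t * (a \<bullet> (x - z))) + (norm (t *\<^sub>R a))\<^sup>2"
          unfolding power2_norm_eq_inner by (simp add: inner_diff_left inner_diff_right inner_commute algebra_simps)
        moreover have "t * (a \<bullet> (x - z)) \<le> 0"
          using t(1) a(2)[OF z] by (intro mult_nonneg_nonpos) (auto simp: inner_diff_right)
        ultimately show ?thesis using zero_le_power2[of "norm (x - z)"] by linarith
      qed
      then have "norm (t *\<^sub>R a) \<le> norm ((x - z) - t *\<^sub>R a)" by (rule power2_le_imp_le) simp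
      then show "dist ?y x \<le> dist ?y z"
        by (simp add: dist_norm algebra_simps)
    qed
    ultimately show "x \<in> f ` {0..2 * pi}" using \<theta> by (intro image_eqI[of _ _ \<theta>]) (auto simp: f_def)
  qed
  then have "hausdorff1_outer (frontier \<Omega>) \<le> hausdorff1_outer (f ` {0..2 * pi})"
    by (rule hausdorff1_outer_mono)
  also have "\<dots> \<le> ennreal (2 * (2 * R * (2 * pi)))"
    using R by (intro hausdorff1_outer_lipschitz_arc lip) auto
  also have "\<dots> < top" by simp
  finally show ?thesis .
qed

section \<open>Traces\<close>

lemma sets_surface_measure: "sets (surface_measure \<Omega>) = sets (restrict_space borel (frontier \<Omega>))"
  unfolding surface_measure_def by (intro sets_restrict_space_cong) simp

lemma space_surface_measure [simp]: "space (surface_measure \<Omega>) = frontier \<Omega>"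
  by (simp add: surface_measure_def space_restrict_space)

lemma emeasure_surface_measure:
  assumes "A \<in> sets (surface_measure \<Omega>)"
  shows "emeasure (surface_measure \<Omega>) A = hausdorff1_outer A" "A \<in> sets borel" "A \<subseteq> frontier \<Omega>"
proof -
  have fr: "frontier \<Omega> \<in> sets borel" by simp
  then show A: "A \<in> sets borel" "A \<subseteq> frontier \<Omega>"
    using assms by (auto simp: sets_surface_measure sets_restrict_space_iff)
  show "emeasure (surface_measure \<Omega>) A = hausdorff1_outer A"
    unfolding surface_measure_def using A fr by (subst emeasure_restrict_space) (auto simp: emeasure_hausdorff1)
qed

locale planar_domain =
  fixes \<Omega> :: "(real^2) set" and \<pi> \<gamma> :: "real^2 \<Rightarrow> real^2" and B C :: real
  assumes bounded: "bounded \<Omega>" and convex: "convex \<Omega>" and op: "open \<Omega>" and nonempty: "\<Omega> \<noteq> {}"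
    and \<pi>_measurable [measurable]: "\<pi> \<in> borel_measurable borel"
    and \<gamma>_measurable [measurable]: "\<gamma> \<in> borel_measurable borel"
    and \<gamma>_bound: "\<And>x j. \<bar>\<gamma> x $ j\<bar> \<le> B"
    and AE_normal: "AE x in lborel. x \<in> \<Omega> \<longrightarrow> \<pi> x \<in> frontier \<Omega> \<and> \<gamma> x \<noteq> 0 \<and>
      is_outward_normal \<Omega> (\<pi> x) ((1 / norm (\<gamma> x)) *\<^sub>R \<gamma> x)"
    and green: "\<And>U j. U \<in> C_infinity \<Longrightarrow> (\<integral>x. indicator \<Omega> x * partial j U x \<partial>lborel)
      = (\<integral>x. indicator \<Omega> x * (U (\<pi> x) * \<gamma> x $ j) \<partial>lborel)"
    and C_pos: "C > 0"
    and push: "\<And>A. A \<in> sets borel \<Longrightarrow> emeasure lborel {x \<in> \<Omega>. \<pi> x \<in> A} \<le> ennreal C * hausdorff1_outer A"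
begin

abbreviation L :: "(real^2) measure" where "L \<equiv> lebesgue_on \<Omega>"

text \<open>Almost all of \<Omega> by \<open>AE_normal\<close>. Here \<open>\<pi>\<close> takes its
  values in the frontier, as a measurable map into \<open>surface_measure \<Omega>\<close>
  must.\<close>

definition D :: "(real^2) set" where "D = {x \<in> \<Omega>. \<pi> x \<in> frontier \<Omega>}"

definition M :: "(real^2) measure" where "M = restrict_space lborel D"

lemma \<gamma>_component_measurable [measurable]: "(\<lambda>x. \<gamma> x $ j) \<in> borel_measurable borel"
  by (rule measurable_compose[OF \<gamma>_measurable])
    (intro borel_measurable_continuous_onI continuous_intros)

lemma bounded_frontier: "bounded (frontier \<Omega>)"
  using compact_frontier_bounded[OF bounded] by (rule compact_imp_bounded)

lemma \<Omega>_borel [measurable]: "\<Omega> \<in> sets borel"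
  using op by simp

lemma \<Omega>_lebesgue: "\<Omega> \<in> sets lebesgue"
  using op by auto

lemma frontier_borel [measurable]: "frontier \<Omega> \<in> sets borel"
  by simp

lemma D_borel [measurable]: "D \<in> sets borel"
  unfolding D_def by measurable

lemma space_M [simp]: "space M = D"
  by (simp add: M_def space_restrict_space)

sublocale finite_L: finite_measure L
  by (rule finite_measure_lebesgue_on_bounded[OF bounded \<Omega>_lebesgue])

sublocale finite_M: finite_measure M
proof
  have "emeasure M (space M) = emeasure lborel D"
    by (simp add: M_def emeasure_restrict_space space_restrict_space)
  also have "\<dots> < \<infinity>" using bounded by (intro emeasure_bounded_finite bounded_subset[OF bounded]) (auto simp: D_def)
  finally show "emeasure M (space M) \<noteq> \<infinity>" by simp
qed

lemma borel_measurable_M [measurable (raw)]: "f \<in> borel_measurable borel \<Longrightarrow> f \<in> borel_measurable M"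
  unfolding M_def by (intro measurable_restrict_space1) simp

lemma \<pi>_M_surface: "\<pi> \<in> measurable M (surface_measure \<Omega>)"
  unfolding surface_measure_def
proof (rule measurable_restrict_space2)
  show "\<pi> \<in> space M \<rightarrow> frontier \<Omega>" by (auto simp: D_def)
  have "\<pi> \<in> measurable M borel" by measurable
  then show "\<pi> \<in> measurable M hausdorff1"
    by (subst measurable_cong_sets[OF refl sets_hausdorff1])
qed

lemma pushforward_le:
  assumes "A \<in> sets (surface_measure \<Omega>)"
  shows "emeasure M (\<pi> -` A \<inter> space M) \<le> ennreal C * emeasure (surface_measure \<Omega>) A"
proof -
  have A: "A \<in> sets borel" by (rule emeasure_surface_measure(2)[OF assms])
  have "\<pi> -` A \<inter> D \<in> sets borel" using A by measurable
  then have "emeasure M (\<pi> -` A \<inter> space M) = emeasure lborel (\<pi> -` A \<inter> D)"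
    by (simp add: M_def emeasure_restrict_space space_restrict_space)
  also have "\<dots> \<le> emeasure lborel {x \<in> \<Omega>. \<pi> x \<in> A}"
  proof (rule emeasure_mono)
    have "{x \<in> \<Omega>. \<pi> x \<in> A} = \<Omega> \<inter> \<pi> -` A" by auto
    also have "\<dots> \<in> sets borel" using A by measurable
    finally show "{x \<in> \<Omega>. \<pi> x \<in> A} \<in> sets lborel" by simp
  qed (auto simp: D_def)
  also have "\<dots> \<le> ennreal C * emeasure (surface_measure \<Omega>) A"
    using push[OF A] emeasure_surface_measure(1)[OF assms] by simp
  finally show ?thesis .
qed

text \<open>The image of \<open>M\<close> under \<open>\<pi>\<close> is at most \<open>C\<close>
  times the surface measure, and integrals are monotone in the measure.\<close>

lemma nn_integral_radial_le:
  assumes "h \<in> borel_measurable (surface_measure \<Omega>)"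
  shows "(\<integral>\<^sup>+x. h (\<pi> x) \<partial>M) \<le> ennreal C * (\<integral>\<^sup>+z. h z \<partial>surface_measure \<Omega>)"
proof -
  let ?S = "surface_measure \<Omega>"
  let ?N = "distr M ?S \<pi>"
  have le: "?N \<le> scale_measure (ennreal C) ?S"
    by (subst le_measure) (auto simp: emeasure_distr[OF \<pi>_M_surface] intro: pushforward_le[simplified])
  have "(\<integral>\<^sup>+x. h (\<pi> x) \<partial>M) = (\<integral>\<^sup>+z. h z \<partial>?N)"
    using assms \<pi>_M_surface by (simp add: nn_integral_distr)
  also have "\<dots> \<le> (\<integral>\<^sup>+z. h z \<partial>scale_measure (ennreal C) ?S)"
    by (rule nn_integral_mono_measure[OF _ le]) simp
  also have "\<dots> = ennreal C * (\<integral>\<^sup>+z. h z \<partial>?S)"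
    using assms by (rule nn_integral_scale_measure)
  finally show ?thesis .
qed

text \<open>This carries the boundary convergence in \<open>has_trace\<close> over to the radial
  integrals of Green's formula; the constant is the square root of that in
  \<open>push\<close>.\<close>

lemma L2_radial:
  fixes G :: "real^2 \<Rightarrow> real"
  assumes "G \<in> L2 (surface_measure \<Omega>)"
  shows "(\<lambda>x. G (\<pi> x)) \<in> L2 M" "L2_norm M (\<lambda>x. G (\<pi> x)) \<le> sqrt C * L2_norm (surface_measure \<Omega>) G"
proof -
  let ?S = "surface_measure \<Omega>"
  have Gm: "G \<in> borel_measurable ?S" and Gi: "integrable ?S (\<lambda>z. (norm (G z))\<^sup>2)"
    using assms by (auto simp: L2_def)
  have m: "(\<lambda>x. G (\<pi> x)) \<in> borel_measurable M"
    using Gm \<pi>_M_surface by (rule measurable_compose[rotated])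
  have "(\<integral>\<^sup>+x. ennreal ((norm (G (\<pi> x)))\<^sup>2) \<partial>M) \<le> ennreal C * (\<integral>\<^sup>+z. ennreal ((norm (G z))\<^sup>2) \<partial>?S)"
    using Gm by (intro nn_integral_radial_le) measurable
  also have "\<dots> = ennreal (C * (\<integral>z. (norm (G z))\<^sup>2 \<partial>?S))"
    using Gi C_pos by (subst nn_integral_eq_integral) (auto simp: ennreal_mult)
  finally have le: "(\<integral>\<^sup>+x. ennreal ((norm (G (\<pi> x)))\<^sup>2) \<partial>M) \<le> ennreal (C * (\<integral>z. (norm (G z))\<^sup>2 \<partial>?S))" .
  then have i: "integrable M (\<lambda>x. (norm (G (\<pi> x)))\<^sup>2)"
    using m by (intro integrableI_bounded) (auto simp: less_top[symmetric] top_unique)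
  then show "(\<lambda>x. G (\<pi> x)) \<in> L2 M" using m by (simp add: L2_def)
  have "(\<integral>x. (norm (G (\<pi> x)))\<^sup>2 \<partial>M) \<le> C * (\<integral>z. (norm (G z))\<^sup>2 \<partial>?S)"
    using le C_pos unfolding nn_integral_eq_integral[OF i, simplified]
    by (subst (asm) nn_integral_eq_integral[OF i]) (auto simp: ennreal_le_iff)
  then show "L2_norm M (\<lambda>x. G (\<pi> x)) \<le> sqrt C * L2_norm ?S G"
    unfolding L2_norm_def real_sqrt_mult[symmetric] by (rule real_sqrt_le_mono)
qed

lemma AE_radial:
  assumes "AE z in surface_measure \<Omega>. P z"
  shows "AE x in M. P (\<pi> x)"
proof -
  obtain N where N: "{z \<in> space (surface_measure \<Omega>). \<not> P z} \<subseteq> N" "N \<in> sets (surface_measure \<Omega>)"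
    "emeasure (surface_measure \<Omega>) N = 0"
    using assms by (rule AE_E)
  have "emeasure M (\<pi> -` N \<inter> space M) = 0"
    using pushforward_le[OF N(2)] N(3) by simp
  then have "\<pi> -` N \<inter> space M \<in> null_sets M"
    using measurable_sets[OF \<pi>_M_surface N(2)] by auto
  then show ?thesis
    by (rule AE_I') (use N(1) in \<open>auto simp: D_def\<close>)
qed

text \<open>By the convention for integrals, \<open>L2_norm\<close> is 0 when the square is not
  integrable. Square integrability, which comes from the finite length of the frontier, is what lets
  convergence in this norm be used.\<close>

lemma C_infinity_L2_surface:
  assumes "U \<in> C_infinity"
  shows "U \<in> L2 (surface_measure \<Omega>)"
proof -
  have fin: "emeasure (surface_measure \<Omega>) (space (surface_measure \<Omega>)) < top"
    using hausdorff1_frontier_finite[OF bounded convex op nonempty]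
    by (subst emeasure_surface_measure(1)[OF sets.top]) simp
  interpret S: finite_measure "surface_measure \<Omega>"
    by (rule finite_measureI) (use fin in \<open>simp add: less_top[symmetric] del: space_surface_measure\<close>)
  have "U \<in> borel_measurable hausdorff1"
    using C_infinity_measurable[OF assms] by (subst measurable_cong_sets[OF sets_hausdorff1 refl])
  then have m: "U \<in> borel_measurable (surface_measure \<Omega>)"
    unfolding surface_measure_def by (rule measurable_restrict_space1)
  obtain K where K: "\<And>x. x \<in> frontier \<Omega> \<Longrightarrow> \<bar>U x\<bar> \<le> K"
    by (rule C_infinity_bounded_on_bounded[OF assms bounded_frontier]) blast
  have "integrable (surface_measure \<Omega>) (\<lambda>x. (norm (U x))\<^sup>2)"
  proof (rule S.integrable_const_bound)
    show "AE x in surface_measure \<Omega>. norm ((norm (U x))\<^sup>2) \<le> K\<^sup>2"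
    proof (rule AE_I2)
      fix x assume "x \<in> space (surface_measure \<Omega>)"
      then show "norm ((norm (U x))\<^sup>2) \<le> K\<^sup>2" using power_mono[OF K, of x 2] by simp
    qed
  qed (use m in simp)
  with m show ?thesis by (simp add: L2_def)
qed

lemma AE_lborel_M:
  assumes "AE x in lborel. x \<in> \<Omega> \<longrightarrow> P x"
  shows "AE x in M. P x"
  unfolding M_def using assms
  by (subst AE_restrict_space_iff) (auto simp: D_def elim: eventually_mono)

lemma integral_L_eq:
  fixes f :: "real^2 \<Rightarrow> real"
  assumes [measurable]: "f \<in> borel_measurable borel"
  shows "(\<integral>x. f x \<partial>L) = (\<integral>x. indicator \<Omega> x * f x \<partial>lborel)"
proof -
  have "(\<lambda>x. indicator \<Omega> x * f x) \<in> borel_measurable lborel" by measurable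
  then show ?thesis
    using \<Omega>_lebesgue integral_completion[of "\<lambda>x. indicator \<Omega> x * f x" lborel]
    by (simp add: integral_restrict_space)
qed

lemma green_M:
  assumes U: "U \<in> C_infinity"
  shows "(\<integral>x. partial j U x \<partial>L) = (\<integral>x. U (\<pi> x) * \<gamma> x $ j \<partial>M)"
proof -
  have [measurable]: "U \<in> borel_measurable borel" using U by (rule C_infinity_measurable)
  have "(\<integral>x. partial j U x \<partial>L) = (\<integral>x. indicator \<Omega> x * (U (\<pi> x) * \<gamma> x $ j) \<partial>lborel)"
    using U by (simp add: green[OF U, symmetric] integral_L_eq C_infinity_measurable C_infinity_partial)
  also have "\<dots> = (\<integral>x. indicator D x * (U (\<pi> x) * \<gamma> x $ j) \<partial>lborel)"
  proof (rule integral_cong_AE)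
    show "AE x in lborel. indicator \<Omega> x * (U (\<pi> x) * \<gamma> x $ j) = indicator D x * (U (\<pi> x) * \<gamma> x $ j)"
      using AE_normal by eventually_elim (auto simp: D_def indicator_def)
  qed measurable
  also have "\<dots> = (\<integral>x. U (\<pi> x) * \<gamma> x $ j \<partial>M)"
    unfolding M_def by (subst integral_restrict_space) auto
  finally show ?thesis .
qed

text \<open>Green's formula for the products of \<open>U n\<close> and \<open>\<psi>\<close> passes
  to the limit: the interior terms by convergence in \<open>H1_norm\<close>, the boundary term
  because the surface norm dominates the radial one.\<close>

lemma green_trace:
  assumes tr: "has_trace \<Omega> u g" and \<psi>: "\<psi> \<in> C_infinity"
  shows "(\<integral>x. weak_partial \<Omega> j u x * \<psi> x \<partial>L) + (\<integral>x. u x * partial j \<psi> x \<partial>L)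
    = (\<integral>x. g (\<pi> x) * (\<psi> (\<pi> x) * \<gamma> x $ j) \<partial>M)"
proof -
  let ?S = "surface_measure \<Omega>"
  obtain U where U: "\<And>n. U n \<in> C_infinity"
    and H1: "(\<lambda>n. H1_norm \<Omega> (\<lambda>x. U n x - u x)) \<longlonglongrightarrow> 0"
    and bd: "(\<lambda>n. L2_norm ?S (\<lambda>x. U n x - g x)) \<longlonglongrightarrow> 0"
    using tr by (auto simp: has_trace_def)
  have u: "u \<in> H1 \<Omega>" and g: "g \<in> L2 ?S" using tr by (auto simp: has_trace_def)
  have [measurable]: "\<psi> \<in> borel_measurable borel" "partial j \<psi> \<in> borel_measurable borel"
    using \<psi> by (auto intro: C_infinity_measurable)
  obtain K1 where K1: "\<And>x. x \<in> \<Omega> \<Longrightarrow> \<bar>\<psi> x\<bar> \<le> K1" "K1 \<ge> 0"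
    using C_infinity_bounded_on_bounded[OF \<psi> bounded] by metis
  obtain K2 where K2: "\<And>x. x \<in> \<Omega> \<Longrightarrow> \<bar>partial j \<psi> x\<bar> \<le> K2" "K2 \<ge> 0"
    using C_infinity_bounded_on_bounded[OF C_infinity_partial[OF \<psi>] bounded] by metis
  obtain K3 where K3: "\<And>x. x \<in> frontier \<Omega> \<Longrightarrow> \<bar>\<psi> x\<bar> \<le> K3" "K3 \<ge> 0"
    using C_infinity_bounded_on_bounded[OF \<psi> bounded_frontier] by metis
  \<comment> \<open>The factors are known to be bounded on \<Omega> or on \<open>D\<close>; an
    indicator makes them bounded everywhere, as the convergence lemmas require.\<close>
  have onL: "(\<integral>x. f x * (indicator \<Omega> x * \<phi> x) \<partial>L) = (\<integral>x. f x * \<phi> x \<partial>L)" for f \<phi> :: "real^2 \<Rightarrow> real"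
    by (intro Bochner_Integration.integral_cong refl) (simp add: space_restrict_space)
  have onM: "(\<integral>x. f x * (indicator D x * \<phi> x) \<partial>M) = (\<integral>x. f x * \<phi> x \<partial>M)" for f \<phi> :: "real^2 \<Rightarrow> real"
    by (intro Bochner_Integration.integral_cong refl) simp
  have l1: "(\<lambda>n. \<integral>x. partial j (U n) x * \<psi> x \<partial>L) \<longlonglongrightarrow> (\<integral>x. weak_partial \<Omega> j u x * \<psi> x \<partial>L)"
    unfolding onL[where \<phi> = \<psi>, symmetric]
    by (rule H1_approximation_tendsto(2)[OF op bounded u U H1, where B = K1])
      (use K1 in \<open>auto intro!: borel_measurable_lebesgue_on simp: indicator_def\<close>)
  have l2: "(\<lambda>n. \<integral>x. U n x * partial j \<psi> x \<partial>L) \<longlonglongrightarrow> (\<integral>x. u x * partial j \<psi> x \<partial>L)"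
    unfolding onL[where \<phi> = "partial j \<psi>", symmetric]
    by (rule H1_approximation_tendsto(1)[OF op bounded u U H1, where B = K2])
      (use K2 in \<open>auto intro!: borel_measurable_lebesgue_on simp: indicator_def\<close>)
  have l3: "(\<lambda>n. \<integral>x. U n (\<pi> x) * (\<psi> (\<pi> x) * \<gamma> x $ j) \<partial>M) \<longlonglongrightarrow> (\<integral>x. g (\<pi> x) * (\<psi> (\<pi> x) * \<gamma> x $ j) \<partial>M)"
    unfolding onM[where \<phi> = "\<lambda>x. \<psi> (\<pi> x) * \<gamma> x $ j", symmetric]
  proof (rule finite_M.L2_tendsto_integral_mult[where B = "K3 * \<bar>B\<bar>"])
    have d: "(\<lambda>x. U n x - g x) \<in> L2 ?S" for n
      using C_infinity_L2_surface[OF U] g by (rule L2_diff)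
    have "(\<lambda>n. sqrt C * L2_norm ?S (\<lambda>x. U n x - g x)) \<longlonglongrightarrow> 0"
      using tendsto_mult_left[OF bd, of "sqrt C"] by simp
    then show "(\<lambda>n. L2_norm M (\<lambda>x. U n (\<pi> x) - g (\<pi> x))) \<longlonglongrightarrow> 0"
      by (rule tendsto_sandwich[OF _ _ tendsto_const, rotated 2])
        (auto intro!: always_eventually L2_norm_nonneg L2_radial(2)[OF d])
    show "(\<lambda>x. U n (\<pi> x)) \<in> L2 M" for n by (rule L2_radial(1)[OF C_infinity_L2_surface[OF U]])
    show "(\<lambda>x. g (\<pi> x)) \<in> L2 M" by (rule L2_radial(1)[OF g])
    show "(\<lambda>x. indicator D x * (\<psi> (\<pi> x) * \<gamma> x $ j)) \<in> borel_measurable M"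
      by (rule borel_measurable_M) measurable
    fix x
    show "\<bar>indicator D x * (\<psi> (\<pi> x) * \<gamma> x $ j)\<bar> \<le> K3 * \<bar>B\<bar>"
    proof (cases "x \<in> D")
      case True
      then have "\<bar>\<psi> (\<pi> x)\<bar> \<le> K3" by (intro K3) (simp add: D_def)
      moreover have "\<bar>\<gamma> x $ j\<bar> \<le> \<bar>B\<bar>" using \<gamma>_bound[of x j] by simp
      ultimately have "\<bar>\<psi> (\<pi> x)\<bar> * \<bar>\<gamma> x $ j\<bar> \<le> K3 * \<bar>B\<bar>" using K3(2) by (intro mult_mono) auto
      then show ?thesis using True by (simp add: abs_mult)
    qed (use K3 in simp)
  qed
  have "(\<integral>x. partial j (U n) x * \<psi> x \<partial>L) + (\<integral>x. U n x * partial j \<psi> x \<partial>L)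
      = (\<integral>x. U n (\<pi> x) * (\<psi> (\<pi> x) * \<gamma> x $ j) \<partial>M)" for n
  proof -
    have int: "integrable L F" if "F \<in> C_infinity" for F
      by (rule finite_L.L2_integrable[OF C_infinity_L2[OF that bounded \<Omega>_lebesgue]])
    have "(\<integral>x. partial j (U n) x * \<psi> x \<partial>L) + (\<integral>x. U n x * partial j \<psi> x \<partial>L)
        = (\<integral>x. partial j (U n) x * \<psi> x + U n x * partial j \<psi> x \<partial>L)"
      using U \<psi> by (intro Bochner_Integration.integral_add[symmetric] int C_infinity_mult C_infinity_partial)
    also have "\<dots> = (\<integral>x. partial j (\<lambda>x. U n x * \<psi> x) x \<partial>L)"
      by (subst partial_mult) (auto intro: C_infinity_differentiable[OF U] C_infinity_differentiable[OF \<psi>])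
    also have "\<dots> = (\<integral>x. (U n (\<pi> x) * \<psi> (\<pi> x)) * \<gamma> x $ j \<partial>M)"
      by (rule green_M) (use U \<psi> in auto)
    finally show ?thesis by (simp add: mult.assoc)
  qed
  with tendsto_add[OF l1 l2] l3 show ?thesis by (simp add: LIMSEQ_unique)
qed

lemma zero_trace_by_parts:
  assumes "has_trace \<Omega> u (\<lambda>_. 0)" "\<psi> \<in> C_infinity"
  shows "(\<integral>x. weak_partial \<Omega> j u x * \<psi> x \<partial>L) = - (\<integral>x. u x * partial j \<psi> x \<partial>L)"
  using green_trace[OF assms, of j] by simp

text \<open>The single boundary terms need not vanish. But \<open>\<gamma>\<close> is a positive
  multiple of the normal, so the sum over \<open>j\<close> of the boundary integrands is a multiple
  of the inner product of \<open>S\<close> with the normal, which does vanish.\<close>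

lemma zero_normal_trace_by_parts:
  fixes s :: "real^2 \<Rightarrow> real^2" and S :: "real^2 \<Rightarrow> real^2"
  assumes tr: "\<And>j. has_trace \<Omega> (\<lambda>x. s x $ j) (\<lambda>x. S x $ j)"
    and normal: "AE z in surface_measure \<Omega>. S z \<bullet> outward_normal \<Omega> z = 0"
    and \<psi>: "\<psi> \<in> C_infinity"
  shows "(\<Sum>j\<in>UNIV. \<integral>x. weak_partial \<Omega> j (\<lambda>x. s x $ j) x * \<psi> x \<partial>L)
    = - (\<Sum>j\<in>UNIV. \<integral>x. s x $ j * partial j \<psi> x \<partial>L)"
proof -
  let ?I = "\<lambda>j x. S (\<pi> x) $ j * (\<psi> (\<pi> x) * \<gamma> x $ j)"
  have [measurable]: "\<psi> \<in> borel_measurable borel" using \<psi> by (rule C_infinity_measurable)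
  obtain K3 where K3: "\<And>x. x \<in> frontier \<Omega> \<Longrightarrow> \<bar>\<psi> x\<bar> \<le> K3" "K3 \<ge> 0"
    using C_infinity_bounded_on_bounded[OF \<psi> bounded_frontier] by metis
  have int: "integrable M (?I j)" for j
  proof -
      have "integrable M (\<lambda>x. S (\<pi> x) $ j * (indicator D x * (\<psi> (\<pi> x) * \<gamma> x $ j)))"
    proof (rule integrable_mult_bounded[where B = "K3 * \<bar>B\<bar>"])
      show "integrable M (\<lambda>x. S (\<pi> x) $ j)"
        using tr[of j] by (intro finite_M.L2_integrable L2_radial(1)) (simp add: has_trace_def)
      show "(\<lambda>x. indicator D x * (\<psi> (\<pi> x) * \<gamma> x $ j)) \<in> borel_measurable M"
        by (rule borel_measurable_M) measurable
      fix x
      show "\<bar>indicator D x * (\<psi> (\<pi> x) * \<gamma> x $ j)\<bar> \<le> K3 * \<bar>B\<bar>"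
      proof (cases "x \<in> D")
        case True
        then have "\<bar>\<psi> (\<pi> x)\<bar> \<le> K3" by (intro K3) (simp add: D_def)
        moreover have "\<bar>\<gamma> x $ j\<bar> \<le> \<bar>B\<bar>" using \<gamma>_bound[of x j] by simp
        ultimately have "\<bar>\<psi> (\<pi> x)\<bar> * \<bar>\<gamma> x $ j\<bar> \<le> K3 * \<bar>B\<bar>" using K3(2) by (intro mult_mono) auto
        then show ?thesis using True by (simp add: abs_mult)
      qed (use K3 in simp)
    qed
    then show ?thesis by (subst (asm) Bochner_Integration.integrable_cong[OF refl, where g = "?I j"]) simp_all
  qed
  have zero: "AE x in M. (\<Sum>j\<in>UNIV. ?I j x) = 0"
    using AE_radial[OF normal] AE_lborel_M[OF AE_normal]
  proof eventually_elim
    case (elim x)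
    then have n: "is_outward_normal \<Omega> (\<pi> x) ((1 / norm (\<gamma> x)) *\<^sub>R \<gamma> x)" and g: "\<gamma> x \<noteq> 0" by auto
    have "outward_normal \<Omega> (\<pi> x) = (1 / norm (\<gamma> x)) *\<^sub>R \<gamma> x"
      unfolding outward_normal_def using n by (rule the_equality) (rule is_outward_normal_unique[OF _ n])
    then have "S (\<pi> x) \<bullet> \<gamma> x = 0" using elim g by simp
    moreover have "(\<Sum>j\<in>UNIV. ?I j x) = \<psi> (\<pi> x) * (S (\<pi> x) \<bullet> \<gamma> x)"
      by (simp add: inner_vec_def sum_distrib_left mult_ac)
    ultimately show ?case by simp
  qed
  have "(\<Sum>j\<in>UNIV. \<integral>x. weak_partial \<Omega> j (\<lambda>x. s x $ j) x * \<psi> x \<partial>L)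
      + (\<Sum>j\<in>UNIV. \<integral>x. s x $ j * partial j \<psi> x \<partial>L) = (\<Sum>j\<in>UNIV. \<integral>x. ?I j x \<partial>M)"
    by (simp add: sum.distrib[symmetric] green_trace[OF tr \<psi>])
  also have "\<dots> = (\<integral>x. (\<Sum>j\<in>UNIV. ?I j x) \<partial>M)"
    using int by (intro Bochner_Integration.integral_sum[symmetric])
  also have "\<dots> = 0" using zero by (rule integral_eq_zero_AE)
  finally show ?thesis by simp
qed

end

section \<open>A priori estimates for compactly supported smooth fields\<close>

text \<open>Two applications of the mean value theorem. The second difference is symmetric in
  \<open>a\<close> and \<open>b\<close>, so reading it in both orders and letting \<open>h\<close>
  tend to 0 gives the symmetry of second derivatives in \<open>partial_commute\<close>.\<close>

lemma C_infinity_mixed_second_difference: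
  fixes \<phi> :: "real^'n::finite \<Rightarrow> real"
  assumes \<phi>: "\<phi> \<in> C_infinity" and h: "h > 0"
  obtains \<xi> where "norm (\<xi> - x) \<le> 2 * h"
    "\<phi> (x + h *\<^sub>R axis a 1 + h *\<^sub>R axis b 1) - \<phi> (x + h *\<^sub>R axis a 1) - \<phi> (x + h *\<^sub>R axis b 1) + \<phi> x
      = h * (h * partial b (partial a \<phi>) \<xi>)"
proof -
  define G where "G y = \<phi> (h *\<^sub>R axis b 1 + 1 *\<^sub>R y) - \<phi> y" for y
  have G: "G \<in> C_infinity"
    unfolding G_def[abs_def] by (intro C_infinity_diff C_infinity_affine \<phi>)
  have pG: "partial a G y = partial a \<phi> (y + h *\<^sub>R axis b 1) - partial a \<phi> y" for y
  proof -
    have d: "(\<lambda>y. \<phi> (h *\<^sub>R axis b 1 + 1 *\<^sub>R y)) differentiable at y"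
      by (rule C_infinity_differentiable[OF C_infinity_affine[OF \<phi>]])
    have "(G has_derivative (\<lambda>k. frechet_derivative (\<lambda>y. \<phi> (h *\<^sub>R axis b 1 + 1 *\<^sub>R y)) (at y) k - frechet_derivative \<phi> (at y) k)) (at y)"
      unfolding G_def[abs_def] using d C_infinity_differentiable[OF \<phi>, of y]
      by (intro has_derivative_diff) (simp_all only: frechet_derivative_works)
    then have "partial a G y = partial a (\<lambda>y. \<phi> (h *\<^sub>R axis b 1 + 1 *\<^sub>R y)) y - partial a \<phi> y"
      by (subst partial_eqI) (simp_all add: partial_def)
    also have "partial a (\<lambda>y. \<phi> (h *\<^sub>R axis b 1 + 1 *\<^sub>R y)) y = partial a \<phi> (y + h *\<^sub>R axis b 1)"
      by (subst partial_affine[OF C_infinity_differentiable[OF \<phi>]]) (simp add: add.commute)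
    finally show ?thesis .
  qed
  obtain t where t: "0 < t" "t < h" "G (x + h *\<^sub>R axis a 1) - G x = h * partial a G (x + t *\<^sub>R axis a 1)"
    using C_infinity_line_mean_value[OF G h] by metis
  let ?y = "x + t *\<^sub>R axis a 1"
  obtain s where s: "0 < s" "s < h" "partial a \<phi> (?y + h *\<^sub>R axis b 1) - partial a \<phi> ?y
      = h * partial b (partial a \<phi>) (?y + s *\<^sub>R axis b 1)"
    using C_infinity_line_mean_value[OF C_infinity_partial[OF \<phi>] h] by metis
  show ?thesis
  proof (rule that[of "?y + s *\<^sub>R axis b 1"])
    have "norm (t *\<^sub>R (axis a 1 :: real^'n) + s *\<^sub>R axis b 1) \<le> norm (t *\<^sub>R (axis a 1 :: real^'n)) + norm (s *\<^sub>R (axis b 1 :: real^'n))"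
      by (rule norm_triangle_ineq)
    then show "norm (?y + s *\<^sub>R axis b 1 - x) \<le> 2 * h" using t s by simp
    show "\<phi> (x + h *\<^sub>R axis a 1 + h *\<^sub>R axis b 1) - \<phi> (x + h *\<^sub>R axis a 1) - \<phi> (x + h *\<^sub>R axis b 1) + \<phi> x
        = h * (h * partial b (partial a \<phi>) (?y + s *\<^sub>R axis b 1))"
      using t(3) s(3) by (simp add: pG) (simp add: G_def add_ac)
  qed
qed

lemma partial_commute:
  fixes \<phi> :: "real^'n::finite \<Rightarrow> real"
  assumes \<phi>: "\<phi> \<in> C_infinity"
  shows "partial a (partial b \<phi>) x = partial b (partial a \<phi>) x"
proof -
  have pts: "\<exists>\<xi> \<eta>. norm (\<xi> - x) \<le> 2 * h \<and> norm (\<eta> - x) \<le> 2 * h \<and>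
      partial b (partial a \<phi>) \<xi> = partial a (partial b \<phi>) \<eta>" if h: "h > 0" for h
  proof -
    obtain \<xi> where \<xi>: "norm (\<xi> - x) \<le> 2 * h"
      "\<phi> (x + h *\<^sub>R axis a 1 + h *\<^sub>R axis b 1) - \<phi> (x + h *\<^sub>R axis a 1) - \<phi> (x + h *\<^sub>R axis b 1) + \<phi> x
        = h * (h * partial b (partial a \<phi>) \<xi>)"
      using C_infinity_mixed_second_difference[OF \<phi> h] by metis
    obtain \<eta> where \<eta>: "norm (\<eta> - x) \<le> 2 * h"
      "\<phi> (x + h *\<^sub>R axis b 1 + h *\<^sub>R axis a 1) - \<phi> (x + h *\<^sub>R axis b 1) - \<phi> (x + h *\<^sub>R axis a 1) + \<phi> x
        = h * (h * partial a (partial b \<phi>) \<eta>)"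
      using C_infinity_mixed_second_difference[OF \<phi> h] by metis
    have eq: "x + h *\<^sub>R axis b 1 + h *\<^sub>R axis a 1 = x + h *\<^sub>R axis a 1 + h *\<^sub>R axis b 1" by simp
    have "h * (h * partial b (partial a \<phi>) \<xi>) = h * (h * partial a (partial b \<phi>) \<eta>)"
      using \<xi>(2) \<eta>(2)[unfolded eq] by linarith
    then have "partial b (partial a \<phi>) \<xi> = partial a (partial b \<phi>) \<eta>" using h by simp
    then show ?thesis using \<xi>(1) \<eta>(1) by blast
  qed
  have "\<forall>n. \<exists>\<xi> \<eta>. norm (\<xi> - x) \<le> 2 * (1 / real (Suc n)) \<and> norm (\<eta> - x) \<le> 2 * (1 / real (Suc n)) \<and>
      partial b (partial a \<phi>) \<xi> = partial a (partial b \<phi>) \<eta>"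
    by (intro allI pts) simp
  then obtain \<xi> \<eta> where *: "\<And>n. norm (\<xi> n - x) \<le> 2 * (1 / real (Suc n))"
      "\<And>n. norm (\<eta> n - x) \<le> 2 * (1 / real (Suc n))"
      "\<And>n. partial b (partial a \<phi>) (\<xi> n) = partial a (partial b \<phi>) (\<eta> n)"
    by metis
  have z: "(\<lambda>n. 2 * (1 / real (Suc n))) \<longlonglongrightarrow> 0"
    using tendsto_mult_left[OF LIMSEQ_inverse_real_of_nat, of 2] by (simp add: inverse_eq_divide)
  have lim: "\<zeta> \<longlonglongrightarrow> x" if "\<And>n. norm (\<zeta> n - x) \<le> 2 * (1 / real (Suc n))" for \<zeta> :: "nat \<Rightarrow> real^'n"
    by (rule LIM_zero_cancel, rule Lim_null_comparison[OF always_eventually[OF allI] z], rule that)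
  have cont: "isCont (partial a (partial b \<phi>)) x" "isCont (partial b (partial a \<phi>)) x"
    using \<phi> by (auto intro!: differentiable_imp_continuous_within C_infinity_differentiable)
  have "(\<lambda>n. partial b (partial a \<phi>) (\<xi> n)) \<longlonglongrightarrow> partial b (partial a \<phi>) x"
    "(\<lambda>n. partial a (partial b \<phi>) (\<eta> n)) \<longlonglongrightarrow> partial a (partial b \<phi>) x"
    by (rule isCont_tendsto_compose[OF cont(2) lim[OF *(1)]], rule isCont_tendsto_compose[OF cont(1) lim[OF *(2)]])
  then show ?thesis unfolding *(3) by (rule LIMSEQ_unique[rotated])
qed

text \<open>One integration by parts on either side leads to the same integral of \<open>Y\<close>
  against a mixed second derivative of \<open>X\<close>.\<close>

lemma integral_partial_swap:
  assumes X: "X \<in> test_functions UNIV" and Y: "Y \<in> test_functions UNIV"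
  shows "(\<integral>x. partial a X x * partial b Y x \<partial>lborel) = (\<integral>x. partial b X x * partial a Y x \<partial>lborel)"
proof -
  have XC: "X \<in> C_infinity" using X by (rule test_function_C_infinity)
  show ?thesis
    using integral_by_parts_test_function[OF C_infinity_partial[OF XC] Y, of a b]
      integral_by_parts_test_function[OF C_infinity_partial[OF XC] Y, of b a]
    by (simp add: partial_commute[OF XC, of a b])
qed

lemma integrable_test_mult:
  assumes "X \<in> test_functions UNIV" "Y \<in> test_functions UNIV"
  shows "integrable lborel (\<lambda>x. X x * Y x)"
  by (rule integrable_test_function[OF test_functions_mult[OF test_function_C_infinity[OF assms(1)] assms(2)]])

lemma partial_sum:
  assumes "\<And>i. i \<in> I \<Longrightarrow> f i \<in> C_infinity"
  shows "partial j (\<lambda>x. \<Sum>i\<in>I. f i x) = (\<lambda>x. \<Sum>i\<in>I. partial j (f i) x)"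
  using assms
proof (induction I rule: infinite_finite_induct)
  case (insert i I)
  then show ?case
    by (intro ext) (simp, subst partial_add; auto intro!: C_infinity_differentiable C_infinity_sum)
qed auto

text \<open>Swapping derivatives between the two factors turns each squared mixed derivative into a
  product of pure second derivatives, and these products sum to the squared Laplacian. The Hessian
  is thereby controlled with constant 1.\<close>

lemma integral_hessian_square:
  fixes W :: "real^'n::finite \<Rightarrow> real"
  assumes W: "W \<in> test_functions UNIV"
  shows "(\<Sum>a\<in>UNIV. \<Sum>b\<in>UNIV. \<integral>x. (partial a (partial b W) x)\<^sup>2 \<partial>lborel)
    = (\<integral>x. (\<Sum>a\<in>UNIV. partial a (partial a W) x)\<^sup>2 \<partial>lborel)"
proof -
  have WC: "W \<in> C_infinity" using W by (rule test_function_C_infinity)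
  note t = test_functions_partial[OF test_functions_partial[OF W]]
  have "(\<integral>x. (partial a (partial b W) x)\<^sup>2 \<partial>lborel)
      = (\<integral>x. partial a (partial a W) x * partial b (partial b W) x \<partial>lborel)" for a b
  proof -
    have "(\<integral>x. (partial a (partial b W) x)\<^sup>2 \<partial>lborel) = (\<integral>x. partial a (partial b W) x * partial b (partial a W) x \<partial>lborel)"
      using partial_commute[OF WC, of a b] by (simp add: power2_eq_square)
    also have "\<dots> = (\<integral>x. partial b (partial b W) x * partial a (partial a W) x \<partial>lborel)"
      by (rule integral_partial_swap) (use W in auto)
    finally show ?thesis by (simp add: mult.commute)
  qed
  then have "(\<Sum>a\<in>UNIV. \<Sum>b\<in>UNIV. \<integral>x. (partial a (partial b W) x)\<^sup>2 \<partial>lborel)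
      = (\<Sum>a\<in>UNIV. \<Sum>b\<in>UNIV. \<integral>x. partial a (partial a W) x * partial b (partial b W) x \<partial>lborel)"
    by simp
  also have "\<dots> = (\<integral>x. (\<Sum>a\<in>UNIV. \<Sum>b\<in>UNIV. partial a (partial a W) x * partial b (partial b W) x) \<partial>lborel)"
    using integrable_test_mult[OF t t] by simp
  also have "\<dots> = (\<integral>x. (\<Sum>a\<in>UNIV. partial a (partial a W) x)\<^sup>2 \<partial>lborel)"
    by (simp add: power2_eq_square sum_product)
  finally show ?thesis .
qed

text \<open>Row \<open>i\<close> of the divergence of the stress, left in the order of derivatives
  in which the weak form produces it, so that the mollified equation matches it term by term. The
  estimate below regroups it into Laplacian and gradient of the divergence.\<close>

definition lame :: "real \<Rightarrow> real \<Rightarrow> ('n \<Rightarrow> real^'n::finite \<Rightarrow> real) \<Rightarrow> 'n \<Rightarrow> real^'n \<Rightarrow> real" where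
  "lame lam mu W i x = (\<Sum>j\<in>UNIV. mu * (partial j (partial j (W i)) x + partial i (partial j (W j)) x))
    + lam * (\<Sum>k\<in>UNIV. partial k (partial i (W k)) x)"

text \<open>Two integrations by parts turn the cross term \<open>\<nabla> div W \<bullet> \<Delta> W\<close> into the square of \<open>\<nabla> div W\<close>.\<close>

lemma lame_laplacian_estimate:
  fixes W :: "'n::finite \<Rightarrow> real^'n \<Rightarrow> real"
  assumes W: "\<And>i. W i \<in> test_functions UNIV" and lam: "lam \<ge> 0" and mu: "mu > 0"
  shows "mu\<^sup>2 * (\<Sum>i\<in>UNIV. \<integral>x. (\<Sum>a\<in>UNIV. partial a (partial a (W i)) x)\<^sup>2 \<partial>lborel)
    \<le> (\<Sum>i\<in>UNIV. \<integral>x. (lame lam mu W i x)\<^sup>2 \<partial>lborel)"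
proof -
  have WC: "W i \<in> C_infinity" for i using W by (rule test_function_C_infinity)
  define Lap where "Lap i x = (\<Sum>a\<in>UNIV. partial a (partial a (W i)) x)" for i x
  define Dv where "Dv x = (\<Sum>j\<in>UNIV. partial j (W j) x)" for x
  have Dv: "Dv \<in> test_functions UNIV"
    unfolding Dv_def[abs_def] by (intro test_functions_sum test_functions_partial W)
  have Lap: "Lap i \<in> test_functions UNIV" for i
    unfolding Lap_def[abs_def] by (intro test_functions_sum test_functions_partial W)
  have pDv: "partial i Dv x = (\<Sum>j\<in>UNIV. partial i (partial j (W j)) x)" for i x
    unfolding Dv_def[abs_def] by (subst partial_sum) (auto intro: WC)
  have F: "lame lam mu W i x = mu * Lap i x + (mu + lam) * partial i Dv x" for i x
  proof -
    have "(\<Sum>k\<in>UNIV. partial k (partial i (W k)) x) = partial i Dv x"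
      unfolding pDv by (intro sum.cong refl partial_commute WC)
    then show ?thesis
      by (simp add: lame_def Lap_def pDv sum.distrib sum_distrib_left[symmetric] distrib_left distrib_right)
  qed
  have cross: "(\<Sum>i\<in>UNIV. \<integral>x. partial i Dv x * Lap i x \<partial>lborel) = (\<Sum>k\<in>UNIV. \<integral>x. (partial k Dv x)\<^sup>2 \<partial>lborel)"
  proof -
    have "(\<integral>x. partial i Dv x * Lap i x \<partial>lborel) = (\<Sum>k\<in>UNIV. \<integral>x. partial k Dv x * partial k (partial i (W i)) x \<partial>lborel)" for i
    proof -
      have "(\<integral>x. partial i Dv x * Lap i x \<partial>lborel) = (\<integral>x. (\<Sum>k\<in>UNIV. partial i Dv x * partial k (partial k (W i)) x) \<partial>lborel)"
        by (simp add: Lap_def sum_distrib_left)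
      also have "\<dots> = (\<Sum>k\<in>UNIV. \<integral>x. partial i Dv x * partial k (partial k (W i)) x \<partial>lborel)"
        using W Dv by (intro Bochner_Integration.integral_sum integrable_test_mult) auto
      also have "\<dots> = (\<Sum>k\<in>UNIV. \<integral>x. partial k Dv x * partial i (partial k (W i)) x \<partial>lborel)"
        using W Dv by (intro sum.cong refl integral_partial_swap) auto
      also have "\<dots> = (\<Sum>k\<in>UNIV. \<integral>x. partial k Dv x * partial k (partial i (W i)) x \<partial>lborel)"
        by (simp add: partial_commute[OF WC, of i])
      finally show ?thesis .
    qed
    then have "(\<Sum>i\<in>UNIV. \<integral>x. partial i Dv x * Lap i x \<partial>lborel)
        = (\<Sum>i\<in>UNIV. \<Sum>k\<in>UNIV. \<integral>x. partial k Dv x * partial k (partial i (W i)) x \<partial>lborel)"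
      by simp
    also have "\<dots> = (\<Sum>k\<in>UNIV. \<Sum>i\<in>UNIV. \<integral>x. partial k Dv x * partial k (partial i (W i)) x \<partial>lborel)"
      by (rule sum.swap)
    also have "\<dots> = (\<Sum>k\<in>UNIV. \<integral>x. (\<Sum>i\<in>UNIV. partial k Dv x * partial k (partial i (W i)) x) \<partial>lborel)"
      using W Dv by (intro sum.cong refl Bochner_Integration.integral_sum[symmetric] integrable_test_mult) auto
    also have "\<dots> = (\<Sum>k\<in>UNIV. \<integral>x. (partial k Dv x)\<^sup>2 \<partial>lborel)"
      by (simp add: power2_eq_square pDv sum_distrib_left)
    finally show ?thesis .
  qed
  have i1: "integrable lborel (\<lambda>x. (Lap i x)\<^sup>2)" "integrable lborel (\<lambda>x. partial i Dv x * Lap i x)"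
    "integrable lborel (\<lambda>x. (partial i Dv x)\<^sup>2)" for i
    unfolding power2_eq_square using Lap Dv by (auto intro!: integrable_test_mult)
  have i2: "integrable lborel (\<lambda>x. (lame lam mu W i x)\<^sup>2)" for i
  proof -
    have "(\<lambda>x. (lame lam mu W i x)\<^sup>2)
        = (\<lambda>x. mu\<^sup>2 * (Lap i x)\<^sup>2 + 2 * mu * (mu + lam) * (partial i Dv x * Lap i x) + (mu + lam)\<^sup>2 * (partial i Dv x)\<^sup>2)"
      unfolding F by (simp add: fun_eq_iff power2_sum power_mult_distrib)
    then show ?thesis using i1 by simp
  qed
  \<comment> \<open>The square of the gradient of the divergence is discarded. The mixed term is
    kept: by \<open>cross\<close> its integral, summed over the rows, is nonnegative.\<close>
  have sq: "mu\<^sup>2 * a\<^sup>2 + 2 * (mu * s) * (c * a) \<le> (mu * a + s * c)\<^sup>2" for s a c :: real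
    using zero_le_power2[of "s * c"] by (simp add: power2_sum power_mult_distrib mult_ac)
  have "mu\<^sup>2 * (\<integral>x. (Lap i x)\<^sup>2 \<partial>lborel) + 2 * (mu * (mu + lam)) * (\<integral>x. partial i Dv x * Lap i x \<partial>lborel)
      \<le> (\<integral>x. (lame lam mu W i x)\<^sup>2 \<partial>lborel)" for i
  proof -
    have "mu\<^sup>2 * (\<integral>x. (Lap i x)\<^sup>2 \<partial>lborel) + 2 * (mu * (mu + lam)) * (\<integral>x. partial i Dv x * Lap i x \<partial>lborel)
        = (\<integral>x. mu\<^sup>2 * (Lap i x)\<^sup>2 + 2 * (mu * (mu + lam)) * (partial i Dv x * Lap i x) \<partial>lborel)"
      using i1[of i] by simp
    also have "\<dots> \<le> (\<integral>x. (lame lam mu W i x)\<^sup>2 \<partial>lborel)"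
    proof (rule integral_mono)
      show "mu\<^sup>2 * (Lap i x)\<^sup>2 + 2 * (mu * (mu + lam)) * (partial i Dv x * Lap i x) \<le> (lame lam mu W i x)\<^sup>2" for x
        unfolding F by (rule sq)
    qed (use i1 i2 in auto)
    finally show ?thesis .
  qed
  then have "(\<Sum>i\<in>UNIV. mu\<^sup>2 * (\<integral>x. (Lap i x)\<^sup>2 \<partial>lborel) + 2 * (mu * (mu + lam)) * (\<integral>x. partial i Dv x * Lap i x \<partial>lborel))
      \<le> (\<Sum>i\<in>UNIV. \<integral>x. (lame lam mu W i x)\<^sup>2 \<partial>lborel)"
    by (rule sum_mono)
  then have "mu\<^sup>2 * (\<Sum>i\<in>UNIV. \<integral>x. (Lap i x)\<^sup>2 \<partial>lborel)
      + 2 * (mu * (mu + lam)) * (\<Sum>i\<in>UNIV. \<integral>x. partial i Dv x * Lap i x \<partial>lborel)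
      \<le> (\<Sum>i\<in>UNIV. \<integral>x. (lame lam mu W i x)\<^sup>2 \<partial>lborel)"
    by (simp add: sum.distrib sum_distrib_left)
  moreover have "0 \<le> 2 * (mu * (mu + lam)) * (\<Sum>i\<in>UNIV. \<integral>x. partial i Dv x * Lap i x \<partial>lborel)"
    unfolding cross using lam mu by (intro mult_nonneg_nonneg sum_nonneg integral_nonneg_AE) auto
  ultimately show ?thesis by (simp add: Lap_def)
qed

lemma lame_hessian_estimate:
  fixes W :: "'n::finite \<Rightarrow> real^'n \<Rightarrow> real"
  assumes W: "\<And>i. W i \<in> test_functions UNIV" and lam: "lam \<ge> 0" and mu: "mu > 0"
  shows "mu\<^sup>2 * (\<integral>x. (partial a (partial b (W i)) x)\<^sup>2 \<partial>lborel)
    \<le> (\<Sum>i\<in>UNIV. \<integral>x. (lame lam mu W i x)\<^sup>2 \<partial>lborel)"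
proof -
  let ?H = "\<lambda>a b i. \<integral>x. (partial a (partial b (W i)) x)\<^sup>2 \<partial>lborel"
  have nn: "0 \<le> ?H a b i" for a b i by (intro integral_nonneg_AE) auto
  have "?H a b i \<le> (\<Sum>b\<in>UNIV. ?H a b i)" by (rule member_le_sum) (auto simp: nn)
  also have "\<dots> \<le> (\<Sum>a\<in>UNIV. \<Sum>b\<in>UNIV. ?H a b i)"
    by (rule member_le_sum[of a UNIV "\<lambda>a. \<Sum>b\<in>UNIV. ?H a b i"]) (auto simp: nn sum_nonneg)
  also have "\<dots> \<le> (\<Sum>i\<in>UNIV. \<Sum>a\<in>UNIV. \<Sum>b\<in>UNIV. ?H a b i)"
    by (rule member_le_sum[of i UNIV "\<lambda>i. \<Sum>a\<in>UNIV. \<Sum>b\<in>UNIV. ?H a b i"]) (auto simp: nn sum_nonneg)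
  also have "\<dots> = (\<Sum>i\<in>UNIV. \<integral>x. (\<Sum>a\<in>UNIV. partial a (partial a (W i)) x)\<^sup>2 \<partial>lborel)"
    by (simp add: integral_hessian_square[OF W])
  finally have "mu\<^sup>2 * ?H a b i \<le> mu\<^sup>2 * \<dots>" by (rule mult_left_mono) simp
  also note lame_laplacian_estimate[OF W lam mu]
  finally show ?thesis .
qed

lemma coordinate_C_infinity: "(\<lambda>x::real^'n::finite. x $ j) \<in> C_infinity" "partial i (\<lambda>x::real^'n. x $ j) = (\<lambda>_. if i = j then 1 else 0)"
proof -
  have D: "((\<lambda>x::real^'n. x $ j) has_derivative (\<lambda>h. h $ j)) (at x)" for x
    by (rule bounded_linear_imp_has_derivative[OF bounded_linear_vec_nth])
  show p: "partial i (\<lambda>x::real^'n. x $ j) = (\<lambda>_. if i = j then 1 else 0)" for i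
    by (intro ext, subst partial_eqI[OF D]) (simp add: axis_def)
  show "(\<lambda>x::real^'n. x $ j) \<in> C_infinity"
  proof (rule C_infinity_coinduct[where S = "insert (\<lambda>x. x $ j) C_infinity"])
    fix f :: "real^'n \<Rightarrow> real" and x i
    assume f: "f \<in> insert (\<lambda>x. x $ j) C_infinity"
    then show "f differentiable (at x)"
      using D by (auto intro: differentiableI C_infinity_differentiable)
    show "partial i f \<in> insert (\<lambda>x. x $ j) C_infinity"
      using f by (auto simp: p)
  qed simp
qed

text \<open>Integrating \<open>x $ j\<close> times the derivative of the square of \<open>W\<close>
  by parts produces the left side, and \<open>x $ j\<close> is at most \<open>R\<close> on the
  support. Young's inequality absorbs half of the left side and leaves \<open>2 * R\<^sup>2\<close>
  on the right; doubling gives the factor 4.\<close>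

lemma poincare_test_function:
  assumes W: "W \<in> test_functions UNIV" and R: "R \<ge> 0" "\<And>x. W x \<noteq> 0 \<Longrightarrow> norm x \<le> R"
  shows "(\<integral>x. (W x)\<^sup>2 \<partial>lborel) \<le> 4 * R\<^sup>2 * (\<integral>x. (partial j W x)\<^sup>2 \<partial>lborel)"
proof -
  let ?W2 = "\<lambda>x. W x * W x"
  have WC: "W \<in> C_infinity" using W by (rule test_function_C_infinity)
  have W2: "?W2 \<in> test_functions UNIV" using WC W by (rule test_functions_mult)
  have pW2: "partial j ?W2 x = 2 * (W x * partial j W x)" for x
    using partial_mult[OF C_infinity_differentiable[OF WC] C_infinity_differentiable[OF WC], of j x]
    by (simp add: mult.commute)
  have i1: "integrable lborel (\<lambda>x. (W x)\<^sup>2)" "integrable lborel (\<lambda>x. (partial j W x)\<^sup>2)"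
    unfolding power2_eq_square using W by (auto intro!: integrable_test_mult)
  have "(\<integral>x. (W x)\<^sup>2 \<partial>lborel) = - (\<integral>x. x $ j * partial j ?W2 x \<partial>lborel)"
    using integral_by_parts_test_function[OF coordinate_C_infinity(1) W2, of j j]
    by (simp add: coordinate_C_infinity(2) power2_eq_square)
  also have "\<dots> = (\<integral>x. - (x $ j * partial j ?W2 x) \<partial>lborel)" by simp
  also have "\<dots> \<le> (\<integral>x. (W x)\<^sup>2 / 2 + 2 * R\<^sup>2 * (partial j W x)\<^sup>2 \<partial>lborel)"
  proof (rule integral_mono)
    show "integrable lborel (\<lambda>x. - (x $ j * partial j ?W2 x))"
      by (intro Bochner_Integration.integrable_minus integrable_test_function[where \<Omega> = UNIV] test_functions_mult
          coordinate_C_infinity(1) test_functions_partial W2)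
    show "integrable lborel (\<lambda>x. (W x)\<^sup>2 / 2 + 2 * R\<^sup>2 * (partial j W x)\<^sup>2)"
      using i1 by simp
    fix x
    show "- (x $ j * partial j ?W2 x) \<le> (W x)\<^sup>2 / 2 + 2 * R\<^sup>2 * (partial j W x)\<^sup>2"
    proof (cases "W x = 0")
      case False
      have "\<bar>x $ j\<bar> \<le> R" using component_le_norm_cart[of x j] R(2)[OF False] by simp
      then have "(x $ j)\<^sup>2 \<le> R\<^sup>2" using power_mono[of "\<bar>x $ j\<bar>" R 2] by simp
      then have "(x $ j)\<^sup>2 * (partial j W x)\<^sup>2 \<le> R\<^sup>2 * (partial j W x)\<^sup>2" by (rule mult_right_mono) simp
      moreover define b where "b = x $ j * partial j W x"
      ultimately have "b\<^sup>2 \<le> R\<^sup>2 * (partial j W x)\<^sup>2" by (simp add: power_mult_distrib)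
      moreover have "0 \<le> (W x)\<^sup>2 + 4 * b\<^sup>2 + 4 * (W x * b)"
        using zero_le_power2[of "W x + 2 * b"] by (simp add: power2_sum power_mult_distrib)
      moreover have "x $ j * partial j ?W2 x = 2 * (W x * b)" by (simp add: pW2 b_def)
      ultimately show ?thesis by linarith
    qed (simp add: pW2)
  qed
  also have "\<dots> = (\<integral>x. (W x)\<^sup>2 \<partial>lborel) / 2 + 2 * R\<^sup>2 * (\<integral>x. (partial j W x)\<^sup>2 \<partial>lborel)"
    using i1 by simp
  finally show ?thesis by simp
qed

section \<open>Norm equivalence\<close>

lemma sum_le_of_bound:
  fixes f :: "'a::finite \<Rightarrow> real"
  assumes "\<And>i. f i \<le> c"
  shows "(\<Sum>i\<in>UNIV. f i) \<le> real CARD('a) * c"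
  using sum_bounded_above[of UNIV f c] assms by simp

context planar_domain
begin

section \<open>Norms on the domain recovered from mollifications on the whole plane\<close>

lemma L2_mult_C_infinity_integrable:
  fixes u :: "real^2 \<Rightarrow> real"
  assumes u: "u \<in> L2 L" and \<psi>: "\<psi> \<in> C_infinity"
  shows "integrable L (\<lambda>x. u x * \<psi> x)"
proof -
  obtain K where K: "\<And>x. x \<in> \<Omega> \<Longrightarrow> \<bar>\<psi> x\<bar> \<le> K" "K \<ge> 0"
    using C_infinity_bounded_on_bounded[OF \<psi> bounded] by metis
  have [measurable]: "\<psi> \<in> borel_measurable borel" using \<psi> by (rule C_infinity_measurable)
  have "integrable L (\<lambda>x. u x * (indicator \<Omega> x * \<psi> x))"
  proof (rule integrable_mult_bounded[OF finite_L.L2_integrable[OF u]])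
    show "(\<lambda>x. indicator \<Omega> x * \<psi> x) \<in> borel_measurable L"
      by (rule borel_measurable_lebesgue_on) measurable
    show "\<bar>indicator \<Omega> x * \<psi> x\<bar> \<le> K" for x using K by (auto simp: indicator_def)
  qed
  then show ?thesis
    by (subst (asm) Bochner_Integration.integrable_cong[OF refl, where g = "\<lambda>x. u x * \<psi> x"])
      (simp_all add: space_restrict_space)
qed

text \<open>The representative vanishes at every point outside \<Omega>, not merely at almost every
  one, which keeps the supports of its mollifications bounded.\<close>

lemma L2_borel_extension:
  fixes u :: "real^2 \<Rightarrow> real"
  assumes u: "u \<in> L2 L"
  obtains u' where "u' \<in> borel_measurable borel" "integrable lborel u'" "integrable lborel (\<lambda>x. (u' x)\<^sup>2)"
    "\<And>x. x \<notin> \<Omega> \<Longrightarrow> u' x = 0"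
    "\<And>\<phi>. \<phi> \<in> borel_measurable borel \<Longrightarrow> (\<integral>x. u x * \<phi> x \<partial>L) = (\<integral>x. u' x * \<phi> x \<partial>lborel)"
    "(\<integral>\<^sup>+x. ennreal ((u' x)\<^sup>2) \<partial>lborel) = ennreal ((L2_norm L u)\<^sup>2)"
proof -
  have ui: "integrable L u" by (rule finite_L.L2_integrable[OF u])
  have um: "u \<in> borel_measurable L" using ui by auto
  obtain v where v: "v \<in> borel_measurable borel" "integrable lborel v" "AE x in lborel. v x = indicator \<Omega> x * u x"
    using borel_representative[OF ui \<Omega>_lebesgue] by metis
  define u' where "u' x = indicator \<Omega> x * v x" for x
  have [measurable]: "v \<in> borel_measurable borel" by (rule v(1))
  have m [measurable]: "u' \<in> borel_measurable borel" unfolding u'_def[abs_def] by measurable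
  have AE: "AE x in lborel. u' x = indicator \<Omega> x * u x"
    using v(3) by eventually_elim (simp add: u'_def indicator_def)
  have i: "integrable lborel u'"
    by (rule Bochner_Integration.integrable_bound[OF v(2)]) (auto simp: u'_def indicator_def)
  have sqi: "integrable lebesgue (\<lambda>x. indicator \<Omega> x *\<^sub>R (u x)\<^sup>2)" "(\<integral>x. indicator \<Omega> x *\<^sub>R (u x)\<^sup>2 \<partial>lebesgue) = (L2_norm L u)\<^sup>2"
    using u \<Omega>_lebesgue by (simp_all add: L2_def L2_norm_def integrable_restrict_space integral_restrict_space integral_nonneg_AE)
  have AE2: "AE x in lebesgue. (u' x)\<^sup>2 = indicator \<Omega> x *\<^sub>R (u x)\<^sup>2"
    using AE unfolding AE_completion_iff by eventually_elim (simp add: indicator_def)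
  have m2: "(\<lambda>x. (u' x)\<^sup>2) \<in> borel_measurable lborel" by measurable
  have m3: "(\<lambda>x. (u' x)\<^sup>2) \<in> borel_measurable lebesgue" using m2 by (rule measurable_completion)
  have "integrable lebesgue (\<lambda>x. (u' x)\<^sup>2)"
    using sqi(1) by (rule integrable_cong_AE_imp[OF _ m3]) (use AE2 in \<open>auto elim: eventually_mono\<close>)
  then have i2: "integrable lborel (\<lambda>x. (u' x)\<^sup>2)" using m2 by (simp only: integrable_completion)
  have "(\<integral>x. (u' x)\<^sup>2 \<partial>lborel) = (\<integral>x. (u' x)\<^sup>2 \<partial>lebesgue)"
    by (rule integral_completion[OF m2, symmetric])
  also have "\<dots> = (L2_norm L u)\<^sup>2"
    unfolding sqi(2)[symmetric] by (rule integral_cong_AE[OF m3 _ AE2]) (use sqi(1) in auto)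
  finally have "(\<integral>\<^sup>+x. ennreal ((u' x)\<^sup>2) \<partial>lborel) = ennreal ((L2_norm L u)\<^sup>2)"
    using i2 by (subst nn_integral_eq_integral) auto
  moreover have "(\<integral>x. u x * \<phi> x \<partial>L) = (\<integral>x. u' x * \<phi> x \<partial>lborel)" if "\<phi> \<in> borel_measurable borel" for \<phi>
    by (rule integral_borel_representative[OF \<Omega>_lebesgue m AE um that])
  ultimately show ?thesis
    using m i i2 by (intro that[of u']) (auto simp: u'_def)
qed

text \<open>The identity with \<open>G\<close> is demanded only at points whose ball of radius
  \<open>r\<close> lies in \<Omega>, the bound on \<open>G\<close> over the whole plane: global
  estimates for a mollified extension thus bound functions known only inside the domain.\<close>

lemma L2_norm_le_of_mollifications:
  fixes u :: "real^2 \<Rightarrow> real"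
  assumes u: "u \<in> L2 L" and E: "E \<ge> 0"
    and eq: "\<And>r x. 0 < r \<Longrightarrow> r < 1 \<Longrightarrow> cball x r \<subseteq> \<Omega> \<Longrightarrow> (\<integral>y. u y * mollifier r (x - y) \<partial>L) = G r x"
    and G: "\<And>r. 0 < r \<Longrightarrow> r < 1 \<Longrightarrow> integrable lborel (\<lambda>x. (G r x)\<^sup>2)"
      "\<And>r. 0 < r \<Longrightarrow> r < 1 \<Longrightarrow> (\<integral>x. (G r x)\<^sup>2 \<partial>lborel) \<le> E"
  shows "(L2_norm L u)\<^sup>2 \<le> E"
proof -
  obtain u' where u': "u' \<in> borel_measurable borel" "integrable lborel u'" "integrable lborel (\<lambda>x. (u' x)\<^sup>2)"
    "\<And>x. x \<notin> \<Omega> \<Longrightarrow> u' x = 0"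
    "\<And>\<phi>. \<phi> \<in> borel_measurable borel \<Longrightarrow> (\<integral>x. u x * \<phi> x \<partial>L) = (\<integral>x. u' x * \<phi> x \<partial>lborel)"
    "(\<integral>\<^sup>+x. ennreal ((u' x)\<^sup>2) \<partial>lborel) = ennreal ((L2_norm L u)\<^sup>2)"
    by (rule L2_borel_extension[OF u]) blast
  have "(\<integral>\<^sup>+x\<in>\<Omega>. ennreal ((u' x)\<^sup>2) \<partial>lborel) \<le> ennreal E"
  proof (rule L2_bound_of_mollified_bound[OF u'(2) op bounded E])
    fix K assume K: "compact K" "K \<subseteq> \<Omega>"
    obtain \<epsilon> where \<epsilon>: "\<epsilon> > 0" "(\<Union>x\<in>K. cball x \<epsilon>) \<subseteq> \<Omega>"
      using compact_subset_open_imp_cball_epsilon_subset[OF K(1) op K(2)] by metis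
    have "(\<integral>\<^sup>+x\<in>K. ennreal ((mollify r u' x)\<^sup>2) \<partial>lborel) \<le> ennreal E" if r: "0 < r" "r < min \<epsilon> 1" for r
    proof -
      have pt: "mollify r u' x = G r x" if "x \<in> K" for x
      proof -
        have "cball x r \<subseteq> \<Omega>" using \<epsilon>(2) r that subset_cball[of r \<epsilon> x] by auto
        then have "G r x = (\<integral>y. u y * mollifier r (x - y) \<partial>L)" using r by (intro eq[symmetric]) auto
        also have "\<dots> = mollify r u' x"
          unfolding conv_def by (rule u'(5)[OF C_infinity_measurable[OF C_infinity_reflect[OF mollifier_C_infinity]]])
        finally show ?thesis ..
      qed
      have "(\<integral>\<^sup>+x\<in>K. ennreal ((mollify r u' x)\<^sup>2) \<partial>lborel) \<le> (\<integral>\<^sup>+x. ennreal ((G r x)\<^sup>2) \<partial>lborel)"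
        by (rule nn_integral_mono) (auto simp: pt indicator_def)
      also have "\<dots> = ennreal (\<integral>x. (G r x)\<^sup>2 \<partial>lborel)"
        using r by (intro nn_integral_eq_integral G) auto
      also have "\<dots> \<le> ennreal E" using r by (intro ennreal_leI G) auto
      finally show ?thesis .
    qed
    then show "\<exists>d>0. \<forall>r. 0 < r \<and> r < d \<longrightarrow> (\<integral>\<^sup>+x\<in>K. ennreal ((mollify r u' x)\<^sup>2) \<partial>lborel) \<le> ennreal E"
      using \<epsilon>(1) by (intro exI[of _ "min \<epsilon> 1"]) auto
  qed
  also have "(\<integral>\<^sup>+x\<in>\<Omega>. ennreal ((u' x)\<^sup>2) \<partial>lborel) = (\<integral>\<^sup>+x. ennreal ((u' x)\<^sup>2) \<partial>lborel)"
    by (rule nn_integral_cong) (auto simp: indicator_def u'(4))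
  finally show ?thesis using u'(6) E by (simp add: ennreal_le_iff)
qed

section \<open>Components of norm and stress, and the weak form of the system\<close>

lemma H2_norm_square:
  "(H2_norm \<Omega> u)\<^sup>2 = (L2_norm L u)\<^sup>2 + (\<Sum>j\<in>UNIV. (L2_norm L (weak_partial \<Omega> j u))\<^sup>2)
    + (\<Sum>j\<in>UNIV. \<Sum>k\<in>UNIV. (L2_norm L (weak_partial \<Omega> k (weak_partial \<Omega> j u)))\<^sup>2)"
  unfolding H2_norm_def H1_norm_def
  by (subst (1 2) real_sqrt_pow2) (auto intro!: add_nonneg_nonneg sum_nonneg)

lemma H2_vec_norm_square: "(H2_vec_norm \<Omega> w)\<^sup>2 = (\<Sum>i\<in>UNIV. (H2_norm \<Omega> (\<lambda>x. w x $ i))\<^sup>2)"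
  unfolding H2_vec_norm_def by (rule real_sqrt_pow2) (auto intro: sum_nonneg)

lemma H2_vec_norm_nonneg: "0 \<le> H2_vec_norm \<Omega> w"
  unfolding H2_vec_norm_def by (auto intro: sum_nonneg)

lemma stress_component:
  "stress lam mu \<Omega> w x $ i $ j = mu * (weak_partial \<Omega> j (\<lambda>y. w y $ i) x + weak_partial \<Omega> i (\<lambda>y. w y $ j) x)
    + (if i = j then lam * (\<Sum>k\<in>UNIV. weak_partial \<Omega> k (\<lambda>y. w y $ k) x) else 0)"
  by (simp add: stress_def strain_def weak_gradient_def transpose_def trace_def mat_def algebra_simps)

lemma row_divergence_component:
  "row_divergence \<Omega> S x $ i = (\<Sum>j\<in>UNIV. weak_partial \<Omega> j (\<lambda>y. S y $ i $ j) x)"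
  by (simp add: row_divergence_def)

lemma H2_vec_facts:
  assumes "w \<in> H2_vec \<Omega>"
  shows "(\<lambda>x. w x $ i) \<in> H1 \<Omega>" "(\<lambda>x. w x $ i) \<in> L2 L"
    "weak_partial \<Omega> j (\<lambda>x. w x $ i) \<in> H1 \<Omega>" "weak_partial \<Omega> j (\<lambda>x. w x $ i) \<in> L2 L"
    "weak_partial \<Omega> k (weak_partial \<Omega> j (\<lambda>x. w x $ i)) \<in> L2 L"
proof -
  have w: "(\<lambda>x. w x $ i) \<in> H2 \<Omega>" using assms by (simp add: H2_vec_def)
  then show "(\<lambda>x. w x $ i) \<in> H1 \<Omega>" "weak_partial \<Omega> j (\<lambda>x. w x $ i) \<in> H1 \<Omega>" by (auto simp: H2_def)
  then show "(\<lambda>x. w x $ i) \<in> L2 L" "weak_partial \<Omega> j (\<lambda>x. w x $ i) \<in> L2 L"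
    "weak_partial \<Omega> k (weak_partial \<Omega> j (\<lambda>x. w x $ i)) \<in> L2 L"
    using H1_weak_partial(2)[OF op] by (auto simp: H1_def)
qed

text \<open>The test function is unrestricted at the boundary. Moving the first derivative uses the
  vanishing normal trace of the stress, moving the second the zero trace of \<open>w\<close>; taken
  for all such \<open>\<psi>\<close>, this is the Lame system for the zero extensions on the whole
  plane.\<close>

lemma V_space_weak_form:
  assumes w: "w \<in> V_space lam mu \<Omega>" and \<psi>: "\<psi> \<in> C_infinity"
  shows "(\<integral>x. row_divergence \<Omega> (stress lam mu \<Omega> w) x $ i * \<psi> x \<partial>L)
    = (\<Sum>j\<in>UNIV. mu * ((\<integral>x. w x $ i * partial j (partial j \<psi>) x \<partial>L) + (\<integral>x. w x $ j * partial i (partial j \<psi>) x \<partial>L)))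
      + lam * (\<Sum>k\<in>UNIV. \<integral>x. w x $ k * partial k (partial i \<psi>) x \<partial>L)"
    "(\<lambda>x. row_divergence \<Omega> (stress lam mu \<Omega> w) x $ i) \<in> L2 L"
proof -
  let ?s = "stress lam mu \<Omega> w"
  let ?D = "\<lambda>j i. weak_partial \<Omega> j (\<lambda>y. w y $ i)"
  have wH: "w \<in> H2_vec \<Omega>" and tr0: "\<And>i. has_trace \<Omega> (\<lambda>x. w x $ i) (\<lambda>x. 0)"
    using w by (auto simp: V_space_def)
  obtain S where S: "\<And>i j. has_trace \<Omega> (\<lambda>x. ?s x $ i $ j) (\<lambda>x. S x $ i $ j)"
    "AE x in surface_measure \<Omega>. S x *v outward_normal \<Omega> x = 0"
    using w by (auto simp: V_space_def)
  note facts = H2_vec_facts[OF wH]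
  have by1: "(\<integral>x. ?D j i x * \<phi> x \<partial>L) = - (\<integral>x. w x $ i * partial j \<phi> x \<partial>L)" if "\<phi> \<in> C_infinity" for i j \<phi>
    by (rule zero_trace_by_parts[OF tr0 that])
  have "AE x in surface_measure \<Omega>. S x $ i \<bullet> outward_normal \<Omega> x = 0"
    using S(2)
  proof eventually_elim
    case (elim x)
    then have "(S x *v outward_normal \<Omega> x) $ i = 0" by simp
    then show ?case by (simp add: matrix_vector_mult_def inner_vec_def)
  qed
  from zero_normal_trace_by_parts[where s = "\<lambda>x. ?s x $ i" and S = "\<lambda>x. S x $ i", OF S(1) this \<psi>]
  have weak: "(\<Sum>j\<in>UNIV. \<integral>x. weak_partial \<Omega> j (\<lambda>x. ?s x $ i $ j) x * \<psi> x \<partial>L)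
    = - (\<Sum>j\<in>UNIV. \<integral>x. ?s x $ i $ j * partial j \<psi> x \<partial>L)" .
  have dL2: "weak_partial \<Omega> j (\<lambda>x. ?s x $ i $ j) \<in> L2 L" for j
    using S(1)[of i j] by (intro H1_weak_partial(2)[OF op]) (simp add: has_trace_def)
  have fi: "row_divergence \<Omega> ?s x $ i = weak_partial \<Omega> 1 (\<lambda>x. ?s x $ i $ 1) x + weak_partial \<Omega> 2 (\<lambda>x. ?s x $ i $ 2) x" for x
    by (simp add: row_divergence_component sum_2)
  show "(\<lambda>x. row_divergence \<Omega> ?s x $ i) \<in> L2 L"
    unfolding fi using L2_lincomb[OF dL2[of 1] dL2[of 2], of 1 1] by simp
  have int: "integrable L (\<lambda>x. weak_partial \<Omega> j (\<lambda>x. ?s x $ i $ j) x * \<psi> x)" for j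
    using dL2 \<psi> by (rule L2_mult_C_infinity_integrable)
  have int1: "integrable L (\<lambda>x. ?D j k x * \<phi> x)" if "\<phi> \<in> C_infinity" for j k \<phi>
    using facts(4) that by (rule L2_mult_C_infinity_integrable)
  have "(\<integral>x. row_divergence \<Omega> ?s x $ i * \<psi> x \<partial>L)
      = (\<Sum>j\<in>UNIV. \<integral>x. weak_partial \<Omega> j (\<lambda>x. ?s x $ i $ j) x * \<psi> x \<partial>L)"
    using int by (simp add: row_divergence_component sum_distrib_right)
  also have "\<dots> = (\<Sum>j\<in>UNIV. - (\<integral>x. ?s x $ i $ j * partial j \<psi> x \<partial>L))"
    unfolding weak by (simp add: sum_negf)
  also have "\<dots> = (\<Sum>j\<in>UNIV. mu * ((\<integral>x. w x $ i * partial j (partial j \<psi>) x \<partial>L) + (\<integral>x. w x $ j * partial i (partial j \<psi>) x \<partial>L))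
      + (if i = j then lam * (\<Sum>k\<in>UNIV. \<integral>x. w x $ k * partial k (partial i \<psi>) x \<partial>L) else 0))"
  proof (rule sum.cong[OF refl])
    fix j
    have p\<psi>: "partial j \<psi> \<in> C_infinity" using \<psi> by auto
    have div: "integrable L (\<lambda>x. (if i = j then lam * (\<Sum>k\<in>UNIV. ?D k k x) else 0) * partial j \<psi> x)"
      "(\<integral>x. (if i = j then lam * (\<Sum>k\<in>UNIV. ?D k k x) else 0) * partial j \<psi> x \<partial>L)
        = (if i = j then lam * (\<Sum>k\<in>UNIV. - (\<integral>x. w x $ k * partial k (partial j \<psi>) x \<partial>L)) else 0)"
    proof -
      have eq: "(\<lambda>x. (if i = j then lam * (\<Sum>k\<in>UNIV. ?D k k x) else 0) * partial j \<psi> x)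
          = (\<lambda>x. (if i = j then lam else 0) * (\<Sum>k\<in>UNIV. ?D k k x * partial j \<psi> x))"
        by (auto simp: sum_distrib_right)
      have i: "integrable L (\<lambda>x. \<Sum>k\<in>UNIV. ?D k k x * partial j \<psi> x)"
        using int1[OF p\<psi>] by (intro Bochner_Integration.integrable_sum)
      show "integrable L (\<lambda>x. (if i = j then lam * (\<Sum>k\<in>UNIV. ?D k k x) else 0) * partial j \<psi> x)"
        unfolding eq using i by (rule integrable_mult_right)
      show "(\<integral>x. (if i = j then lam * (\<Sum>k\<in>UNIV. ?D k k x) else 0) * partial j \<psi> x \<partial>L)
        = (if i = j then lam * (\<Sum>k\<in>UNIV. - (\<integral>x. w x $ k * partial k (partial j \<psi>) x \<partial>L)) else 0)"
        unfolding eq integral_mult_right_zero using int1[OF p\<psi>]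
        by (simp add: Bochner_Integration.integral_sum by1[OF p\<psi>])
    qed
    have eq: "?s x $ i $ j * partial j \<psi> x = mu * (?D j i x * partial j \<psi> x + ?D i j x * partial j \<psi> x)
        + (if i = j then lam * (\<Sum>k\<in>UNIV. ?D k k x) else 0) * partial j \<psi> x" for x
      unfolding stress_component by (simp add: algebra_simps)
    have s: "(\<integral>x. ?s x $ i $ j * partial j \<psi> x \<partial>L) = mu * ((\<integral>x. ?D j i x * partial j \<psi> x \<partial>L) + (\<integral>x. ?D i j x * partial j \<psi> x \<partial>L))
        + (\<integral>x. (if i = j then lam * (\<Sum>k\<in>UNIV. ?D k k x) else 0) * partial j \<psi> x \<partial>L)"
      unfolding eq using int1[OF p\<psi>] div(1)
      by (subst Bochner_Integration.integral_add) (auto intro!: Bochner_Integration.integrable_add integrable_mult_right)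
    show "- (\<integral>x. ?s x $ i $ j * partial j \<psi> x \<partial>L)
      = mu * ((\<integral>x. w x $ i * partial j (partial j \<psi>) x \<partial>L) + (\<integral>x. w x $ j * partial i (partial j \<psi>) x \<partial>L))
        + (if i = j then lam * (\<Sum>k\<in>UNIV. \<integral>x. w x $ k * partial k (partial i \<psi>) x \<partial>L) else 0)"
      unfolding s by1[OF p\<psi>] div(2) by (auto simp: sum_negf algebra_simps)
  qed
  also have "\<dots> = (\<Sum>j\<in>UNIV. mu * ((\<integral>x. w x $ i * partial j (partial j \<psi>) x \<partial>L) + (\<integral>x. w x $ j * partial i (partial j \<psi>) x \<partial>L)))
      + lam * (\<Sum>k\<in>UNIV. \<integral>x. w x $ k * partial k (partial i \<psi>) x \<partial>L)"
    by (simp add: sum.distrib)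
  finally show "(\<integral>x. row_divergence \<Omega> ?s x $ i * \<psi> x \<partial>L) = \<dots>" .
qed

lemma L2_norm_vec_square:
  fixes f :: "real^2 \<Rightarrow> real^2"
  assumes "\<And>i. (\<lambda>x. f x $ i) \<in> L2 L"
  shows "(L2_norm L f)\<^sup>2 = (\<Sum>i\<in>UNIV. (L2_norm L (\<lambda>x. f x $ i))\<^sup>2)"
proof -
  have i: "integrable L (\<lambda>x. (f x $ i)\<^sup>2)" for i using assms[of i] by (simp add: L2_def)
  have "(norm (f x))\<^sup>2 = (\<Sum>i\<in>UNIV. (f x $ i)\<^sup>2)" for x
    unfolding power2_norm_eq_inner by (simp add: inner_vec_def power2_eq_square)
  then have "(\<integral>x. (norm (f x))\<^sup>2 \<partial>L) = (\<Sum>i\<in>UNIV. \<integral>x. (f x $ i)\<^sup>2 \<partial>L)"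
    using i by simp
  then show ?thesis
    by (simp add: L2_norm_def integral_nonneg_AE sum_nonneg)
qed

text \<open>Testing with the mollifier reflected about \<open>x\<close> evaluates the mollified
  extension at \<open>x\<close>. Each derivative of the reflected mollifier changes the sign, so
  that second derivatives agree without one.\<close>

lemma conv_reflect_second:
  assumes u': "\<And>\<phi>. \<phi> \<in> borel_measurable borel \<Longrightarrow> (\<integral>y. u y * \<phi> y \<partial>L) = (\<integral>y. u' y * \<phi> y \<partial>lborel)"
    and i: "integrable lborel u'"
  shows "(\<integral>y. u y * mollifier r (x - y) \<partial>L) = mollify r u' x"
    "(\<integral>y. u y * partial j (\<lambda>y. mollifier r (x - y)) y \<partial>L) = - partial j (mollify r u') x"
    "(\<integral>y. u y * partial k (partial j (\<lambda>y. mollifier r (x - y))) y \<partial>L) = partial k (partial j (mollify r u')) x"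
proof -
  let ?\<rho> = "mollifier r :: real^2 \<Rightarrow> real"
  have \<rho>: "?\<rho> \<in> test_functions UNIV" "?\<rho> \<in> C_infinity"
    using mollifier_test_function mollifier_C_infinity by auto
  have m: "(\<lambda>y. \<phi> (x - y)) \<in> borel_measurable borel" if "\<phi> \<in> C_infinity" for \<phi> :: "real^2 \<Rightarrow> real"
    by (rule C_infinity_measurable[OF C_infinity_reflect[OF that]])
  have on: "(\<integral>y. u y * \<phi> (x - y) \<partial>L) = conv u' \<phi> x" if "\<phi> \<in> C_infinity" for \<phi>
    unfolding conv_def by (rule u'[OF m[OF that]])
  show "(\<integral>y. u y * ?\<rho> (x - y) \<partial>L) = mollify r u' x" by (rule on[OF \<rho>(2)])
  have p1: "partial j (\<lambda>y. \<phi> (x - y)) = (\<lambda>y. - partial j \<phi> (x - y))" if "\<phi> \<in> C_infinity" for \<phi> j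
    using that by (rule partial_reflect)
  show "(\<integral>y. u y * partial j (\<lambda>y. ?\<rho> (x - y)) y \<partial>L) = - partial j (mollify r u') x"
    using on[OF C_infinity_partial[OF \<rho>(2)], of j] by (simp add: p1[OF \<rho>(2)] partial_conv[OF i \<rho>(1)])
  have "partial k (partial j (\<lambda>y. ?\<rho> (x - y))) = (\<lambda>y. partial k (partial j ?\<rho>) (x - y))"
  proof -
    have "partial k (\<lambda>y. - 1 * partial j ?\<rho> (x - y)) y = - 1 * partial k (\<lambda>y. partial j ?\<rho> (x - y)) y" for y
      using partial_mult[of "\<lambda>_. - 1" y "\<lambda>y. partial j ?\<rho> (x - y)" k] \<rho>(2)
      by (simp add: C_infinity_differentiable C_infinity_reflect C_infinity_partial)
    then show ?thesis
      unfolding p1[OF \<rho>(2)] using p1[OF C_infinity_partial[OF \<rho>(2)], of k j] by (simp add: fun_eq_iff)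
  qed
  then show "(\<integral>y. u y * partial k (partial j (\<lambda>y. ?\<rho> (x - y))) y \<partial>L) = partial k (partial j (mollify r u')) x"
    using on[OF C_infinity_partial[OF C_infinity_partial[OF \<rho>(2)]], of k j]
    by (simp add: partial_conv[OF i] \<rho>(1) test_functions_partial)
qed

text \<open>\<open>4 * (R + 1)^2\<close> is the Poincare constant of the ball of radius
  \<open>R + 1\<close>, which contains the supports of mollifications of radius below 1. In the
  bracket its square belongs to \<open>w\<close>, twice it to the two first derivatives and 4 to the
  second derivatives of one component; the outer 2 counts the components, and the division by
  \<open>mu^2\<close> comes from the Hessian estimate.\<close>

lemma lower_bound:
  assumes lam: "lam > 0" and mu: "mu > 0" and R: "R \<ge> 0" "\<And>x. x \<in> \<Omega> \<Longrightarrow> norm x \<le> R" and w: "w \<in> V_space lam mu \<Omega>"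
  shows "(H2_vec_norm \<Omega> w)\<^sup>2 \<le> (2 * (4 * (R + 1)\<^sup>2 * (4 * (R + 1)\<^sup>2) + 2 * (4 * (R + 1)\<^sup>2) + 4) / mu\<^sup>2)
    * (L2_norm L (row_divergence \<Omega> (stress lam mu \<Omega> w)))\<^sup>2"
proof -
  let ?f = "row_divergence \<Omega> (stress lam mu \<Omega> w)"
  let ?D = "\<lambda>j i. weak_partial \<Omega> j (\<lambda>y. w y $ i)"
  let ?P = "4 * (R + 1)\<^sup>2"
  define E where "E = (L2_norm L ?f)\<^sup>2 / mu\<^sup>2"
  have E: "E \<ge> 0" by (simp add: E_def)
  have wH: "w \<in> H2_vec \<Omega>" and tr0: "\<And>i. has_trace \<Omega> (\<lambda>x. w x $ i) (\<lambda>x. 0)"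
    using w by (auto simp: V_space_def)
  note facts = H2_vec_facts[OF wH]
  have fL2: "(\<lambda>x. ?f x $ i) \<in> L2 L" for i
    by (rule V_space_weak_form(2)[OF w C_infinity_const])
  have "\<forall>i. \<exists>u'. integrable lborel u' \<and> (\<forall>x. x \<notin> \<Omega> \<longrightarrow> u' x = 0) \<and>
      (\<forall>\<phi>. \<phi> \<in> borel_measurable borel \<longrightarrow> (\<integral>x. w x $ i * \<phi> x \<partial>L) = (\<integral>x. u' x * \<phi> x \<partial>lborel))"
    by (intro allI, rule L2_borel_extension[OF facts(2)]) blast
  from choice[OF this] obtain w' where w'0: "\<forall>i. integrable lborel (w' i) \<and> (\<forall>x. x \<notin> \<Omega> \<longrightarrow> w' i x = 0) \<and>
      (\<forall>\<phi>. \<phi> \<in> borel_measurable borel \<longrightarrow> (\<integral>x. w x $ i * \<phi> x \<partial>L) = (\<integral>x. w' i x * \<phi> x \<partial>lborel))" ..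
  then have w': "\<And>i. integrable lborel (w' i)" "\<And>i x. x \<notin> \<Omega> \<Longrightarrow> w' i x = 0"
      "\<And>i \<phi>. \<phi> \<in> borel_measurable borel \<Longrightarrow> (\<integral>x. w x $ i * \<phi> x \<partial>L) = (\<integral>x. w' i x * \<phi> x \<partial>lborel)"
    by auto
  have "\<forall>i. \<exists>u'. integrable lborel u' \<and> integrable lborel (\<lambda>x. (u' x)\<^sup>2) \<and>
      (\<forall>\<phi>. \<phi> \<in> borel_measurable borel \<longrightarrow> (\<integral>x. ?f x $ i * \<phi> x \<partial>L) = (\<integral>x. u' x * \<phi> x \<partial>lborel)) \<and>
      (\<integral>\<^sup>+x. ennreal ((u' x)\<^sup>2) \<partial>lborel) = ennreal ((L2_norm L (\<lambda>x. ?f x $ i))\<^sup>2) \<and> (\<forall>x. x \<notin> \<Omega> \<longrightarrow> u' x = 0)"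
    by (intro allI, rule L2_borel_extension[OF fL2]) blast
  from choice[OF this] obtain f' where f'0: "\<forall>i. integrable lborel (f' i) \<and> integrable lborel (\<lambda>x. (f' i x)\<^sup>2) \<and>
      (\<forall>\<phi>. \<phi> \<in> borel_measurable borel \<longrightarrow> (\<integral>x. ?f x $ i * \<phi> x \<partial>L) = (\<integral>x. f' i x * \<phi> x \<partial>lborel)) \<and>
      (\<integral>\<^sup>+x. ennreal ((f' i x)\<^sup>2) \<partial>lborel) = ennreal ((L2_norm L (\<lambda>x. ?f x $ i))\<^sup>2) \<and> (\<forall>x. x \<notin> \<Omega> \<longrightarrow> f' i x = 0)" ..
  then have f': "\<And>i. integrable lborel (f' i)" "\<And>i. integrable lborel (\<lambda>x. (f' i x)\<^sup>2)"
      "\<And>i \<phi>. \<phi> \<in> borel_measurable borel \<Longrightarrow> (\<integral>x. ?f x $ i * \<phi> x \<partial>L) = (\<integral>x. f' i x * \<phi> x \<partial>lborel)"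
      "\<And>i. (\<integral>\<^sup>+x. ennreal ((f' i x)\<^sup>2) \<partial>lborel) = ennreal ((L2_norm L (\<lambda>x. ?f x $ i))\<^sup>2)"
      "\<And>i x. x \<notin> \<Omega> \<Longrightarrow> f' i x = 0"
    by auto
  define W where "W r i = mollify r (w' i)" for r i
  have supp: "bounded {x. g x \<noteq> 0}" if "\<And>x. x \<notin> \<Omega> \<Longrightarrow> g x = 0" for g :: "real^2 \<Rightarrow> real"
    using that by (intro bounded_subset[OF bounded]) auto
  have W: "W r i \<in> test_functions UNIV" for r i
    unfolding W_def by (intro conv_test_function w' mollifier_test_function supp)
  \<comment> \<open>Here the boundary conditions enter: the reflected mollifier is an admissible
    test function for every \<open>x\<close>, also when its support crosses the boundary.\<close>
  have lameW: "lame lam mu (W r) i x = mollify r (f' i) x" for r i x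
  proof -
    let ?\<psi> = "\<lambda>y. mollifier r (x - y)"
    have \<psi>: "?\<psi> \<in> C_infinity" by (intro C_infinity_reflect mollifier_C_infinity)
    have "mollify r (f' i) x = (\<integral>y. ?f y $ i * ?\<psi> y \<partial>L)"
      by (rule conv_reflect_second(1)[OF f'(3) f'(1), symmetric])
    also have "\<dots> = lame lam mu (W r) i x"
      unfolding V_space_weak_form(1)[OF w \<psi>] lame_def W_def
      by (simp only: conv_reflect_second(3)[OF w'(3) w'(1)])
    finally show ?thesis ..
  qed
  have energy: "(\<Sum>i\<in>UNIV. \<integral>x. (lame lam mu (W r) i x)\<^sup>2 \<partial>lborel) \<le> (L2_norm L ?f)\<^sup>2" if r: "r > 0" for r
  proof -
    have "(\<integral>x. (lame lam mu (W r) i x)\<^sup>2 \<partial>lborel) \<le> (L2_norm L (\<lambda>x. ?f x $ i))\<^sup>2" for i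
    proof -
      have t: "mollify r (f' i) \<in> test_functions UNIV"
        by (intro conv_test_function f' mollifier_test_function supp)
      have i: "integrable lborel (\<lambda>x. (mollify r (f' i) x)\<^sup>2)"
        unfolding power2_eq_square by (rule integrable_test_mult[OF t t])
      have "ennreal (\<integral>x. (mollify r (f' i) x)\<^sup>2 \<partial>lborel) = (\<integral>\<^sup>+x. ennreal ((mollify r (f' i) x)\<^sup>2) \<partial>lborel)"
        by (rule nn_integral_eq_integral[OF i, symmetric]) simp
      also have "\<dots> \<le> ennreal ((L2_norm L (\<lambda>x. ?f x $ i))\<^sup>2)"
        unfolding f'(4)[symmetric] by (rule mollify_square_le[OF f'(1,2) r])
      finally show ?thesis by (simp add: lameW ennreal_le_iff)
    qed
    then show ?thesis unfolding L2_norm_vec_square[OF fL2] by (rule sum_mono)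
  qed
  have int_sq: "integrable lborel (\<lambda>x. (Z x)\<^sup>2)" if "Z \<in> test_functions UNIV" for Z :: "real^2 \<Rightarrow> real"
    unfolding power2_eq_square by (rule integrable_test_mult[OF that that])
  have b2: "(\<integral>x. (partial a (partial b (W r i)) x)\<^sup>2 \<partial>lborel) \<le> E" if "r > 0" for r a b i
  proof -
    have "mu\<^sup>2 * (\<integral>x. (partial a (partial b (W r i)) x)\<^sup>2 \<partial>lborel) \<le> (L2_norm L ?f)\<^sup>2"
      using lame_hessian_estimate[where W = "W r", OF W less_imp_le[OF lam] mu, of a b i] energy[OF that] by linarith
    then show ?thesis using mu by (simp add: E_def field_simps)
  qed
  have suppW: "norm x \<le> R + 1" if r: "r < 1" and "W r i x \<noteq> 0" for r i x
  proof -
    have "\<exists>y. w' i y * mollifier r (x - y) \<noteq> 0"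
    proof (rule ccontr)
      assume "\<not> ?thesis"
      then have "\<forall>y. w' i y * mollifier r (x - y) = 0" by blast
      then have "W r i x = 0" unfolding W_def conv_def by (simp only:) simp
      with that show False by simp
    qed
    then obtain y where y: "w' i y \<noteq> 0" "mollifier r (x - y) \<noteq> 0" by auto
    then have "norm y \<le> R" "norm (x - y) < r" using w'(2) R(2) mollifier_nonzeroD by blast+
    then show ?thesis using norm_triangle_sub[of x y] r by simp
  qed
  have suppDW: "norm x \<le> R + 1" if r: "r < 1" and x: "partial b (W r i) x \<noteq> 0" for r b i x
  proof -
    have "x \<in> closure {x. W r i x \<noteq> 0}" using partial_support x by fastforce
    also have "\<dots> \<subseteq> cball 0 (R + 1)" using suppW[OF r] by (intro closure_minimal) auto
    finally show ?thesis by simp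
  qed
  have b1: "(\<integral>x. (partial b (W r i) x)\<^sup>2 \<partial>lborel) \<le> ?P * E" if r: "0 < r" "r < 1" for r b i
  proof -
    have "(\<integral>x. (partial b (W r i) x)\<^sup>2 \<partial>lborel) \<le> ?P * (\<integral>x. (partial 1 (partial b (W r i)) x)\<^sup>2 \<partial>lborel)"
      using R(1) suppDW[OF r(2)] by (intro poincare_test_function test_functions_partial W) auto
    also have "\<dots> \<le> ?P * E" using b2[OF r(1)] by (intro mult_left_mono) auto
    finally show ?thesis .
  qed
  have b0: "(\<integral>x. (W r i x)\<^sup>2 \<partial>lborel) \<le> ?P * (?P * E)" if r: "0 < r" "r < 1" for r i
  proof -
    have "(\<integral>x. (W r i x)\<^sup>2 \<partial>lborel) \<le> ?P * (\<integral>x. (partial 1 (W r i) x)\<^sup>2 \<partial>lborel)"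
      using R(1) suppW[OF r(2)] by (intro poincare_test_function W) auto
    also have "\<dots> \<le> ?P * (?P * E)" using b1[OF r] by (intro mult_left_mono) auto
    finally show ?thesis .
  qed
  have n0: "(L2_norm L (\<lambda>x. w x $ i))\<^sup>2 \<le> ?P * (?P * E)" for i
    by (rule L2_norm_le_of_mollifications[OF facts(2), where G = "\<lambda>r. W r i"])
      (use E b0 int_sq[OF W] in \<open>auto simp: W_def conv_reflect_second(1)[OF w'(3) w'(1)]\<close>)
  have n1: "(L2_norm L (?D j i))\<^sup>2 \<le> ?P * E" for i j
  proof (rule L2_norm_le_of_mollifications[OF facts(4), where G = "\<lambda>r. partial j (W r i)"])
    fix r x
    show "(\<integral>y. ?D j i y * mollifier r (x - y) \<partial>L) = partial j (W r i) x"
      by (subst zero_trace_by_parts[OF tr0 C_infinity_reflect[OF mollifier_C_infinity]])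
        (simp add: W_def conv_reflect_second(2)[OF w'(3) w'(1)])
  qed (use E b1 int_sq[OF test_functions_partial[OF W]] in auto)
  \<comment> \<open>The first derivatives of \<open>w\<close> are not known to have zero trace, so
    the outer derivative is moved by the definition of a weak derivative, with a mollifier supported
    in \<Omega>; the inner one is moved by the zero trace of \<open>w\<close>.\<close>
  have n2: "(L2_norm L (weak_partial \<Omega> k (?D j i)))\<^sup>2 \<le> E" for i j k
  proof (rule L2_norm_le_of_mollifications[OF facts(5), where G = "\<lambda>r. partial j (partial k (W r i))"])
    fix r x assume sub: "cball x r \<subseteq> \<Omega>"
    let ?\<psi> = "\<lambda>y. mollifier r (x - y)"
    have \<psi>: "?\<psi> \<in> test_functions \<Omega>" by (rule mollifier_reflect_test_function[OF sub])
    have "(\<integral>y. ?D j i y * partial k ?\<psi> y \<partial>L) = - (\<integral>y. weak_partial \<Omega> k (?D j i) y * ?\<psi> y \<partial>L)"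
      using H1_weak_partial(1)[OF op facts(3), of k j i] \<psi> by (simp add: has_weak_partial_def)
    moreover have "(\<integral>y. ?D j i y * partial k ?\<psi> y \<partial>L) = - (\<integral>y. w y $ i * partial j (partial k ?\<psi>) y \<partial>L)"
      by (rule zero_trace_by_parts[OF tr0 C_infinity_partial[OF C_infinity_reflect[OF mollifier_C_infinity]]])
    ultimately show "(\<integral>y. weak_partial \<Omega> k (?D j i) y * ?\<psi> y \<partial>L) = partial j (partial k (W r i)) x"
      by (simp add: W_def conv_reflect_second(3)[OF w'(3) w'(1)])
  qed (use E b2 int_sq[OF test_functions_partial[OF test_functions_partial[OF W]]] in auto)
  have H: "(H2_norm \<Omega> (\<lambda>x. w x $ i))\<^sup>2 \<le> ?P * (?P * E) + 2 * (?P * E) + 2 * (2 * E)" for i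
  proof -
    have "(\<Sum>j\<in>UNIV. (L2_norm L (?D j i))\<^sup>2) \<le> 2 * (?P * E)"
      using sum_le_of_bound[of "\<lambda>j. (L2_norm L (?D j i))\<^sup>2", OF n1] by simp
    moreover have "(\<Sum>k\<in>UNIV. (L2_norm L (weak_partial \<Omega> k (?D j i)))\<^sup>2) \<le> 2 * E" for j
      using sum_le_of_bound[of "\<lambda>k. (L2_norm L (weak_partial \<Omega> k (?D j i)))\<^sup>2", OF n2] by simp
    then have "(\<Sum>j\<in>UNIV. \<Sum>k\<in>UNIV. (L2_norm L (weak_partial \<Omega> k (?D j i)))\<^sup>2) \<le> 2 * (2 * E)"
      using sum_le_of_bound[of "\<lambda>j. \<Sum>k\<in>UNIV. (L2_norm L (weak_partial \<Omega> k (?D j i)))\<^sup>2" "2 * E"] by simp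
    ultimately show ?thesis
      unfolding H2_norm_square using n0[of i] by linarith
  qed
  have "(H2_vec_norm \<Omega> w)\<^sup>2 \<le> 2 * (?P * (?P * E) + 2 * (?P * E) + 2 * (2 * E))"
    unfolding H2_vec_norm_square using sum_le_of_bound[of "\<lambda>i. (H2_norm \<Omega> (\<lambda>x. w x $ i))\<^sup>2", OF H] by simp
  also have "\<dots> = (2 * (?P * ?P + 2 * ?P + 4) / mu\<^sup>2) * (L2_norm L ?f)\<^sup>2"
    by (simp add: E_def algebra_simps add_divide_distrib)
  finally show ?thesis .
qed

text \<open>Almost everywhere each component of the divergence is a fixed linear combination of
  second derivatives of \<open>w\<close>, hence bounded by a multiple of the square root of the sum
  \<open>Q\<close> of their squares.\<close>

lemma upper_bound:
  assumes lam: "lam > 0" and mu: "mu > 0" and w: "w \<in> V_space lam mu \<Omega>"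
  shows "(L2_norm L (row_divergence \<Omega> (stress lam mu \<Omega> w)))\<^sup>2 \<le> 2 * (4 * mu + 2 * lam)\<^sup>2 * (H2_vec_norm \<Omega> w)\<^sup>2"
proof -
  let ?f = "row_divergence \<Omega> (stress lam mu \<Omega> w)"
  let ?D = "\<lambda>j i. weak_partial \<Omega> j (\<lambda>y. w y $ i)"
  let ?DD = "\<lambda>k j i. weak_partial \<Omega> k (?D j i)"
  have wH: "w \<in> H2_vec \<Omega>" using w by (auto simp: V_space_def)
  note facts = H2_vec_facts[OF wH]
  have fL2: "(\<lambda>x. ?f x $ i) \<in> L2 L" for i
    by (rule V_space_weak_form(2)[OF w C_infinity_const])
  define Q where "Q x = (\<Sum>i\<in>UNIV. \<Sum>j\<in>UNIV. \<Sum>k\<in>UNIV. (?DD k j i x)\<^sup>2)" for x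
  have DD_int: "integrable L (\<lambda>x. (?DD k j i x)\<^sup>2)" for k j i using facts(5)[of k j i] by (simp add: L2_def)
  have Q_int: "integrable L Q" unfolding Q_def[abs_def] using DD_int by simp
  have Q_le: "(\<integral>x. Q x \<partial>L) \<le> (H2_vec_norm \<Omega> w)\<^sup>2"
  proof -
    have "(\<integral>x. Q x \<partial>L) = (\<Sum>i\<in>UNIV. \<Sum>j\<in>UNIV. \<Sum>k\<in>UNIV. (L2_norm L (?DD k j i))\<^sup>2)"
      unfolding Q_def using DD_int by (simp add: L2_norm_def integral_nonneg_AE)
    also have "\<dots> \<le> (\<Sum>i\<in>UNIV. (H2_norm \<Omega> (\<lambda>x. w x $ i))\<^sup>2)"
      unfolding H2_norm_square by (intro sum_mono) (simp add: sum_nonneg add_nonneg_nonneg)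
    finally show ?thesis by (simp add: H2_vec_norm_square)
  qed
  have DD_le: "\<bar>?DD k j i x\<bar> \<le> sqrt (Q x)" for k j i x
  proof -
    have "(?DD k j i x)\<^sup>2 \<le> (\<Sum>k\<in>UNIV. (?DD k j i x)\<^sup>2)"
      by (rule member_le_sum[of k UNIV "\<lambda>k. (?DD k j i x)\<^sup>2"]) auto
    also have "\<dots> \<le> (\<Sum>j\<in>UNIV. \<Sum>k\<in>UNIV. (?DD k j i x)\<^sup>2)"
      by (rule member_le_sum[of j UNIV "\<lambda>j. \<Sum>k\<in>UNIV. (?DD k j i x)\<^sup>2"]) (simp_all add: sum_nonneg)
    also have "\<dots> \<le> Q x" unfolding Q_def
      by (rule member_le_sum[of i UNIV "\<lambda>i. \<Sum>j\<in>UNIV. \<Sum>k\<in>UNIV. (?DD k j i x)\<^sup>2"]) (simp_all add: sum_nonneg)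
    finally show ?thesis by (simp add: real_le_rsqrt)
  qed
  have wp: "has_weak_partial \<Omega> k (?D j i) (?DD k j i)" for k j i
    by (rule H1_weak_partial(1)[OF op facts(3)])
  have "AE x in L. weak_partial \<Omega> j (\<lambda>y. stress lam mu \<Omega> w y $ i $ j) x
      = mu * (?DD j j i x + ?DD j i j x) + (if i = j then lam * (?DD j 1 1 x + ?DD j 2 2 x) else 0)" for i j
  \<comment> \<open>The chosen weak derivative of the stress is a priori unrelated to the chosen
    second derivatives of \<open>w\<close>; linearity and uniqueness identify it almost
    everywhere.\<close>
  proof (rule weak_partial_AE_eq[OF op])
    have 1: "has_weak_partial \<Omega> j (\<lambda>x. mu * ?D j i x + mu * ?D i j x) (\<lambda>x. mu * ?DD j j i x + mu * ?DD j i j x)"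
      by (rule has_weak_partial_lincomb[OF op wp wp])
    have 2: "has_weak_partial \<Omega> j (\<lambda>x. lam * ?D 1 1 x + lam * ?D 2 2 x) (\<lambda>x. lam * ?DD j 1 1 x + lam * ?DD j 2 2 x)"
      by (rule has_weak_partial_lincomb[OF op wp wp])
    have "has_weak_partial \<Omega> j (\<lambda>x. 1 * (mu * ?D j i x + mu * ?D i j x) + (if i = j then 1 else 0) * (lam * ?D 1 1 x + lam * ?D 2 2 x))
      (\<lambda>x. 1 * (mu * ?DD j j i x + mu * ?DD j i j x) + (if i = j then 1 else 0) * (lam * ?DD j 1 1 x + lam * ?DD j 2 2 x))"
      by (rule has_weak_partial_lincomb[OF op 1 2])
    moreover have "(\<lambda>y. stress lam mu \<Omega> w y $ i $ j)
        = (\<lambda>x. 1 * (mu * ?D j i x + mu * ?D i j x) + (if i = j then 1 else 0) * (lam * ?D 1 1 x + lam * ?D 2 2 x))"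
      unfolding stress_component by (auto simp: sum_2 distrib_left)
    moreover have "(\<lambda>x. mu * (?DD j j i x + ?DD j i j x) + (if i = j then lam * (?DD j 1 1 x + ?DD j 2 2 x) else 0))
        = (\<lambda>x. 1 * (mu * ?DD j j i x + mu * ?DD j i j x) + (if i = j then 1 else 0) * (lam * ?DD j 1 1 x + lam * ?DD j 2 2 x))"
      by (auto simp: distrib_left)
    ultimately show "has_weak_partial \<Omega> j (\<lambda>y. stress lam mu \<Omega> w y $ i $ j)
        (\<lambda>x. mu * (?DD j j i x + ?DD j i j x) + (if i = j then lam * (?DD j 1 1 x + ?DD j 2 2 x) else 0))"
      by simp
  qed
  then have AE_f: "AE x in L. \<forall>j\<in>UNIV. weak_partial \<Omega> j (\<lambda>y. stress lam mu \<Omega> w y $ i $ j) x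
      = mu * (?DD j j i x + ?DD j i j x) + (if i = j then lam * (?DD j 1 1 x + ?DD j 2 2 x) else 0)" for i
    by (intro AE_ball_countable') auto
  have f_le: "AE x in L. (?f x $ i)\<^sup>2 \<le> (4 * mu + 2 * lam)\<^sup>2 * Q x" for i
    using AE_f[of i]
  proof eventually_elim
    case (elim x)
    have "\<bar>?f x $ i\<bar> \<le> (\<Sum>j\<in>UNIV. \<bar>mu * (?DD j j i x + ?DD j i j x) + (if i = j then lam * (?DD j 1 1 x + ?DD j 2 2 x) else 0)\<bar>)"
      unfolding row_divergence_component using elim by (subst sum.cong[OF refl]) auto
    also have "\<dots> \<le> (\<Sum>j\<in>UNIV. mu * (sqrt (Q x) + sqrt (Q x)) + (if i = j then lam * (sqrt (Q x) + sqrt (Q x)) else 0))"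
    proof (rule sum_mono)
      fix j
      have "\<bar>mu * (?DD j j i x + ?DD j i j x)\<bar> \<le> mu * (sqrt (Q x) + sqrt (Q x))"
        unfolding abs_mult using mu DD_le[of j j i x] DD_le[of j i j x]
        by (simp add: abs_of_pos)
      moreover have "\<bar>lam * (?DD j 1 1 x + ?DD j 2 2 x)\<bar> \<le> lam * (sqrt (Q x) + sqrt (Q x))"
        unfolding abs_mult using lam DD_le[of j 1 1 x] DD_le[of j 2 2 x]
        by (simp add: abs_of_pos)
      ultimately show "\<bar>mu * (?DD j j i x + ?DD j i j x) + (if i = j then lam * (?DD j 1 1 x + ?DD j 2 2 x) else 0)\<bar>
          \<le> mu * (sqrt (Q x) + sqrt (Q x)) + (if i = j then lam * (sqrt (Q x) + sqrt (Q x)) else 0)"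
        by (auto intro: order_trans[OF abs_triangle_ineq])
    qed
    \<comment> \<open>Each of the two indices \<open>j\<close> contributes \<open>2 * mu\<close>,
      and the diagonal one \<open>2 * lam\<close> in addition.\<close>
    also have "\<dots> = (4 * mu + 2 * lam) * sqrt (Q x)"
      by (simp add: sum.distrib algebra_simps)
    finally have "\<bar>?f x $ i\<bar>\<^sup>2 \<le> ((4 * mu + 2 * lam) * sqrt (Q x))\<^sup>2" by (rule power_mono) simp
    moreover have "Q x \<ge> 0" by (simp add: Q_def sum_nonneg)
    ultimately show ?case by (simp add: power_mult_distrib)
  qed
  have "(L2_norm L (\<lambda>x. ?f x $ i))\<^sup>2 \<le> (4 * mu + 2 * lam)\<^sup>2 * (\<integral>x. Q x \<partial>L)" for i
  proof -
    have "(L2_norm L (\<lambda>x. ?f x $ i))\<^sup>2 = (\<integral>x. (?f x $ i)\<^sup>2 \<partial>L)"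
      by (simp add: L2_norm_def integral_nonneg_AE)
    also have "\<dots> \<le> (\<integral>x. (4 * mu + 2 * lam)\<^sup>2 * Q x \<partial>L)"
      using fL2[of i] Q_int f_le[of i] by (intro integral_mono_AE) (auto simp: L2_def)
    finally show ?thesis by simp
  qed
  then have "(L2_norm L ?f)\<^sup>2 \<le> 2 * ((4 * mu + 2 * lam)\<^sup>2 * (\<integral>x. Q x \<partial>L))"
    unfolding L2_norm_vec_square[OF fL2] using sum_le_of_bound[where 'a = 2] by fastforce
  also have "\<dots> \<le> 2 * ((4 * mu + 2 * lam)\<^sup>2 * (H2_vec_norm \<Omega> w)\<^sup>2)"
    using Q_le by (intro mult_left_mono) auto
  finally show ?thesis by (simp add: mult.assoc)
qed

end

theorem theorem3:
  fixes \<Omega> :: "(real^2) set" and lam mu :: real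
  assumes "bounded \<Omega>" and "convex \<Omega>" and "lipschitz_domain \<Omega>"
    and "lam > 0" and "mu > 0"
  shows "\<exists>c>0. \<exists>C>0. \<forall>w \<in> V_space lam mu \<Omega>.
           c * H2_vec_norm \<Omega> w \<le> L2_norm (lebesgue_on \<Omega>) (row_divergence \<Omega> (stress lam mu \<Omega> w)) \<and>
           L2_norm (lebesgue_on \<Omega>) (row_divergence \<Omega> (stress lam mu \<Omega> w)) \<le> C * H2_vec_norm \<Omega> w"
proof -
  have op: "open \<Omega>" and ne: "\<Omega> \<noteq> {}" using assms(3) by (auto simp: lipschitz_domain_def)
  obtain \<pi> \<gamma> :: "real^2 \<Rightarrow> real^2" and B C :: real where rep:
    "\<pi> \<in> borel_measurable borel" "\<gamma> \<in> borel_measurable borel" "\<And>x j. \<bar>\<gamma> x $ j\<bar> \<le> B"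
    "AE x in lborel. x \<in> \<Omega> \<longrightarrow> \<pi> x \<in> frontier \<Omega> \<and> \<gamma> x \<noteq> 0 \<and>
      is_outward_normal \<Omega> (\<pi> x) ((1 / norm (\<gamma> x)) *\<^sub>R \<gamma> x)"
    "\<And>U j. U \<in> C_infinity \<Longrightarrow> (\<integral>x. indicator \<Omega> x * partial j U x \<partial>lborel)
      = (\<integral>x. indicator \<Omega> x * (U (\<pi> x) * \<gamma> x $ j) \<partial>lborel)"
    "C > 0" "\<And>A. A \<in> sets borel \<Longrightarrow> emeasure lborel {x \<in> \<Omega>. \<pi> x \<in> A} \<le> ennreal C * hausdorff1_outer A"
    by (rule convex_boundary_representation[OF assms(1,2) op ne]) blast
  interpret planar_domain \<Omega> \<pi> \<gamma> B C
    by unfold_locales (use assms op ne rep in \<open>simp_all\<close>)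
  obtain R where R: "R \<ge> 0" "\<And>x. x \<in> \<Omega> \<Longrightarrow> norm x \<le> R"
    using assms(1) unfolding bounded_pos by (meson less_imp_le)
  define K where "K = 2 * (4 * (R + 1)\<^sup>2 * (4 * (R + 1)\<^sup>2) + 2 * (4 * (R + 1)\<^sup>2) + 4) / mu\<^sup>2"
  have K: "K > 0" using assms(5) by (auto simp: K_def intro!: divide_pos_pos mult_pos_pos add_nonneg_pos)
  define K' where "K' = 2 * (4 * mu + 2 * lam)\<^sup>2"
  have K': "K' > 0" using assms(4,5) by (simp add: K'_def)
  have "1 / sqrt K * H2_vec_norm \<Omega> w \<le> L2_norm L (row_divergence \<Omega> (stress lam mu \<Omega> w)) \<and>
      L2_norm L (row_divergence \<Omega> (stress lam mu \<Omega> w)) \<le> sqrt K' * H2_vec_norm \<Omega> w"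
    if w: "w \<in> V_space lam mu \<Omega>" for w
  proof
    let ?h = "H2_vec_norm \<Omega> w" and ?l = "L2_norm L (row_divergence \<Omega> (stress lam mu \<Omega> w))"
    have nn: "?h \<ge> 0" "?l \<ge> 0" by (rule H2_vec_norm_nonneg, rule L2_norm_nonneg)
    have "sqrt (?h\<^sup>2) \<le> sqrt (K * ?l\<^sup>2)"
      using lower_bound[OF assms(4,5) R w] by (intro real_sqrt_le_mono) (simp add: K_def)
    then have "?h \<le> sqrt K * ?l"
      using nn by (simp add: real_sqrt_mult)
    then show "1 / sqrt K * ?h \<le> ?l" using K by (simp add: field_simps)
    have "sqrt (?l\<^sup>2) \<le> sqrt (K' * ?h\<^sup>2)"
      using upper_bound[OF assms(4,5) w] by (intro real_sqrt_le_mono) (simp add: K'_def)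
    then show "?l \<le> sqrt K' * ?h"
      using nn by (simp add: real_sqrt_mult)
  qed
  then show ?thesis
    using K K' by (intro exI[of _ "1 / sqrt K"] exI[of _ "sqrt K'"] conjI ballI) auto
qed

end
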